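(* Let $K$ satisfy, for every $t\in I$ and $x,y\in\mathbb{R}^d$, $$\lambda(2-\alpha)|x-y|^{-d-\alpha}\le K(t;x,y)\le \Lambda(2-\alpha)|x-y|^{-d-\alpha}.$$ Then there is a constant $c=c(d,\alpha_0,\lambda,\Lambda)>0$ such that for every $R>0$, $t_0\in I$, $x_0\in\Omega$ with $I_{4R}(t_0)\times B_{4R}(x_0)\subset I\times\Omega$, and every weak subsolution $u$ to $\partial_tu-L_tu=0$ in $I\times\Omega$, $$\sup_{I_{R/2}^{\ominus}(t_0)\times B_{R/2}(x_0)}u_+\le c\left(\frac{1}{|I_R^{\ominus}(t_0)\times B_R(x_0)|}\int_{I_R^{\ominus}(t_0)}\int_{B_R(x_0)}u_+^2(t,x)\,dx\,dt\right)^{1/2}+\frac{c}{|I_R^{\ominus}(t_0)|}\int_{I_R^{\ominus}(t_0)}\mathrm{Tail}(u_+(t);R,x_0)\,dt .$$ In particular, since all terms on the right-hand side are finite, $u_+\in L^\infty(I_{R/2}^{\ominus}(t_0)\times B_{R/2}(x_0))$.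
   Context: Let $d\in\mathbb{N}$, let $I\subset[0,\infty)$ be a finite open interval and $\Omega\subset\mathbb{R}^d$ a bounded domain. Let $\alpha_0\in(0,2)$, $\alpha\in[\alpha_0,2)$ and $\Lambda\ge\lambda>0$. The jumping kernel $K:[0,\infty)\times\mathbb{R}^d\times\mathbb{R}^d\to[0,\infty]$ is measurable and symmetric, $K(t;x,y)=K(t;y,x)$ for all $t\in I$, $x,y\in\mathbb{R}^d$. The operator is $-L_tu(x)=\mathrm{p.v.}\int_{\mathbb{R}^d}(u(x)-u(y))K(t;x,y)\,dy$, understood through the form $\mathcal{E}^{K(t)}(u,v)=\int_{\mathbb{R}^d}\int_{\mathbb{R}^d}(u(x)-u(y))(v(x)-v(y))K(t;x,y)\,dy\,dx$. Function spaces: $H^{\alpha/2}(\Omega)=\{v\in L^2(\Omega):(2-\alpha)\int_\Omega\int_\Omega\frac{(v(x)-v(y))^2}{|x-y|^{d+\alpha}}\,dy\,dx<\infty\}$ with its natural norm; $H^{\alpha/2}_\Omega(\mathbb{R}^d)=\{v\in H^{\alpha/2}(\mathbb{R}^d):\operatorname{supp}(v)\subset\Omega\}$; $L^1_\alpha(\mathbb{R}^d)=\{v:\int_{\mathbb{R}^d}|v(x)|(1+|x|)^{-d-\alpha}\,dx<\infty\}$. Weak subsolutions: $u\in L^2_{loc}(I;H^{\alpha/2}_{loc}(\Omega))\cap L^1_{loc}(I;L^1_\alpha(\mathbb{R}^d))\cap L^\infty_{loc}(I;L^2_{loc}(\Omega))$ is a weak subsolution to $\partial_tu-L_tu=0$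 in $I\times\Omega$ if the weak $L^2(\Omega)$-derivative $\partial_tu$ exists, $\partial_tu\in L^1_{loc}(I;L^2_{loc}(\Omega))$, and $(\partial_tu(t),\phi)+\mathcal{E}^{K(t)}(u(t),\phi)\le 0$ for all $t\in I$ and all $\phi\in H^{\alpha/2}_\Omega(\mathbb{R}^d)$ with $\phi\ge0$, where $(\cdot,\cdot)$ is the $L^2$ pairing. Tail: $\mathrm{Tail}(v;R,x_0)=(2-\alpha)R^\alpha\int_{\mathbb{R}^d\setminus B_R(x_0)}|v(y)||x_0-y|^{-d-\alpha}\,dy$. Notation $u_+=\max(u,0)$. Time intervals: $I_R^{\ominus}(t_0)=(t_0-R^\alpha,t_0)$, $I_R(t_0)=(t_0-R^\alpha,t_0+R^\alpha)$. Suprema are essential suprema. *)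

theory Defs
  imports "HOL-Analysis.Analysis" "HOL-Probability.Essential_Supremum"
begin

definition ennsqrt :: "ennreal \<Rightarrow> ennreal" where
  "ennsqrt x = (if x = \<infinity> then \<infinity> else ennreal (sqrt (enn2real x)))"

text \<open>The kernel \<open>|x - y|^(-d-\<alpha>)\<close>, where \<open>d\<close> is the dimension of the space. The inverse is
  taken in \<open>[0,\<infinity>]\<close>, so that the value on the diagonal is \<open>\<infinity>\<close>; together with the convention
  \<open>0 * \<infinity> = 0\<close> the diagonal contributes nothing to the double integrals below.\<close>

definition frac_kernel :: "real \<Rightarrow> 'a::euclidean_space \<Rightarrow> 'a \<Rightarrow> ennreal" where
  "frac_kernel \<alpha> x y = inverse (ennreal (norm (x - y) powr (real DIM('a) + \<alpha>)))"

subsection \<open>Function spaces\<close>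

text \<open>Elements of the spaces are represented by functions, and nothing below depends on their
  values on null sets, except where a statement is made for every time.\<close>

definition L2_norm :: "'a::euclidean_space set \<Rightarrow> ('a \<Rightarrow> real) \<Rightarrow> ennreal" where
  "L2_norm A v = ennsqrt (\<integral>\<^sup>+x\<in>A. ennreal ((v x)\<^sup>2) \<partial>lebesgue)"

definition H_norm :: "real \<Rightarrow> 'a::euclidean_space set \<Rightarrow> ('a \<Rightarrow> real) \<Rightarrow> ennreal" where
  "H_norm \<alpha> A v = ennsqrt ((\<integral>\<^sup>+x\<in>A. ennreal ((v x)\<^sup>2) \<partial>lebesgue)
     + ennreal (2 - \<alpha>) *
       (\<integral>\<^sup>+x\<in>A. (\<integral>\<^sup>+y\<in>A. ennreal ((v x - v y)\<^sup>2) * frac_kernel \<alpha> x y \<partial>lebesgue) \<partial>lebesgue))"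

definition H_space :: "real \<Rightarrow> 'a::euclidean_space set \<Rightarrow> ('a \<Rightarrow> real) set" where
  "H_space \<alpha> A = {v. v \<in> borel_measurable (lebesgue_on A) \<and> H_norm \<alpha> A v < \<infinity>}"

text \<open>The support of a function that is defined up to null sets: the complement of the largest
  open set on which it vanishes almost everywhere.\<close>

definition ess_support :: "('a::euclidean_space \<Rightarrow> real) \<Rightarrow> 'a set" where
  "ess_support v = - \<Union>{U. open U \<and> (AE x in lebesgue. x \<in> U \<longrightarrow> v x = 0)}"

definition H_space_supp :: "real \<Rightarrow> 'a::euclidean_space set \<Rightarrow> ('a \<Rightarrow> real) set" where
  "H_space_supp \<alpha> \<Omega> = {v \<in> H_space \<alpha> UNIV. ess_support v \<subseteq> \<Omega>}"

definition L1_weighted_norm :: "real \<Rightarrow> ('a::euclidean_space \<Rightarrow> real) \<Rightarrow> ennreal" where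
  "L1_weighted_norm \<alpha> v =
     (\<integral>\<^sup>+x. ennreal (\<bar>v x\<bar> * (1 + norm x) powr (- real DIM('a) - \<alpha>)) \<partial>lebesgue)"

definition compactly_inside :: "'a::euclidean_space set \<Rightarrow> 'a set \<Rightarrow> bool" where
  "compactly_inside U \<Omega> \<longleftrightarrow> open U \<and> compact (closure U) \<and> closure U \<subseteq> \<Omega>"

text \<open>Local spaces in time and space: the norm over each compact set \<open>J\<close> of times and each open
  set \<open>U\<close> compactly contained in \<open>\<Omega>\<close> is finite. Measurability is not part of these predicates; it
  is imposed as joint measurability in \<open>(t,x)\<close> in the definition of a weak subsolution.\<close>

definition L2loc_Hloc :: "real \<Rightarrow> real set \<Rightarrow> 'a::euclidean_space set \<Rightarrow> (real \<Rightarrow> 'a \<Rightarrow> real) \<Rightarrow> bool" where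
  "L2loc_Hloc \<alpha> I \<Omega> u \<longleftrightarrow> (\<forall>J U. compact J \<and> J \<subseteq> I \<and> compactly_inside U \<Omega> \<longrightarrow>
     (\<integral>\<^sup>+t\<in>J. (H_norm \<alpha> U (u t))\<^sup>2 \<partial>lebesgue) < \<infinity>)"

definition L1loc_L1weighted :: "real \<Rightarrow> real set \<Rightarrow> (real \<Rightarrow> 'a::euclidean_space \<Rightarrow> real) \<Rightarrow> bool" where
  "L1loc_L1weighted \<alpha> I u \<longleftrightarrow> (\<forall>J. compact J \<and> J \<subseteq> I \<longrightarrow>
     (\<integral>\<^sup>+t\<in>J. L1_weighted_norm \<alpha> (u t) \<partial>lebesgue) < \<infinity>)"

definition Linfloc_L2loc :: "real set \<Rightarrow> 'a::euclidean_space set \<Rightarrow> (real \<Rightarrow> 'a \<Rightarrow> real) \<Rightarrow> bool" where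
  "Linfloc_L2loc I \<Omega> u \<longleftrightarrow> (\<forall>J U. compact J \<and> J \<subseteq> I \<and> compactly_inside U \<Omega> \<longrightarrow>
     (\<exists>C. AE t in lebesgue. t \<in> J \<longrightarrow> L2_norm U (u t) \<le> ennreal C))"

definition L1loc_L2loc :: "real set \<Rightarrow> 'a::euclidean_space set \<Rightarrow> (real \<Rightarrow> 'a \<Rightarrow> real) \<Rightarrow> bool" where
  "L1loc_L2loc I \<Omega> w \<longleftrightarrow> (\<forall>J U. compact J \<and> J \<subseteq> I \<and> compactly_inside U \<Omega> \<longrightarrow>
     (\<integral>\<^sup>+t\<in>J. L2_norm U (w t) \<partial>lebesgue) < \<infinity>)"

definition in_Linfty :: "'a measure \<Rightarrow> ('a \<Rightarrow> real) \<Rightarrow> bool" where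
  "in_Linfty M f \<longleftrightarrow> f \<in> borel_measurable M \<and> esssup M (\<lambda>x. ennreal \<bar>f x\<bar>) < \<infinity>"

subsection \<open>Weak subsolutions\<close>

definition test_functions :: "real set \<Rightarrow> (real \<Rightarrow> real) set" where
  "test_functions I = {\<eta>. (\<forall>k. (deriv ^^ k) \<eta> differentiable_on UNIV)
     \<and> compact (closure {t. \<eta> t \<noteq> 0}) \<and> closure {t. \<eta> t \<noteq> 0} \<subseteq> I}"

text \<open>\<open>w\<close> is the weak derivative of \<open>u\<close> with respect to time, as functions of time with values in
  the square integrable functions of \<open>x\<close>: the two vector-valued integrals over \<open>I\<close> are equal as
  classes of functions of \<open>x\<close>, i.e. for almost every \<open>x\<close>.\<close>

definition weak_time_deriv ::
    "real set \<Rightarrow> 'a::euclidean_space set \<Rightarrow> (real \<Rightarrow> 'a \<Rightarrow> real) \<Rightarrow> (real \<Rightarrow> 'a \<Rightarrow> real) \<Rightarrow> bool" where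
  "weak_time_deriv I \<Omega> u w \<longleftrightarrow> (\<forall>\<eta>\<in>test_functions I. AE x in lebesgue. x \<in> \<Omega> \<longrightarrow>
     (LINT t:I|lebesgue. deriv \<eta> t * u t x) = - (LINT t:I|lebesgue. \<eta> t * w t x))"

text \<open>The kernel takes values in \<open>[0,\<infinity>]\<close>. The real-valued integrand uses \<open>enn2real\<close>, which sends
  \<open>\<infinity>\<close> to \<open>0\<close>; for the kernels considered here the value \<open>\<infinity>\<close> occurs only for \<open>x = y\<close>, where the
  integrand is \<open>0\<close> in any case.\<close>

definition energy :: "('a::euclidean_space \<Rightarrow> 'a \<Rightarrow> ennreal) \<Rightarrow> ('a \<Rightarrow> real) \<Rightarrow> ('a \<Rightarrow> real) \<Rightarrow> real" where
  "energy k u v =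
     (LINT x|lebesgue. LINT y|lebesgue. (u x - u y) * (v x - v y) * enn2real (k x y))"

definition weak_subsolution ::
    "real \<Rightarrow> (real \<Rightarrow> 'a::euclidean_space \<Rightarrow> 'a \<Rightarrow> ennreal) \<Rightarrow> real set \<Rightarrow> 'a set \<Rightarrow> (real \<Rightarrow> 'a \<Rightarrow> real) \<Rightarrow> bool" where
  "weak_subsolution \<alpha> K I \<Omega> u \<longleftrightarrow>
     (\<lambda>(t, x). u t x) \<in> borel_measurable (lebesgue_on (I \<times> UNIV))
     \<and> L2loc_Hloc \<alpha> I \<Omega> u \<and> L1loc_L1weighted \<alpha> I u \<and> Linfloc_L2loc I \<Omega> u
     \<and> (\<exists>w. (\<lambda>(t, x). w t x) \<in> borel_measurable (lebesgue_on (I \<times> \<Omega>))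
            \<and> L1loc_L2loc I \<Omega> w \<and> weak_time_deriv I \<Omega> u w
            \<and> (\<forall>t\<in>I. \<forall>\<phi>\<in>H_space_supp \<alpha> \<Omega>. (AE x in lebesgue. 0 \<le> \<phi> x) \<longrightarrow>
                 (LINT x:\<Omega>|lebesgue. w t x * \<phi> x) + energy (K t) (u t) \<phi> \<le> 0))"

subsection \<open>Tail and time intervals\<close>

definition Tail :: "real \<Rightarrow> ('a::euclidean_space \<Rightarrow> real) \<Rightarrow> real \<Rightarrow> 'a \<Rightarrow> ennreal" where
  "Tail \<alpha> v R x0 = ennreal ((2 - \<alpha>) * R powr \<alpha>) *
     (\<integral>\<^sup>+y\<in>- ball x0 R. ennreal \<bar>v y\<bar> * frac_kernel \<alpha> x0 y \<partial>lebesgue)"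

definition time_int :: "real \<Rightarrow> real \<Rightarrow> real \<Rightarrow> real set" where
  "time_int \<alpha> R t0 = {t0 - R powr \<alpha> <..< t0 + R powr \<alpha>}"

definition time_int_minus :: "real \<Rightarrow> real \<Rightarrow> real \<Rightarrow> real set" where
  "time_int_minus \<alpha> R t0 = {t0 - R powr \<alpha> <..< t0}"

end

theory Submission
  imports Defs
begin

text \<open>
The proof is De Giorgi's iteration for parabolic equations, adapted to a nonlocal operator. The equation is tested with
\<open>\<phi>\<^sup>2 w\<close>, where \<open>w = (u - l)\<^sub>+\<close> and \<open>\<phi>\<close> is a spatial cutoff. The identity
\<open>(a - b) (p\<^sup>2 a - q\<^sup>2 b) = (p a - q b)\<^sup>2 - a b (p - q)\<^sup>2\<close> shows that the form controls the energy of \<open>\<phi> w\<close> up to the localisation error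
\<open>\<integral>\<integral> w x * w y * (\<phi> x - \<phi> y)\<^sup>2 * |x - y|^(-d-\<alpha>)\<close> (\<open>form_lower_bound\<close>). The part of this error that comes from distant
points is the integral of \<open>\<phi>\<^sup>2 w\<close> times a tail of \<open>u\<^sub>+\<close> (\<open>cross_energy_bound\<close>).

The tail is merely integrable in time. Therefore the level is not kept fixed: it is \<open>k + h(t)\<close>, where \<open>h\<close> increases at a rate
proportional to the tail at time \<open>t\<close>. Differentiating \<open>(u - k - h)\<^sub>+\<^sup>2\<close> in time produces the additional term
\<open>- 2 h' (u - k - h)\<^sub>+\<close>, and it cancels the distant part of the localisation error (\<open>flux_energy_bound\<close>, \<open>excess_evolution\<close>). The iteration then
proceeds as if there were no tail and shows \<open>u \<le> M + h\<close> on the smaller cylinder, with \<open>M\<close> comparable to the \<open>L\<^sup>2\<close> mean of \<open>u\<^sub>+\<close>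
(\<open>local_bound\<close>). The total rise of \<open>h\<close> is at most a constant times the integral of the tail plus a multiple of \<open>M\<close>, which yields the second term of the
estimate (\<open>height_bound\<close>).

The constants must not degenerate as \<open>\<alpha>\<close> tends to \<open>2\<close>. The Sobolev inequality is replaced by the inequality of Faber-Krahn type
\<open>||f||\<^sup>2 \<le> C |{f \<noteq> 0}|^(\<alpha>/d) E(f)\<close>, where the energy \<open>E\<close> carries the factor \<open>2 - \<alpha>\<close> (\<open>fractional_faber_krahn\<close>). Its proof is elementary: the function
\<open>g(z) = ||f(\<cdot> + z) - f||\<^sup>2\<close> satisfies \<open>g(2 z) \<le> 4 g(z)\<close>, hence about \<open>1 / (2 - \<alpha>)\<close> dyadic scales contribute comparably to the energy. Together
with Chebyshev's inequality it gives the superlinear gain of each step (\<open>level_set_energy\<close>, \<open>level_bound_step\<close>).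

Before all this, the weak formulation has to be made pointwise. The solution, its weak time derivative and the kernel
are replaced by Borel functions that agree with them almost everywhere. For almost every \<open>x\<close>, a countable family of test
functions in time shows that the solution has a version which is the primitive of the time derivative
(\<open>weak_derivative_imp_primitive\<close>), and for it the inequality form of the chain rule for \<open>(u\<^sub>+)\<^sup>2\<close> holds (\<open>pos_part_sq_chain_rule\<close>). For this version the energy
inequality holds between any two times.
\<close>

section \<open>The Riesz kernel\<close>

text \<open>The real-valued version of \<open>frac_kernel\<close>, as a function of the difference. It vanishes at the
origin because \<open>0 powr p = 0\<close>; this changes nothing, since the kernel is only ever multiplied by
increments \<open>f x - f y\<close> or integrated.\<close>

definition riesz_kernel :: "real \<Rightarrow> 'a::euclidean_space \<Rightarrow> real" where
  "riesz_kernel \<alpha> z = norm z powr (- (real DIM('a) + \<alpha>))"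

lemma ball_borel [measurable]: "ball (c :: 'a::metric_space) r \<in> sets borel"
  by simp

lemma Compl_ball_borel [measurable]: "- ball (c :: 'a::metric_space) r \<in> sets borel"
  by (intro borel_comp ball_borel)

lemma riesz_kernel_measurable [measurable]: "riesz_kernel \<alpha> \<in> borel_measurable borel"
  unfolding riesz_kernel_def by measurable

lemma riesz_kernel_nonneg [simp]: "0 \<le> riesz_kernel \<alpha> z"
  by (simp add: riesz_kernel_def)

lemma riesz_kernel_zero [simp]: "riesz_kernel \<alpha> 0 = 0"
  by (simp add: riesz_kernel_def)

lemma riesz_kernel_minus: "riesz_kernel \<alpha> (x - y) = riesz_kernel \<alpha> (y - x)"
  by (simp add: riesz_kernel_def norm_minus_commute)

lemma frac_kernel_eq_riesz:
  "x \<noteq> y \<Longrightarrow> frac_kernel \<alpha> x y = ennreal (riesz_kernel \<alpha> (x - y))"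
  unfolding frac_kernel_def riesz_kernel_def
  by (simp add: inverse_ennreal powr_minus[of _ "real DIM('a) + \<alpha>"] del: minus_add_distrib)

lemma ennreal_mult_frac_kernel:
  assumes "x = y \<Longrightarrow> a = 0" "0 \<le> a"
  shows "ennreal a * frac_kernel \<alpha> x y = ennreal (a * riesz_kernel \<alpha> (x - y))"
  using assms by (cases "x = y") (auto simp: frac_kernel_eq_riesz ennreal_mult)

text \<open>The weighted Young inequality that trades an \<open>L\<^sup>1\<close> quantity for a measure and an \<open>L\<^sup>2\<close> quantity. The
free parameter \<open>M\<close> will be the size of the level at which a function is truncated.\<close>

lemma le_add_square:
  fixes e M :: real
  assumes "0 < M"
  shows "e \<le> M + 1 / M * e\<^sup>2"
proof -
  have "2 * e * M \<le> e\<^sup>2 + M\<^sup>2" by (rule sum_squares_bound)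
  moreover have "0 \<le> e\<^sup>2 + M\<^sup>2" by simp
  ultimately have "e * M \<le> e\<^sup>2 + M\<^sup>2" by linarith
  then show ?thesis using assms by (simp add: field_simps power2_eq_square)
qed

lemma nn_integral_le_square:
  fixes f :: "'a \<Rightarrow> real"
  assumes M: "0 < M" and [measurable]: "f \<in> borel_measurable N" "A \<in> sets N"
  shows "(\<integral>\<^sup>+x\<in>A. ennreal (f x) \<partial>N) \<le> ennreal M * emeasure N A + ennreal (1 / M) * (\<integral>\<^sup>+x\<in>A. ennreal ((f x)\<^sup>2) \<partial>N)"
proof -
  have "(\<integral>\<^sup>+x\<in>A. ennreal (f x) \<partial>N) \<le> (\<integral>\<^sup>+x. ennreal M * indicator A x + ennreal (1 / M) * (ennreal ((f x)\<^sup>2) * indicator A x) \<partial>N)"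
  proof (rule nn_integral_mono)
    fix x
    have "ennreal (f x) \<le> ennreal (M + 1 / M * (f x)\<^sup>2)" by (intro ennreal_leI le_add_square M)
    also have "\<dots> = ennreal M + ennreal (1 / M) * ennreal ((f x)\<^sup>2)"
      using M by (subst ennreal_plus) (auto simp: ennreal_mult[symmetric])
    finally show "ennreal (f x) * indicator A x \<le> ennreal M * indicator A x + ennreal (1 / M) * (ennreal ((f x)\<^sup>2) * indicator A x)"
      by (cases "x \<in> A") auto
  qed
  also have "\<dots> = ennreal M * emeasure N A + ennreal (1 / M) * (\<integral>\<^sup>+x\<in>A. ennreal ((f x)\<^sup>2) \<partial>N)"
    by (simp add: nn_integral_add nn_integral_cmult nn_integral_cmult_indicator)
  finally show ?thesis .
qed

lemma nn_integral_translate: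
  fixes x :: "'a::euclidean_space"
  assumes [measurable]: "f \<in> borel_measurable borel"
  shows "(\<integral>\<^sup>+y. f (x + y) \<partial>lborel) = (\<integral>\<^sup>+y. f y \<partial>lborel)"
proof -
  have "(\<integral>\<^sup>+y. f y \<partial>lborel) = (\<integral>\<^sup>+y. f y \<partial>distr lborel borel ((+) x))"
    by (simp only: lborel_distr_plus)
  also have "\<dots> = (\<integral>\<^sup>+y. f (x + y) \<partial>lborel)"
    by (rule nn_integral_distr) auto
  finally show ?thesis by simp
qed

lemma nn_integral_translate_diff:
  fixes x :: "'a::euclidean_space"
  assumes [measurable]: "f \<in> borel_measurable borel"
  shows "(\<integral>\<^sup>+y. f (y - x) \<partial>lborel) = (\<integral>\<^sup>+y. f y \<partial>lborel)"
  using nn_integral_translate[OF assms, of "- x"] by simp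

lemma nn_integral_dilate2:
  fixes f :: "'a::euclidean_space \<Rightarrow> ennreal"
  assumes [measurable]: "f \<in> borel_measurable borel"
  shows "(\<integral>\<^sup>+y. f y \<partial>lborel) = ennreal (2 ^ DIM('a)) * (\<integral>\<^sup>+y. f (2 *\<^sub>R y) \<partial>lborel)"
proof -
  have "(\<integral>\<^sup>+y. f y \<partial>lborel) =
      (\<integral>\<^sup>+y. f y \<partial>density (distr lborel borel (\<lambda>x::'a. 0 + 2 *\<^sub>R x)) (\<lambda>_. ennreal (\<bar>2\<bar> ^ DIM('a))))"
    using lborel_affine[of 2 "0::'a"] by simp
  also have "\<dots> = (\<integral>\<^sup>+y. ennreal (2 ^ DIM('a)) * f (2 *\<^sub>R y) \<partial>lborel)"
    by (simp add: nn_integral_density nn_integral_distr)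
  also have "\<dots> = ennreal (2 ^ DIM('a)) * (\<integral>\<^sup>+y. f (2 *\<^sub>R y) \<partial>lborel)"
    by (rule nn_integral_cmult) simp
  finally show ?thesis .
qed

text \<open>Integrals of power functions are estimated by dyadic shells rather than by polar coordinates:
a bound on each shell and the volume of the ball that contains it suffice, up to a factor that
depends on the dimension only.\<close>

lemma nn_integral_le_sum_balls:
  fixes f :: "'a::euclidean_space \<Rightarrow> ennreal"
  assumes "\<And>k. 0 \<le> a k" "\<And>k. 0 < r k"
    and f: "\<And>z. f z \<noteq> 0 \<Longrightarrow> \<exists>k. z \<in> ball 0 (r k) \<and> f z \<le> ennreal (a k)"
    and s: "(\<lambda>k. a k * r k ^ DIM('a)) sums s"
  shows "(\<integral>\<^sup>+z. f z \<partial>lborel) \<le> ennreal (unit_ball_vol DIM('a) * s)"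
proof -
  have le: "f z \<le> (\<Sum>k. ennreal (a k) * indicator (ball 0 (r k)) z)" for z
  proof (cases "f z = 0")
    case False
    then obtain k where k: "z \<in> ball 0 (r k)" "f z \<le> ennreal (a k)" using f by blast
    have "f z \<le> (\<Sum>j\<in>{k}. ennreal (a j) * indicator (ball 0 (r j)) z)"
      using k by simp
    also have "\<dots> \<le> (\<Sum>j. ennreal (a j) * indicator (ball 0 (r j)) z)"
      by (rule sum_le_suminf) auto
    finally show ?thesis .
  qed simp
  have "(\<integral>\<^sup>+z. f z \<partial>lborel) \<le> (\<integral>\<^sup>+z. (\<Sum>k. ennreal (a k) * indicator (ball 0 (r k)) z) \<partial>(lborel :: 'a measure))"
    by (intro nn_integral_mono le)
  also have "\<dots> = (\<Sum>k. ennreal (a k) * emeasure lborel (ball (0::'a) (r k)))"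
    by (subst nn_integral_suminf) (auto simp: nn_integral_cmult_indicator)
  also have "\<dots> = (\<Sum>k. ennreal (unit_ball_vol DIM('a) * (a k * r k ^ DIM('a))))"
    using assms(1,2) by (intro suminf_cong) (simp add: emeasure_ball less_imp_le ennreal_mult[symmetric] mult_ac)
  also have "\<dots> = ennreal (unit_ball_vol DIM('a) * s)"
    using assms(1,2) s by (intro suminf_ennreal_eq sums_mult) (auto simp: less_imp_le)
  finally show ?thesis .
qed

text \<open>Quantifies the geometric series with ratio \<open>2 powr (- s)\<close> as \<open>s\<close> tends to \<open>0\<close>: its sum is at most
\<open>4 / s\<close>. For \<open>s = 2 - \<alpha>\<close> this is the singularity that the normalising factor \<open>2 - \<alpha>\<close> of the energies
compensates, so that the estimates stay uniform up to \<open>\<alpha> = 2\<close>.\<close>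

lemma one_minus_two_powr_ge:
  assumes "0 \<le> s" "s \<le> (2::real)"
  shows "s / 4 \<le> 1 - 2 powr (- s)"
proof -
  have l: "1 / 2 \<le> ln (2::real)" using ln2_ge_two_thirds by simp
  have "1 + s / 2 \<le> 1 + s * ln 2" using assms mult_left_mono[OF l, of s] by simp
  also have "\<dots> \<le> exp (s * ln 2)" by (rule exp_ge_add_one_self)
  finally have "1 + s / 2 \<le> 2 powr s" by (simp add: powr_def)
  then have "2 powr (-s) \<le> 1 / (1 + s / 2)"
    using assms by (simp add: powr_minus field_simps)
  also have "1 / (1 + s / 2) \<le> 1 - s / 4"
    using assms by (simp add: field_simps power2_eq_square[symmetric])
      (use mult_right_mono[of s 2 s] in \<open>simp add: power2_eq_square\<close>)
  finally show ?thesis by simp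
qed

lemma dyadic_sums:
  assumes "0 < s" "s \<le> (2::real)"
  obtains S where "(\<lambda>k. (2 powr (- s)) ^ k) sums S" "0 \<le> S" "S \<le> 4 / s"
proof
  have lt: "2 powr (- s) < 1" using assms by (simp add: powr_less_one)
  show "(\<lambda>k. (2 powr (- s)) ^ k) sums (1 / (1 - 2 powr (- s)))"
    by (rule geometric_sums) (use lt in auto)
  show "0 \<le> 1 / (1 - 2 powr (- s))" using lt by simp
  show "1 / (1 - 2 powr (- s)) \<le> 4 / s"
    using one_minus_two_powr_ge[of s] assms lt by (simp add: field_simps)
qed

lemma dyadic_inside:
  fixes s t :: real
  assumes "0 < t" "t < s"
  obtains k where "t < s / 2 ^ k" "s / 2 ^ Suc k \<le> t"
proof -
  obtain n where n: "s / 2 ^ n \<le> t"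
  proof -
    obtain n where "s / t < 2 ^ n" using real_arch_pow[of 2 "s / t"] by auto
    then have "s / 2 ^ n \<le> t" using assms by (simp add: field_simps)
    then show ?thesis using that by blast
  qed
  define m where "m = (LEAST n. s / 2 ^ n \<le> t)"
  have m: "s / 2 ^ m \<le> t" unfolding m_def by (rule LeastI[of _ n]) (rule n)
  have "m \<noteq> 0" using m assms by (intro notI) simp
  then obtain k where k: "m = Suc k" by (cases m) auto
  have "\<not> s / 2 ^ k \<le> t" using not_less_Least[of k "\<lambda>n. s / 2 ^ n \<le> t"] k m_def by auto
  then show ?thesis using that[of k] m k by auto
qed

lemma dyadic_outside:
  fixes s t :: real
  assumes "0 < s" "s \<le> t"
  obtains k where "t < s * 2 ^ Suc k" "s * 2 ^ k \<le> t"
proof -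
  obtain n where n: "t < s * 2 ^ n"
  proof -
    obtain n where "t / s < 2 ^ n" using real_arch_pow[of 2 "t / s"] by auto
    then have "t < s * 2 ^ n" using assms by (simp add: field_simps)
    then show ?thesis using that by blast
  qed
  define m where "m = (LEAST n. t < s * 2 ^ n)"
  have m: "t < s * 2 ^ m" unfolding m_def by (rule LeastI[of _ n]) (rule n)
  have "m \<noteq> 0" using m assms by (intro notI) simp
  then obtain k where k: "m = Suc k" by (cases m) auto
  have "\<not> t < s * 2 ^ k" using not_less_Least[of k "\<lambda>n. t < s * 2 ^ n"] k m_def by auto
  then show ?thesis using that[of k] m k by auto
qed

lemma powr_mono_base_neg:
  fixes a b p :: real
  assumes "0 < a" "a \<le> b" "0 \<le> p"
  shows "b powr (- p) \<le> a powr (- p)"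
  using assms powr_mono_both'[of "-p" "-p" b a] 
  by (simp add: powr_minus le_imp_inverse_le powr_mono2)

lemma riesz_near:
  fixes \<alpha> s :: real
  assumes "0 < s" "0 < \<alpha>" "\<alpha> < 2"
  shows "(\<integral>\<^sup>+z\<in>ball 0 s. ennreal ((norm z)\<^sup>2 * riesz_kernel \<alpha> z) \<partial>(lborel :: 'a::euclidean_space measure))
     \<le> ennreal (unit_ball_vol DIM('a) * 2 ^ (DIM('a) + 4) * s powr (2 - \<alpha>) / (2 - \<alpha>))"
proof -
  define p where "p = real DIM('a) + \<alpha>"
  have p: "0 \<le> p" "p \<le> DIM('a) + 2" using assms by (auto simp: p_def)
  obtain S where S: "(\<lambda>k. (2 powr (- (2 - \<alpha>))) ^ k) sums S" "0 \<le> S" "S \<le> 4 / (2 - \<alpha>)"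
    using dyadic_sums[of "2 - \<alpha>"] assms by auto
  (* bounds the integrand on the k-th shell *)
  define a where "a k = (s / 2 ^ k)\<^sup>2 * (s / 2 ^ Suc k) powr (- p)" for k
  have ak: "a k * (s / 2 ^ k) ^ DIM('a) = 2 powr p * s powr (2 - \<alpha>) * (2 powr (- (2 - \<alpha>))) ^ k" for k
  proof -
    define q where "q = s / 2 ^ k"
    have q: "0 < q" using assms by (simp add: q_def)
    have "(q / 2) powr (- p) = q powr (-p) * 2 powr p"
      using q by (simp add: powr_divide powr_minus field_simps)
    then have "a k * q ^ DIM('a) = 2 powr p * (q powr 2 * q powr (- p) * q powr DIM('a))"
      using q unfolding a_def q_def by (simp add: powr_realpow mult_ac)
    also have "q powr 2 * q powr (- p) * q powr DIM('a) = q powr (2 - \<alpha>)"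
      by (simp add: powr_add[symmetric] p_def)
    also have "q powr (2 - \<alpha>) = s powr (2 - \<alpha>) * (2 powr (- (2 - \<alpha>))) ^ k"
    proof -
      have "(2 ^ k) powr (2 - \<alpha>) * (2 powr (- (2 - \<alpha>))) ^ k = (1::real)"
        by (simp add: powr_realpow[symmetric] powr_powr powr_power powr_add[symmetric] algebra_simps)
      then show ?thesis
        using assms by (simp add: q_def powr_divide field_simps)
    qed
    finally show ?thesis by (simp add: q_def)
  qed
  have "(\<integral>\<^sup>+z\<in>ball 0 s. ennreal ((norm z)\<^sup>2 * riesz_kernel \<alpha> z) \<partial>(lborel :: 'a measure))
     \<le> ennreal (unit_ball_vol DIM('a) * (2 powr p * s powr (2 - \<alpha>) * S))"
  proof (rule nn_integral_le_sum_balls[where r="\<lambda>k. s / 2 ^ k" and a=a])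
    show "0 \<le> a k" for k by (simp add: a_def)
    show "0 < s / 2 ^ k" for k using assms by simp
    show "(\<lambda>k. a k * (s / 2 ^ k) ^ DIM('a)) sums (2 powr p * s powr (2 - \<alpha>) * S)"
      unfolding ak by (intro sums_mult S)
    fix z :: 'a
    assume "ennreal ((norm z)\<^sup>2 * riesz_kernel \<alpha> z) * indicator (ball 0 s) z \<noteq> 0"
    then have z: "norm z < s" "z \<noteq> 0"
      by (auto simp: indicator_def split: if_splits)
    then obtain k where k: "norm z < s / 2 ^ k" "s / 2 ^ Suc k \<le> norm z"
      using dyadic_inside[of "norm z" s] by auto
    have "(norm z)\<^sup>2 * riesz_kernel \<alpha> z \<le> a k"
      unfolding a_def riesz_kernel_def p_def[symmetric]
      using k assms p by (intro mult_mono power_mono powr_mono_base_neg) auto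
    then show "\<exists>k. z \<in> ball 0 (s / 2 ^ k) \<and> ennreal ((norm z)\<^sup>2 * riesz_kernel \<alpha> z) * indicator (ball 0 s) z \<le> ennreal (a k)"
      using k z by (intro exI[of _ k]) (auto simp: ennreal_leI)
  qed
  also have "\<dots> \<le> ennreal (unit_ball_vol DIM('a) * (2 powr (real (DIM('a) + 2)) * s powr (2 - \<alpha>) * (4 / (2 - \<alpha>))))"
    using S p assms by (intro ennreal_leI mult_left_mono mult_mono mult_right_mono powr_mono[of p] mult_nonneg_nonneg) auto
  also have "2 powr (real (DIM('a) + 2)) = 2 ^ (DIM('a) + 2)"
    by (rule powr_realpow) simp
  finally show ?thesis by (simp add: power_add mult_ac)
qed

lemma riesz_far:
  fixes \<alpha> s :: real
  assumes "0 < s" "0 < \<alpha>" "\<alpha> < 2"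
  shows "(\<integral>\<^sup>+z\<in>- ball 0 s. ennreal (riesz_kernel \<alpha> z) \<partial>(lborel :: 'a::euclidean_space measure))
     \<le> ennreal (unit_ball_vol DIM('a) * 2 ^ (DIM('a) + 4) * s powr (- \<alpha>) / \<alpha>)"
proof -
  define p where "p = real DIM('a) + \<alpha>"
  have p: "0 \<le> p" using assms by (auto simp: p_def)
  obtain S where S: "(\<lambda>k. (2 powr (- \<alpha>)) ^ k) sums S" "0 \<le> S" "S \<le> 4 / \<alpha>"
    using dyadic_sums[of \<alpha>] assms by auto
  define a where "a k = (s * 2 ^ k) powr (- p)" for k
  have ak: "a k * (s * 2 ^ Suc k) ^ DIM('a) = 2 ^ DIM('a) * s powr (- \<alpha>) * (2 powr (- \<alpha>)) ^ k" for k
  proof -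
    define q where "q = s * 2 ^ k"
    have q: "0 < q" using assms by (simp add: q_def)
    have "a k * (s * 2 ^ Suc k) ^ DIM('a) = 2 ^ DIM('a) * (q powr (- p) * q powr DIM('a))"
      using q unfolding a_def q_def by (simp add: powr_realpow power_mult_distrib)
    also have "q powr (- p) * q powr DIM('a) = q powr (- \<alpha>)"
      by (simp add: powr_add[symmetric] p_def)
    also have "q powr (- \<alpha>) = s powr (- \<alpha>) * (2 powr (- \<alpha>)) ^ k"
      using assms by (simp add: q_def powr_mult powr_power powr_realpow[symmetric] powr_powr mult.commute)
    finally show ?thesis by (simp add: q_def)
  qed
  have "(\<integral>\<^sup>+z\<in>- ball 0 s. ennreal (riesz_kernel \<alpha> z) \<partial>(lborel :: 'a measure))
     \<le> ennreal (unit_ball_vol DIM('a) * (2 ^ DIM('a) * s powr (- \<alpha>) * S))"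
  proof (rule nn_integral_le_sum_balls[where r="\<lambda>k. s * 2 ^ Suc k" and a=a])
    show "0 \<le> a k" for k by (simp add: a_def)
    show "0 < s * 2 ^ Suc k" for k using assms by simp
    show "(\<lambda>k. a k * (s * 2 ^ Suc k) ^ DIM('a)) sums (2 ^ DIM('a) * s powr (- \<alpha>) * S)"
      unfolding ak by (intro sums_mult S)
    fix z :: 'a
    assume "ennreal (riesz_kernel \<alpha> z) * indicator (- ball 0 s) z \<noteq> 0"
    then have z: "s \<le> norm z"
      by (auto simp: indicator_def split: if_splits)
    then obtain k where k: "norm z < s * 2 ^ Suc k" "s * 2 ^ k \<le> norm z"
      using dyadic_outside[of s "norm z"] assms by auto
    have "riesz_kernel \<alpha> z \<le> a k"
      unfolding a_def riesz_kernel_def p_def[symmetric]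
      using k assms p by (intro powr_mono_base_neg) auto
    then show "\<exists>k. z \<in> ball 0 (s * 2 ^ Suc k) \<and> ennreal (riesz_kernel \<alpha> z) * indicator (- ball 0 s) z \<le> ennreal (a k)"
      using k z by (intro exI[of _ k]) (auto simp: ennreal_leI)
  qed
  also have "\<dots> \<le> ennreal (unit_ball_vol DIM('a) * (2 ^ (DIM('a) + 2) * s powr (- \<alpha>) * (4 / \<alpha>)))"
    using S p assms by (intro ennreal_leI mult_left_mono mult_mono) auto
  finally show ?thesis by (simp add: power_add mult_ac)
qed

text \<open>Near the diagonal the Lipschitz bound makes the integrand comparable to \<open>L\<^sup>2 |x - y|^(2-d-\<alpha>)\<close>, away
from it the oscillation is at most \<open>1\<close>; splitting at distance \<open>1 / L\<close> balances both parts.\<close>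

lemma riesz_lipschitz:
  fixes \<phi> :: "'a::euclidean_space \<Rightarrow> real"
  assumes L: "0 < L" "\<And>x y. \<bar>\<phi> x - \<phi> y\<bar> \<le> L * norm (x - y)" "\<And>x y. \<bar>\<phi> x - \<phi> y\<bar> \<le> 1"
    and \<alpha>: "0 < \<alpha>" "\<alpha> < 2"
  shows "(\<integral>\<^sup>+y. ennreal ((\<phi> x - \<phi> y)\<^sup>2 * riesz_kernel \<alpha> (x - y)) \<partial>lborel)
     \<le> ennreal (unit_ball_vol DIM('a) * 2 ^ (DIM('a) + 5) * L powr \<alpha> / (\<alpha> * (2 - \<alpha>)))"
proof -
  let ?c = "unit_ball_vol DIM('a) * 2 ^ (DIM('a) + 4)"
  define F :: "'a \<Rightarrow> ennreal" where "F z = ennreal (L\<^sup>2) * (ennreal ((norm z)\<^sup>2 * riesz_kernel \<alpha> z) * indicator (ball 0 (1 / L)) z)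
      + ennreal (riesz_kernel \<alpha> z) * indicator (- ball 0 (1 / L)) z" for z
  have [measurable]: "F \<in> borel_measurable borel" unfolding F_def by measurable
  have "ennreal ((\<phi> x - \<phi> y)\<^sup>2 * riesz_kernel \<alpha> (x - y)) \<le> F (y - x)" for y
  proof (cases "norm (y - x) < 1 / L")
    case True
    have "(\<phi> x - \<phi> y)\<^sup>2 \<le> (L * norm (y - x))\<^sup>2"
      using L(2)[of x y] by (metis abs_ge_zero norm_minus_commute power2_abs power_mono)
    then have "(\<phi> x - \<phi> y)\<^sup>2 * riesz_kernel \<alpha> (x - y) \<le> L\<^sup>2 * ((norm (y - x))\<^sup>2 * riesz_kernel \<alpha> (y - x))"
      using mult_right_mono[of "(\<phi> x - \<phi> y)\<^sup>2" "(L * norm (y - x))\<^sup>2" "riesz_kernel \<alpha> (y - x)"] riesz_kernel_minus[of \<alpha> x y]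
      by (simp add: power_mult_distrib mult.assoc)
    then show ?thesis using True
      by (simp add: F_def ennreal_mult[symmetric] ennreal_leI)
  next
    case False
    have "(\<phi> x - \<phi> y)\<^sup>2 \<le> 1"
      using L(3)[of x y] by (simp add: abs_square_le_1)
    then have "(\<phi> x - \<phi> y)\<^sup>2 * riesz_kernel \<alpha> (x - y) \<le> riesz_kernel \<alpha> (y - x)"
      using mult_right_mono[of "(\<phi> x - \<phi> y)\<^sup>2" 1 "riesz_kernel \<alpha> (y - x)"] riesz_kernel_minus[of \<alpha> x y] by simp
    then show ?thesis using False by (simp add: F_def ennreal_leI)
  qed
  then have "(\<integral>\<^sup>+y. ennreal ((\<phi> x - \<phi> y)\<^sup>2 * riesz_kernel \<alpha> (x - y)) \<partial>lborel) \<le> (\<integral>\<^sup>+y. F (y - x) \<partial>lborel)"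
    by (intro nn_integral_mono) auto
  also have "\<dots> = (\<integral>\<^sup>+y. F y \<partial>lborel)"
    by (rule nn_integral_translate_diff) simp
  also have "\<dots> = ennreal (L\<^sup>2) * (\<integral>\<^sup>+z\<in>ball 0 (1 / L). ennreal ((norm z)\<^sup>2 * riesz_kernel \<alpha> z) \<partial>(lborel :: 'a measure))
      + (\<integral>\<^sup>+z\<in>- ball 0 (1 / L). ennreal (riesz_kernel \<alpha> z) \<partial>(lborel :: 'a measure))"
    unfolding F_def by (subst nn_integral_add) (auto simp: nn_integral_cmult)
  also have "\<dots> \<le> ennreal (L\<^sup>2) * ennreal (?c * (1 / L) powr (2 - \<alpha>) / (2 - \<alpha>)) + ennreal (?c * (1 / L) powr (- \<alpha>) / \<alpha>)"
    using L \<alpha> by (intro add_mono mult_left_mono riesz_near riesz_far) auto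
  also have "\<dots> = ennreal (L\<^sup>2 * (?c * (1 / L) powr (2 - \<alpha>) / (2 - \<alpha>)) + ?c * (1 / L) powr (- \<alpha>) / \<alpha>)"
    using \<alpha> by (simp add: ennreal_mult[symmetric] ennreal_plus[symmetric] del: ennreal_plus)
  also have "L\<^sup>2 * (?c * (1 / L) powr (2 - \<alpha>) / (2 - \<alpha>)) + ?c * (1 / L) powr (- \<alpha>) / \<alpha>
     = ?c * 2 * L powr \<alpha> / (\<alpha> * (2 - \<alpha>))"
  proof -
    have "(1 / L) powr (2 - \<alpha>) = L powr \<alpha> / L\<^sup>2"
      using L by (simp add: powr_divide powr_diff)
    moreover have "(1 / L) powr (- \<alpha>) = L powr \<alpha>"
      using L by (simp add: powr_divide powr_minus)
    ultimately show ?thesis using L \<alpha> by (simp add: field_simps)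
  qed
  finally show ?thesis by (simp add: power_add mult_ac)
qed

section \<open>A fractional Faber-Krahn inequality\<close>

definition gagliardo :: "real \<Rightarrow> ('a::euclidean_space \<Rightarrow> real) \<Rightarrow> ennreal" where
  "gagliardo \<alpha> f = ennreal (2 - \<alpha>) *
     (\<integral>\<^sup>+x. \<integral>\<^sup>+y. ennreal ((f x - f y)\<^sup>2 * riesz_kernel \<alpha> (x - y)) \<partial>lborel \<partial>lborel)"

text \<open>The squared \<open>L\<^sup>2\<close> modulus of continuity \<open>||f(\<cdot> + z) - f||\<^sup>2\<close>.\<close>

definition sq_increment :: "('a::euclidean_space \<Rightarrow> real) \<Rightarrow> 'a \<Rightarrow> ennreal" where
  "sq_increment f z = (\<integral>\<^sup>+x. ennreal ((f (x + z) - f x)\<^sup>2) \<partial>lborel)"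

lemma sq_increment_measurable [measurable]:
  assumes [measurable]: "f \<in> borel_measurable borel"
  shows "sq_increment f \<in> borel_measurable borel"
  unfolding sq_increment_def by measurable

lemma gagliardo_eq_sq_increment:
  fixes f :: "'a::euclidean_space \<Rightarrow> real"
  assumes [measurable]: "f \<in> borel_measurable borel"
  shows "gagliardo \<alpha> f = ennreal (2 - \<alpha>) * (\<integral>\<^sup>+z. ennreal (riesz_kernel \<alpha> z) * sq_increment f z \<partial>lborel)"
proof -
  have "(\<integral>\<^sup>+y. ennreal ((f x - f y)\<^sup>2 * riesz_kernel \<alpha> (x - y)) \<partial>lborel)
      = (\<integral>\<^sup>+z. ennreal (riesz_kernel \<alpha> z) * ennreal ((f (x + z) - f x)\<^sup>2) \<partial>lborel)" for x
  proof -
    have "(\<integral>\<^sup>+y. ennreal ((f x - f y)\<^sup>2 * riesz_kernel \<alpha> (x - y)) \<partial>lborel)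
        = (\<integral>\<^sup>+y. ennreal ((f x - f (x + y))\<^sup>2 * riesz_kernel \<alpha> (x - (x + y))) \<partial>lborel)"
      by (rule nn_integral_translate[symmetric]) simp
    also have "\<dots> = (\<integral>\<^sup>+z. ennreal (riesz_kernel \<alpha> z) * ennreal ((f (x + z) - f x)\<^sup>2) \<partial>lborel)"
      using riesz_kernel_minus[of \<alpha> "0::'a"] by (intro nn_integral_cong) (simp add: ennreal_mult[symmetric] power2_commute mult.commute)
    finally show ?thesis .
  qed
  then have "gagliardo \<alpha> f = ennreal (2 - \<alpha>) *
      (\<integral>\<^sup>+x. \<integral>\<^sup>+z. ennreal (riesz_kernel \<alpha> z) * ennreal ((f (x + z) - f x)\<^sup>2) \<partial>lborel \<partial>lborel)"
    unfolding gagliardo_def by simp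
  also have "(\<integral>\<^sup>+x. \<integral>\<^sup>+z. ennreal (riesz_kernel \<alpha> z) * ennreal ((f (x + z) - f x)\<^sup>2) \<partial>lborel \<partial>lborel)
      = (\<integral>\<^sup>+z. \<integral>\<^sup>+x. ennreal (riesz_kernel \<alpha> z) * ennreal ((f (x + z) - f x)\<^sup>2) \<partial>lborel \<partial>lborel)"
    by (rule lborel_pair.Fubini') measurable
  also have "\<dots> = (\<integral>\<^sup>+z. ennreal (riesz_kernel \<alpha> z) * sq_increment f z \<partial>lborel)"
    unfolding sq_increment_def by (simp add: nn_integral_cmult)
  finally show ?thesis .
qed

text \<open>Two steps of length \<open>z\<close> make one step of length \<open>2 z\<close>, and \<open>(a + b)\<^sup>2 \<le> 2 a\<^sup>2 + 2 b\<^sup>2\<close>. This doubling property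
compares the modulus at different scales.\<close>

lemma sq_increment_double:
  fixes f :: "'a::euclidean_space \<Rightarrow> real"
  assumes [measurable]: "f \<in> borel_measurable borel"
  shows "sq_increment f (2 *\<^sub>R z) \<le> 4 * sq_increment f z"
proof -
  have "sq_increment f (2 *\<^sub>R z) \<le> (\<integral>\<^sup>+x. 2 * ennreal ((f ((x + z) + z) - f (x + z))\<^sup>2) + 2 * ennreal ((f (x + z) - f x)\<^sup>2) \<partial>lborel)"
    unfolding sq_increment_def
  proof (rule nn_integral_mono)
    fix x :: 'a
    have "(a - c)\<^sup>2 \<le> 2 * (a - b)\<^sup>2 + 2 * (b - c)\<^sup>2" for a b c :: real
      using zero_le_power2[of "(a - b) - (b - c)"] by (simp add: power2_eq_square algebra_simps)
    from this[of "f ((x + z) + z)" "f x" "f (x + z)"]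
    show "ennreal ((f (x + 2 *\<^sub>R z) - f x)\<^sup>2) \<le> 2 * ennreal ((f ((x + z) + z) - f (x + z))\<^sup>2) + 2 * ennreal ((f (x + z) - f x)\<^sup>2)"
      by (simp add: scaleR_2 add.assoc ennreal_leI flip: ennreal_plus ennreal_numeral ennreal_mult)
  qed
  also have "\<dots> = 2 * (\<integral>\<^sup>+x. ennreal ((f ((x + z) + z) - f (x + z))\<^sup>2) \<partial>lborel) + 2 * sq_increment f z"
    unfolding sq_increment_def by (subst nn_integral_add) (auto simp: nn_integral_cmult)
  also have "(\<integral>\<^sup>+x. ennreal ((f ((x + z) + z) - f (x + z))\<^sup>2) \<partial>lborel) = sq_increment f z"
    unfolding sq_increment_def
    using nn_integral_translate[of "\<lambda>x. ennreal ((f (x + z) - f x)\<^sup>2)" z] by (simp add: add.commute)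
  also have "2 * sq_increment f z + 2 * sq_increment f z = 4 * sq_increment f z"
    by (simp flip: distrib_right)
  finally show ?thesis .
qed

definition ball_increment :: "('a::euclidean_space \<Rightarrow> real) \<Rightarrow> real \<Rightarrow> ennreal" where
  "ball_increment f r = (\<integral>\<^sup>+z\<in>ball 0 r. sq_increment f z \<partial>lborel)"

lemma ball_increment_halve:
  fixes f :: "'a::euclidean_space \<Rightarrow> real"
  assumes [measurable]: "f \<in> borel_measurable borel"
  shows "ball_increment f r \<le> ennreal (2 ^ (DIM('a) + 2)) * ball_increment f (r / 2)"
proof -
  have "ball_increment f r = ennreal (2 ^ DIM('a)) * (\<integral>\<^sup>+z. sq_increment f (2 *\<^sub>R z) * indicator (ball 0 r) (2 *\<^sub>R z) \<partial>lborel)"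
    unfolding ball_increment_def by (rule nn_integral_dilate2) simp
  also have "\<dots> \<le> ennreal (2 ^ DIM('a)) * (\<integral>\<^sup>+z. 4 * (sq_increment f z * indicator (ball 0 (r / 2)) z) \<partial>lborel)"
  proof (intro mult_left_mono nn_integral_mono)
    fix z :: 'a
    have "sq_increment f (2 *\<^sub>R z) \<le> 4 * sq_increment f z" by (rule sq_increment_double) simp
    then show "sq_increment f (2 *\<^sub>R z) * indicator (ball 0 r) (2 *\<^sub>R z) \<le> 4 * (sq_increment f z * indicator (ball 0 (r / 2)) z)"
      by (auto simp: indicator_def)
  qed simp
  also have "\<dots> = ennreal (2 ^ (DIM('a) + 2)) * ball_increment f (r / 2)"
    unfolding ball_increment_def
    by (subst nn_integral_cmult) (simp_all add: power_add ennreal_mult mult_ac)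
  finally show ?thesis .
qed

lemma ball_increment_halves:
  fixes f :: "'a::euclidean_space \<Rightarrow> real"
  assumes [measurable]: "f \<in> borel_measurable borel"
  shows "ball_increment f r \<le> ennreal (2 ^ ((DIM('a) + 2) * k)) * ball_increment f (r / 2 ^ k)"
proof (induction k)
  case (Suc k)
  have "ball_increment f r \<le> ennreal (2 ^ ((DIM('a) + 2) * k)) * ball_increment f (r / 2 ^ k)" by (rule Suc)
  also have "\<dots> \<le> ennreal (2 ^ ((DIM('a) + 2) * k)) * (ennreal (2 ^ (DIM('a) + 2)) * ball_increment f (r / 2 ^ k / 2))"
    by (intro mult_left_mono ball_increment_halve) auto
  finally show ?case
    by (simp add: power_add ennreal_mult mult_ac)
qed simp

text \<open>The nonzero terms grow geometrically, so the sum is dominated by the last of them, which belongs to the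
smallest ball that still contains \<open>z\<close>. The ratio is at least \<open>2\<close> because \<open>d + \<alpha> \<ge> 1\<close>, which is why
the constant does not see \<open>\<alpha>\<close>.\<close>

lemma dyadic_kernel_sum:
  fixes z :: "'a::euclidean_space" and r \<alpha> :: real
  assumes "0 < r" "0 < \<alpha>" "z \<noteq> 0"
  shows "(\<Sum>k<N. (r / 2 ^ k) powr (- (real DIM('a) + \<alpha>)) * indicator (ball 0 (r / 2 ^ k)) z) \<le> 2 * riesz_kernel \<alpha> z"
proof -
  define p where "p = real DIM('a) + \<alpha>"
  have "1 \<le> real DIM('a)" using DIM_ge_Suc0[where 'a='a] by simp
  then have p: "1 \<le> p" using assms unfolding p_def by linarith
  define a where "a k = (r / 2 ^ k) powr (- p)" for k
  have a: "2 * a k \<le> a (Suc k)" for k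
  proof -
    have "a (Suc k) = 2 powr p * a k"
      using assms unfolding a_def by (simp add: powr_divide powr_mult powr_minus field_simps)
    moreover have "2 powr 1 \<le> 2 powr p" by (rule powr_mono) (use p in auto)
    ultimately show ?thesis using mult_right_mono[of 2 "2 powr p" "a k"] by (simp add: a_def)
  qed
  have "(\<Sum>k<N. a k * indicator (ball 0 (r / 2 ^ k)) z) \<le> 2 * riesz_kernel \<alpha> z
      \<and> (\<Sum>k<N. a k * indicator (ball 0 (r / 2 ^ k)) z) \<le> a N"
  proof (induction N)
    case 0
    then show ?case by (simp add: a_def)
  next
    case (Suc N)
    show ?case
    proof (cases "norm z < r / 2 ^ N")
      case True
      then have *: "(\<Sum>k<Suc N. a k * indicator (ball 0 (r / 2 ^ k)) z) \<le> 2 * a N"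
        using Suc by simp
      have "a N \<le> riesz_kernel \<alpha> z"
        unfolding a_def riesz_kernel_def p_def[symmetric]
        using True assms p by (intro powr_mono_base_neg) auto
      then show ?thesis using * a[of N] by linarith
    next
      case False
      have "a N \<le> a (Suc N)" using a[of N] a_def[of N] powr_ge_zero[of "r / 2 ^ N" "-p"] by linarith
      then show ?thesis using False Suc by simp
    qed
  qed
  then show ?thesis by (simp add: a_def p_def)
qed

text \<open>By doubling, the average of the modulus over \<open>ball 0 (r / 2^k)\<close> is at least \<open>4^-k\<close> times the one over
\<open>ball 0 r\<close>. Against the kernel, the scale \<open>r / 2^k\<close> therefore contributes at least
\<open>2^(-(2-\<alpha>) k)\<close> times the contribution of the scale \<open>r\<close>. For \<open>k \<le> 1 / (2 - \<alpha>)\<close> this factor is at least \<open>1/2\<close>, so about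
\<open>1 / (2 - \<alpha>)\<close> scales count fully, and they pay for the prefactor \<open>2 - \<alpha>\<close> of the energy.\<close>

lemma ball_increment_le_gagliardo:
  fixes f :: "'a::euclidean_space \<Rightarrow> real" and r \<alpha> :: real
  assumes [measurable]: "f \<in> borel_measurable borel"
    and r: "0 < r" and \<alpha>: "0 < \<alpha>" "\<alpha> < 2"
  shows "ball_increment f r \<le> ennreal (4 * r powr (DIM('a) + \<alpha>)) * gagliardo \<alpha> f"
proof -
  define p where "p = real DIM('a) + \<alpha>"
  (* each of the first N scales contributes at least half as much as the largest one *)
  define N where "N = nat \<lceil>1 / (2 - \<alpha>)\<rceil>"
  have N: "1 / (2 - \<alpha>) \<le> real N" unfolding N_def by linarith
  have N1: "real k \<le> 1 / (2 - \<alpha>)" if "k < N" for k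
    using that \<alpha> unfolding N_def by linarith
  let ?I = "\<integral>\<^sup>+z. ennreal (riesz_kernel \<alpha> z) * sq_increment f z \<partial>lborel"
  have z0: "sq_increment f 0 = 0" by (simp add: sq_increment_def)
  have "(\<Sum>k<N. ennreal ((r / 2 ^ k) powr (- p)) * ball_increment f (r / 2 ^ k))
      = (\<integral>\<^sup>+z. (\<Sum>k<N. ennreal ((r / 2 ^ k) powr (- p)) * (sq_increment f z * indicator (ball 0 (r / 2 ^ k)) z)) \<partial>lborel)"
    unfolding ball_increment_def by (subst nn_integral_sum) (auto simp: nn_integral_cmult)
  also have "\<dots> \<le> (\<integral>\<^sup>+z. 2 * (ennreal (riesz_kernel \<alpha> z) * sq_increment f z) \<partial>lborel)"
  proof (rule nn_integral_mono)
    fix z :: 'a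
    show "(\<Sum>k<N. ennreal ((r / 2 ^ k) powr (- p)) * (sq_increment f z * indicator (ball 0 (r / 2 ^ k)) z))
        \<le> 2 * (ennreal (riesz_kernel \<alpha> z) * sq_increment f z)"
    proof (cases "z = 0")
      case False
      have "(\<Sum>k<N. ennreal ((r / 2 ^ k) powr (- p)) * (sq_increment f z * indicator (ball 0 (r / 2 ^ k)) z))
          = (\<Sum>k<N. ennreal ((r / 2 ^ k) powr (- p) * indicator (ball 0 (r / 2 ^ k)) z)) * sq_increment f z"
        unfolding sum_distrib_right by (intro sum.cong) (auto simp: indicator_def)
      also have "\<dots> = ennreal (\<Sum>k<N. (r / 2 ^ k) powr (- p) * indicator (ball 0 (r / 2 ^ k)) z) * sq_increment f z"
        by (simp add: sum_ennreal)
      also have "\<dots> \<le> ennreal (2 * riesz_kernel \<alpha> z) * sq_increment f z"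
        unfolding p_def using dyadic_kernel_sum[OF r \<alpha>(1) False]
        by (intro mult_right_mono ennreal_leI) (auto simp: p_def)
      finally show ?thesis by (simp add: ennreal_mult mult.assoc)
    qed (simp add: z0)
  qed
  also have "\<dots> = 2 * ?I" by (simp add: nn_integral_cmult)
  finally have 1: "(\<Sum>k<N. ennreal ((r / 2 ^ k) powr (- p)) * ball_increment f (r / 2 ^ k)) \<le> 2 * ?I" .
  have "ennreal (r powr (- p) / 2) * ball_increment f r \<le> ennreal ((r / 2 ^ k) powr (- p)) * ball_increment f (r / 2 ^ k)" if "k < N" for k
  proof -
    have e: "(r / 2 ^ k) powr (- p) = r powr (- p) * (2 ^ ((DIM('a) + 2) * k)) * 2 powr (- (2 - \<alpha>) * k)"
    proof -
      have "(2 ^ k) powr p = (2 ^ ((DIM('a) + 2) * k)) * 2 powr (- (2 - \<alpha>) * k)"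
        by (simp add: powr_realpow[symmetric] powr_powr powr_power powr_add[symmetric] algebra_simps p_def)
      then show ?thesis using r by (simp add: powr_divide powr_minus field_simps)
    qed
    have h: "1 / 2 \<le> 2 powr (- (2 - \<alpha>) * k)"
    proof -
      have "(2 - \<alpha>) * k \<le> 1" using N1[OF that] \<alpha> by (simp add: field_simps)
      then have "2 powr (-1) \<le> (2::real) powr (- (2 - \<alpha>) * k)" by (intro powr_mono) (auto simp: algebra_simps)
      then show ?thesis by (simp add: powr_minus)
    qed
    have "ennreal (r powr (- p) / 2) * ball_increment f r
       \<le> ennreal (r powr (- p) / 2) * (ennreal (2 ^ ((DIM('a) + 2) * k)) * ball_increment f (r / 2 ^ k))"
      by (intro mult_left_mono ball_increment_halves) auto
    also have "\<dots> = ennreal (r powr (- p) / 2 * 2 ^ ((DIM('a) + 2) * k)) * ball_increment f (r / 2 ^ k)"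
      by (subst ennreal_mult) (auto simp: mult.assoc)
    also have "\<dots> \<le> ennreal ((r / 2 ^ k) powr (- p)) * ball_increment f (r / 2 ^ k)"
    proof (intro mult_right_mono ennreal_leI)
      show "r powr (- p) / 2 * 2 ^ ((DIM('a) + 2) * k) \<le> (r / 2 ^ k) powr (- p)"
        unfolding e using mult_left_mono[OF h, of "r powr (- p) * 2 ^ ((DIM('a) + 2) * k)"] by (simp add: mult_ac)
    qed auto
    finally show ?thesis .
  qed
  then have "(\<Sum>k<N. ennreal (r powr (- p) / 2) * ball_increment f r) \<le> 2 * ?I"
    by (intro order_trans[OF sum_mono 1]) auto
  then have 2: "ennreal (real N) * (ennreal (r powr (- p) / 2) * ball_increment f r) \<le> 2 * ?I"
    by (simp add: ennreal_of_nat_eq_real_of_nat)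
  have c: "1 \<le> (2 - \<alpha>) * real N" using N \<alpha> by (simp add: field_simps)
  have pr: "2 * r powr p * (r powr (- p) / 2) = 1" using r by (simp add: powr_minus field_simps)
  have "ball_increment f r = ennreal (2 * r powr p * (r powr (- p) / 2)) * ball_increment f r"
    unfolding pr by simp
  also have "\<dots> \<le> ennreal (2 * r powr p * (r powr (- p) / 2)) * ennreal ((2 - \<alpha>) * real N) * ball_increment f r"
    using c unfolding pr by (simp add: mult_right_mono[of 1 "ennreal ((2 - \<alpha>) * real N)", simplified])
  also have "\<dots> = ennreal (2 * r powr p * (2 - \<alpha>)) * (ennreal (real N) * (ennreal (r powr (- p) / 2) * ball_increment f r))"
  proof -
    have "ennreal (2 * r powr p * (r powr (- p) / 2)) * ennreal ((2 - \<alpha>) * real N)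
      = ennreal (2 * r powr p * (2 - \<alpha>)) * (ennreal (real N) * (ennreal (r powr (- p) / 2)))"
      using \<alpha> by (simp add: ennreal_mult[symmetric] mult_ac)
    then show ?thesis by (simp add: mult.assoc)
  qed
  also have "\<dots> \<le> ennreal (2 * r powr p * (2 - \<alpha>)) * (2 * ?I)"
    by (intro mult_left_mono 2) auto
  also have "\<dots> = ennreal (4 * r powr p) * gagliardo \<alpha> f"
  proof -
    have "ennreal (2 * r powr p * (2 - \<alpha>)) * 2 = ennreal (4 * r powr p) * ennreal (2 - \<alpha>)"
      using \<alpha> by (simp add: ennreal_mult[symmetric] mult_ac flip: ennreal_numeral)
    then show ?thesis
      by (subst gagliardo_eq_sq_increment) (simp_all add: mult.assoc[symmetric])
  qed
  finally show ?thesis by (simp add: p_def)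
qed

text \<open>Choose \<open>r\<close> so that the ball of radius \<open>r\<close> has volume \<open>2 m\<close>. For every \<open>x\<close>, the function vanishes on at
least half of the ball around \<open>x\<close>, where the increment from \<open>x\<close> is \<open>f x\<close> itself; hence \<open>m ||f||\<^sup>2\<close> is at
most the integral of the modulus over that ball. This replaces the fractional Sobolev inequality in
De Giorgi's argument and has a constant that is uniform in \<open>\<alpha>\<close>.\<close>

lemma fractional_faber_krahn:
  fixes f :: "'a::euclidean_space \<Rightarrow> real" and m \<alpha> :: real
  assumes f[measurable]: "f \<in> borel_measurable borel"
    and \<alpha>: "0 < \<alpha>" "\<alpha> < 2"
    and m: "0 < m" "emeasure lborel {x. f x \<noteq> 0} \<le> ennreal m"
  shows "(\<integral>\<^sup>+x. ennreal ((f x)\<^sup>2) \<partial>lborel)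
      \<le> ennreal (8 / unit_ball_vol DIM('a) * (2 * m / unit_ball_vol DIM('a)) powr (\<alpha> / DIM('a))) * gagliardo \<alpha> f"
proof -
  define \<omega> where "\<omega> = unit_ball_vol DIM('a)"
  have \<omega>: "0 < \<omega>" by (simp add: \<omega>_def)
  define r where "r = (2 * m / \<omega>) powr (1 / DIM('a))"
  have r: "0 < r" using m \<omega> by (simp add: r_def)
  have rd: "\<omega> * r ^ DIM('a) = 2 * m"
    using m \<omega> r by (simp add: powr_realpow[symmetric] r_def powr_powr)
  have rp: "r powr (DIM('a) + \<alpha>) = 2 * m / \<omega> * (2 * m / \<omega>) powr (\<alpha> / DIM('a))"
    using m \<omega> by (simp add: r_def powr_powr add_divide_distrib powr_add)
  have [measurable]: "{x. f x \<noteq> 0} \<in> sets borel" by measurable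
  have pt: "ennreal m * ennreal ((f x)\<^sup>2) \<le> (\<integral>\<^sup>+z\<in>ball 0 r. ennreal ((f (x + z) - f x)\<^sup>2) \<partial>lborel)" for x
  proof -
    let ?S = "{z. f (x + z) = 0} \<inter> ball 0 r"
    have Sm [measurable]: "?S \<in> sets borel" by measurable
    have Nm: "{z. f (x + z) \<noteq> 0} \<in> sets borel" by measurable
    have tr: "emeasure lborel {z. f (x + z) \<noteq> 0} = emeasure lborel {x. f x \<noteq> 0}"
    proof -
      have "emeasure lborel {z. f (x + z) \<noteq> 0} = (\<integral>\<^sup>+z. indicator {y. f y \<noteq> 0} (x + z) \<partial>lborel)"
        using nn_integral_indicator[of "{z. f (x + z) \<noteq> 0}" lborel] Nm by (simp add: indicator_def)
      also have "\<dots> = emeasure lborel {x. f x \<noteq> 0}"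
        by (subst nn_integral_translate) auto
      finally show ?thesis .
    qed
    have "ennreal (2 * m) = emeasure lborel (ball (0::'a) r)"
      using r rd by (simp add: emeasure_ball \<omega>_def)
    also have "\<dots> \<le> emeasure lborel (?S \<union> {z. f (x + z) \<noteq> 0})"
      using Sm Nm by (intro emeasure_mono) auto
    also have "\<dots> \<le> emeasure lborel ?S + emeasure lborel {z. f (x + z) \<noteq> 0}"
      using Sm Nm by (intro emeasure_subadditive) auto
    also have "\<dots> \<le> emeasure lborel ?S + ennreal m" using m tr by (intro add_left_mono) simp
    finally have "ennreal m + ennreal m \<le> emeasure lborel ?S + ennreal m"
      using m by (simp flip: ennreal_plus)
    then have "ennreal m \<le> emeasure lborel ?S"
      by (simp add: ennreal_add_left_cancel_le add.commute)
    then have "ennreal m * ennreal ((f x)\<^sup>2) \<le> emeasure lborel ?S * ennreal ((f x)\<^sup>2)"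
      by (rule mult_right_mono) simp
    also have "\<dots> = (\<integral>\<^sup>+z\<in>?S. ennreal ((f x)\<^sup>2) \<partial>lborel)"
      using Sm by (simp add: nn_integral_cmult_indicator mult.commute)
    also have "\<dots> \<le> (\<integral>\<^sup>+z\<in>ball 0 r. ennreal ((f (x + z) - f x)\<^sup>2) \<partial>lborel)"
      by (intro nn_integral_mono) (auto simp: indicator_def)
    finally show ?thesis .
  qed
  have "ennreal m * (\<integral>\<^sup>+x. ennreal ((f x)\<^sup>2) \<partial>lborel) = (\<integral>\<^sup>+x. ennreal m * ennreal ((f x)\<^sup>2) \<partial>lborel)"
    by (simp add: nn_integral_cmult)
  also have "\<dots> \<le> (\<integral>\<^sup>+x. \<integral>\<^sup>+z. ennreal ((f (x + z) - f x)\<^sup>2) * indicator (ball 0 r) z \<partial>lborel \<partial>lborel)"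
    by (intro nn_integral_mono pt)
  also have "\<dots> = (\<integral>\<^sup>+z. \<integral>\<^sup>+x. ennreal ((f (x + z) - f x)\<^sup>2) * indicator (ball 0 r) z \<partial>lborel \<partial>lborel)"
    by (rule lborel_pair.Fubini') measurable
  also have "\<dots> = ball_increment f r"
    unfolding ball_increment_def sq_increment_def by (simp add: nn_integral_multc)
  also have "\<dots> \<le> ennreal (4 * r powr (DIM('a) + \<alpha>)) * gagliardo \<alpha> f"
    by (rule ball_increment_le_gagliardo[OF f r \<alpha>])
  finally have *: "ennreal m * (\<integral>\<^sup>+x. ennreal ((f x)\<^sup>2) \<partial>lborel) \<le> ennreal (4 * r powr (DIM('a) + \<alpha>)) * gagliardo \<alpha> f" .
  have "(\<integral>\<^sup>+x. ennreal ((f x)\<^sup>2) \<partial>lborel) = ennreal (1 / m) * (ennreal m * (\<integral>\<^sup>+x. ennreal ((f x)\<^sup>2) \<partial>lborel))"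
    using m by (simp add: mult.assoc[symmetric] ennreal_mult[symmetric])
  also have "\<dots> \<le> ennreal (1 / m) * (ennreal (4 * r powr (DIM('a) + \<alpha>)) * gagliardo \<alpha> f)"
    by (intro mult_left_mono *) simp
  also have "\<dots> = ennreal (8 / \<omega> * (2 * m / \<omega>) powr (\<alpha> / DIM('a))) * gagliardo \<alpha> f"
    using m \<omega> unfolding rp by (simp add: mult.assoc[symmetric] ennreal_mult[symmetric])
  finally show ?thesis by (simp add: \<omega>_def)
qed

section \<open>Smooth bumps on the line\<close>

text \<open>The functions that arise by differentiating \<open>bump\<close>: polynomial over a power of \<open>(t - p) (q - t)\<close>, times
the exponential. The class is closed under differentiation, which gives smoothness.\<close>

definition bump_term :: "real \<Rightarrow> real \<Rightarrow> real \<Rightarrow> real poly \<Rightarrow> nat \<Rightarrow> real \<Rightarrow> real" where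
  "bump_term p q c P m t = (if p < t \<and> t < q
     then poly P t / ((t - p) * (q - t)) ^ m * exp (- c / ((t - p) * (q - t))) else 0)"

text \<open>The parameter \<open>c\<close> allows \<open>bump p q c\<close> to approach the indicator of \<open>{p<..<q}\<close> as \<open>c\<close> tends to \<open>0\<close>.\<close>

definition bump :: "real \<Rightarrow> real \<Rightarrow> real \<Rightarrow> real \<Rightarrow> real" where
  "bump p q c t = (if p < t \<and> t < q then exp (- c / ((t - p) * (q - t))) else 0)"

lemma bump_eq_bump_term: "bump p q c = bump_term p q c 1 0"
  by (auto simp: bump_def bump_term_def fun_eq_iff)

lemma power_div_fact_le_exp:
  fixes x :: real assumes "0 \<le> x" shows "x ^ k / fact k \<le> exp x"
proof -
  have "(\<Sum>n\<in>{k}. x ^ n /\<^sub>R fact n) \<le> (\<Sum>n. x ^ n /\<^sub>R fact n)"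
    using summable_exp_generic[of x] assms by (intro sum_le_suminf) auto
  then show ?thesis by (simp add: exp_def divide_inverse mult.commute)
qed

text \<open>The exponential beats every power of \<open>(t - p) (q - t)\<close>. Quadratic decay at both endpoints is enough
to see that the derivative there exists and is \<open>0\<close>.\<close>

lemma bump_term_quadratic:
  assumes "p < q" "0 < c"
  shows "\<exists>C. (\<forall>t. \<bar>bump_term p q c P m t\<bar> \<le> C * (t - p)\<^sup>2) \<and> (\<forall>t. \<bar>bump_term p q c P m t\<bar> \<le> C * (t - q)\<^sup>2)"
proof -
  have "bounded (poly P ` {p..q})"
    by (intro compact_imp_bounded compact_continuous_image) (auto intro!: continuous_intros)
  then obtain B where B: "0 < B" "\<And>t. t \<in> {p..q} \<Longrightarrow> \<bar>poly P t\<bar> \<le> B"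
    unfolding bounded_pos by auto
  define k where "k = m + 2"
  define C where "C = B * (fact k / c ^ k) * (q - p)\<^sup>2"
  have main: "\<bar>bump_term p q c P m t\<bar> \<le> B * (fact k / c ^ k) * ((t - p) * (q - t))\<^sup>2" if t: "p < t" "t < q" for t
  proof -
    define s where "s = (t - p) * (q - t)"
    have s: "0 < s" using t by (simp add: s_def)
    have "(c / s) ^ k / fact k \<le> exp (c / s)" using s assms by (intro power_div_fact_le_exp) auto
    then have "exp (- (c / s)) \<le> inverse ((c / s) ^ k / fact k)"
      unfolding exp_minus using s assms by (intro le_imp_inverse_le) auto
    also have "\<dots> = fact k / c ^ k * s ^ k" using s assms by (simp add: field_simps)
    finally have e: "exp (- (c / s)) \<le> fact k / c ^ k * s ^ k" .
    have "\<bar>bump_term p q c P m t\<bar> = \<bar>poly P t\<bar> / s ^ m * exp (- (c / s))"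
      using t s by (simp add: bump_term_def s_def[symmetric] abs_mult)
    also have "\<dots> \<le> B / s ^ m * (fact k / c ^ k * s ^ k)"
      using B t s e assms by (intro mult_mono divide_right_mono) auto
    also have "\<dots> = B * (fact k / c ^ k) * s\<^sup>2"
      using s by (simp add: k_def power_add power2_eq_square)
    finally show ?thesis by (simp add: s_def)
  qed
  have nn: "0 \<le> B * (fact k / c ^ k)" using B assms by simp
  have C0: "0 \<le> C" unfolding C_def by (rule mult_nonneg_nonneg[OF nn]) simp
  show ?thesis
  proof (intro exI[of _ C] conjI allI)
    fix t
    show "\<bar>bump_term p q c P m t\<bar> \<le> C * (t - p)\<^sup>2"
    proof (cases "p < t \<and> t < q")
      case True
      then have "((t - p) * (q - t))\<^sup>2 \<le> (q - p)\<^sup>2 * (t - p)\<^sup>2"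
        by (simp add: power_mult_distrib mult.commute mult_right_mono power_mono)
      then have "B * (fact k / c ^ k) * ((t - p) * (q - t))\<^sup>2 \<le> B * (fact k / c ^ k) * ((q - p)\<^sup>2 * (t - p)\<^sup>2)"
        using nn by (rule mult_left_mono)
      then show ?thesis using main[of t] True by (simp add: C_def mult.assoc)
    qed (use C0 in \<open>auto simp: bump_term_def\<close>)
    show "\<bar>bump_term p q c P m t\<bar> \<le> C * (t - q)\<^sup>2"
    proof (cases "p < t \<and> t < q")
      case True
      then have "((t - p) * (q - t))\<^sup>2 \<le> (q - p)\<^sup>2 * (t - q)\<^sup>2"
        by (simp add: power_mult_distrib power2_commute[of t q] mult_right_mono power_mono)
      then have "B * (fact k / c ^ k) * ((t - p) * (q - t))\<^sup>2 \<le> B * (fact k / c ^ k) * ((q - p)\<^sup>2 * (t - q)\<^sup>2)"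
        using nn by (rule mult_left_mono)
      then show ?thesis using main[of t] True by (simp add: C_def mult.assoc)
    qed (use C0 in \<open>auto simp: bump_term_def\<close>)
  qed
qed

lemma quadratic_zero_deriv:
  fixes f :: "real \<Rightarrow> real"
  assumes "\<And>t. \<bar>f t\<bar> \<le> C * (t - b)\<^sup>2"
  shows "(f has_real_derivative 0) (at b)"
proof -
  have fb: "f b = 0" using assms[of b] by simp
  have "((\<lambda>h. f (b + h) / h) \<longlongrightarrow> 0) (at 0)"
  proof (rule Lim_null_comparison[where g="\<lambda>h. C * \<bar>h\<bar>"])
    show "\<forall>\<^sub>F h in at 0. norm (f (b + h) / h) \<le> C * \<bar>h\<bar>"
      unfolding eventually_at_filter
    proof (intro always_eventually allI impI)
      fix h :: real assume "h \<noteq> 0"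
      then show "norm (f (b + h) / h) \<le> C * \<bar>h\<bar>"
        using assms[of "b + h"] by (simp add: field_simps power2_eq_square abs_mult)
    qed
    show "((\<lambda>h. C * \<bar>h\<bar>) \<longlongrightarrow> 0) (at 0)"
      by (auto intro!: tendsto_eq_intros)
  qed
  then show ?thesis unfolding DERIV_def using fb by simp
qed

lemma bump_term_has_derivative:
  assumes "p < q" "0 < c"
  obtains P' m' where "\<And>t. (bump_term p q c P m has_real_derivative bump_term p q c P' m' t) (at t)"
proof -
  define S where "S = [:- p, 1:] * [:q, -1:]"
  have S: "poly S t = (t - p) * (q - t)" for t by (simp add: S_def algebra_simps)
  define P' where "P' = pderiv P * S * S + smult c (P * pderiv S) - smult (real m) (P * pderiv S * S)"
  have "(bump_term p q c P m has_real_derivative bump_term p q c P' (m + 2) t) (at t)" for t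
  proof -
    consider "p < t \<and> t < q" | "t < p" | "q < t" | "t = p" | "t = q" by linarith
    then show ?thesis
    proof cases
      case 1
      define s where "s = (t - p) * (q - t)"
      have s: "0 < s" using 1 by (simp add: s_def)
      have s': "poly S t = s" using S s_def by simp
      have d1: "((\<lambda>t. poly P t / poly S t ^ m) has_real_derivative
          (poly (pderiv P) t * s ^ m - poly P t * (real m * s ^ (m - Suc 0) * poly (pderiv S) t)) / (s ^ m * s ^ m)) (at t)"
        using s by (auto intro!: derivative_eq_intros poly_DERIV simp: s')
      have d2: "((\<lambda>t. exp (- c / poly S t)) has_real_derivative exp (- c / s) * (c * poly (pderiv S) t / (s * s))) (at t)"
        using s by (auto intro!: derivative_eq_intros poly_DERIV simp: s')
      have "((\<lambda>t. poly P t / poly S t ^ m * exp (- c / poly S t)) has_real_derivative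
          (poly (pderiv P) t * s ^ m - poly P t * (real m * s ^ (m - Suc 0) * poly (pderiv S) t)) / (s ^ m * s ^ m) * exp (- c / s)
           + exp (- c / s) * (c * poly (pderiv S) t / (s * s)) * (poly P t / s ^ m)) (at t)"
        using DERIV_mult[OF d1 d2] by (simp add: s')
      also have "(poly (pderiv P) t * s ^ m - poly P t * (real m * s ^ (m - Suc 0) * poly (pderiv S) t)) / (s ^ m * s ^ m) * exp (- c / s)
           + exp (- c / s) * (c * poly (pderiv S) t / (s * s)) * (poly P t / s ^ m)
         = poly P' t / s ^ (m + 2) * exp (- c / s)"
      proof (cases m)
        case 0
        then show ?thesis using s unfolding P'_def by (simp add: s' field_simps power2_eq_square)
      next
        case (Suc n)
        have "(poly (pderiv P) t * s ^ m - poly P t * (real m * s ^ (m - Suc 0) * poly (pderiv S) t)) / (s ^ m * s ^ m)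
            = (poly (pderiv P) t * s - poly P t * (real m * poly (pderiv S) t)) * s / s ^ (m + 2)"
          using s Suc by (simp add: field_simps power_add)
        moreover have "(c * poly (pderiv S) t / (s * s)) * (poly P t / s ^ m) = c * poly (pderiv S) t * poly P t / s ^ (m + 2)"
          using s by (simp add: power_add power2_eq_square)
        moreover have "poly P' t = (poly (pderiv P) t * s - poly P t * (real m * poly (pderiv S) t)) * s + c * poly (pderiv S) t * poly P t"
          unfolding P'_def by (simp add: s' algebra_simps)
        ultimately have eq: "(poly (pderiv P) t * s ^ m - poly P t * (real m * s ^ (m - Suc 0) * poly (pderiv S) t)) / (s ^ m * s ^ m)
           + (c * poly (pderiv S) t / (s * s)) * (poly P t / s ^ m) = poly P' t / s ^ (m + 2)"
          by (simp only: add_divide_distrib)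
        show ?thesis unfolding eq[symmetric] by (simp only: ring_distribs mult_ac)
      qed
      finally have "((\<lambda>t. poly P t / poly S t ^ m * exp (- c / poly S t)) has_real_derivative bump_term p q c P' (m + 2) t) (at t)"
        using 1 by (simp add: bump_term_def s_def)
      then show ?thesis
        by (rule has_field_derivative_transform_within_open[where S="{p<..<q}"])
           (use 1 in \<open>auto simp: bump_term_def S\<close>)
    next
      case 2
      have "((\<lambda>_. 0) has_real_derivative 0) (at t)" by simp
      then have "(bump_term p q c P m has_real_derivative 0) (at t)"
        by (rule has_field_derivative_transform_within_open[where S="{..<p}"]) (use 2 in \<open>auto simp: bump_term_def\<close>)
      then show ?thesis using 2 by (simp add: bump_term_def)
    next
      case 3
      have "((\<lambda>_. 0) has_real_derivative 0) (at t)" by simp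
      then have "(bump_term p q c P m has_real_derivative 0) (at t)"
        by (rule has_field_derivative_transform_within_open[where S="{q<..}"]) (use 3 in \<open>auto simp: bump_term_def\<close>)
      then show ?thesis using 3 by (simp add: bump_term_def)
    next
      case 4
      obtain C where "\<And>t. \<bar>bump_term p q c P m t\<bar> \<le> C * (t - p)\<^sup>2"
        using bump_term_quadratic[OF assms, of P m] by metis
      from quadratic_zero_deriv[OF this] have "(bump_term p q c P m has_real_derivative 0) (at p)" .
      moreover have "bump_term p q c P' (m + 2) p = 0" by (simp add: bump_term_def)
      ultimately show ?thesis using 4 by simp
    next
      case 5
      obtain C where "\<And>t. \<bar>bump_term p q c P m t\<bar> \<le> C * (t - q)\<^sup>2"
        using bump_term_quadratic[OF assms, of P m] by metis
      from quadratic_zero_deriv[OF this] have "(bump_term p q c P m has_real_derivative 0) (at q)" .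
      moreover have "bump_term p q c P' (m + 2) q = 0" by (simp add: bump_term_def)
      ultimately show ?thesis using 5 by simp
    qed
  qed
  then show ?thesis by (rule that)
qed

lemma bump_continuous:
  assumes "p < q" "0 < c" shows "continuous_on A (bump p q c)"
proof -
  obtain P' m' where "\<And>t. (bump_term p q c 1 0 has_real_derivative bump_term p q c P' m' t) (at t)"
    using bump_term_has_derivative[OF assms, of 1 0] by blast
  then have "isCont (bump p q c) t" for t unfolding bump_eq_bump_term by (rule DERIV_isCont)
  then show ?thesis by (simp add: continuous_at_imp_continuous_on)
qed

text \<open>Two bumps are differentiated at once because the test functions below have the derivative
\<open>bump - r * bump\<close>, with a multiple that makes the integral vanish.\<close>

lemma bump_combination_derivs:
  assumes "p < q" "0 < c" "p' < q'" "0 < c'"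
  shows "\<exists>P m P' m'. (deriv ^^ k) (\<lambda>t. bump p q c t - r * bump p' q' c' t)
     = (\<lambda>t. bump_term p q c P m t - r * bump_term p' q' c' P' m' t)"
proof (induction k)
  case 0
  then show ?case unfolding bump_eq_bump_term by (intro exI) simp
next
  case (Suc k)
  then obtain P m P' m' where *: "(deriv ^^ k) (\<lambda>t. bump p q c t - r * bump p' q' c' t)
     = (\<lambda>t. bump_term p q c P m t - r * bump_term p' q' c' P' m' t)" by blast
  obtain Q n where 1: "\<And>t. (bump_term p q c P m has_real_derivative bump_term p q c Q n t) (at t)"
    using bump_term_has_derivative[OF assms(1,2), of P m] by blast
  obtain Q' n' where 2: "\<And>t. (bump_term p' q' c' P' m' has_real_derivative bump_term p' q' c' Q' n' t) (at t)"
    using bump_term_has_derivative[OF assms(3,4), of P' m'] by blast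
  have "((\<lambda>t. bump_term p q c P m t - r * bump_term p' q' c' P' m' t) has_real_derivative
     bump_term p q c Q n t - r * bump_term p' q' c' Q' n' t) (at t)" for t
    by (auto intro!: derivative_eq_intros 1 2)
  then have "deriv (\<lambda>t. bump_term p q c P m t - r * bump_term p' q' c' P' m' t) =
     (\<lambda>t. bump_term p q c Q n t - r * bump_term p' q' c' Q' n' t)"
    by (intro ext DERIV_imp_deriv)
  then show ?case using * by auto
qed

lemma bump_combination_differentiable:
  assumes "p < q" "0 < c" "p' < q'" "0 < c'"
  shows "(deriv ^^ k) (\<lambda>t. bump p q c t - r * bump p' q' c' t) differentiable_on UNIV"
proof -
  obtain P m P' m' where *: "(deriv ^^ k) (\<lambda>t. bump p q c t - r * bump p' q' c' t)
     = (\<lambda>t. bump_term p q c P m t - r * bump_term p' q' c' P' m' t)" using bump_combination_derivs[OF assms] by blast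
  obtain Q n where 1: "\<And>t. (bump_term p q c P m has_real_derivative bump_term p q c Q n t) (at t)"
    using bump_term_has_derivative[OF assms(1,2), of P m] by blast
  obtain Q' n' where 2: "\<And>t. (bump_term p' q' c' P' m' has_real_derivative bump_term p' q' c' Q' n' t) (at t)"
    using bump_term_has_derivative[OF assms(3,4), of P' m'] by blast
  have "((\<lambda>t. bump_term p q c P m t - r * bump_term p' q' c' P' m' t) has_real_derivative
     bump_term p q c Q n t - r * bump_term p' q' c' Q' n' t) (at t)" for t
    by (auto intro!: derivative_eq_intros 1 2)
  then have "(\<lambda>t. bump_term p q c P m t - r * bump_term p' q' c' P' m' t) differentiable at t" for t
    using real_differentiable_def by blast
  then show ?thesis unfolding * differentiable_on_def by simp
qed

lemma bump_measurable [measurable]: "bump p q c \<in> borel_measurable borel"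
  unfolding bump_def by measurable

lemma bump_bounds: "0 < c \<Longrightarrow> 0 \<le> bump p q c t \<and> bump p q c t \<le> indicator {p<..<q} t"
  by (auto simp: bump_def indicator_def)

lemma bump_nonneg: "0 \<le> bump p q c t"
  by (simp add: bump_def)

lemma bump_le_one: "0 < c \<Longrightarrow> bump p q c t \<le> 1"
  using bump_bounds[of c p q t] by (cases "p < t \<and> t < q") auto

lemma bump_integrable: "0 < c \<Longrightarrow> integrable lborel (bump p q c)"
proof (rule Bochner_Integration.integrable_bound)
  assume c: "0 < c"
  show "integrable lborel (\<lambda>t. indicator {p<..<q} t :: real)"
    by (cases "p \<le> q") (auto intro!: integrable_real_indicator)
  show "AE t in lborel. norm (bump p q c t) \<le> norm (indicator {p<..<q} t :: real)"
    using bump_bounds[OF c, of p q] by simp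
qed measurable

lemma bump_integral_pos: assumes "p < q" "0 < c" shows "0 < (LINT t|lborel. bump p q c t)"
proof -
  have "(LINT t|lborel. bump p q c t) \<noteq> 0"
  proof
    assume "(LINT t|lborel. bump p q c t) = 0"
    then have "AE t in lborel. bump p q c t = 0"
      using integral_nonneg_eq_0_iff_AE[OF bump_integrable[OF assms(2)]] bump_bounds[OF assms(2)] by auto
    then have "AE t in lborel. t \<notin> {p<..<q}" by eventually_elim (auto simp: bump_def)
    then have "emeasure lborel {p<..<q} = 0" by (intro AE_iff_measurable[THEN iffD1]) auto
    then show False using assms by simp
  qed
  moreover have "0 \<le> (LINT t|lborel. bump p q c t)" using bump_bounds[OF assms(2)] by simp
  ultimately show ?thesis by simp
qed

section \<open>Primitives\<close>

definition primitive :: "(real \<Rightarrow> real) \<Rightarrow> real \<Rightarrow> real" where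
  "primitive w t = (LINT s|lborel. indicator {..<t} s * w s)"

lemma integrable_indicator_mult:
  fixes w :: "real \<Rightarrow> real"
  assumes "integrable lborel w" "A \<in> sets borel"
  shows "integrable lborel (\<lambda>s. indicator A s * w s)"
  using integrable_mult_indicator[of A lborel w] assms by simp

lemma primitive_bound:
  assumes "integrable lborel w"
  shows "\<bar>primitive w t\<bar> \<le> (LINT s|lborel. \<bar>w s\<bar>)"
proof -
  have "\<bar>primitive w t\<bar> \<le> (LINT s|lborel. \<bar>indicator {..<t} s * w s\<bar>)"
    unfolding primitive_def by (rule integral_abs_bound)
  also have "\<dots> \<le> (LINT s|lborel. \<bar>w s\<bar>)"
    using assms by (intro integral_mono integrable_abs integrable_indicator_mult) (auto simp: indicator_def)
  finally show ?thesis .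
qed

lemma primitive_tendsto:
  assumes "integrable lborel w" "X \<longlonglongrightarrow> x"
  shows "(\<lambda>n. primitive w (X n)) \<longlonglongrightarrow> primitive w x"
  unfolding primitive_def
proof (rule integral_dominated_convergence[where w="\<lambda>s. \<bar>w s\<bar>"])
  have [measurable]: "w \<in> borel_measurable borel" using assms(1) by auto
  show "(\<lambda>s. indicator {..<x} s * w s) \<in> borel_measurable lborel" by measurable
  show "(\<lambda>s. indicator {..<X n} s * w s) \<in> borel_measurable lborel" for n by measurable
  show "integrable lborel (\<lambda>s. \<bar>w s\<bar>)" using assms by simp
  show "AE s in lborel. (\<lambda>n. indicator {..<X n} s * w s) \<longlonglongrightarrow> indicator {..<x} s * w s"
    using AE_lborel_singleton[of x]
  proof eventually_elim
    case (elim s)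
    have "\<forall>\<^sub>F n in sequentially. indicator {..<X n} s = (indicator {..<x} s :: real)"
    proof (cases "s < x")
      case True
      then have "\<forall>\<^sub>F n in sequentially. s < X n" using assms(2) order_tendstoD(1) by blast
      then show ?thesis by eventually_elim (use True in auto)
    next
      case False
      then have "x < s" using elim by simp
      then have "\<forall>\<^sub>F n in sequentially. X n < s" using assms(2) order_tendstoD(2) by blast
      then show ?thesis by eventually_elim (use False in auto)
    qed
    then have "\<forall>\<^sub>F n in sequentially. indicator {..<X n} s * w s = indicator {..<x} s * w s"
      by eventually_elim simp
    then show ?case by (rule tendsto_eventually)
  qed
qed (auto simp: indicator_def)

lemma primitive_continuous:
  assumes "integrable lborel w"
  shows "continuous_on A (primitive w)"
  using primitive_tendsto[OF assms]
  by (auto intro!: continuous_at_imp_continuous_on simp: continuous_at_sequentially o_def)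

lemma primitive_measurable [measurable]:
  assumes "integrable lborel w" shows "primitive w \<in> borel_measurable borel"
  using primitive_continuous[OF assms] by (rule borel_measurable_continuous_onI)

lemma primitive_diff:
  assumes "integrable lborel w" "s \<le> t"
  shows "primitive w t - primitive w s = (LINT r|lborel. indicator {s..<t} r * w r)"
proof -
  have "primitive w t - primitive w s = (LINT r|lborel. indicator {..<t} r * w r - indicator {..<s} r * w r)"
    unfolding primitive_def using assms by (intro Bochner_Integration.integral_diff[symmetric] integrable_indicator_mult) auto
  also have "\<dots> = (LINT r|lborel. indicator {s..<t} r * w r)"
    using assms by (intro Bochner_Integration.integral_cong) (auto simp: indicator_def)
  finally show ?thesis .
qed


section \<open>Functions with a weak derivative in time\<close>

text \<open>A fixed bump on the middle third of the interval, used to remove the mean of all other bumps.\<close>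

definition ref_bump :: "real \<Rightarrow> real \<Rightarrow> real \<Rightarrow> real" where
  "ref_bump a b = bump ((2 * a + b) / 3) ((a + 2 * b) / 3) 1"

text \<open>A bump corrected to mean zero, so that its primitive has compact support.\<close>

definition balanced_bump :: "real \<Rightarrow> real \<Rightarrow> real \<Rightarrow> real \<Rightarrow> real \<Rightarrow> real \<Rightarrow> real" where
  "balanced_bump a b p q c t = bump p q c t
     - (LINT s|lborel. bump p q c s) / (LINT s|lborel. ref_bump a b s) * ref_bump a b t"

definition supp_lo :: "real \<Rightarrow> real \<Rightarrow> real \<Rightarrow> real" where
  "supp_lo a b p = min p ((2 * a + b) / 3)"

definition supp_hi :: "real \<Rightarrow> real \<Rightarrow> real \<Rightarrow> real" where
  "supp_hi a b q = max q ((a + 2 * b) / 3)"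

definition bump_primitive :: "real \<Rightarrow> real \<Rightarrow> real \<Rightarrow> real \<Rightarrow> real \<Rightarrow> real \<Rightarrow> real" where
  "bump_primitive a b p q c = primitive (balanced_bump a b p q c)"

context
  fixes a b p q c :: real
  assumes ab: "a < b" and pq: "a < p" "p < q" "q < b" and c: "0 < c"
begin

lemma ref_bump_pos: "0 < (LINT s|lborel. ref_bump a b s)"
  unfolding ref_bump_def using ab by (intro bump_integral_pos) auto

lemma balanced_bump_integrable: "integrable lborel (balanced_bump a b p q c)"
  unfolding balanced_bump_def ref_bump_def using c
  by (intro Bochner_Integration.integrable_diff integrable_mult_right bump_integrable) auto

lemma balanced_bump_measurable [measurable]: "balanced_bump a b p q c \<in> borel_measurable borel"
  unfolding balanced_bump_def ref_bump_def by measurable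

lemma balanced_bump_integral: "(LINT t|lborel. balanced_bump a b p q c t) = 0"
proof -
  have "(LINT t|lborel. balanced_bump a b p q c t) = (LINT t|lborel. bump p q c t)
     - (LINT s|lborel. bump p q c s) / (LINT s|lborel. ref_bump a b s) * (LINT t|lborel. ref_bump a b t)"
  proof -
    have "integrable lborel (bump p q c)" "integrable lborel (\<lambda>t. (LINT s|lborel. bump p q c s) / (LINT s|lborel. ref_bump a b s) * ref_bump a b t)"
      unfolding ref_bump_def using c by (auto intro!: bump_integrable integrable_mult_right)
    from Bochner_Integration.integral_diff[OF this] show ?thesis
      unfolding balanced_bump_def by (simp only: integral_mult_right_zero)
  qed
  also have "\<dots> = 0" using ref_bump_pos by simp
  finally show ?thesis .
qed

lemma balanced_bump_supp:
  "a < supp_lo a b p" "supp_hi a b q < b" "t \<notin> {supp_lo a b p<..<supp_hi a b q} \<Longrightarrow> balanced_bump a b p q c t = 0"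
  using ab pq by (auto simp: supp_lo_def supp_hi_def balanced_bump_def bump_def ref_bump_def)

lemma balanced_bump_continuous: "continuous_on A (balanced_bump a b p q c)"
  unfolding balanced_bump_def ref_bump_def using ab pq c
  by (intro continuous_intros bump_continuous) auto

lemma bump_primitive_zero:
  "t \<notin> {supp_lo a b p<..<supp_hi a b q} \<Longrightarrow> bump_primitive a b p q c t = 0"
proof -
  assume t: "t \<notin> {supp_lo a b p<..<supp_hi a b q}"
  then consider "t \<le> supp_lo a b p" | "supp_hi a b q \<le> t"
    by (meson greaterThanLessThan_iff not_le)
  then show ?thesis
  proof cases
    case 1
    then have "(\<lambda>s. indicator {..<t} s * balanced_bump a b p q c s) = (\<lambda>s. 0)"
      using balanced_bump_supp(3) by (auto simp: fun_eq_iff indicator_def)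
    then show ?thesis unfolding bump_primitive_def primitive_def by simp
  next
    case 2
    then have "(\<lambda>s. indicator {..<t} s * balanced_bump a b p q c s) = balanced_bump a b p q c"
      using balanced_bump_supp(3) by (auto simp: fun_eq_iff indicator_def)
    then show ?thesis unfolding bump_primitive_def primitive_def using balanced_bump_integral by (simp only:)
  qed
qed

lemma bump_primitive_has_derivative:
  "(bump_primitive a b p q c has_real_derivative balanced_bump a b p q c t) (at t)"
proof (cases "t < supp_lo a b p")
  case True
  have "((\<lambda>_. 0) has_real_derivative 0) (at t)" by simp
  then have "(bump_primitive a b p q c has_real_derivative 0) (at t)"
  proof (rule has_field_derivative_transform_within_open[where S="{..<supp_lo a b p}"])
    fix x assume "x \<in> {..<supp_lo a b p}"
    then show "0 = bump_primitive a b p q c x" using bump_primitive_zero[of x] by simp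
  qed (use True in auto)
  then show ?thesis using True balanced_bump_supp(3)[of t] by simp
next
  case False
  then have at: "a < t" using balanced_bump_supp(1) by linarith
  have eq: "bump_primitive a b p q c x = integral {a..x} (balanced_bump a b p q c)" for x
  proof -
    have "bump_primitive a b p q c x = (LINT s:{a..x}|lborel. balanced_bump a b p q c s)"
      unfolding bump_primitive_def primitive_def set_lebesgue_integral_def
    proof (rule integral_cong_AE)
      show "AE s in lborel. indicator {..<x} s * balanced_bump a b p q c s = indicator {a..x} s *\<^sub>R balanced_bump a b p q c s"
        using AE_lborel_singleton[of x]
        by eventually_elim (use balanced_bump_supp(1,3) in \<open>force simp: indicator_def\<close>)
    qed measurable
    also have "\<dots> = integral {a..x} (balanced_bump a b p q c)"
      by (rule set_borel_integral_eq_integral(2))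
         (use integrable_mult_indicator[OF _ balanced_bump_integrable, of "{a..x}"] in \<open>simp add: set_integrable_def\<close>)
    finally show ?thesis .
  qed
  have "((\<lambda>x. integral {a..x} (balanced_bump a b p q c)) has_real_derivative balanced_bump a b p q c t) (at t within {a..t + 1})"
    using at by (intro integral_has_real_derivative balanced_bump_continuous) auto
  then have "((\<lambda>x. integral {a..x} (balanced_bump a b p q c)) has_real_derivative balanced_bump a b p q c t) (at t)"
    using at by (subst (asm) at_within_interior) auto
  then show ?thesis unfolding eq[symmetric] .
qed

lemma deriv_bump_primitive: "deriv (bump_primitive a b p q c) = balanced_bump a b p q c"
  by (intro ext DERIV_imp_deriv bump_primitive_has_derivative)

lemma bump_primitive_test_function: "bump_primitive a b p q c \<in> test_functions {a<..<b}"
  unfolding test_functions_def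
proof (intro CollectI conjI allI)
  fix k
  show "(deriv ^^ k) (bump_primitive a b p q c) differentiable_on UNIV"
  proof (cases k)
    case 0
    have "bump_primitive a b p q c differentiable at t" for t
      using bump_primitive_has_derivative real_differentiable_def by blast
    then show ?thesis using 0 by (simp add: differentiable_on_def)
  next
    case (Suc n)
    have "(deriv ^^ k) (bump_primitive a b p q c) = (deriv ^^ n) (balanced_bump a b p q c)"
      unfolding Suc funpow_Suc_right o_def deriv_bump_primitive ..
    also have "\<dots> = (deriv ^^ n) (\<lambda>t. bump p q c t - (LINT s|lborel. bump p q c s) / (LINT s|lborel. ref_bump a b s) * bump ((2 * a + b) / 3) ((a + 2 * b) / 3) 1 t)"
      by (simp add: balanced_bump_def[abs_def] ref_bump_def)
    finally have eq: "(deriv ^^ k) (bump_primitive a b p q c) = \<dots>" .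
    show ?thesis
      unfolding eq using ab pq c by (intro bump_combination_differentiable) auto
  qed
next
  let ?S = "{t. bump_primitive a b p q c t \<noteq> 0}"
  have sub: "closure ?S \<subseteq> {supp_lo a b p..supp_hi a b q}"
  proof (rule closure_minimal)
    show "?S \<subseteq> {supp_lo a b p..supp_hi a b q}"
    proof
      fix t assume "t \<in> ?S"
      then have "t \<in> {supp_lo a b p<..<supp_hi a b q}" using bump_primitive_zero[of t] by blast
      then show "t \<in> {supp_lo a b p..supp_hi a b q}" by simp
    qed
  qed simp
  then show "closure ?S \<subseteq> {a<..<b}" using balanced_bump_supp(1,2) by force
  show "compact (closure ?S)" 
    unfolding compact_closure using sub closure_subset[of ?S]
    by (intro bounded_subset[OF bounded_closed_interval[of "supp_lo a b p" "supp_hi a b q"]]) (rule order_trans)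
qed

lemma bump_primitive_by_parts:
  assumes w: "integrable lborel w"
  shows "(LINT t|lborel. bump_primitive a b p q c t * w t) = - (LINT t|lborel. balanced_bump a b p q c t * primitive w t)"
proof -
  let ?B = "balanced_bump a b p q c"
  have [measurable]: "w \<in> borel_measurable borel" using w by auto
  define F where "F = (\<lambda>(s::real, t::real). indicator {s<..} t * (w s * ?B t))"
  have [measurable]: "F \<in> borel_measurable (lborel \<Otimes>\<^sub>M lborel)"
  proof -
    have "F = (\<lambda>z. (if fst z < snd z then 1 else 0) * (w (fst z) * ?B (snd z)))"
      by (auto simp: F_def indicator_def fun_eq_iff)
    also have "\<dots> \<in> borel_measurable (lborel \<Otimes>\<^sub>M lborel)" by measurable
    finally show ?thesis .
  qed
  have prod: "integrable (lborel \<Otimes>\<^sub>M lborel) (\<lambda>(s, t). w s * ?B t)"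
  proof (rule lborel_pair.Fubini_integrable)
    show "integrable lborel (\<lambda>x. LINT y|lborel. norm (case (x, y) of (s, t) \<Rightarrow> w s * ?B t))"
      using w by (simp add: abs_mult)
    show "AE x in lborel. integrable lborel (\<lambda>y. case (x, y) of (s, t) \<Rightarrow> w s * ?B t)"
      using balanced_bump_integrable by simp
  qed measurable
  have intF: "integrable (lborel \<Otimes>\<^sub>M lborel) F"
    by (rule Bochner_Integration.integrable_bound[OF prod]) (auto simp: F_def indicator_def)
  have prim: "bump_primitive a b p q c s = - (LINT t|lborel. indicator {s<..} t * ?B t)" for s
  proof -
    have "0 = (LINT t|lborel. indicator {..<s} t * ?B t + indicator {s<..} t * ?B t)"
      unfolding balanced_bump_integral[symmetric]
    proof (rule integral_cong_AE)
      show "AE t in lborel. ?B t = indicator {..<s} t * ?B t + indicator {s<..} t * ?B t"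
        using AE_lborel_singleton[of s] by eventually_elim (auto simp: indicator_def)
    qed measurable
    also have "\<dots> = bump_primitive a b p q c s + (LINT t|lborel. indicator {s<..} t * ?B t)"
      unfolding bump_primitive_def primitive_def
      by (intro Bochner_Integration.integral_add integrable_indicator_mult balanced_bump_integrable) auto
    finally show ?thesis by simp
  qed
  have "(LINT t|lborel. ?B t * primitive w t) = (LINT t|lborel. LINT s|lborel. F (s, t))"
  proof (intro Bochner_Integration.integral_cong refl)
    fix t
    have "F (s, t) = ?B t * (indicator {..<t} s * w s)" for s by (simp add: F_def indicator_def)
    then show "?B t * primitive w t = (LINT s|lborel. F (s, t))" by (simp add: primitive_def)
  qed
  also have "\<dots> = (LINT s|lborel. LINT t|lborel. F (s, t))"
    using lborel_pair.Fubini_integral[of "\<lambda>s t. F (s, t)"] intF by simp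
  also have "\<dots> = (LINT s|lborel. - (bump_primitive a b p q c s * w s))"
  proof (intro Bochner_Integration.integral_cong refl)
    fix s
    have "F (s, t) = w s * (indicator {s<..} t * ?B t)" for t by (simp add: F_def indicator_def)
    then show "(LINT t|lborel. F (s, t)) = - (bump_primitive a b p q c s * w s)" by (simp add: prim)
  qed
  finally show ?thesis by simp
qed

end

text \<open>Countably many test functions, whose derivatives still determine a function up to constants. In the
weak formulation the exceptional null set of points \<open>x\<close> depends on the test function in time, so only
countably many of them can be used at the same \<open>x\<close>.\<close>

definition test_family :: "real \<Rightarrow> real \<Rightarrow> (real \<Rightarrow> real) set" where
  "test_family a b = {bump_primitive a b p q (1 / real (Suc n)) | p q n. p \<in> \<rat> \<and> q \<in> \<rat> \<and> a < p \<and> p < q \<and> q < b}"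

lemma test_family_countable: "countable (test_family a b)"
proof -
  have "test_family a b \<subseteq> (\<lambda>(p, q, n). bump_primitive a b p q (1 / real (Suc n))) ` (\<rat> \<times> \<rat> \<times> (UNIV :: nat set))"
    unfolding test_family_def by force
  then show ?thesis by (rule countable_subset) (auto simp: countable_rat)
qed

lemma test_family_test_functions: "a < b \<Longrightarrow> test_family a b \<subseteq> test_functions {a<..<b}"
  unfolding test_family_def using bump_primitive_test_function by auto

text \<open>By dominated convergence the integrals over all intervals \<open>{p<..<b}\<close> vanish, and the intervals
\<open>{x<..}\<close> determine a finite measure on the line; so on \<open>{a<..<b}\<close> the positive and the negative part of \<open>f\<close> have the
same integrals, hence are equal.\<close>

lemma AE_zero_if_interval_integrals_zero:
  fixes f :: "real \<Rightarrow> real"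
  assumes f: "integrable lborel f"
    and z: "\<And>p q. p \<in> \<rat> \<Longrightarrow> q \<in> \<rat> \<Longrightarrow> a < p \<Longrightarrow> p < q \<Longrightarrow> q < b \<Longrightarrow> (LINT t|lborel. indicator {p<..<q} t * f t) = 0"
  shows "AE t in lborel. t \<in> {a<..<b} \<longrightarrow> f t = 0"
proof -
  have [measurable]: "f \<in> borel_measurable borel" using f by auto
  have z': "(LINT t|lborel. indicator {p<..<b} t * f t) = 0" if pb: "a \<le> p" "p < b" for p
  proof -
    define e where "e n = (b - p) / 2 * inverse (real (Suc n))" for n
    have e: "0 < e n" "2 * e n \<le> b - p" for n
    proof -
      show "0 < e n" using pb by (simp add: e_def)
      have "(b - p) * inverse (real (Suc n)) \<le> (b - p) * 1"
        using pb by (intro mult_left_mono) (auto simp: inverse_le_1_iff)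
      moreover have "2 * e n = (b - p) * inverse (real (Suc n))" unfolding e_def by (simp del: of_nat_Suc)
      ultimately show "2 * e n \<le> b - p" by (simp only: mult_1_right)
    qed
    have "\<exists>r. r \<in> \<rat> \<and> p < r \<and> r < p + e n" for n
      using Rats_dense_in_real[of p "p + e n"] e(1)[of n] by (simp add: Bex_def)
    then obtain P where P: "\<And>n. P n \<in> \<rat>" "\<And>n. p < P n" "\<And>n. P n < p + e n" by metis
    have "\<exists>r. r \<in> \<rat> \<and> b - e n < r \<and> r < b" for n
      using Rats_dense_in_real[of "b - e n" b] e(1)[of n] by (simp add: Bex_def)
    then obtain Q where Q: "\<And>n. Q n \<in> \<rat>" "\<And>n. b - e n < Q n" "\<And>n. Q n < b" by metis
    have lim: "e \<longlonglongrightarrow> 0"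
    proof -
      have "e = (\<lambda>n. (b - p) / 2 * inverse (real (Suc n)))" by (simp only: e_def[abs_def])
      then show ?thesis using tendsto_mult_right_zero[OF LIMSEQ_inverse_real_of_nat, of "(b - p) / 2"] by (simp only:)
    qed
    have "P \<longlonglongrightarrow> p"
    proof (rule tendsto_sandwich[OF _ _ tendsto_const])
      show "\<forall>\<^sub>F n in sequentially. p \<le> P n" by (intro always_eventually allI less_imp_le P(2))
      show "\<forall>\<^sub>F n in sequentially. P n \<le> p + e n" by (intro always_eventually allI less_imp_le P(3))
      show "(\<lambda>n. p + e n) \<longlonglongrightarrow> p" using tendsto_add[OF tendsto_const[of p] lim] by (simp only: add_0_right)
    qed
    have "Q \<longlonglongrightarrow> b"
    proof (rule tendsto_sandwich[OF _ _ _ tendsto_const])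
      show "\<forall>\<^sub>F n in sequentially. Q n \<le> b" by (intro always_eventually allI less_imp_le Q(3))
      show "\<forall>\<^sub>F n in sequentially. b - e n \<le> Q n" by (intro always_eventually allI less_imp_le Q(2))
      show "(\<lambda>n. b - e n) \<longlonglongrightarrow> b" using tendsto_diff[OF tendsto_const[of b] lim] by (simp only: diff_0_right)
    qed
    have PQ: "P n < Q n" for n
      using P(3)[of n] Q(2)[of n] e(2)[of n] by linarith
    have "(\<lambda>n. LINT t|lborel. indicator {P n<..<Q n} t * f t) \<longlonglongrightarrow> (LINT t|lborel. indicator {p<..<b} t * f t)"
    proof (rule integral_dominated_convergence[where w="\<lambda>s. \<bar>f s\<bar>"])
      show "AE t in lborel. (\<lambda>n. indicator {P n<..<Q n} t * f t) \<longlonglongrightarrow> indicator {p<..<b} t * f t"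
      proof (intro AE_I2)
        fix t
        have "\<forall>\<^sub>F n in sequentially. indicator {P n<..<Q n} t = (indicator {p<..<b} t :: real)"
        proof (cases "p < t \<and> t < b")
          case True
          have "\<forall>\<^sub>F n in sequentially. P n < t" using \<open>P \<longlonglongrightarrow> p\<close> True order_tendstoD(2) by blast
          moreover have "\<forall>\<^sub>F n in sequentially. t < Q n" using \<open>Q \<longlonglongrightarrow> b\<close> True order_tendstoD(1) by blast
          ultimately show ?thesis by eventually_elim (use True in auto)
        next
          case False
          have "indicator {P n<..<Q n} t = (indicator {p<..<b} t :: real)" for n
            using False P(2)[of n] Q(3)[of n] by (auto simp: indicator_def)
          then show ?thesis by simp
        qed
        then have "\<forall>\<^sub>F n in sequentially. indicator {P n<..<Q n} t * f t = indicator {p<..<b} t * f t"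
          by eventually_elim simp
        then show "(\<lambda>n. indicator {P n<..<Q n} t * f t) \<longlonglongrightarrow> indicator {p<..<b} t * f t"
          by (rule tendsto_eventually)
      qed
      show "integrable lborel (\<lambda>s. \<bar>f s\<bar>)" using f by simp
    qed (auto simp: indicator_def)
    moreover have "(LINT t|lborel. indicator {P n<..<Q n} t * f t) = 0" for n
      using le_less_trans[OF pb(1) P(2)[of n]] by (intro z P(1) Q(1,3) PQ)
    ultimately show ?thesis by (simp add: LIMSEQ_const_iff)
  qed
  define fp where "fp t = ennreal (indicator {a<..<b} t * max (f t) 0)" for t
  define fn where "fn t = ennreal (indicator {a<..<b} t * max (- f t) 0)" for t
  have [measurable]: "fp \<in> borel_measurable borel" "fn \<in> borel_measurable borel" unfolding fp_def fn_def by measurable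
  have em: "emeasure (density lborel fp) {x<..} = ennreal (LINT t|lborel. indicator {max a x<..<b} t * max (f t) 0)"
    "emeasure (density lborel fn) {x<..} = ennreal (LINT t|lborel. indicator {max a x<..<b} t * max (- f t) 0)" for x
  proof -
    have i: "integrable lborel (\<lambda>t. indicator {max a x<..<b} t * max (f t) 0)"
      "integrable lborel (\<lambda>t. indicator {max a x<..<b} t * max (- f t) 0)"
      using f by (auto intro!: integrable_indicator_mult)
    have "emeasure (density lborel fp) {x<..} = (\<integral>\<^sup>+t. ennreal (indicator {max a x<..<b} t * max (f t) 0) \<partial>lborel)"
      by (subst emeasure_density) (auto simp: fp_def indicator_def intro!: nn_integral_cong)
    also have "\<dots> = ennreal (LINT t|lborel. indicator {max a x<..<b} t * max (f t) 0)"
      by (rule nn_integral_eq_integral[OF i(1)]) auto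
    finally show "emeasure (density lborel fp) {x<..} = ennreal (LINT t|lborel. indicator {max a x<..<b} t * max (f t) 0)" .
    have "emeasure (density lborel fn) {x<..} = (\<integral>\<^sup>+t. ennreal (indicator {max a x<..<b} t * max (- f t) 0) \<partial>lborel)"
      by (subst emeasure_density) (auto simp: fn_def indicator_def intro!: nn_integral_cong)
    also have "\<dots> = ennreal (LINT t|lborel. indicator {max a x<..<b} t * max (- f t) 0)"
      by (rule nn_integral_eq_integral[OF i(2)]) auto
    finally show "emeasure (density lborel fn) {x<..} = ennreal (LINT t|lborel. indicator {max a x<..<b} t * max (- f t) 0)" .
  qed
  have "density lborel fp = density lborel fn"
  proof (rule measure_eqI_lessThan)
    fix x :: real
    show "emeasure (density lborel fp) {x<..} < \<infinity>" unfolding em by simp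
    have i: "integrable lborel (\<lambda>t. indicator {max a x<..<b} t * max (f t) 0)"
      "integrable lborel (\<lambda>t. indicator {max a x<..<b} t * max (- f t) 0)"
      using f by (auto intro!: integrable_indicator_mult)
    have "(LINT t|lborel. indicator {max a x<..<b} t * f t) = 0"
    proof (cases "max a x < b")
      case True then show ?thesis by (intro z') auto
    next
      case False
      then have "{max a x<..<b} = {}" by auto
      then show ?thesis by simp
    qed
    also have "(LINT t|lborel. indicator {max a x<..<b} t * f t)
       = (LINT t|lborel. indicator {max a x<..<b} t * max (f t) 0 - indicator {max a x<..<b} t * max (- f t) 0)"
      by (intro Bochner_Integration.integral_cong) (auto simp: indicator_def)
    finally show "emeasure (density lborel fp) {x<..} = emeasure (density lborel fn) {x<..}"
      unfolding em by (simp add: Bochner_Integration.integral_diff[OF i])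
  qed auto
  then have "AE t in lborel. fp t = fn t"
    by (intro sigma_finite_measure.density_unique[OF sigma_finite_lborel]) auto
  then show ?thesis
    by eventually_elim (auto simp: fp_def fn_def max_def split: if_splits)
qed

text \<open>The du Bois-Reymond lemma. Testing with the primitive of a balanced bump and integrating by parts
shows that \<open>v\<close> minus the primitive of its weak derivative has the same integral against every bump as
the constant on the right, which is the mean of that difference with respect to \<open>ref_bump\<close>. Letting
the bumps shrink to indicators of intervals gives equality almost everywhere.\<close>

lemma weak_derivative_imp_primitive:
  assumes ab: "a < b" and v: "integrable lborel v" and w: "integrable lborel w"
    and eq: "\<And>\<eta>. \<eta> \<in> test_family a b \<Longrightarrow> (LINT t|lborel. deriv \<eta> t * v t) = - (LINT t|lborel. \<eta> t * w t)"
  shows "AE t in lborel. t \<in> {a<..<b} \<longrightarrow>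
    v t = (LINT s|lborel. ref_bump a b s * (v s - primitive w s)) / (LINT s|lborel. ref_bump a b s) + primitive w t"
proof -
  let ?C = "(LINT s|lborel. ref_bump a b s * (v s - primitive w s)) / (LINT s|lborel. ref_bump a b s)"
  (* the difference between the function and its claimed representation *)
  define f where "f t = v t - primitive w t - ?C" for t
  have mv[measurable]: "v \<in> borel_measurable borel" using v by auto
  have mw[measurable]: "primitive w \<in> borel_measurable borel" using w by (rule primitive_measurable)
  have mf[measurable]: "f \<in> borel_measurable borel" unfolding f_def by measurable
  have R: "0 < (LINT s|lborel. ref_bump a b s)" unfolding ref_bump_def using ab by (intro bump_integral_pos) auto
  have bv: "integrable lborel (\<lambda>t. bump p q c t * v t)" if "0 < c" for p q c
    by (rule Bochner_Integration.integrable_bound[OF v])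
       (auto simp: abs_mult bump_nonneg bump_le_one[OF that] intro!: mult_left_le_one_le AE_I2)
  have bw: "integrable lborel (\<lambda>t. bump p q c t * primitive w t)" if "0 < c" for p q c
  proof (rule Bochner_Integration.integrable_bound)
    show "integrable lborel (\<lambda>t. bump p q c t * (LINT s|lborel. \<bar>w s\<bar>))"
      by (intro integrable_mult_left bump_integrable that)
    show "AE t in lborel. norm (bump p q c t * primitive w t) \<le> norm (bump p q c t * (LINT s|lborel. \<bar>w s\<bar>))"
      using primitive_bound[OF w] by (intro AE_I2) (auto simp: abs_mult bump_nonneg intro!: mult_left_mono)
  qed measurable
  have bc: "integrable lborel (\<lambda>t. bump p q c t * ?C)" if "0 < c" for p q c
    using bump_integrable[OF that] by simp
  have bf: "(LINT t|lborel. bump p q (1 / real (Suc n)) t * f t) = 0"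
    if pq: "p \<in> \<rat>" "q \<in> \<rat>" "a < p" "p < q" "q < b" for p q n
  proof -
    let ?c = "1 / real (Suc n)" and ?m = "(LINT s|lborel. bump p q (1 / real (Suc n)) s) / (LINT s|lborel. ref_bump a b s)"
    have c: "0 < ?c" by simp
    have "bump_primitive a b p q ?c \<in> test_family a b" unfolding test_family_def using pq by auto
    from eq[OF this] have "(LINT t|lborel. balanced_bump a b p q ?c t * v t) = (LINT t|lborel. balanced_bump a b p q ?c t * primitive w t)"
      using deriv_bump_primitive[OF ab pq(3-5) c] bump_primitive_by_parts[OF ab pq(3-5) c w] by simp
    then have "0 = (LINT t|lborel. balanced_bump a b p q ?c t * v t) - (LINT t|lborel. balanced_bump a b p q ?c t * primitive w t)"
      by simp
    also have "(LINT t|lborel. balanced_bump a b p q ?c t * v t)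
        = (LINT t|lborel. bump p q ?c t * v t) - ?m * (LINT t|lborel. ref_bump a b t * v t)"
      unfolding balanced_bump_def ref_bump_def left_diff_distrib mult.assoc
      using bv c by (subst Bochner_Integration.integral_diff) auto
    also have "(LINT t|lborel. balanced_bump a b p q ?c t * primitive w t)
        = (LINT t|lborel. bump p q ?c t * primitive w t) - ?m * (LINT t|lborel. ref_bump a b t * primitive w t)"
      unfolding balanced_bump_def ref_bump_def left_diff_distrib mult.assoc
      using bw c by (subst Bochner_Integration.integral_diff) auto
    finally have "(LINT t|lborel. bump p q ?c t * v t) - (LINT t|lborel. bump p q ?c t * primitive w t)
        = ?m * ((LINT t|lborel. ref_bump a b t * v t) - (LINT t|lborel. ref_bump a b t * primitive w t))"
      by (simp add: right_diff_distrib)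
    also have "(LINT t|lborel. ref_bump a b t * v t) - (LINT t|lborel. ref_bump a b t * primitive w t)
        = (LINT t|lborel. ref_bump a b t * (v t - primitive w t))"
      unfolding ref_bump_def right_diff_distrib using bv bw
      by (subst Bochner_Integration.integral_diff) auto
    also have "?m * \<dots> = (LINT t|lborel. bump p q ?c t * ?C)" by simp
    finally have *: "(LINT t|lborel. bump p q ?c t * v t) - (LINT t|lborel. bump p q ?c t * primitive w t) - (LINT t|lborel. bump p q ?c t * ?C) = 0"
      by simp
    have "(\<lambda>t. bump p q ?c t * f t) = (\<lambda>t. bump p q ?c t * v t - bump p q ?c t * primitive w t - bump p q ?c t * ?C)"
      unfolding f_def by (simp only: right_diff_distrib)
    with * show ?thesis
      by (simp only: Bochner_Integration.integral_diff[OF Bochner_Integration.integrable_diff[OF bv[OF c] bw[OF c]] bc[OF c]]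
        Bochner_Integration.integral_diff[OF bv[OF c] bw[OF c]])
  qed
  define g where "g t = indicator {a<..<b} t * f t" for t
  have g: "integrable lborel g"
  proof -
    have "integrable lborel (\<lambda>t. indicator {a<..<b} t * (\<bar>v t\<bar>) + indicator {a<..<b} t * ((LINT s|lborel. \<bar>w s\<bar>) + \<bar>?C\<bar>))"
      using v ab by (intro Bochner_Integration.integrable_add integrable_indicator_mult integrable_mult_left integrable_real_indicator integrable_abs) auto
    then show ?thesis
    proof (rule Bochner_Integration.integrable_bound)
      show "g \<in> borel_measurable lborel" unfolding g_def by measurable
      have "\<bar>f t\<bar> \<le> \<bar>v t\<bar> + ((LINT s|lborel. \<bar>w s\<bar>) + \<bar>?C\<bar>)" for t
        unfolding f_def using primitive_bound[OF w, of t] by linarith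
      from order_trans[OF this abs_ge_self]
      show "AE t in lborel. norm (g t) \<le> norm (indicator {a<..<b} t * \<bar>v t\<bar> + indicator {a<..<b} t * ((LINT s|lborel. \<bar>w s\<bar>) + \<bar>?C\<bar>))"
        by (intro AE_I2) (simp add: g_def indicator_def)
    qed
  qed
  have "AE t in lborel. t \<in> {a<..<b} \<longrightarrow> g t = 0"
  proof (rule AE_zero_if_interval_integrals_zero[OF g])
    fix p q :: real assume pq: "p \<in> \<rat>" "q \<in> \<rat>" "a < p" "p < q" "q < b"
    have "(\<lambda>n. LINT t|lborel. bump p q (1 / real (Suc n)) t * f t) \<longlonglongrightarrow> (LINT t|lborel. indicator {p<..<q} t * g t)"
    proof (rule integral_dominated_convergence[where w="\<lambda>s. \<bar>g s\<bar>"])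
      show "integrable lborel (\<lambda>s. \<bar>g s\<bar>)" using g by simp
      show "(\<lambda>t. indicator {p<..<q} t * g t) \<in> borel_measurable lborel" unfolding g_def by measurable
      show "AE t in lborel. (\<lambda>n. bump p q (1 / real (Suc n)) t * f t) \<longlonglongrightarrow> indicator {p<..<q} t * g t"
      proof (intro AE_I2)
        fix t
        show "(\<lambda>n. bump p q (1 / real (Suc n)) t * f t) \<longlonglongrightarrow> indicator {p<..<q} t * g t"
        proof (cases "p < t \<and> t < q")
          case True
          have "(\<lambda>n. - (1 / real (Suc n)) / ((t - p) * (q - t))) \<longlonglongrightarrow> 0"
          proof -
            have "- (1 / real (Suc n)) / ((t - p) * (q - t)) = - 1 / ((t - p) * (q - t)) * inverse (real (Suc n))" for n
              by (simp add: divide_inverse)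
            then show ?thesis
              using tendsto_mult_right_zero[OF LIMSEQ_inverse_real_of_nat, of "- 1 / ((t - p) * (q - t))"] by (simp only:)
          qed
          then have "(\<lambda>n. exp (- (1 / real (Suc n)) / ((t - p) * (q - t))) * f t) \<longlonglongrightarrow> exp 0 * f t"
            by (intro tendsto_intros)
          then show ?thesis using True pq by (simp add: bump_def g_def)
        next
          case False then show ?thesis by (auto simp: bump_def)
        qed
      qed
      show "AE t in lborel. norm (bump p q (1 / real (Suc n)) t * f t) \<le> \<bar>g t\<bar>" for n
        using bump_bounds[of "1 / real (Suc n)" p q] pq
        by (intro AE_I2) (auto simp: g_def abs_mult indicator_def bump_def intro!: mult_left_le_one_le)
    qed measurable
    then show "(LINT t|lborel. indicator {p<..<q} t * g t) = 0"
      unfolding bf[OF pq] by (simp add: LIMSEQ_const_iff)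
  qed
  then show ?thesis by eventually_elim (auto simp: g_def f_def)
qed


section \<open>A chain rule for the square of the positive part\<close>

text \<open>The tangent inequality for the convex function \<open>x \<mapsto> (max x 0)\<^sup>2\<close>.\<close>

lemma pos_part_sq_convex:
  fixes x y :: real
  shows "(max x 0)\<^sup>2 - (max y 0)\<^sup>2 \<le> 2 * max x 0 * (x - y)"
proof -
  define X Y where "X = max x 0" and "Y = max y 0"
  have 1: "0 \<le> (X - Y)\<^sup>2" by simp
  have 2: "X * y \<le> X * Y" unfolding X_def Y_def by (intro mult_left_mono) auto
  have 3: "X * x = X * X" by (auto simp: X_def max_def)
  have "2 * X * (x - y) = 2 * (X * x) - 2 * (X * y)" by (simp add: algebra_simps)
  moreover have "(X - Y)\<^sup>2 = X * X - 2 * (X * Y) + Y * Y" by (simp add: power2_eq_square algebra_simps)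
  ultimately show ?thesis
    unfolding X_def[symmetric] Y_def[symmetric] power2_eq_square[of X] power2_eq_square[of Y] using 1 2 3
    by linarith
qed

text \<open>A chain rule for functions that are only absolutely continuous, as the one-sided inequality that the
energy method needs. Convexity bounds every increment over a grid of mesh \<open>(t - s) / n\<close> by the slope at the
right end of the cell times the increment of \<open>g\<close>; the slopes converge to the slope of \<open>g\<close> by continuity,
and dominated convergence passes to the limit.\<close>

lemma pos_part_sq_chain_rule:
  fixes g0 :: real
  assumes G: "integrable lborel G" and st: "s < t"
  defines "g \<equiv> \<lambda>r. g0 + primitive G r"
  shows "(max (g t) 0)\<^sup>2 - (max (g s) 0)\<^sup>2 \<le> (LINT r|lborel. indicator {s..<t} r * (2 * max (g r) 0 * G r))"
proof -
  have [measurable]: "G \<in> borel_measurable borel" using G by auto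
  have [measurable]: "primitive G \<in> borel_measurable borel" using G by (rule primitive_measurable)
  have [measurable]: "g \<in> borel_measurable borel" unfolding g_def by measurable
  define B where "B = 2 * (\<bar>g0\<bar> + (LINT s|lborel. \<bar>G s\<bar>))"
  have B: "\<bar>2 * max (g r) 0\<bar> \<le> B" for r
  proof -
    have "\<bar>g r\<bar> \<le> \<bar>g0\<bar> + (LINT s|lborel. \<bar>G s\<bar>)"
      unfolding g_def using primitive_bound[OF G, of r] by linarith
    moreover have "\<bar>max (g r) 0\<bar> \<le> \<bar>g r\<bar>" by auto
    ultimately show ?thesis unfolding B_def abs_mult by simp
  qed
  (* the right end of the cell of the n-th grid that contains r *)
  define \<tau> where "\<tau> n r = s + (of_int \<lfloor>(r - s) * real (Suc n) / (t - s)\<rfloor> + 1) * ((t - s) / real (Suc n))" for n r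
  have \<tau>_grid: "\<tau> n r = s + real (Suc k) * ((t - s) / real (Suc n))"
    if "r \<in> {s + real k * ((t - s) / real (Suc n))..<s + real (Suc k) * ((t - s) / real (Suc n))}" for n k r
  proof -
    have "real k \<le> (r - s) * real (Suc n) / (t - s)" "(r - s) * real (Suc n) / (t - s) < real k + 1"
      using that st by (auto simp: field_simps simp del: of_nat_Suc) (auto simp: algebra_simps)
    then have "\<lfloor>(r - s) * real (Suc n) / (t - s)\<rfloor> = int k" by linarith
    then show ?thesis by (simp add: \<tau>_def)
  qed
  have [measurable]: "\<tau> n \<in> borel_measurable borel" for n unfolding \<tau>_def by measurable
  define H where "H n r = 2 * max (g (\<tau> n r)) 0 * G r" for n r
  have intH: "integrable lborel (H n)" for n
  proof (rule Bochner_Integration.integrable_bound)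
    show "integrable lborel (\<lambda>r. B * G r)" using G by simp
    show "AE r in lborel. norm (H n r) \<le> norm (B * G r)"
    proof (intro AE_I2)
      fix r
      have "\<bar>2 * max (g (\<tau> n r)) 0\<bar> * \<bar>G r\<bar> \<le> \<bar>B\<bar> * \<bar>G r\<bar>"
        using B[of "\<tau> n r"] by (intro mult_right_mono) auto
      then show "norm (H n r) \<le> norm (B * G r)" by (simp add: H_def abs_mult)
    qed
    show "H n \<in> borel_measurable lborel" unfolding H_def by measurable
  qed
  have step: "(max (g (s + real k * ((t - s) / real (Suc n)))) 0)\<^sup>2 - (max (g s) 0)\<^sup>2
      \<le> (LINT r|lborel. indicator {s..<s + real k * ((t - s) / real (Suc n))} r * H n r)" for n k
  proof (induction k)
    case 0
    then show ?case by simp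
  next
    case (Suc k)
    let ?a = "s + real k * ((t - s) / real (Suc n))" and ?b = "s + real (Suc k) * ((t - s) / real (Suc n))"
    define h where "h = (t - s) / real (Suc n)"
    have "0 \<le> h" using st by (simp add: h_def)
    then have ab: "s \<le> ?a" "?a \<le> ?b"
      unfolding h_def[symmetric] by (simp_all add: distrib_right)
    have "(max (g ?b) 0)\<^sup>2 - (max (g ?a) 0)\<^sup>2 \<le> 2 * max (g ?b) 0 * (g ?b - g ?a)" by (rule pos_part_sq_convex)
    also have "g ?b - g ?a = (LINT r|lborel. indicator {?a..<?b} r * G r)"
      unfolding g_def using primitive_diff[OF G ab(2)] by simp
    also have "2 * max (g ?b) 0 * \<dots> = (LINT r|lborel. 2 * max (g ?b) 0 * (indicator {?a..<?b} r * G r))"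
      by (rule integral_mult_right_zero[symmetric])
    also have "\<dots> = (LINT r|lborel. indicator {?a..<?b} r * H n r)"
    proof (intro Bochner_Integration.integral_cong refl)
      fix r
      show "2 * max (g ?b) 0 * (indicator {?a..<?b} r * G r) = indicator {?a..<?b} r * H n r"
      proof (cases "r \<in> {?a..<?b}")
        case True
        then show ?thesis unfolding H_def \<tau>_grid[OF True] by simp
      next
        case False
        then have "indicator {?a..<?b} r = (0::real)" by (rule indicator_simps(2))
        then show ?thesis by (simp only: mult_zero_left mult_zero_right)
      qed
    qed
    finally have "(max (g ?b) 0)\<^sup>2 - (max (g s) 0)\<^sup>2
        \<le> (LINT r|lborel. indicator {s..<?a} r * H n r) + (LINT r|lborel. indicator {?a..<?b} r * H n r)"
      using Suc by linarith
    also have "\<dots> = (LINT r|lborel. indicator {s..<?a} r * H n r + indicator {?a..<?b} r * H n r)"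
      by (intro Bochner_Integration.integral_add[symmetric] integrable_indicator_mult intH) auto
    also have "\<dots> = (LINT r|lborel. indicator {s..<?b} r * H n r)"
    proof (intro Bochner_Integration.integral_cong refl)
      fix r
      show "indicator {s..<?a} r * H n r + indicator {?a..<?b} r * H n r = indicator {s..<?b} r * H n r"
        using ab by (cases "r < ?a") (auto simp: indicator_def)
    qed
    finally show ?case .
  qed
  have tn: "s + real (Suc n) * ((t - s) / real (Suc n)) = t" for n by simp
  have le: "(max (g t) 0)\<^sup>2 - (max (g s) 0)\<^sup>2 \<le> (LINT r|lborel. indicator {s..<t} r * H n r)" for n
    using step[of "Suc n" n] unfolding tn .
  have "(\<lambda>n. LINT r|lborel. indicator {s..<t} r * H n r) \<longlonglongrightarrow> (LINT r|lborel. indicator {s..<t} r * (2 * max (g r) 0 * G r))"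
  proof (rule integral_dominated_convergence[where w="\<lambda>r. \<bar>B * G r\<bar>"])
    show "integrable lborel (\<lambda>r. \<bar>B * G r\<bar>)" using G by simp
    show "AE r in lborel. norm (indicator {s..<t} r * H n r) \<le> \<bar>B * G r\<bar>" for n
    proof (intro AE_I2)
      fix r
      have "\<bar>2 * max (g (\<tau> n r)) 0\<bar> * \<bar>G r\<bar> \<le> \<bar>B\<bar> * \<bar>G r\<bar>"
        using B[of "\<tau> n r"] by (intro mult_right_mono) auto
      then show "norm (indicator {s..<t} r * H n r) \<le> \<bar>B * G r\<bar>" by (auto simp: H_def abs_mult indicator_def)
    qed
    show "AE r in lborel. (\<lambda>n. indicator {s..<t} r * H n r) \<longlonglongrightarrow> indicator {s..<t} r * (2 * max (g r) 0 * G r)"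
    proof (intro AE_I2)
      fix r
      have "(\<lambda>n. \<tau> n r) \<longlonglongrightarrow> r"
      proof (rule tendsto_sandwich[OF _ _ tendsto_const])
        have b: "r \<le> \<tau> n r \<and> \<tau> n r \<le> r + (t - s) * inverse (real (Suc n))" for n
        proof -
          define N where "N = real (Suc n)"
          have N: "0 < N" by (simp add: N_def)
          define h where "h = (t - s) / N"
          have h: "0 < h" using st N by (simp add: h_def)
          have q: "(r - s) * N / (t - s) = (r - s) / h" using N by (simp add: h_def)
          have "(r - s) / h < of_int \<lfloor>(r - s) / h\<rfloor> + 1" "of_int \<lfloor>(r - s) / h\<rfloor> \<le> (r - s) / h"
            by linarith+
          then have "r - s < (of_int \<lfloor>(r - s) / h\<rfloor> + 1) * h" "of_int \<lfloor>(r - s) / h\<rfloor> * h \<le> r - s"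
            using h by (simp_all only: pos_divide_less_eq pos_le_divide_eq)
          then have "r \<le> s + (of_int \<lfloor>(r - s) / h\<rfloor> + 1) * h" "s + (of_int \<lfloor>(r - s) / h\<rfloor> + 1) * h \<le> r + h"
            unfolding distrib_right by linarith+
          moreover have "\<tau> n r = s + (of_int \<lfloor>(r - s) / h\<rfloor> + 1) * h"
            unfolding \<tau>_def N_def[symmetric] q unfolding h_def ..
          moreover have "(t - s) * inverse (real (Suc n)) = h" by (simp only: h_def N_def divide_inverse)
          ultimately show ?thesis by simp
        qed
        show "\<forall>\<^sub>F n in sequentially. r \<le> \<tau> n r" using b by simp
        show "\<forall>\<^sub>F n in sequentially. \<tau> n r \<le> r + (t - s) * inverse (real (Suc n))" using b by (intro always_eventually allI) blast
        show "(\<lambda>n. r + (t - s) * inverse (real (Suc n))) \<longlonglongrightarrow> r"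
          using tendsto_add[OF tendsto_const[of r] tendsto_mult_right_zero[OF LIMSEQ_inverse_real_of_nat, of "t - s"]] by (simp only: add_0_right)
      qed
      then have "(\<lambda>n. g (\<tau> n r)) \<longlonglongrightarrow> g r"
        unfolding g_def by (intro tendsto_add tendsto_const primitive_tendsto[OF G])
      then show "(\<lambda>n. indicator {s..<t} r * H n r) \<longlonglongrightarrow> indicator {s..<t} r * (2 * max (g r) 0 * G r)"
        unfolding H_def by (intro tendsto_intros)
    qed
    show "(\<lambda>r. indicator {s..<t} r * (2 * max (g r) 0 * G r)) \<in> borel_measurable lborel" by measurable
    show "(\<lambda>r. indicator {s..<t} r * H n r) \<in> borel_measurable lborel" for n using intH[of n] by measurable
  qed
  then show ?thesis using le by (intro LIMSEQ_le_const) auto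
qed

section \<open>Cutoff functions and localised energies\<close>

text \<open>The Gagliardo energy without the normalising factor \<open>2 - \<alpha>\<close>.\<close>

definition sq_energy :: "real \<Rightarrow> ('a::euclidean_space \<Rightarrow> real) \<Rightarrow> ennreal" where
  "sq_energy \<alpha> f = (\<integral>\<^sup>+x. \<integral>\<^sup>+y. ennreal ((f x - f y)\<^sup>2 * riesz_kernel \<alpha> (x - y)) \<partial>lborel \<partial>lborel)"

lemma gagliardo_eq_sq_energy: "gagliardo \<alpha> f = ennreal (2 - \<alpha>) * sq_energy \<alpha> f"
  by (simp add: gagliardo_def sq_energy_def)

definition cutoff :: "'a::euclidean_space \<Rightarrow> real \<Rightarrow> real \<Rightarrow> ('a \<Rightarrow> real) \<Rightarrow> bool" where
  "cutoff x0 \<sigma> L \<phi> \<longleftrightarrow> (\<forall>x. 0 \<le> \<phi> x \<and> \<phi> x \<le> 1) \<and> (\<forall>x y. \<bar>\<phi> x - \<phi> y\<bar> \<le> L * norm (x - y)) \<and>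
     (\<forall>x. x \<notin> ball x0 \<sigma> \<longrightarrow> \<phi> x = 0)"

lemma cutoffD:
  assumes "cutoff x0 \<sigma> L \<phi>"
  shows "0 \<le> \<phi> x" "\<phi> x \<le> 1" "\<bar>\<phi> x - \<phi> y\<bar> \<le> L * norm (x - y)" "x \<notin> ball x0 \<sigma> \<Longrightarrow> \<phi> x = 0" "\<bar>\<phi> x - \<phi> y\<bar> \<le> 1"
proof -
  show 1: "0 \<le> \<phi> x" "\<phi> x \<le> 1" for x using assms by (auto simp: cutoff_def)
  show "\<bar>\<phi> x - \<phi> y\<bar> \<le> 1" using 1[of x] 1[of y] by linarith
qed (use assms in \<open>auto simp: cutoff_def\<close>)

lemma cutoff_measurable:
  assumes "cutoff x0 \<sigma> L \<phi>" shows "\<phi> \<in> borel_measurable borel"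
proof -
  have L: "\<bar>\<phi> x - \<phi> y\<bar> \<le> max L 1 * norm (x - y)" for x y
    using cutoffD(3)[OF assms, of x y] mult_right_mono[of L "max L 1" "norm (x - y)"] by simp
  have "continuous_on UNIV \<phi>"
    unfolding continuous_on_iff dist_norm
  proof (intro ballI allI impI)
    fix x :: 'a and e :: real assume "0 < e"
    show "\<exists>d>0. \<forall>x'\<in>UNIV. norm (x' - x) < d \<longrightarrow> norm (\<phi> x' - \<phi> x) < e"
    proof (intro exI[of _ "e / max L 1"] conjI ballI impI)
      show "0 < e / max L 1" using \<open>0 < e\<close> by simp
      fix x' assume "norm (x' - x) < e / max L 1"
      then have "max L 1 * norm (x' - x) < e" by (simp add: pos_less_divide_eq mult.commute)
      then show "norm (\<phi> x' - \<phi> x) < e" using L[of x' x] by simp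
    qed
  qed
  then show ?thesis by (rule borel_measurable_continuous_onI)
qed

lemma cutoff_square: "cutoff x0 \<sigma> L \<phi> \<Longrightarrow> cutoff x0 \<sigma> (2 * L) (\<lambda>x. (\<phi> x)\<^sup>2)"
proof -
  assume c: "cutoff x0 \<sigma> L \<phi>"
  have "\<bar>(\<phi> x)\<^sup>2 - (\<phi> y)\<^sup>2\<bar> \<le> 2 * L * norm (x - y)" for x y
  proof -
    have "\<bar>(\<phi> x)\<^sup>2 - (\<phi> y)\<^sup>2\<bar> = \<bar>\<phi> x + \<phi> y\<bar> * \<bar>\<phi> x - \<phi> y\<bar>"
      by (simp add: abs_mult[symmetric] power2_eq_square algebra_simps)
    also have "\<dots> \<le> 2 * (L * norm (x - y))"
      using cutoffD(1,2)[OF c, of x] cutoffD(1,2)[OF c, of y] cutoffD(3)[OF c, of x y] by (intro mult_mono) auto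
    finally show ?thesis by simp
  qed
  then show ?thesis using cutoffD[OF c] by (auto simp: cutoff_def power_le_one)
qed

definition lipschitz_const :: "nat \<Rightarrow> real" where
  "lipschitz_const d = unit_ball_vol (real d) * 2 ^ (d + 5)"

lemma lipschitz_const_pos: "0 < lipschitz_const d"
  by (simp add: lipschitz_const_def)

lemma cutoff_kernel_bound:
  fixes \<phi> :: "'a::euclidean_space \<Rightarrow> real"
  assumes "cutoff x0 \<sigma> L \<phi>" "0 < L" "0 < \<alpha>" "\<alpha> < 2"
  shows "(\<integral>\<^sup>+y. ennreal ((\<phi> x - \<phi> y)\<^sup>2 * riesz_kernel \<alpha> (x - y)) \<partial>lborel)
     \<le> ennreal (lipschitz_const DIM('a) * L powr \<alpha> / (\<alpha> * (2 - \<alpha>)))"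
  unfolding lipschitz_const_def using assms by (intro riesz_lipschitz cutoffD(3,5)[OF assms(1)])

text \<open>If \<open>x\<close> stays in \<open>ball x0 ((1 - \<kappa>) r)\<close> and \<open>y\<close> outside \<open>ball x0 r\<close>, then \<open>|x - y| \<ge> \<kappa> |x0 - y|\<close>: seen from
far away, the ball may be replaced by its centre.\<close>

lemma riesz_kernel_compare:
  fixes x y x0 :: "'a::euclidean_space"
  assumes \<kappa>: "0 < \<kappa>" "\<kappa> \<le> 1" "\<sigma> \<le> (1 - \<kappa>) * r" and \<alpha>: "0 < \<alpha>" "\<alpha> < 2"
    and x: "x \<in> ball x0 \<sigma>" and y: "y \<notin> ball x0 r"
  shows "riesz_kernel \<alpha> (x - y) \<le> (1 / \<kappa>) ^ (DIM('a) + 2) * riesz_kernel \<alpha> (x0 - y)"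
proof -
  define p where "p = real DIM('a) + \<alpha>"
  have p: "0 \<le> p" "p \<le> real (DIM('a) + 2)" using \<alpha> by (auto simp: p_def)
  have "r \<le> norm (x0 - y)" using y by (simp add: dist_norm)
  then have "(1 - \<kappa>) * r \<le> (1 - \<kappa>) * norm (x0 - y)" using \<kappa> by (intro mult_left_mono) auto
  then have "norm (x0 - x) < (1 - \<kappa>) * norm (x0 - y)" using x \<kappa> by (simp add: dist_norm)
  moreover have "norm (x0 - y) \<le> norm (x0 - x) + norm (x - y)" using norm_triangle_ineq[of "x0 - x" "x - y"] by simp
  ultimately have k: "\<kappa> * norm (x0 - y) \<le> norm (x - y)" by (simp add: left_diff_distrib)
  have "x0 \<noteq> y"
  proof
    assume "x0 = y"
    then have "norm (x0 - x) < 0" using \<open>norm (x0 - x) < (1 - \<kappa>) * norm (x0 - y)\<close> by simp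
    then show False by simp
  qed
  then have n: "0 < norm (x0 - y)" by simp
  have "riesz_kernel \<alpha> (x - y) \<le> (\<kappa> * norm (x0 - y)) powr (- p)"
    unfolding riesz_kernel_def p_def[symmetric] using k n \<kappa> p by (intro powr_mono_base_neg) auto
  also have "\<dots> = (1 / \<kappa>) powr p * riesz_kernel \<alpha> (x0 - y)"
    unfolding riesz_kernel_def p_def[symmetric] using n \<kappa> by (simp add: powr_mult powr_divide powr_minus field_simps)
  also have "\<dots> \<le> (1 / \<kappa>) powr (real (DIM('a) + 2)) * riesz_kernel \<alpha> (x0 - y)"
    using \<kappa> p by (intro mult_right_mono powr_mono) auto
  also have "(1 / \<kappa>) powr (real (DIM('a) + 2)) = (1 / \<kappa>) ^ (DIM('a) + 2)"
    using \<kappa> by (intro powr_realpow) auto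
  finally show ?thesis .
qed

lemma riesz_kernel_separated:
  fixes x y x0 :: "'a::euclidean_space" and \<alpha> \<sigma> \<rho> :: real
  assumes "\<sigma> < \<rho>" "0 < \<alpha>" and x: "x \<in> ball x0 \<sigma>" and y: "y \<notin> ball x0 \<rho>"
  shows "riesz_kernel \<alpha> (x - y) \<le> (\<rho> - \<sigma>) powr (- (DIM('a) + \<alpha>))"
proof -
  have "norm (x0 - y) \<le> norm (x0 - x) + norm (x - y)" using norm_triangle_ineq[of "x0 - x" "x - y"] by simp
  then have "\<rho> - \<sigma> \<le> norm (x - y)" using x y by (simp add: dist_norm)
  then show ?thesis unfolding riesz_kernel_def using assms by (intro powr_mono_base_neg) auto
qed

lemma nn_integral_pair_swap:
  fixes f :: "'a::euclidean_space \<Rightarrow> 'a \<Rightarrow> ennreal"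
  assumes "(\<lambda>(x, y). f x y) \<in> borel_measurable (lborel \<Otimes>\<^sub>M lborel)"
  shows "(\<integral>\<^sup>+x. \<integral>\<^sup>+y. f y x \<partial>lborel \<partial>lborel) = (\<integral>\<^sup>+x. \<integral>\<^sup>+y. f x y \<partial>lborel \<partial>lborel)"
  using lborel_pair.Fubini'[OF assms] by simp

text \<open>For \<open>x\<close> and \<open>y\<close> in the ball, the increment of the product is controlled by the increment of \<open>w\<close> and by
that of the cutoff; otherwise one of the two products vanishes and only the increment of the cutoff
remains, whose kernel integral is finite by the Lipschitz bound.\<close>

lemma cutoff_product_energy_finite:
  fixes w \<zeta> :: "'a::euclidean_space \<Rightarrow> real"
  assumes c: "cutoff x0 R L \<zeta>" "0 < L" and \<alpha>: "0 < \<alpha>" "\<alpha> < 2"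
    and [measurable]: "w \<in> borel_measurable borel"
    and fin: "(\<integral>\<^sup>+x\<in>ball x0 R. ennreal ((w x)\<^sup>2) \<partial>lborel) < \<infinity>"
      "(\<integral>\<^sup>+x. \<integral>\<^sup>+y. ennreal ((w x - w y)\<^sup>2 * riesz_kernel \<alpha> (x - y)) * indicator (ball x0 R) x * indicator (ball x0 R) y \<partial>lborel \<partial>lborel) < \<infinity>"
  shows "sq_energy \<alpha> (\<lambda>x. \<zeta> x * w x) < \<infinity>"
proof -
  let ?B = "ball x0 R"
  note [measurable] = cutoff_measurable[OF c(1)]
  define k where "k x y = riesz_kernel \<alpha> (x - y)" for x y :: 'a
  have km[measurable]: "(\<lambda>(x, y). k x y) \<in> borel_measurable (borel \<Otimes>\<^sub>M borel)" unfolding k_def by measurable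
  have k0: "0 \<le> k x y" for x y by (simp add: k_def)
  define F1 where "F1 x y = ennreal ((w x - w y)\<^sup>2 * riesz_kernel \<alpha> (x - y)) * indicator ?B x * indicator ?B y" for x y
  define F2 where "F2 x y = ennreal ((w x)\<^sup>2) * indicator ?B x * ennreal ((\<zeta> x - \<zeta> y)\<^sup>2 * riesz_kernel \<alpha> (x - y))" for x y
  have m1[measurable]: "(\<lambda>(x, y). F1 x y) \<in> borel_measurable (lborel \<Otimes>\<^sub>M lborel)" unfolding F1_def by measurable
  have m2[measurable]: "(\<lambda>(x, y). F2 x y) \<in> borel_measurable (lborel \<Otimes>\<^sub>M lborel)" unfolding F2_def by measurable
  have pt: "ennreal ((\<zeta> x * w x - \<zeta> y * w y)\<^sup>2 * riesz_kernel \<alpha> (x - y)) \<le> 2 * F1 x y + 2 * F2 x y + 2 * F2 y x" for x y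
  proof -
    have cs: "(a + b)\<^sup>2 \<le> 2 * a\<^sup>2 + 2 * b\<^sup>2" for a b :: real
      using zero_le_power2[of "a - b"] by (simp add: power2_eq_square algebra_simps)
    define bx by' where "bx = (indicator ?B x :: real)" and "by' = (indicator ?B y :: real)"
    have "(\<zeta> x * w x - \<zeta> y * w y)\<^sup>2 \<le> 2 * (bx * by' * (w x - w y)\<^sup>2) + 2 * (bx * (w x)\<^sup>2 * (\<zeta> x - \<zeta> y)\<^sup>2) + 2 * (by' * (w y)\<^sup>2 * (\<zeta> y - \<zeta> x)\<^sup>2)"
    proof (cases "x \<in> ?B"; cases "y \<in> ?B")
      assume xy: "x \<in> ?B" "y \<in> ?B"
      have "(\<zeta> x * w x - \<zeta> y * w y)\<^sup>2 = (\<zeta> x * (w x - w y) + w y * (\<zeta> x - \<zeta> y))\<^sup>2" by (simp add: algebra_simps)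
      also have "\<dots> \<le> 2 * (\<zeta> x * (w x - w y))\<^sup>2 + 2 * (w y * (\<zeta> x - \<zeta> y))\<^sup>2" by (rule cs)
      also have "(\<zeta> x * (w x - w y))\<^sup>2 \<le> (w x - w y)\<^sup>2"
        using cutoffD(1,2)[OF c(1), of x] by (simp add: power_mult_distrib mult_left_le_one_le power_le_one)
      also have "2 * (w x - w y)\<^sup>2 + 2 * (w y * (\<zeta> x - \<zeta> y))\<^sup>2 \<le> 2 * (bx * by' * (w x - w y)\<^sup>2) + 2 * (bx * (w x)\<^sup>2 * (\<zeta> x - \<zeta> y)\<^sup>2) + 2 * (by' * (w y)\<^sup>2 * (\<zeta> y - \<zeta> x)\<^sup>2)"
        using xy by (simp add: bx_def by'_def power_mult_distrib power2_commute)
      finally show ?thesis by simp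
    qed (use cutoffD(4)[OF c(1)] in \<open>auto simp: bx_def by'_def power_mult_distrib mult.commute\<close>)
    then have "(\<zeta> x * w x - \<zeta> y * w y)\<^sup>2 * k x y \<le> (2 * (bx * by' * (w x - w y)\<^sup>2) + 2 * (bx * (w x)\<^sup>2 * (\<zeta> x - \<zeta> y)\<^sup>2) + 2 * (by' * (w y)\<^sup>2 * (\<zeta> y - \<zeta> x)\<^sup>2)) * k x y"
      using k0 by (rule mult_right_mono)
    also have "\<dots> = 2 * ((w x - w y)\<^sup>2 * k x y * bx * by') + 2 * ((w x)\<^sup>2 * bx * ((\<zeta> x - \<zeta> y)\<^sup>2 * k x y)) + 2 * ((w y)\<^sup>2 * by' * ((\<zeta> y - \<zeta> x)\<^sup>2 * k y x))"
      unfolding k_def riesz_kernel_minus[of \<alpha> y x] by (simp add: algebra_simps)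
    finally have le: "(\<zeta> x * w x - \<zeta> y * w y)\<^sup>2 * k x y \<le> \<dots>" .
    have i: "indicator ?B x = ennreal bx" "indicator ?B y = ennreal by'" "0 \<le> bx" "0 \<le> by'"
      by (auto simp: bx_def by'_def indicator_def)
    have "2 * F1 x y + 2 * F2 x y + 2 * F2 y x = ennreal (2 * ((w x - w y)\<^sup>2 * k x y * bx * by') + 2 * ((w x)\<^sup>2 * bx * ((\<zeta> x - \<zeta> y)\<^sup>2 * k x y)) + 2 * ((w y)\<^sup>2 * by' * ((\<zeta> y - \<zeta> x)\<^sup>2 * k y x)))"
      unfolding F1_def F2_def k_def[symmetric] i using i(3,4) k0
      by (simp add: ennreal_mult ennreal_plus)
    then show ?thesis using ennreal_leI[OF le] by (simp add: k_def)
  qed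
  have "sq_energy \<alpha> (\<lambda>x. \<zeta> x * w x) \<le> (\<integral>\<^sup>+x. \<integral>\<^sup>+y. 2 * F1 x y + 2 * F2 x y + 2 * F2 y x \<partial>lborel \<partial>lborel)"
    unfolding sq_energy_def by (intro nn_integral_mono pt)
  also have "\<dots> = 2 * (\<integral>\<^sup>+x. \<integral>\<^sup>+y. F1 x y \<partial>lborel \<partial>lborel) + 2 * (\<integral>\<^sup>+x. \<integral>\<^sup>+y. F2 x y \<partial>lborel \<partial>lborel) + 2 * (\<integral>\<^sup>+x. \<integral>\<^sup>+y. F2 y x \<partial>lborel \<partial>lborel)"
    by (simp add: nn_integral_add nn_integral_cmult)
  also have "(\<integral>\<^sup>+x. \<integral>\<^sup>+y. F2 y x \<partial>lborel \<partial>lborel) = (\<integral>\<^sup>+x. \<integral>\<^sup>+y. F2 x y \<partial>lborel \<partial>lborel)"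
    by (rule nn_integral_pair_swap) measurable
  finally have le: "sq_energy \<alpha> (\<lambda>x. \<zeta> x * w x) \<le> 2 * (\<integral>\<^sup>+x. \<integral>\<^sup>+y. F1 x y \<partial>lborel \<partial>lborel) + 2 * (\<integral>\<^sup>+x. \<integral>\<^sup>+y. F2 x y \<partial>lborel \<partial>lborel) + 2 * (\<integral>\<^sup>+x. \<integral>\<^sup>+y. F2 x y \<partial>lborel \<partial>lborel)" .
  let ?c = "lipschitz_const DIM('a) * L powr \<alpha> / (\<alpha> * (2 - \<alpha>))"
  have "(\<integral>\<^sup>+x. \<integral>\<^sup>+y. F2 x y \<partial>lborel \<partial>lborel) \<le> (\<integral>\<^sup>+x. ennreal ?c * (ennreal ((w x)\<^sup>2) * indicator ?B x) \<partial>lborel)"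
  proof (intro nn_integral_mono)
    fix x
    have "(\<integral>\<^sup>+y. F2 x y \<partial>lborel) = ennreal ((w x)\<^sup>2) * indicator ?B x * (\<integral>\<^sup>+y. ennreal ((\<zeta> x - \<zeta> y)\<^sup>2 * riesz_kernel \<alpha> (x - y)) \<partial>lborel)"
      unfolding F2_def by (rule nn_integral_cmult) measurable
    also have "\<dots> \<le> ennreal ((w x)\<^sup>2) * indicator ?B x * ennreal ?c"
      by (intro mult_left_mono cutoff_kernel_bound[OF c \<alpha>]) auto
    finally show "(\<integral>\<^sup>+y. F2 x y \<partial>lborel) \<le> ennreal ?c * (ennreal ((w x)\<^sup>2) * indicator ?B x)" by (simp add: mult.commute)
  qed
  also have "\<dots> = ennreal ?c * (\<integral>\<^sup>+x\<in>?B. ennreal ((w x)\<^sup>2) \<partial>lborel)"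
    by (rule nn_integral_cmult) measurable
  also have "\<dots> < \<infinity>" using fin(1) by (simp add: ennreal_mult_less_top)
  finally have "(\<integral>\<^sup>+x. \<integral>\<^sup>+y. F2 x y \<partial>lborel \<partial>lborel) < \<infinity>" .
  moreover have "(\<integral>\<^sup>+x. \<integral>\<^sup>+y. F1 x y \<partial>lborel \<partial>lborel) < \<infinity>" using fin(2) by (simp add: F1_def)
  ultimately have "2 * (\<integral>\<^sup>+x. \<integral>\<^sup>+y. F1 x y \<partial>lborel \<partial>lborel) + 2 * (\<integral>\<^sup>+x. \<integral>\<^sup>+y. F2 x y \<partial>lborel \<partial>lborel) + 2 * (\<integral>\<^sup>+x. \<integral>\<^sup>+y. F2 x y \<partial>lborel \<partial>lborel) < \<infinity>"
    by (simp add: ennreal_mult_less_top)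
  with le show ?thesis by (rule le_less_trans)
qed

text \<open>The price of localisation: the term that the cutoff adds to the energy of \<open>w\<close> when the equation is
tested with \<open>\<phi>\<^sup>2 w\<close>.\<close>

definition cross_energy :: "real \<Rightarrow> ('a::euclidean_space \<Rightarrow> real) \<Rightarrow> ('a \<Rightarrow> real) \<Rightarrow> ennreal" where
  "cross_energy \<alpha> \<phi> w = (\<integral>\<^sup>+x. \<integral>\<^sup>+y. ennreal (w x * w y * (\<phi> x - \<phi> y)\<^sup>2 * riesz_kernel \<alpha> (x - y)) \<partial>lborel \<partial>lborel)"

text \<open>The integrand vanishes unless \<open>x\<close> or \<open>y\<close> is in \<open>ball x0 \<sigma>\<close>, so by symmetry there are three regions. For both
points in \<open>ball x0 \<rho>\<close>, the Lipschitz bound on the cutoff gives a local \<open>L\<^sup>2\<close> term. For \<open>y\<close> in the annulus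
between \<open>\<rho>\<close> and \<open>r\<close> the kernel is bounded by the distance of the balls. For \<open>y\<close> outside \<open>ball x0 r\<close> it is
comparable to the kernel centred at \<open>x0\<close>, which leaves a tail. The constant in front of the tail
depends on the ratio of \<open>\<sigma>\<close> and \<open>r\<close> only and does not deteriorate when \<open>\<rho> - \<sigma>\<close> becomes small; the
moving level can cancel the tail only because of this.\<close>

lemma cross_energy_bound:
  fixes w \<phi> :: "'a::euclidean_space \<Rightarrow> real" and \<alpha> \<sigma> \<rho> r \<kappa> L :: real
  assumes c: "cutoff x0 \<sigma> L \<phi>" "0 < L" and \<alpha>: "0 < \<alpha>" "\<alpha> < 2"
    and [measurable]: "w \<in> borel_measurable borel" and w0: "\<And>x. 0 \<le> w x"
    and r: "\<sigma> < \<rho>" "\<rho> \<le> r" and \<kappa>: "0 < \<kappa>" "\<kappa> \<le> 1" "\<sigma> \<le> (1 - \<kappa>) * r"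
  shows "cross_energy \<alpha> \<phi> w \<le> 2 * (ennreal (lipschitz_const DIM('a) * L powr \<alpha> / (\<alpha> * (2 - \<alpha>))) * (\<integral>\<^sup>+x\<in>ball x0 \<rho>. ennreal ((w x)\<^sup>2) \<partial>lborel))
     + 2 * ((\<integral>\<^sup>+x. ennreal ((\<phi> x)\<^sup>2 * w x) \<partial>lborel) *
       (ennreal ((1 / \<kappa>) ^ (DIM('a) + 2)) * (\<integral>\<^sup>+y\<in>- ball x0 r. ennreal (w y * riesz_kernel \<alpha> (x0 - y)) \<partial>lborel)
       + ennreal ((\<rho> - \<sigma>) powr (- (DIM('a) + \<alpha>))) * (\<integral>\<^sup>+y\<in>ball x0 r - ball x0 \<rho>. ennreal (w y) \<partial>lborel)))"
proof -
  note [measurable] = cutoff_measurable[OF c(1)]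
  have [measurable]: "ball x0 r - ball x0 \<rho> \<in> sets borel" by auto
  let ?c = "lipschitz_const DIM('a) * L powr \<alpha> / (\<alpha> * (2 - \<alpha>))"
  define k where "k x y = riesz_kernel \<alpha> (x - y)" for x y :: 'a
  have k0: "0 \<le> k x y" for x y by (simp add: k_def)
  have ks: "k x y = k y x" for x y by (simp add: k_def riesz_kernel_minus[of \<alpha> y x])
  define F where "F x y = ennreal ((w x)\<^sup>2) * indicator (ball x0 \<rho>) x * ennreal ((\<phi> x - \<phi> y)\<^sup>2 * riesz_kernel \<alpha> (x - y))" for x y
  define H where "H x y = ennreal ((\<phi> x)\<^sup>2 * w x) * (ennreal ((1 / \<kappa>) ^ (DIM('a) + 2)) * (ennreal (w y * riesz_kernel \<alpha> (x0 - y)) * indicator (- ball x0 r) y)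
       + ennreal ((\<rho> - \<sigma>) powr (- (DIM('a) + \<alpha>))) * (ennreal (w y) * indicator (ball x0 r - ball x0 \<rho>) y))" for x y
  have m1[measurable]: "(\<lambda>(x, y). F x y) \<in> borel_measurable (lborel \<Otimes>\<^sub>M lborel)" unfolding F_def by measurable
  have m2[measurable]: "(\<lambda>(x, y). H x y) \<in> borel_measurable (lborel \<Otimes>\<^sub>M lborel)" unfolding H_def by measurable
  have far: "ennreal (w x * w y * (\<phi> x - \<phi> y)\<^sup>2 * riesz_kernel \<alpha> (x - y)) \<le> H x y" if y: "y \<notin> ball x0 \<rho>" for x y
  proof (cases "x \<in> ball x0 \<sigma>")
    case False
    moreover have "y \<notin> ball x0 \<sigma>" using y r by auto
    ultimately show ?thesis using cutoffD(4)[OF c(1)] by simp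
  next
    case x: True
    have "y \<notin> ball x0 \<sigma>" using y r by auto
    then have p: "\<phi> y = 0" by (rule cutoffD(4)[OF c(1)])
    show ?thesis
    proof (cases "y \<in> ball x0 r")
      case True
      have "w x * w y * (\<phi> x)\<^sup>2 * riesz_kernel \<alpha> (x - y) \<le> w x * w y * (\<phi> x)\<^sup>2 * (\<rho> - \<sigma>) powr (- (DIM('a) + \<alpha>))"
        using w0 riesz_kernel_separated[OF r(1) \<alpha>(1) x y] by (intro mult_left_mono) auto
      also have "\<dots> = (\<phi> x)\<^sup>2 * w x * ((\<rho> - \<sigma>) powr (- (DIM('a) + \<alpha>)) * w y)" by simp
      finally show ?thesis using True y w0 p
        by (simp add: H_def ennreal_mult[symmetric] ennreal_leI)
    next
      case False
      have "w x * w y * (\<phi> x)\<^sup>2 * riesz_kernel \<alpha> (x - y) \<le> w x * w y * (\<phi> x)\<^sup>2 * ((1 / \<kappa>) ^ (DIM('a) + 2) * riesz_kernel \<alpha> (x0 - y))"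
        using w0 riesz_kernel_compare[OF \<kappa> \<alpha> x False] by (intro mult_left_mono) auto
      also have "\<dots> = (\<phi> x)\<^sup>2 * w x * ((1 / \<kappa>) ^ (DIM('a) + 2) * (w y * riesz_kernel \<alpha> (x0 - y)))" by simp
      finally show ?thesis using False y w0 p \<kappa>
        by (simp add: H_def ennreal_mult[symmetric] ennreal_leI)
    qed
  qed
  have near: "ennreal (w x * w y * (\<phi> x - \<phi> y)\<^sup>2 * riesz_kernel \<alpha> (x - y)) \<le> F x y + F y x" if "x \<in> ball x0 \<rho>" "y \<in> ball x0 \<rho>" for x y
  proof -
    have "w x * w y \<le> (w x)\<^sup>2 + (w y)\<^sup>2"
      using zero_le_power2[of "w x - w y"] mult_nonneg_nonneg[OF w0[of x] w0[of y]]
      by (simp add: power2_eq_square algebra_simps)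
    then have "w x * w y * ((\<phi> x - \<phi> y)\<^sup>2 * k x y) \<le> ((w x)\<^sup>2 + (w y)\<^sup>2) * ((\<phi> x - \<phi> y)\<^sup>2 * k x y)"
      using k0 by (intro mult_right_mono) auto
    also have "\<dots> = (w x)\<^sup>2 * ((\<phi> x - \<phi> y)\<^sup>2 * k x y) + (w y)\<^sup>2 * ((\<phi> y - \<phi> x)\<^sup>2 * k y x)"
      unfolding ks[of y x] power2_commute[of "\<phi> y" "\<phi> x"] by (simp add: distrib_right)
    finally have "ennreal (w x * w y * ((\<phi> x - \<phi> y)\<^sup>2 * k x y)) \<le> ennreal (\<dots>)" by (rule ennreal_leI)
    also have "\<dots> = F x y + F y x"
      using that k0 by (simp add: F_def ennreal_plus ennreal_mult k_def[symmetric])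
    finally show ?thesis by (simp add: k_def mult.assoc)
  qed
  have pt: "ennreal (w x * w y * (\<phi> x - \<phi> y)\<^sup>2 * riesz_kernel \<alpha> (x - y)) \<le> F x y + F y x + (H x y + H y x)" for x y
  proof -
    consider "x \<in> ball x0 \<rho>" "y \<in> ball x0 \<rho>" | "y \<notin> ball x0 \<rho>" | "x \<notin> ball x0 \<rho>" by blast
    then show ?thesis
    proof cases
      case 1 from near[OF this] show ?thesis by (rule order_trans) simp
    next
      case 2 from far[OF this] show ?thesis by (rule order_trans) (simp add: add_increasing)
    next
      case 3
      have "ennreal (w x * w y * (\<phi> x - \<phi> y)\<^sup>2 * riesz_kernel \<alpha> (x - y)) = ennreal (w y * w x * (\<phi> y - \<phi> x)\<^sup>2 * riesz_kernel \<alpha> (y - x))"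
        unfolding riesz_kernel_minus[of \<alpha> y x] power2_commute[of "\<phi> y" "\<phi> x"] by (simp add: mult.commute)
      also have "\<dots> \<le> H y x" by (rule far[OF 3])
      finally show ?thesis by (rule order_trans) (simp add: add_increasing)
    qed
  qed
  have "cross_energy \<alpha> \<phi> w \<le> (\<integral>\<^sup>+x. \<integral>\<^sup>+y. F x y + F y x + (H x y + H y x) \<partial>lborel \<partial>lborel)"
    unfolding cross_energy_def by (intro nn_integral_mono pt)
  also have "\<dots> = (\<integral>\<^sup>+x. \<integral>\<^sup>+y. F x y \<partial>lborel \<partial>lborel) + (\<integral>\<^sup>+x. \<integral>\<^sup>+y. F y x \<partial>lborel \<partial>lborel)
     + ((\<integral>\<^sup>+x. \<integral>\<^sup>+y. H x y \<partial>lborel \<partial>lborel) + (\<integral>\<^sup>+x. \<integral>\<^sup>+y. H y x \<partial>lborel \<partial>lborel))"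
    by (simp add: nn_integral_add)
  also have "(\<integral>\<^sup>+x. \<integral>\<^sup>+y. F y x \<partial>lborel \<partial>lborel) = (\<integral>\<^sup>+x. \<integral>\<^sup>+y. F x y \<partial>lborel \<partial>lborel)"
    by (rule nn_integral_pair_swap) measurable
  also have "(\<integral>\<^sup>+x. \<integral>\<^sup>+y. H y x \<partial>lborel \<partial>lborel) = (\<integral>\<^sup>+x. \<integral>\<^sup>+y. H x y \<partial>lborel \<partial>lborel)"
    by (rule nn_integral_pair_swap) measurable
  also have "(\<integral>\<^sup>+x. \<integral>\<^sup>+y. F x y \<partial>lborel \<partial>lborel) + (\<integral>\<^sup>+x. \<integral>\<^sup>+y. F x y \<partial>lborel \<partial>lborel)
      = 2 * (\<integral>\<^sup>+x. \<integral>\<^sup>+y. F x y \<partial>lborel \<partial>lborel)" by (simp add: mult_2)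
  also have "(\<integral>\<^sup>+x. \<integral>\<^sup>+y. H x y \<partial>lborel \<partial>lborel) + (\<integral>\<^sup>+x. \<integral>\<^sup>+y. H x y \<partial>lborel \<partial>lborel)
      = 2 * (\<integral>\<^sup>+x. \<integral>\<^sup>+y. H x y \<partial>lborel \<partial>lborel)" by (simp add: mult_2)
  also have "(\<integral>\<^sup>+x. \<integral>\<^sup>+y. H x y \<partial>lborel \<partial>lborel) = (\<integral>\<^sup>+x. ennreal ((\<phi> x)\<^sup>2 * w x) \<partial>lborel) *
       (ennreal ((1 / \<kappa>) ^ (DIM('a) + 2)) * (\<integral>\<^sup>+y\<in>- ball x0 r. ennreal (w y * riesz_kernel \<alpha> (x0 - y)) \<partial>lborel)
       + ennreal ((\<rho> - \<sigma>) powr (- (DIM('a) + \<alpha>))) * (\<integral>\<^sup>+y\<in>ball x0 r - ball x0 \<rho>. ennreal (w y) \<partial>lborel))"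
    unfolding H_def by (simp add: nn_integral_cmult nn_integral_multc nn_integral_add)
  also have "(\<integral>\<^sup>+x. \<integral>\<^sup>+y. F x y \<partial>lborel \<partial>lborel) \<le> ennreal ?c * (\<integral>\<^sup>+x\<in>ball x0 \<rho>. ennreal ((w x)\<^sup>2) \<partial>lborel)"
  proof -
    have "(\<integral>\<^sup>+y. F x y \<partial>lborel) \<le> ennreal ?c * (ennreal ((w x)\<^sup>2) * indicator (ball x0 \<rho>) x)" for x
    proof -
      have "(\<integral>\<^sup>+y. F x y \<partial>lborel) = ennreal ((w x)\<^sup>2) * indicator (ball x0 \<rho>) x * (\<integral>\<^sup>+y. ennreal ((\<phi> x - \<phi> y)\<^sup>2 * riesz_kernel \<alpha> (x - y)) \<partial>lborel)"
        unfolding F_def by (simp add: nn_integral_cmult)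
      also have "\<dots> \<le> ennreal ((w x)\<^sup>2) * indicator (ball x0 \<rho>) x * ennreal ?c"
        by (intro mult_left_mono cutoff_kernel_bound[OF c \<alpha>]) auto
      finally show ?thesis by (simp add: mult.commute)
    qed
    then have "(\<integral>\<^sup>+x. \<integral>\<^sup>+y. F x y \<partial>lborel \<partial>lborel) \<le> (\<integral>\<^sup>+x. ennreal ?c * (ennreal ((w x)\<^sup>2) * indicator (ball x0 \<rho>) x) \<partial>lborel)"
      by (intro nn_integral_mono) auto
    also have "\<dots> = ennreal ?c * (\<integral>\<^sup>+x\<in>ball x0 \<rho>. ennreal ((w x)\<^sup>2) \<partial>lborel)"
      by (simp add: nn_integral_cmult)
    finally show ?thesis .
  qed
  finally show ?thesis by (simp add: add_right_mono mult_left_mono)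
qed


text \<open>If \<open>v1\<close> and \<open>v2\<close> are both above the level \<open>l\<close>, the identity
\<open>(a - b) (p\<^sup>2 a - q\<^sup>2 b) = (p a - q b)\<^sup>2 - a b (p - q)\<^sup>2\<close> gives equality. A value below the level only
increases the difference \<open>|v1 - v2|\<close> where the other factor has the right sign.\<close>

lemma energy_pointwise:
  fixes v1 v2 p1 p2 l :: real
  defines "w1 \<equiv> max (v1 - l) 0" and "w2 \<equiv> max (v2 - l) 0"
  shows "(p1 * w1 - p2 * w2)\<^sup>2 - w1 * w2 * (p1 - p2)\<^sup>2 \<le> (v1 - v2) * (p1\<^sup>2 * w1 - p2\<^sup>2 * w2)"
proof -
  have "(p1 * w1 - p2 * w2)\<^sup>2 - w1 * w2 * (p1 - p2)\<^sup>2 = (w1 - w2) * (p1\<^sup>2 * w1 - p2\<^sup>2 * w2)"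
    by (simp add: power2_eq_square algebra_simps)
  also have "\<dots> \<le> (v1 - v2) * (p1\<^sup>2 * w1 - p2\<^sup>2 * w2)"
  proof -
    define n1 n2 where "n1 = w1 - (v1 - l)" and "n2 = w2 - (v2 - l)"
    have n: "0 \<le> n1" "0 \<le> n2" "n1 * w1 = 0" "n2 * w2 = 0" "0 \<le> w1" "0 \<le> w2"
      by (auto simp: n1_def n2_def w1_def w2_def max_def)
    have "(v1 - v2) * (p1\<^sup>2 * w1 - p2\<^sup>2 * w2) - (w1 - w2) * (p1\<^sup>2 * w1 - p2\<^sup>2 * w2) = - (n1 - n2) * (p1\<^sup>2 * w1 - p2\<^sup>2 * w2)"
      by (simp add: n1_def n2_def algebra_simps)
    also have "\<dots> = - p1\<^sup>2 * (n1 * w1) - p2\<^sup>2 * (n2 * w2) + (n1 * p2\<^sup>2 * w2 + n2 * p1\<^sup>2 * w1)"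
      by (simp add: algebra_simps)
    also have "\<dots> \<ge> 0" unfolding n(3,4) using n by simp
    finally show ?thesis by simp
  qed
  finally show ?thesis .
qed

section \<open>The bilinear form at a fixed time\<close>

text \<open>A function at one fixed time, with the regularity that a subsolution has at almost every time: finite
energy near the ball, and a finite tail.\<close>

locale static_energy =
  fixes \<alpha> R :: real and x0 :: "'a::euclidean_space" and v :: "'a \<Rightarrow> real"
  assumes \<alpha>: "0 < \<alpha>" "\<alpha> < 2" and R: "0 < R"
    and v_meas [measurable]: "v \<in> borel_measurable borel"
    and v_L2: "(\<integral>\<^sup>+x\<in>ball x0 R. ennreal ((v x)\<^sup>2) \<partial>lborel) < \<infinity>"
    and v_H: "(\<integral>\<^sup>+x. \<integral>\<^sup>+y. ennreal ((v x - v y)\<^sup>2 * riesz_kernel \<alpha> (x - y)) * indicator (ball x0 R) x * indicator (ball x0 R) y \<partial>lborel \<partial>lborel) < \<infinity>"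
    and v_tail: "(\<integral>\<^sup>+y\<in>- ball x0 R. ennreal (\<bar>v y\<bar> * riesz_kernel \<alpha> (x0 - y)) \<partial>lborel) < \<infinity>"
begin

definition trunc :: "real \<Rightarrow> 'a \<Rightarrow> real" where "trunc l x = max (v x - l) 0"

lemma trunc_measurable [measurable]: "trunc l \<in> borel_measurable borel"
  unfolding trunc_def by measurable

lemma trunc_props:
  assumes "0 \<le> l"
  shows "0 \<le> trunc l x" "trunc l x \<le> \<bar>v x\<bar>" "(trunc l x)\<^sup>2 \<le> (v x)\<^sup>2" "(trunc l x - trunc l y)\<^sup>2 \<le> (v x - v y)\<^sup>2"
proof -
  show 1: "0 \<le> trunc l x" "trunc l x \<le> \<bar>v x\<bar>" using assms by (auto simp: trunc_def)
  then show "(trunc l x)\<^sup>2 \<le> (v x)\<^sup>2" using power_mono[OF 1(2,1), of 2] by simp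
  have "\<bar>trunc l x - trunc l y\<bar> \<le> \<bar>v x - v y\<bar>" by (auto simp: trunc_def max_def)
  then show "(trunc l x - trunc l y)\<^sup>2 \<le> (v x - v y)\<^sup>2" by (rule abs_le_square_iff[THEN iffD1])
qed

context
  fixes l :: real assumes l: "0 \<le> l"
begin

lemma trunc_L2: "(\<integral>\<^sup>+x\<in>ball x0 R. ennreal ((trunc l x)\<^sup>2) \<partial>lborel) < \<infinity>"
  by (rule le_less_trans[OF nn_integral_mono v_L2]) (intro mult_right_mono ennreal_leI trunc_props l, simp)

lemma trunc_H: "(\<integral>\<^sup>+x. \<integral>\<^sup>+y. ennreal ((trunc l x - trunc l y)\<^sup>2 * riesz_kernel \<alpha> (x - y)) * indicator (ball x0 R) x * indicator (ball x0 R) y \<partial>lborel \<partial>lborel) < \<infinity>"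
  by (rule le_less_trans[OF nn_integral_mono[OF nn_integral_mono] v_H])
     (intro mult_right_mono ennreal_leI trunc_props(4) l, simp_all)

lemma trunc_tail: "(\<integral>\<^sup>+y\<in>- ball x0 R. ennreal (trunc l y * riesz_kernel \<alpha> (x0 - y)) \<partial>lborel) < \<infinity>"
  by (rule le_less_trans[OF nn_integral_mono v_tail]) (intro mult_right_mono ennreal_leI trunc_props(2) l, simp_all)

lemma trunc_cutoff_energy:
  assumes "cutoff x0 R L \<zeta>" "0 < L"
  shows "sq_energy \<alpha> (\<lambda>x. \<zeta> x * trunc l x) < \<infinity>"
  by (rule cutoff_product_energy_finite[OF assms \<alpha> _ trunc_L2 trunc_H]) measurable

end

end

lemma cutoff_mono: "cutoff x0 \<sigma> L \<phi> \<Longrightarrow> \<sigma> \<le> \<rho> \<Longrightarrow> cutoff x0 \<rho> L \<phi>"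
  unfolding cutoff_def by auto

lemma riesz_tail_finite:
  fixes x0 :: "'a::euclidean_space"
  assumes "0 < R" "0 < \<alpha>" "\<alpha> < 2"
  shows "(\<integral>\<^sup>+y\<in>- ball x0 R. ennreal (riesz_kernel \<alpha> (x0 - y)) \<partial>lborel) < \<infinity>"
proof -
  have "(\<integral>\<^sup>+y\<in>- ball x0 R. ennreal (riesz_kernel \<alpha> (x0 - y)) \<partial>lborel)
    = (\<integral>\<^sup>+y. ennreal (riesz_kernel \<alpha> (y - x0)) * indicator (- ball 0 R) (y - x0) \<partial>lborel)"
    by (intro nn_integral_cong) (auto simp: riesz_kernel_minus[of \<alpha> x0] indicator_def dist_norm norm_minus_commute)
  also have "\<dots> = (\<integral>\<^sup>+z\<in>- ball 0 R. ennreal (riesz_kernel \<alpha> z) \<partial>(lborel :: 'a measure))"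
    by (rule nn_integral_translate_diff[where f="\<lambda>z. ennreal (riesz_kernel \<alpha> z) * indicator (- ball 0 R) z"]) measurable
  also have "\<dots> < \<infinity>"
    using riesz_far[OF assms, where 'a='a] by (rule le_less_trans) simp
  finally show ?thesis .
qed

context static_energy
begin

context
  fixes l \<sigma> L :: real and \<phi> :: "'a \<Rightarrow> real"
  assumes l: "0 \<le> l" and \<sigma>: "0 < \<sigma>" "\<sigma> < R" and L: "0 < L" and \<phi>: "cutoff x0 \<sigma> L \<phi>"
begin

lemmas \<phi>_meas [measurable] = cutoff_measurable[OF \<phi>]

definition test :: "'a \<Rightarrow> real" where "test x = (\<phi> x)\<^sup>2 * trunc l x"

lemma test_measurable [measurable]: "test \<in> borel_measurable borel"
  unfolding test_def by measurable

lemma test_nonneg: "0 \<le> test x"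
  unfolding test_def using trunc_props(1)[OF l] by simp

lemma test_zero: "x \<notin> ball x0 \<sigma> \<Longrightarrow> test x = 0"
  unfolding test_def using cutoffD(4)[OF \<phi>] by simp

lemma test_le_trunc: "test x \<le> trunc l x"
  unfolding test_def using cutoffD(1,2)[OF \<phi>, of x] trunc_props(1)[OF l, of x]
  by (intro mult_left_le_one_le) (auto simp: power_le_one)

lemma test_energy: "sq_energy \<alpha> test < \<infinity>"
  unfolding test_def[abs_def]
  by (rule trunc_cutoff_energy[OF l cutoff_mono[OF cutoff_square[OF \<phi>]], of]) (use \<sigma> L in auto)

lemma cutoff_trunc_energy: "sq_energy \<alpha> (\<lambda>x. \<phi> x * trunc l x) < \<infinity>"
  by (rule trunc_cutoff_energy[OF l cutoff_mono[OF \<phi>] L]) (use \<sigma> in auto)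

lemma test_v_finite: "(\<integral>\<^sup>+x. ennreal (\<bar>v x\<bar> * test x) \<partial>lborel) < \<infinity>"
proof -
  have "(\<integral>\<^sup>+x. ennreal (\<bar>v x\<bar> * test x) \<partial>lborel) \<le> (\<integral>\<^sup>+x\<in>ball x0 R. ennreal ((v x)\<^sup>2) \<partial>lborel)"
  proof (rule nn_integral_mono)
    fix x
    have "\<bar>v x\<bar> * test x \<le> \<bar>v x\<bar> * \<bar>v x\<bar>"
      using test_le_trunc[of x] trunc_props(2)[OF l, of x] by (intro mult_left_mono) auto
    then show "ennreal (\<bar>v x\<bar> * test x) \<le> ennreal ((v x)\<^sup>2) * indicator (ball x0 R) x"
      using test_zero[of x] \<sigma> by (cases "x \<in> ball x0 R") (auto simp: power2_eq_square intro!: ennreal_leI)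
  qed
  with v_L2 show ?thesis by (rule le_less_trans[rotated])
qed

lemma test_L1: "(\<integral>\<^sup>+x. ennreal (test x) \<partial>lborel) < \<infinity>"
proof -
  have "(\<integral>\<^sup>+x. ennreal (test x) \<partial>lborel) \<le> (\<integral>\<^sup>+x\<in>ball x0 R. ennreal \<bar>v x\<bar> \<partial>lborel)"
  proof (rule nn_integral_mono)
    fix x
    have "test x \<le> \<bar>v x\<bar>" using test_le_trunc[of x] trunc_props(2)[OF l, of x] by simp
    then show "ennreal (test x) \<le> ennreal \<bar>v x\<bar> * indicator (ball x0 R) x"
      using test_zero[of x] \<sigma> by (cases "x \<in> ball x0 R") (auto intro: ennreal_leI)
  qed
  also have "\<dots> \<le> ennreal 1 * emeasure lborel (ball x0 R) + ennreal (1 / 1) * (\<integral>\<^sup>+x\<in>ball x0 R. ennreal (\<bar>v x\<bar>\<^sup>2) \<partial>lborel)"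
    by (rule nn_integral_le_square) auto
  also have "\<dots> < \<infinity>" using v_L2 R by (simp add: emeasure_ball)
  finally show ?thesis .
qed

lemma cross_energy_finite: "cross_energy \<alpha> \<phi> (trunc l) < \<infinity>"
proof -
  define \<kappa> where "\<kappa> = 1 - \<sigma> / R"
  have \<kappa>: "0 < \<kappa>" "\<kappa> \<le> 1" "\<sigma> \<le> (1 - \<kappa>) * R" using \<sigma> R by (auto simp: \<kappa>_def)
  show ?thesis
    by (rule le_less_trans[OF cross_energy_bound[OF \<phi> L \<alpha> trunc_measurable trunc_props(1)[OF l] \<sigma>(2) order_refl \<kappa>]])
       (use trunc_L2[OF l] trunc_tail[OF l] test_L1 in \<open>simp add: ennreal_mult_less_top test_def\<close>)
qed

text \<open>The closed ball of radius \<open>\<sigma>\<close> contains the support because the test function vanishes on its open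
complement.\<close>

lemma test_in_H_space_supp:
  assumes "cball x0 \<sigma> \<subseteq> \<Omega>"
  shows "test \<in> H_space_supp \<alpha> \<Omega>"
proof -
  have "(\<integral>\<^sup>+x. ennreal ((test x)\<^sup>2) \<partial>lborel) \<le> (\<integral>\<^sup>+x. ennreal (\<bar>v x\<bar> * test x) \<partial>lborel)"
  proof (intro nn_integral_mono ennreal_leI)
    fix x
    have "test x * test x \<le> \<bar>v x\<bar> * test x"
      using test_le_trunc[of x] trunc_props(2)[OF l, of x] test_nonneg[of x] by (intro mult_right_mono) auto
    then show "(test x)\<^sup>2 \<le> \<bar>v x\<bar> * test x" by (simp add: power2_eq_square)
  qed
  then have 1: "(\<integral>\<^sup>+x. ennreal ((test x)\<^sup>2) \<partial>lborel) < \<infinity>" using test_v_finite by (rule le_less_trans)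
  have 2: "(\<integral>\<^sup>+x. \<integral>\<^sup>+y. ennreal ((test x - test y)\<^sup>2) * frac_kernel \<alpha> x y \<partial>lborel \<partial>lborel) < \<infinity>"
    using test_energy unfolding sq_energy_def by (simp add: ennreal_mult_frac_kernel)
  have "H_norm \<alpha> UNIV test < \<infinity>"
    unfolding H_norm_def ennsqrt_def nn_integral_completion using 1 2 by (auto simp: ennreal_mult_eq_top_iff)
  moreover have "test \<in> borel_measurable (lebesgue_on UNIV)"
    by (intro measurable_restrict_space1 measurable_completion) measurable
  moreover have "ess_support test \<subseteq> \<Omega>"
  proof -
    have "- cball x0 \<sigma> \<in> {U. open U \<and> (AE x in lebesgue. x \<in> U \<longrightarrow> test x = 0)}"
      using test_zero by auto
    then have "ess_support test \<subseteq> cball x0 \<sigma>" unfolding ess_support_def by blast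
    with assms show ?thesis by blast
  qed
  ultimately show ?thesis by (simp add: H_space_supp_def H_space_def)
qed

context
  fixes k :: "'a \<times> 'a \<Rightarrow> real" and lam Lam :: real
  assumes k_meas [measurable]: "k \<in> borel_measurable borel"
    and lam: "0 \<le> lam" "0 \<le> Lam"
    and k: "\<And>x y. x \<noteq> y \<Longrightarrow> lam * riesz_kernel \<alpha> (x - y) \<le> k (x, y)" "\<And>x y. x \<noteq> y \<Longrightarrow> k (x, y) \<le> Lam * riesz_kernel \<alpha> (x - y)"
begin

definition form :: "'a \<times> 'a \<Rightarrow> real" where
  "form z = (v (fst z) - v (snd z)) * (test (fst z) - test (snd z)) * k z"

lemma form_measurable [measurable]: "form \<in> borel_measurable borel"
  unfolding form_def borel_prod[symmetric] using k_meas unfolding borel_prod[symmetric] by measurable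

lemma k_nonneg: "x \<noteq> y \<Longrightarrow> 0 \<le> k (x, y)"
  using k(1)[of x y] lam mult_nonneg_nonneg[OF lam(1) riesz_kernel_nonneg[of \<alpha> "x - y"]] by linarith

text \<open>Inside the larger ball, the product of the increments is at most the sum of their squares, and both have
finite energy. If one of the points is outside that ball, the test function vanishes there and
\<open>riesz_kernel_compare\<close> reduces the integral to products of local integrals and tails.\<close>

lemma form_integrable: "integrable (lborel \<Otimes>\<^sub>M lborel) form"
proof -
  let ?B = "ball x0 R"
  (* the relative distance between the support of the test function and the complement of the ball *)
  define \<kappa> where "\<kappa> = 1 - \<sigma> / R"
  have \<kappa>: "0 < \<kappa>" "\<kappa> \<le> 1" "\<sigma> \<le> (1 - \<kappa>) * R" using \<sigma> R by (auto simp: \<kappa>_def)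
  define c where "c = (1 / \<kappa>) ^ (DIM('a) + 2)"
  have c: "0 \<le> c" using \<kappa> by (simp add: c_def)
  define F1 where "F1 x y = ennreal ((v x - v y)\<^sup>2 * riesz_kernel \<alpha> (x - y)) * indicator ?B x * indicator ?B y" for x y
  define F2 where "F2 x y = ennreal ((test x - test y)\<^sup>2 * riesz_kernel \<alpha> (x - y))" for x y
  define H where "H x y = ennreal c * (ennreal (\<bar>v x\<bar> * test x) * (ennreal (riesz_kernel \<alpha> (x0 - y)) * indicator (- ?B) y)
     + ennreal (test x) * (ennreal (\<bar>v y\<bar> * riesz_kernel \<alpha> (x0 - y)) * indicator (- ?B) y))" for x y
  have m1[measurable]: "(\<lambda>(x, y). F1 x y) \<in> borel_measurable (lborel \<Otimes>\<^sub>M lborel)" unfolding F1_def by measurable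
  have m2[measurable]: "(\<lambda>(x, y). F2 x y) \<in> borel_measurable (lborel \<Otimes>\<^sub>M lborel)" unfolding F2_def by measurable
  have m3[measurable]: "(\<lambda>(x, y). H x y) \<in> borel_measurable (lborel \<Otimes>\<^sub>M lborel)" unfolding H_def by measurable
  have far: "ennreal (\<bar>v x - v y\<bar> * \<bar>test x - test y\<bar> * riesz_kernel \<alpha> (x - y)) \<le> H x y" if y: "y \<notin> ?B" for x y
  proof (cases "x \<in> ball x0 \<sigma>")
    case False
    moreover have "y \<notin> ball x0 \<sigma>" using y \<sigma> by auto
    ultimately show ?thesis using test_zero by simp
  next
    case x: True
    have y0: "test y = 0" using y \<sigma> by (intro test_zero) auto
    have "\<bar>v x - v y\<bar> * test x * riesz_kernel \<alpha> (x - y) \<le> (\<bar>v x\<bar> + \<bar>v y\<bar>) * test x * (c * riesz_kernel \<alpha> (x0 - y))"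
      unfolding c_def using test_nonneg riesz_kernel_compare[OF \<kappa> \<alpha> x y]
      by (intro mult_mono) auto
    also have "\<dots> = c * (\<bar>v x\<bar> * test x * riesz_kernel \<alpha> (x0 - y) + test x * (\<bar>v y\<bar> * riesz_kernel \<alpha> (x0 - y)))"
      by (simp add: algebra_simps)
    finally have "ennreal (\<bar>v x - v y\<bar> * test x * riesz_kernel \<alpha> (x - y)) \<le> ennreal (\<dots>)" by (rule ennreal_leI)
    also have "\<dots> = H x y"
      using y test_nonneg c by (simp add: H_def ennreal_mult[symmetric] ennreal_plus[symmetric] del: ennreal_plus)
    finally show ?thesis using y0 test_nonneg[of x] by simp
  qed
  have pt: "ennreal (norm (form (x, y))) \<le> ennreal Lam * (F1 x y + F2 x y + (H x y + H y x))" for x y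
  proof (cases "x = y")
    case True
    then show ?thesis by (simp add: form_def)
  next
    case False
    have kk: "0 \<le> riesz_kernel \<alpha> (x - y)" by simp
    have "norm (form (x, y)) = \<bar>v x - v y\<bar> * \<bar>test x - test y\<bar> * k (x, y)"
      using k_nonneg[OF False] by (simp add: form_def abs_mult)
    also have "\<dots> \<le> \<bar>v x - v y\<bar> * \<bar>test x - test y\<bar> * (Lam * riesz_kernel \<alpha> (x - y))"
      using k(2)[OF False] by (intro mult_left_mono) auto
    also have "\<dots> = Lam * (\<bar>v x - v y\<bar> * \<bar>test x - test y\<bar> * riesz_kernel \<alpha> (x - y))" by simp
    finally have "ennreal (norm (form (x, y))) \<le> ennreal Lam * ennreal (\<bar>v x - v y\<bar> * \<bar>test x - test y\<bar> * riesz_kernel \<alpha> (x - y))"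
      using lam by (simp add: ennreal_mult[symmetric] ennreal_leI)
    also have "\<dots> \<le> ennreal Lam * (F1 x y + F2 x y + (H x y + H y x))"
    proof (rule mult_left_mono)
      consider "x \<in> ?B" "y \<in> ?B" | "y \<notin> ?B" | "x \<notin> ?B" by blast
      then show "ennreal (\<bar>v x - v y\<bar> * \<bar>test x - test y\<bar> * riesz_kernel \<alpha> (x - y)) \<le> F1 x y + F2 x y + (H x y + H y x)"
      proof cases
        case 1
        define X Y where "X = \<bar>v x - v y\<bar>" and "Y = \<bar>test x - test y\<bar>"
        have "0 \<le> X * Y" by (simp add: X_def Y_def)
        moreover have "(X - Y)\<^sup>2 = X\<^sup>2 - 2 * (X * Y) + Y\<^sup>2" by (simp add: power2_eq_square algebra_simps)
        ultimately have "X * Y \<le> X\<^sup>2 + Y\<^sup>2" using zero_le_power2[of "X - Y"] by linarith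
        then have "X * Y * riesz_kernel \<alpha> (x - y) \<le> (X\<^sup>2 + Y\<^sup>2) * riesz_kernel \<alpha> (x - y)" by (intro mult_right_mono) auto
        then have "ennreal (X * Y * riesz_kernel \<alpha> (x - y)) \<le> ennreal (X\<^sup>2 * riesz_kernel \<alpha> (x - y) + Y\<^sup>2 * riesz_kernel \<alpha> (x - y))"
          by (intro ennreal_leI) (simp add: distrib_right)
        also have "\<dots> = F1 x y + F2 x y" using 1 by (simp add: F1_def F2_def X_def Y_def ennreal_plus)
        finally show ?thesis unfolding X_def Y_def by (rule order_trans) simp
      next
        case 2
        from far[OF this] show ?thesis by (rule order_trans) (simp add: add_increasing)
      next
        case 3
        have "ennreal (\<bar>v x - v y\<bar> * \<bar>test x - test y\<bar> * riesz_kernel \<alpha> (x - y)) = ennreal (\<bar>v y - v x\<bar> * \<bar>test y - test x\<bar> * riesz_kernel \<alpha> (y - x))"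
          unfolding riesz_kernel_minus[of \<alpha> y x] by (simp add: abs_minus_commute)
        also have "\<dots> \<le> H y x" by (rule far[OF 3])
        finally show ?thesis by (rule order_trans) (simp add: add_increasing)
      qed
    qed simp
    finally show ?thesis .
  qed
  have "(\<integral>\<^sup>+z. ennreal (norm (form z)) \<partial>(lborel \<Otimes>\<^sub>M lborel)) = (\<integral>\<^sup>+x. \<integral>\<^sup>+y. ennreal (norm (form (x, y))) \<partial>lborel \<partial>lborel)"
    by (rule lborel.nn_integral_fst[symmetric]) (use form_measurable in \<open>simp add: borel_prod[symmetric]\<close>)
  also have "\<dots> \<le> (\<integral>\<^sup>+x. \<integral>\<^sup>+y. ennreal Lam * (F1 x y + F2 x y + (H x y + H y x)) \<partial>lborel \<partial>lborel)"
    by (intro nn_integral_mono pt)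
  also have "\<dots> = ennreal Lam * ((\<integral>\<^sup>+x. \<integral>\<^sup>+y. F1 x y \<partial>lborel \<partial>lborel) + (\<integral>\<^sup>+x. \<integral>\<^sup>+y. F2 x y \<partial>lborel \<partial>lborel)
     + ((\<integral>\<^sup>+x. \<integral>\<^sup>+y. H x y \<partial>lborel \<partial>lborel) + (\<integral>\<^sup>+x. \<integral>\<^sup>+y. H y x \<partial>lborel \<partial>lborel)))"
    by (simp add: nn_integral_add nn_integral_cmult)
  also have "(\<integral>\<^sup>+x. \<integral>\<^sup>+y. H y x \<partial>lborel \<partial>lborel) = (\<integral>\<^sup>+x. \<integral>\<^sup>+y. H x y \<partial>lborel \<partial>lborel)"
    by (rule nn_integral_pair_swap) measurable
  also have "(\<integral>\<^sup>+x. \<integral>\<^sup>+y. H x y \<partial>lborel \<partial>lborel) = ennreal c * ((\<integral>\<^sup>+x. ennreal (\<bar>v x\<bar> * test x) \<partial>lborel) * (\<integral>\<^sup>+y\<in>- ?B. ennreal (riesz_kernel \<alpha> (x0 - y)) \<partial>lborel)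
     + (\<integral>\<^sup>+x. ennreal (test x) \<partial>lborel) * (\<integral>\<^sup>+y\<in>- ?B. ennreal (\<bar>v y\<bar> * riesz_kernel \<alpha> (x0 - y)) \<partial>lborel))"
    unfolding H_def by (simp add: nn_integral_cmult nn_integral_multc nn_integral_add)
  also have "ennreal Lam * ((\<integral>\<^sup>+x. \<integral>\<^sup>+y. F1 x y \<partial>lborel \<partial>lborel) + (\<integral>\<^sup>+x. \<integral>\<^sup>+y. F2 x y \<partial>lborel \<partial>lborel) + (\<dots> + \<dots>)) < \<infinity>"
    using v_H test_energy test_v_finite test_L1 v_tail riesz_tail_finite[OF R \<alpha>, of x0]
    by (simp add: ennreal_mult_less_top F1_def F2_def sq_energy_def)
  finally show ?thesis
    by (intro integrableI_bounded) (use form_measurable in \<open>simp_all add: borel_prod[symmetric]\<close>)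
qed

text \<open>Integrates \<open>energy_pointwise\<close> against the kernel. The square is bounded below with the lower bound on the
kernel and the localisation error above with the upper bound.\<close>

lemma form_lower_bound:
  "lam * enn2real (sq_energy \<alpha> (\<lambda>x. \<phi> x * trunc l x)) - Lam * enn2real (cross_energy \<alpha> \<phi> (trunc l))
    \<le> (LINT z|(lborel \<Otimes>\<^sub>M lborel). form z)"
proof -
  define P where "P z = (\<phi> (fst z) * trunc l (fst z) - \<phi> (snd z) * trunc l (snd z))\<^sup>2 * riesz_kernel \<alpha> (fst z - snd z)" for z
  define N where "N z = trunc l (fst z) * trunc l (snd z) * (\<phi> (fst z) - \<phi> (snd z))\<^sup>2 * riesz_kernel \<alpha> (fst z - snd z)" for z
  have [measurable]: "P \<in> borel_measurable (lborel \<Otimes>\<^sub>M lborel)" "N \<in> borel_measurable (lborel \<Otimes>\<^sub>M lborel)"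
    unfolding P_def N_def by measurable
  have P0: "0 \<le> P z" for z by (simp add: P_def)
  have N0: "0 \<le> N z" for z using trunc_props(1)[OF l] by (simp add: N_def)
  have nP: "(\<integral>\<^sup>+z. ennreal (P z) \<partial>(lborel \<Otimes>\<^sub>M lborel)) = sq_energy \<alpha> (\<lambda>x. \<phi> x * trunc l x)"
    unfolding sq_energy_def by (subst lborel.nn_integral_fst[symmetric]) (auto simp: P_def)
  have nN: "(\<integral>\<^sup>+z. ennreal (N z) \<partial>(lborel \<Otimes>\<^sub>M lborel)) = cross_energy \<alpha> \<phi> (trunc l)"
    unfolding cross_energy_def by (subst lborel.nn_integral_fst[symmetric]) (auto simp: N_def)
  have iP: "integrable (lborel \<Otimes>\<^sub>M lborel) P"
    using cutoff_trunc_energy P0 by (intro integrableI_nonneg) (auto simp: nP)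
  have iN: "integrable (lborel \<Otimes>\<^sub>M lborel) N"
    using cross_energy_finite N0 by (intro integrableI_nonneg) (auto simp: nN)
  have "lam * enn2real (sq_energy \<alpha> (\<lambda>x. \<phi> x * trunc l x)) - Lam * enn2real (cross_energy \<alpha> \<phi> (trunc l))
     = lam * (LINT z|(lborel \<Otimes>\<^sub>M lborel). P z) - Lam * (LINT z|(lborel \<Otimes>\<^sub>M lborel). N z)"
    using P0 N0 by (simp add: integral_eq_nn_integral nP nN)
  also have "\<dots> = (LINT z|(lborel \<Otimes>\<^sub>M lborel). lam * P z - Lam * N z)"
    using iP iN by (simp add: Bochner_Integration.integral_diff)
  also have "\<dots> \<le> (LINT z|(lborel \<Otimes>\<^sub>M lborel). form z)"
  proof (rule integral_mono)
    show "integrable (lborel \<Otimes>\<^sub>M lborel) (\<lambda>z. lam * P z - Lam * N z)" using iP iN by simp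
    show "integrable (lborel \<Otimes>\<^sub>M lborel) form" by (rule form_integrable)
    fix z :: "'a \<times> 'a"
    obtain x y where z: "z = (x, y)" by (cases z)
    show "lam * P z - Lam * N z \<le> form z"
    proof (cases "x = y")
      case True then show ?thesis by (simp add: z P_def N_def form_def)
    next
      case False
      define p where "p = (\<phi> x * trunc l x - \<phi> y * trunc l y)\<^sup>2"
      define n where "n = trunc l x * trunc l y * (\<phi> x - \<phi> y)\<^sup>2"
      have pn: "0 \<le> p" "0 \<le> n" using trunc_props(1)[OF l] by (auto simp: p_def n_def)
      have "lam * P z - Lam * N z = p * (lam * riesz_kernel \<alpha> (x - y)) - n * (Lam * riesz_kernel \<alpha> (x - y))"
        by (simp add: P_def N_def p_def n_def z)
      also have "\<dots> \<le> p * k (x, y) - n * k (x, y)"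
        using k[OF False] pn by (intro diff_mono mult_left_mono) auto
      also have "\<dots> = (p - n) * k (x, y)" by (simp add: left_diff_distrib)
      also have "\<dots> \<le> ((v x - v y) * (test x - test y)) * k (x, y)"
        using energy_pointwise[of "\<phi> x" "v x" l "\<phi> y" "v y"] k_nonneg[OF False]
        unfolding p_def n_def test_def trunc_def by (intro mult_right_mono) auto
      finally show ?thesis by (simp add: form_def z)
    qed
  qed
  finally show ?thesis .
qed

end

end

end

section \<open>The energy inequality above a moving level\<close>

lemma primitive_sub:
  assumes "integrable lborel f" "integrable lborel g"
  shows "primitive (\<lambda>s. f s - g s) t = primitive f t - primitive g t"
  unfolding primitive_def right_diff_distrib
  using assms by (intro Bochner_Integration.integral_diff integrable_indicator_mult) auto

lemma primitive_nonneg: "(\<And>s. 0 \<le> w s) \<Longrightarrow> 0 \<le> primitive w t"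
  unfolding primitive_def by (intro integral_nonneg_AE) auto

text \<open>The equality of two real integrals, arranged so that it can be combined with terms in \<open>[0,\<infinity>]\<close> that are
not yet known to be finite.\<close>

lemma nn_integral_pos_neg_balance:
  fixes D :: "'x \<Rightarrow> real" and \<Gamma> :: "'y \<Rightarrow> real"
  assumes "integrable M D" "integrable N \<Gamma>" "(LINT x|M. D x) = (LINT y|N. \<Gamma> y)"
  shows "(\<integral>\<^sup>+x. ennreal (D x) \<partial>M) + (\<integral>\<^sup>+y. ennreal (- \<Gamma> y) \<partial>N) = (\<integral>\<^sup>+x. ennreal (- D x) \<partial>M) + (\<integral>\<^sup>+y. ennreal (\<Gamma> y) \<partial>N)"
    "(\<integral>\<^sup>+x. ennreal (- D x) \<partial>M) < \<infinity>" "(\<integral>\<^sup>+y. ennreal (- \<Gamma> y) \<partial>N) < \<infinity>"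
proof -
  have fin: "(\<integral>\<^sup>+x. ennreal (D x) \<partial>M) < \<infinity>" "(\<integral>\<^sup>+x. ennreal (- D x) \<partial>M) < \<infinity>"
    "(\<integral>\<^sup>+y. ennreal (\<Gamma> y) \<partial>N) < \<infinity>" "(\<integral>\<^sup>+y. ennreal (- \<Gamma> y) \<partial>N) < \<infinity>"
    using assms(1,2) by (auto simp: real_integrable_def top.not_eq_extremum)
  define d1 d2 g1 g2 where "d1 = enn2real (\<integral>\<^sup>+x. ennreal (D x) \<partial>M)" and "d2 = enn2real (\<integral>\<^sup>+x. ennreal (- D x) \<partial>M)"
    and "g1 = enn2real (\<integral>\<^sup>+y. ennreal (\<Gamma> y) \<partial>N)" and "g2 = enn2real (\<integral>\<^sup>+y. ennreal (- \<Gamma> y) \<partial>N)"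
  have d: "(\<integral>\<^sup>+x. ennreal (D x) \<partial>M) = ennreal d1" "(\<integral>\<^sup>+x. ennreal (- D x) \<partial>M) = ennreal d2"
    "(\<integral>\<^sup>+y. ennreal (\<Gamma> y) \<partial>N) = ennreal g1" "(\<integral>\<^sup>+y. ennreal (- \<Gamma> y) \<partial>N) = ennreal g2"
    using fin by (simp_all add: d1_def d2_def g1_def g2_def less_top)
  have nn: "0 \<le> d1" "0 \<le> d2" "0 \<le> g1" "0 \<le> g2" by (simp_all add: d1_def d2_def g1_def g2_def)
  have "d1 - d2 = g1 - g2"
    using assms(3) unfolding real_lebesgue_integral_def[OF assms(1)] real_lebesgue_integral_def[OF assms(2)] d
    using nn by simp
  then have "d1 + g2 = d2 + g1" by linarith
  then show "(\<integral>\<^sup>+x. ennreal (D x) \<partial>M) + (\<integral>\<^sup>+y. ennreal (- \<Gamma> y) \<partial>N) = (\<integral>\<^sup>+x. ennreal (- D x) \<partial>M) + (\<integral>\<^sup>+y. ennreal (\<Gamma> y) \<partial>N)"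
    unfolding d using nn by (simp flip: ennreal_plus)
  show "(\<integral>\<^sup>+x. ennreal (- D x) \<partial>M) < \<infinity>" "(\<integral>\<^sup>+y. ennreal (- \<Gamma> y) \<partial>N) < \<infinity>" using fin by auto
qed

lemma remainder_arith:
  fixes A :: ennreal
  shows "A * (2 * (K * D) + 2 * (P * (E * T + Q * S))) = (A * 2 * K) * D + (A * 2 * Q) * (P * S) + 2 * (P * (A * E * T))"
  by (simp add: distrib_left mult.assoc mult.left_commute add.assoc add.commute)

lemma ennreal_mult3: "0 \<le> x \<Longrightarrow> 0 \<le> y \<Longrightarrow> 0 \<le> z \<Longrightarrow> ennreal x * ennreal y * ennreal z = ennreal (x * y * z)"
  by (simp add: ennreal_mult)

lemma ennreal_mult_two: "0 \<le> x \<Longrightarrow> 0 \<le> y \<Longrightarrow> ennreal x * 2 * ennreal y = ennreal (x * 2 * y)"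
  by (simp add: ennreal_mult)

text \<open>The subsolution in a form to which real analysis applies: Borel functions on \<open>real \<times> 'a\<close>, with
\<open>t \<mapsto> U (t, x)\<close> absolutely continuous with derivative \<open>W\<close> for almost every \<open>x\<close> of the ball, and the
equation tested with \<open>\<phi>\<^sup>2 (U - l)\<^sub>+\<close>, where \<open>form_lower_bound\<close> has already been applied to the form. The
inequality must hold for all levels \<open>l\<close> at the same time \<open>t\<close>, since the level will depend on \<open>t\<close>.\<close>

locale evolution =
  fixes \<alpha> lam Lam R a b :: real and x0 :: "'a::euclidean_space" and U W :: "real \<times> 'a \<Rightarrow> real"
  assumes \<alpha>: "0 < \<alpha>" "\<alpha> < 2" and R: "0 < R" and ab: "a < b" and lam: "0 < lam" "0 < Lam"
    and U_meas [measurable]: "U \<in> borel_measurable (borel \<Otimes>\<^sub>M borel)"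
    and W_meas [measurable]: "W \<in> borel_measurable (borel \<Otimes>\<^sub>M borel)"
    and U_primitive: "AE x in lborel. x \<in> ball x0 R \<longrightarrow> integrable lborel (\<lambda>s. indicator {a..b} s * W (s, x)) \<and>
      (\<forall>t\<in>{a..b}. U (t, x) = U (a, x) + primitive (\<lambda>s. indicator {a..b} s * W (s, x)) t)"
    and U_L2: "\<exists>C. AE t in lborel. t \<in> {a..b} \<longrightarrow> (\<integral>\<^sup>+x\<in>ball x0 R. ennreal ((U (t, x))\<^sup>2) \<partial>lborel) \<le> ennreal C"
    and UW_L1: "(\<integral>\<^sup>+t\<in>{a..b}. (\<integral>\<^sup>+x\<in>ball x0 R. ennreal (\<bar>U (t, x)\<bar> * \<bar>W (t, x)\<bar>) \<partial>lborel) \<partial>lborel) < \<infinity>"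
    and U_static: "AE t in lborel. t \<in> {a..b} \<longrightarrow> static_energy \<alpha> R x0 (\<lambda>x. U (t, x))"
    and U_tail: "(\<integral>\<^sup>+t\<in>{a..b}. (\<integral>\<^sup>+y\<in>- ball x0 (3 * R / 4). ennreal (\<bar>U (t, y)\<bar> * riesz_kernel \<alpha> (x0 - y)) \<partial>lborel) \<partial>lborel) < \<infinity>"
    and subsolution: "AE t in lborel. t \<in> {a..b} \<longrightarrow> (\<forall>l \<sigma> L \<phi>. 0 \<le> l \<and> 0 < \<sigma> \<and> \<sigma> < R \<and> 0 < L \<and> cutoff x0 \<sigma> L \<phi> \<longrightarrow>
      (LINT x|lborel. W (t, x) * ((\<phi> x)\<^sup>2 * max (U (t, x) - l) 0))
        \<le> Lam * (2 - \<alpha>) * enn2real (cross_energy \<alpha> \<phi> (\<lambda>x. max (U (t, x) - l) 0))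
          - lam * (2 - \<alpha>) * enn2real (sq_energy \<alpha> (\<lambda>x. \<phi> x * max (U (t, x) - l) 0)))"
begin

text \<open>The radius \<open>3 R / 4\<close> is the one at which all later steps of the iteration take their tails; the same
moving level can then serve every step.\<close>

definition outer_tail :: "real \<Rightarrow> ennreal" where
  "outer_tail t = (\<integral>\<^sup>+y\<in>- ball x0 (3 * R / 4). ennreal (max (U (t, y)) 0 * riesz_kernel \<alpha> (x0 - y)) \<partial>lborel)"

lemma outer_tail_measurable [measurable]: "outer_tail \<in> borel_measurable borel"
  unfolding outer_tail_def by measurable

lemma outer_tail_integral: "(\<integral>\<^sup>+t\<in>{a..b}. outer_tail t \<partial>lborel) < \<infinity>"
  unfolding outer_tail_def
  by (rule le_less_trans[OF nn_integral_mono[OF mult_right_mono[OF nn_integral_mono[OF mult_right_mono]]] U_tail])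
     (auto intro!: ennreal_leI mult_right_mono)

lemma outer_tail_finite: "AE t in lborel. t \<in> {a..b} \<longrightarrow> outer_tail t < \<infinity>"
proof -
  have "AE t in lborel. outer_tail t * indicator {a..b} t \<noteq> \<infinity>"
    using outer_tail_integral by (intro nn_integral_PInf_AE) auto
  then show ?thesis by eventually_elim (auto simp: top.not_eq_extremum)
qed

text \<open>The factor \<open>Lam * (2 - \<alpha>)\<close> of the upper bound on the kernel times the factor \<open>2 * 8 ^ (d + 2)\<close> in front of
the tail in \<open>cross_energy_bound\<close>, where \<open>\<kappa> = 1 / 8\<close>: with this rate the rise of the level compensates the tail.\<close>

definition height_coeff :: real where "height_coeff = 2 * Lam * (2 - \<alpha>) * 8 ^ (DIM('a) + 2)"

lemma height_coeff_pos: "0 < height_coeff" using lam \<alpha> by (simp add: height_coeff_def)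

definition height_rate :: "real \<Rightarrow> real" where
  "height_rate t = indicator {a..b} t * (height_coeff * enn2real (outer_tail t))"

lemma height_rate_measurable [measurable]: "height_rate \<in> borel_measurable borel"
  unfolding height_rate_def by measurable

lemma height_rate_nonneg: "0 \<le> height_rate t"
  unfolding height_rate_def using height_coeff_pos by simp

lemma height_rate_integral:
  "(\<integral>\<^sup>+t. ennreal (height_rate t) \<partial>lborel) = ennreal height_coeff * (\<integral>\<^sup>+t\<in>{a..b}. outer_tail t \<partial>lborel)"
proof -
  have "(\<integral>\<^sup>+t. ennreal (height_rate t) \<partial>lborel) = (\<integral>\<^sup>+t. ennreal height_coeff * (outer_tail t * indicator {a..b} t) \<partial>lborel)"
  proof (rule nn_integral_cong_AE)
    show "AE t in lborel. ennreal (height_rate t) = ennreal height_coeff * (outer_tail t * indicator {a..b} t)"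
      using outer_tail_finite
    proof eventually_elim
      case (elim t)
      then show ?case using height_coeff_pos
        by (cases "t \<in> {a..b}") (auto simp: height_rate_def ennreal_mult less_top)
    qed
  qed
  then show ?thesis by (simp add: nn_integral_cmult)
qed

lemma height_rate_integrable: "integrable lborel height_rate"
  by (rule integrableI_nonneg)
     (use height_rate_nonneg outer_tail_integral in \<open>auto simp: height_rate_integral ennreal_mult_less_top\<close>)

text \<open>The amount by which the level has been raised up to time \<open>t\<close>. Raising the level at the rate of the tail
is the way to treat a tail that is only integrable in time: the usual argument with a fixed level
would need a bound that is uniform in time.\<close>

definition height :: "real \<Rightarrow> real" where "height = primitive height_rate"

lemma height_measurable [measurable]: "height \<in> borel_measurable borel"
  unfolding height_def by (rule primitive_measurable[OF height_rate_integrable])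

lemma height_nonneg: "0 \<le> height t"
  unfolding height_def by (rule primitive_nonneg[OF height_rate_nonneg])

lemma height_le: "ennreal (height t) \<le> ennreal height_coeff * (\<integral>\<^sup>+t\<in>{a..b}. outer_tail t \<partial>lborel)"
proof -
  have "height t \<le> (LINT s|lborel. height_rate s)"
    using primitive_bound[OF height_rate_integrable, of t] height_rate_nonneg unfolding height_def by simp
  then have "ennreal (height t) \<le> ennreal (LINT s|lborel. height_rate s)" by (rule ennreal_leI)
  also have "\<dots> = (\<integral>\<^sup>+s. ennreal (height_rate s) \<partial>lborel)"
    by (rule nn_integral_eq_integral[symmetric, OF height_rate_integrable]) (use height_rate_nonneg in auto)
  finally show ?thesis by (simp add: height_rate_integral)
qed

definition excess :: "real \<Rightarrow> real \<Rightarrow> 'a \<Rightarrow> real" where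
  "excess k t x = max (U (t, x) - (k + height t)) 0"

lemma excess_measurable [measurable]: "(\<lambda>(t, x). excess k t x) \<in> borel_measurable (borel \<Otimes>\<^sub>M borel)"
  unfolding excess_def by measurable

lemma excess_measurable' [measurable]: "excess k t \<in> borel_measurable borel"
  unfolding excess_def by measurable

lemma excess_nonneg: "0 \<le> excess k t x" by (simp add: excess_def)

lemma excess_le: "0 \<le> k \<Longrightarrow> excess k t x \<le> max (U (t, x)) 0"
  using height_nonneg[of t] by (simp add: excess_def)

lemma excess_le_abs: "0 \<le> k \<Longrightarrow> excess k t x \<le> \<bar>U (t, x)\<bar>"
  using excess_le[of k t x] by simp

context
  fixes k \<sigma> L :: real and \<phi> :: "'a \<Rightarrow> real"
  assumes k: "0 \<le> k" and \<sigma>: "0 < \<sigma>" "\<sigma> < R" and L: "0 < L" and \<phi>: "cutoff x0 \<sigma> L \<phi>"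
begin

lemmas cutoff_meas [measurable] = cutoff_measurable[OF \<phi>]

text \<open>The time derivative of \<open>(\<phi> x * excess k t x)\<^sup>2\<close>, restricted to \<open>{s..<t}\<close>.\<close>

definition flux :: "real \<Rightarrow> real \<Rightarrow> real \<times> 'a \<Rightarrow> real" where
  "flux s t z = indicator {s..<t} (fst z) * ((\<phi> (snd z))\<^sup>2 * (2 * excess k (fst z) (snd z) * (W z - height_rate (fst z))))"

lemma flux_measurable [measurable]: "flux s t \<in> borel_measurable (borel \<Otimes>\<^sub>M borel)"
  unfolding flux_def by measurable

text \<open>This is where the bound on \<open>U W\<close> enters; the level contributes the product of an integrable function of
time and an \<open>L\<^sup>2\<close> norm that is bounded in time.\<close>

lemma flux_integrable:
  assumes st: "a \<le> s" "t \<le> b"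
  shows "integrable (lborel \<Otimes>\<^sub>M lborel) (flux s t)"
proof (rule integrableI_bounded)
  show "flux s t \<in> borel_measurable (lborel \<Otimes>\<^sub>M lborel)" by measurable
  let ?B = "ball x0 R"
  obtain C where C: "AE t in lborel. t \<in> {a..b} \<longrightarrow> (\<integral>\<^sup>+x\<in>?B. ennreal ((U (t, x))\<^sup>2) \<partial>lborel) \<le> ennreal C"
    using U_L2 by blast
  have pt: "ennreal (norm (flux s t (r, x))) \<le> 2 * (ennreal (\<bar>U (r, x)\<bar> * \<bar>W (r, x)\<bar>) * indicator ?B x * indicator {a..b} r)
     + 2 * (ennreal (height_rate r) * (ennreal (1 + (U (r, x))\<^sup>2) * indicator ?B x))" for r x
  proof (cases "r \<in> {s..<t} \<and> x \<in> ball x0 \<sigma>")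
    case False
    then have "flux s t (r, x) = 0" using cutoffD(4)[OF \<phi>, of x] by (auto simp: flux_def)
    then show ?thesis by simp
  next
    case True
    have e: "0 \<le> excess k r x" "excess k r x \<le> \<bar>U (r, x)\<bar>" using excess_nonneg excess_le_abs[OF k] by auto
    have u: "\<bar>U (r, x)\<bar> \<le> 1 + (U (r, x))\<^sup>2"
      using le_add_square[of 1 "\<bar>U (r, x)\<bar>"] by simp
    have "norm (flux s t (r, x)) = (\<phi> x)\<^sup>2 * (2 * excess k r x * \<bar>W (r, x) - height_rate r\<bar>)"
      using True e by (simp add: flux_def abs_mult)
    also have "\<dots> \<le> 2 * excess k r x * \<bar>W (r, x) - height_rate r\<bar>"
      using cutoffD(1,2)[OF \<phi>, of x] e by (intro mult_left_le_one_le) (auto simp: power_le_one)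
    also have "\<dots> \<le> 2 * \<bar>U (r, x)\<bar> * (\<bar>W (r, x)\<bar> + height_rate r)"
      using e height_rate_nonneg[of r] by (intro mult_mono) auto
    also have "\<dots> = 2 * (\<bar>U (r, x)\<bar> * \<bar>W (r, x)\<bar>) + 2 * (height_rate r * \<bar>U (r, x)\<bar>)"
      by (simp add: algebra_simps)
    also have "\<dots> \<le> 2 * (\<bar>U (r, x)\<bar> * \<bar>W (r, x)\<bar>) + 2 * (height_rate r * (1 + (U (r, x))\<^sup>2))"
      using u height_rate_nonneg[of r] by (intro add_left_mono mult_left_mono) auto
    finally have "ennreal (norm (flux s t (r, x))) \<le> ennreal (\<dots>)" by (rule ennreal_leI)
    also have "\<dots> = 2 * ennreal (\<bar>U (r, x)\<bar> * \<bar>W (r, x)\<bar>) + 2 * (ennreal (height_rate r) * ennreal (1 + (U (r, x))\<^sup>2))"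
      using height_rate_nonneg[of r] by (simp add: ennreal_plus ennreal_mult)
    finally show ?thesis using True \<sigma> st by simp
  qed
  have "(\<integral>\<^sup>+z. ennreal (norm (flux s t z)) \<partial>(lborel \<Otimes>\<^sub>M lborel)) = (\<integral>\<^sup>+r. \<integral>\<^sup>+x. ennreal (norm (flux s t (r, x))) \<partial>lborel \<partial>lborel)"
    by (rule lborel.nn_integral_fst[symmetric]) measurable
  also have "\<dots> \<le> (\<integral>\<^sup>+r. \<integral>\<^sup>+x. 2 * (ennreal (\<bar>U (r, x)\<bar> * \<bar>W (r, x)\<bar>) * indicator ?B x * indicator {a..b} r)
     + 2 * (ennreal (height_rate r) * (ennreal (1 + (U (r, x))\<^sup>2) * indicator ?B x)) \<partial>lborel \<partial>lborel)"
    by (intro nn_integral_mono pt)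
  also have "\<dots> = 2 * (\<integral>\<^sup>+r\<in>{a..b}. (\<integral>\<^sup>+x\<in>?B. ennreal (\<bar>U (r, x)\<bar> * \<bar>W (r, x)\<bar>) \<partial>lborel) \<partial>lborel)
     + 2 * (\<integral>\<^sup>+r. ennreal (height_rate r) * (\<integral>\<^sup>+x\<in>?B. ennreal (1 + (U (r, x))\<^sup>2) \<partial>lborel) \<partial>lborel)"
    by (simp add: nn_integral_add nn_integral_cmult nn_integral_multc)
  also have "\<dots> < \<infinity>"
  proof -
    have "(\<integral>\<^sup>+r. ennreal (height_rate r) * (\<integral>\<^sup>+x\<in>?B. ennreal (1 + (U (r, x))\<^sup>2) \<partial>lborel) \<partial>lborel)
      \<le> (\<integral>\<^sup>+r. ennreal (height_rate r) * (emeasure lborel ?B + ennreal C) \<partial>lborel)"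
    proof (rule nn_integral_mono_AE)
      show "AE r in lborel. ennreal (height_rate r) * (\<integral>\<^sup>+x\<in>?B. ennreal (1 + (U (r, x))\<^sup>2) \<partial>lborel) \<le> ennreal (height_rate r) * (emeasure lborel ?B + ennreal C)"
        using C
      proof eventually_elim
        case (elim r)
        show ?case
        proof (cases "r \<in> {a..b}")
          case True
          have "(\<integral>\<^sup>+x\<in>?B. ennreal (1 + (U (r, x))\<^sup>2) \<partial>lborel) = (\<integral>\<^sup>+x. indicator ?B x + ennreal ((U (r, x))\<^sup>2) * indicator ?B x \<partial>lborel)"
            by (intro nn_integral_cong) (auto simp: ennreal_plus distrib_right indicator_def)
          also have "\<dots> = emeasure lborel ?B + (\<integral>\<^sup>+x\<in>?B. ennreal ((U (r, x))\<^sup>2) \<partial>lborel)"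
            by (subst nn_integral_add) auto
          finally show ?thesis using elim True by (intro mult_left_mono) (auto intro: add_left_mono)
        qed (simp add: height_rate_def)
      qed
    qed
    also have "\<dots> = (\<integral>\<^sup>+r. ennreal (height_rate r) \<partial>lborel) * (emeasure lborel ?B + ennreal C)"
      by (simp add: nn_integral_multc)
    also have "\<dots> < \<infinity>" using outer_tail_integral R by (simp add: height_rate_integral ennreal_mult_less_top emeasure_ball)
    finally show ?thesis using UW_L1 by (simp add: ennreal_mult_less_top)
  qed
  finally show "(\<integral>\<^sup>+z. ennreal (norm (flux s t z)) \<partial>(lborel \<Otimes>\<^sub>M lborel)) < \<infinity>" .
qed

lemma excess_sq_increment:
  assumes st: "a \<le> s" "s < t" "t \<le> b"
  shows "AE x in lborel. (\<phi> x * excess k t x)\<^sup>2 \<le> (\<phi> x * excess k s x)\<^sup>2 + (LINT r|lborel. flux s t (r, x))"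
  using U_primitive
proof eventually_elim
  case (elim x)
  show ?case
  proof (cases "x \<in> ball x0 R")
    case False
    then have "\<phi> x = 0" using \<sigma> by (intro cutoffD(4)[OF \<phi>]) auto
    then show ?thesis by (simp add: flux_def)
  next
    case True
    define w where "w s = indicator {a..b} s * W (s, x)" for s
    have w: "integrable lborel w" and U: "\<And>t. t \<in> {a..b} \<Longrightarrow> U (t, x) = U (a, x) + primitive w t"
      using elim True unfolding w_def[abs_def] by blast+
    define G where "G s = w s - height_rate s" for s
    have G: "integrable lborel G" unfolding G_def using w height_rate_integrable by simp
    have g: "U (a, x) - k + primitive G r = U (r, x) - (k + height r)" if "r \<in> {a..b}" for r
      unfolding G_def using U[OF that] primitive_sub[OF w height_rate_integrable, of r] by (simp add: height_def)
    have "(max (U (a, x) - k + primitive G t) 0)\<^sup>2 - (max (U (a, x) - k + primitive G s) 0)\<^sup>2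
        \<le> (LINT r|lborel. indicator {s..<t} r * (2 * max (U (a, x) - k + primitive G r) 0 * G r))"
      by (rule pos_part_sq_chain_rule[OF G st(2)])
    also have "\<dots> = (LINT r|lborel. indicator {s..<t} r * (2 * excess k r x * (W (r, x) - height_rate r)))"
    proof (intro Bochner_Integration.integral_cong refl)
      fix r
      show "indicator {s..<t} r * (2 * max (U (a, x) - k + primitive G r) 0 * G r) = indicator {s..<t} r * (2 * excess k r x * (W (r, x) - height_rate r))"
      proof (cases "r \<in> {s..<t}")
        case True
        then have r: "r \<in> {a..b}" using st by auto
        then show ?thesis unfolding g[OF r] excess_def by (simp add: G_def w_def)
      qed simp
    qed
    finally have "(excess k t x)\<^sup>2 - (excess k s x)\<^sup>2 \<le> (LINT r|lborel. indicator {s..<t} r * (2 * excess k r x * (W (r, x) - height_rate r)))"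
      using g[of t] g[of s] st by (simp add: excess_def)
    then have "(\<phi> x)\<^sup>2 * ((excess k t x)\<^sup>2 - (excess k s x)\<^sup>2) \<le> (\<phi> x)\<^sup>2 * (LINT r|lborel. indicator {s..<t} r * (2 * excess k r x * (W (r, x) - height_rate r)))"
      by (rule mult_left_mono) simp
    also have "\<dots> = (LINT r|lborel. (\<phi> x)\<^sup>2 * (indicator {s..<t} r * (2 * excess k r x * (W (r, x) - height_rate r))))"
      by (rule integral_mult_right_zero[symmetric])
    also have "\<dots> = (LINT r|lborel. flux s t (r, x))"
      by (intro Bochner_Integration.integral_cong refl) (simp add: flux_def)
    finally show ?thesis by (simp add: power_mult_distrib right_diff_distrib)
  qed
qed

text \<open>What is left of the localisation error after the moving level has absorbed the far tail: a local \<open>L\<^sup>2\<close>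
term and an interaction with the annulus between \<open>\<rho>\<close> and \<open>r'\<close>.\<close>

definition remainder :: "real \<Rightarrow> real \<Rightarrow> real \<Rightarrow> ennreal" where
  "remainder \<rho> r' t = ennreal (4 * Lam * (lipschitz_const DIM('a) * L powr \<alpha> / \<alpha>)) * (\<integral>\<^sup>+x\<in>ball x0 \<rho>. ennreal ((excess k t x)\<^sup>2) \<partial>lborel)
     + ennreal (4 * Lam * (2 - \<alpha>) * (\<rho> - \<sigma>) powr (- (DIM('a) + \<alpha>))) * ((\<integral>\<^sup>+x. ennreal ((\<phi> x)\<^sup>2 * excess k t x) \<partial>lborel)
         * (\<integral>\<^sup>+y\<in>ball x0 r' - ball x0 \<rho>. ennreal (excess k t y) \<partial>lborel))"

lemma remainder_measurable [measurable]: "remainder \<rho> r' \<in> borel_measurable borel"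
proof -
  have [measurable]: "ball x0 r' - ball x0 \<rho> \<in> sets borel" by auto
  show ?thesis unfolding remainder_def by measurable
qed

lemma gagliardo_excess_measurable [measurable]: "(\<lambda>t. gagliardo \<alpha> (\<lambda>x. \<phi> x * excess k t x)) \<in> borel_measurable borel"
  unfolding gagliardo_def by measurable

text \<open>The equation at time \<open>\<tau>\<close>, tested at the level \<open>k + height \<tau>\<close>. The flux equals twice the tested time derivative
minus \<open>2 height_rate \<tau>\<close> times the integral of \<open>\<phi>\<^sup>2\<close> times the excess, and this last term absorbs the contribution of
the points outside \<open>ball x0 r'\<close> to the localisation error. The flux is written with its positive part on the left and its
negative part on the right, so that every term is in \<open>[0,\<infinity>]\<close>.\<close>

lemma flux_energy_bound:
  assumes st: "a \<le> s" "s < t" "t \<le> b" and r: "\<sigma> < \<rho>" "\<rho> \<le> r'" "3 * R / 4 \<le> r'" "r' \<le> R" "8 * \<sigma> \<le> 7 * r'"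
  shows "AE \<tau> in lborel. ennreal (LINT x|lborel. flux s t (\<tau>, x)) + ennreal (2 * lam) * (gagliardo \<alpha> (\<lambda>x. \<phi> x * excess k \<tau> x) * indicator {s..<t} \<tau>)
    \<le> ennreal (- (LINT x|lborel. flux s t (\<tau>, x))) + remainder \<rho> r' \<tau> * indicator {s..<t} \<tau>"
  using U_static subsolution outer_tail_finite lborel_pair.AE_integrable_fst'[OF flux_integrable[OF st(1,3)]]
proof eventually_elim
  case (elim \<tau>)
  show ?case
  proof (cases "\<tau> \<in> {s..<t}")
    case False
    then show ?thesis by (simp add: flux_def)
  next
    case True
    then have \<tau>: "\<tau> \<in> {a..b}" using st by auto
    interpret static_energy \<alpha> R x0 "\<lambda>x. U (\<tau>, x)" using elim \<tau> by blast
    define l where "l = k + height \<tau>"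
    have l: "0 \<le> l" using k height_nonneg by (simp add: l_def)
    have tr: "trunc l = excess k \<tau>" by (rule ext) (simp add: trunc_def excess_def l_def)
    have te: "test l \<phi> x = (\<phi> x)\<^sup>2 * excess k \<tau> x" for x
      using test_def[OF l \<sigma> L \<phi>, of x] by (simp add: tr)
    define p where "p = (LINT x|lborel. (\<phi> x)\<^sup>2 * excess k \<tau> x)"
    have ip: "integrable lborel (\<lambda>x. (\<phi> x)\<^sup>2 * excess k \<tau> x)"
      using test_L1[OF l \<sigma> L \<phi>] excess_nonneg by (intro integrableI_nonneg) (auto simp: te)
    have p0: "0 \<le> p" unfolding p_def using excess_nonneg by simp
    have np: "(\<integral>\<^sup>+x. ennreal ((\<phi> x)\<^sup>2 * excess k \<tau> x) \<partial>lborel) = ennreal p"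
      unfolding p_def by (rule nn_integral_eq_integral[OF ip]) (use excess_nonneg in auto)
    define q where "q = (LINT x|lborel. W (\<tau>, x) * ((\<phi> x)\<^sup>2 * excess k \<tau> x))"
    define e where "e = enn2real (sq_energy \<alpha> (\<lambda>x. \<phi> x * excess k \<tau> x))"
    define c where "c = enn2real (cross_energy \<alpha> \<phi> (excess k \<tau>))"
    have fin: "sq_energy \<alpha> (\<lambda>x. \<phi> x * excess k \<tau> x) < \<infinity>" "cross_energy \<alpha> \<phi> (excess k \<tau>) < \<infinity>"
      using cutoff_trunc_energy[OF l \<sigma> L \<phi>] cross_energy_finite[OF l \<sigma> L \<phi>] by (simp_all add: tr)
    have q: "q \<le> Lam * (2 - \<alpha>) * c - lam * (2 - \<alpha>) * e"
    proof -
      have "0 \<le> l \<and> 0 < \<sigma> \<and> \<sigma> < R \<and> 0 < L \<and> cutoff x0 \<sigma> L \<phi>" using l \<sigma> L \<phi> by blast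
      with elim \<tau> show ?thesis
        unfolding q_def c_def e_def excess_def[abs_def] l_def[symmetric] by blast
    qed
    have \<Gamma>: "(LINT x|lborel. flux s t (\<tau>, x)) = 2 * q - 2 * height_rate \<tau> * p"
    proof -
      have iW: "integrable lborel (\<lambda>x. W (\<tau>, x) * ((\<phi> x)\<^sup>2 * excess k \<tau> x))"
      proof -
        have "integrable lborel (\<lambda>x. (1/2) * flux s t (\<tau>, x) + height_rate \<tau> * ((\<phi> x)\<^sup>2 * excess k \<tau> x))"
          using elim ip by (intro Bochner_Integration.integrable_add integrable_mult_right) auto
        moreover have "(1/2) * flux s t (\<tau>, x) + height_rate \<tau> * ((\<phi> x)\<^sup>2 * excess k \<tau> x) = W (\<tau>, x) * ((\<phi> x)\<^sup>2 * excess k \<tau> x)" for x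
          using True by (simp add: flux_def algebra_simps)
        ultimately show ?thesis by (simp only:)
      qed
      have "(LINT x|lborel. flux s t (\<tau>, x)) = (LINT x|lborel. 2 * (W (\<tau>, x) * ((\<phi> x)\<^sup>2 * excess k \<tau> x)) - (2 * height_rate \<tau>) * ((\<phi> x)\<^sup>2 * excess k \<tau> x))"
        by (intro Bochner_Integration.integral_cong refl) (use True in \<open>simp add: flux_def algebra_simps\<close>)
      also have "\<dots> = 2 * q - 2 * height_rate \<tau> * p"
        unfolding q_def p_def using iW ip by (subst Bochner_Integration.integral_diff) auto
      finally show ?thesis .
    qed
    have rem: "ennreal (2 * Lam * (2 - \<alpha>) * c) \<le> remainder \<rho> r' \<tau> + ennreal (2 * height_rate \<tau> * p)"
    proof -
      let ?D = "\<integral>\<^sup>+x. ennreal ((excess k \<tau> x)\<^sup>2) * indicator (ball x0 \<rho>) x \<partial>lborel"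
      let ?S = "\<integral>\<^sup>+y. ennreal (excess k \<tau> y) * indicator (ball x0 r' - ball x0 \<rho>) y \<partial>lborel"
      let ?T = "\<integral>\<^sup>+y. ennreal (excess k \<tau> y * riesz_kernel \<alpha> (x0 - y)) * indicator (- ball x0 r') y \<partial>lborel"
      let ?K = "lipschitz_const DIM('a) * L powr \<alpha> / (\<alpha> * (2 - \<alpha>))"
      have ce: "ennreal c \<le> 2 * (ennreal ?K * ?D) + 2 * (ennreal p * (ennreal (8 ^ (DIM('a) + 2)) * ?T + ennreal ((\<rho> - \<sigma>) powr (- (DIM('a) + \<alpha>))) * ?S))"
      proof -
        have "ennreal c = cross_energy \<alpha> \<phi> (excess k \<tau>)" unfolding c_def using fin(2) by (simp add: less_top)
        also have "\<dots> \<le> 2 * (ennreal ?K * ?D) + 2 * (ennreal p * (ennreal ((1 / (1/8)) ^ (DIM('a) + 2)) * ?T + ennreal ((\<rho> - \<sigma>) powr (- (DIM('a) + \<alpha>))) * ?S))"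
          unfolding np[symmetric]
          by (rule cross_energy_bound[OF \<phi> L \<alpha> excess_measurable' excess_nonneg r(1,2), where \<kappa>="1/8"]) (use r in auto)
        finally show ?thesis by simp
      qed
      have T: "?T \<le> outer_tail \<tau>"
        unfolding outer_tail_def
      proof (rule nn_integral_mono)
        fix y
        have "excess k \<tau> y * riesz_kernel \<alpha> (x0 - y) \<le> max (U (\<tau>, y)) 0 * riesz_kernel \<alpha> (x0 - y)"
          using excess_le[OF k] by (intro mult_right_mono) auto
        then show "ennreal (excess k \<tau> y * riesz_kernel \<alpha> (x0 - y)) * indicator (- ball x0 r') y \<le> ennreal (max (U (\<tau>, y)) 0 * riesz_kernel \<alpha> (x0 - y)) * indicator (- ball x0 (3 * R / 4)) y"
          using r by (cases "y \<in> ball x0 r'") (auto intro: ennreal_leI)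
      qed
      let ?A = "2 * Lam * (2 - \<alpha>)"
      have A: "0 \<le> ?A" using lam \<alpha> by simp
      have "ennreal (?A * c) = ennreal ?A * ennreal c" using A by (simp add: ennreal_mult c_def)
      also have "\<dots> \<le> ennreal ?A * (2 * (ennreal ?K * ?D) + 2 * (ennreal p * (ennreal (8 ^ (DIM('a) + 2)) * outer_tail \<tau> + ennreal ((\<rho> - \<sigma>) powr (- (DIM('a) + \<alpha>))) * ?S)))"
        by (intro mult_left_mono order_trans[OF ce] add_mono order_refl T) auto
      also have "\<dots> = (ennreal ?A * 2 * ennreal ?K) * ?D + (ennreal ?A * 2 * ennreal ((\<rho> - \<sigma>) powr (- (DIM('a) + \<alpha>)))) * (ennreal p * ?S)
          + 2 * (ennreal p * (ennreal ?A * ennreal (8 ^ (DIM('a) + 2)) * outer_tail \<tau>))"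
        by (rule remainder_arith)
      also have "ennreal ?A * 2 * ennreal ?K = ennreal (4 * Lam * (lipschitz_const DIM('a) * L powr \<alpha> / \<alpha>))"
      proof -
        have "0 \<le> ?K" using \<alpha> lipschitz_const_pos[of "DIM('a)"] by simp
        then have "ennreal ?A * 2 * ennreal ?K = ennreal (?A * 2 * ?K)" by (rule ennreal_mult_two[OF A])
        also have "?A * 2 * ?K = 4 * Lam * (lipschitz_const DIM('a) * L powr \<alpha> / \<alpha>)" using \<alpha> by (simp add: field_simps)
        finally show ?thesis .
      qed
      also have "ennreal ?A * 2 * ennreal ((\<rho> - \<sigma>) powr (- (DIM('a) + \<alpha>))) = ennreal (4 * Lam * (2 - \<alpha>) * (\<rho> - \<sigma>) powr (- (DIM('a) + \<alpha>)))"
      proof -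
        have "ennreal ?A * 2 * ennreal ((\<rho> - \<sigma>) powr (- (DIM('a) + \<alpha>))) = ennreal (?A * 2 * (\<rho> - \<sigma>) powr (- (DIM('a) + \<alpha>)))"
          by (rule ennreal_mult_two[OF A]) simp
        moreover have "?A * 2 = 4 * Lam * (2 - \<alpha>)" by simp
        ultimately show ?thesis by (simp only:)
      qed
      also have "ennreal ?A * ennreal (8 ^ (DIM('a) + 2)) * outer_tail \<tau> = ennreal (height_rate \<tau>)"
      proof -
        have "outer_tail \<tau> = ennreal (enn2real (outer_tail \<tau>))" using elim \<tau> by (simp add: less_top)
        then have "ennreal ?A * ennreal (8 ^ (DIM('a) + 2)) * outer_tail \<tau> = ennreal ?A * ennreal (8 ^ (DIM('a) + 2)) * ennreal (enn2real (outer_tail \<tau>))"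
          by (rule arg_cong)
        also have "\<dots> = ennreal (?A * 8 ^ (DIM('a) + 2) * enn2real (outer_tail \<tau>))"
          by (rule ennreal_mult3[OF A]) auto
        finally have "ennreal ?A * ennreal (8 ^ (DIM('a) + 2)) * outer_tail \<tau> = \<dots>" .
        then show ?thesis using \<tau> by (simp add: height_rate_def height_coeff_def)
      qed
      also have "2 * (ennreal p * ennreal (height_rate \<tau>)) = ennreal (2 * height_rate \<tau> * p)"
        using p0 height_rate_nonneg[of \<tau>] by (simp add: ennreal_mult mult_ac)
      finally show ?thesis unfolding remainder_def np .
    qed
    let ?G = "2 * q - 2 * height_rate \<tau> * p"
    have e0: "0 \<le> e" by (simp add: e_def)
    have ge: "gagliardo \<alpha> (\<lambda>x. \<phi> x * excess k \<tau> x) = ennreal ((2 - \<alpha>) * e)"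
      unfolding gagliardo_eq_sq_energy e_def using fin(1) \<alpha> by (simp add: ennreal_mult less_top)
    have "ennreal ?G + ennreal (2 * lam) * ennreal ((2 - \<alpha>) * e) \<le> ennreal (- ?G) + remainder \<rho> r' \<tau>"
    proof (cases "remainder \<rho> r' \<tau>")
      case (real B)
      have "2 * Lam * (2 - \<alpha>) * c \<le> B + 2 * height_rate \<tau> * p"
        using rem p0 height_rate_nonneg[of \<tau>] unfolding real(2) by (simp add: real(1) ennreal_le_iff flip: ennreal_plus)
      then have le: "?G + 2 * lam * ((2 - \<alpha>) * e) \<le> B" using q by (simp add: algebra_simps)
      have le2: "max ?G 0 + 2 * lam * ((2 - \<alpha>) * e) \<le> max (- ?G) 0 + B" using le by (auto simp: max_def)
      have mx: "ennreal y = ennreal (max y 0)" for y by (simp add: max_def ennreal_neg)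
      have n1: "0 \<le> 2 * lam * ((2 - \<alpha>) * e)" using lam \<alpha> e0 by simp
      have "ennreal ?G + ennreal (2 * lam) * ennreal ((2 - \<alpha>) * e) = ennreal (max ?G 0) + ennreal (2 * lam * ((2 - \<alpha>) * e))"
      proof -
        have "ennreal (2 * lam) * ennreal ((2 - \<alpha>) * e) = ennreal (2 * lam * ((2 - \<alpha>) * e))"
          using lam \<alpha> e0 by (intro ennreal_mult[symmetric]) auto
        moreover have "ennreal ?G = ennreal (max ?G 0)" by (rule mx)
        ultimately show ?thesis by (simp only:)
      qed
      also have "\<dots> = ennreal (max ?G 0 + 2 * lam * ((2 - \<alpha>) * e))"
        by (rule ennreal_plus[symmetric, OF _ n1]) simp
      also have "\<dots> \<le> ennreal (max (- ?G) 0 + B)" by (rule ennreal_leI[OF le2])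
      also have "\<dots> = ennreal (- ?G) + ennreal B"
      proof -
        have "ennreal (max (- ?G) 0 + B) = ennreal (max (- ?G) 0) + ennreal B" by (rule ennreal_plus[OF _ real(1)]) simp
        moreover have "ennreal (- ?G) = ennreal (max (- ?G) 0)" by (rule mx)
        ultimately show ?thesis by (simp only:)
      qed
      finally show ?thesis unfolding real(2) .
    qed simp
    moreover have "indicator {s..<t} \<tau> = (1 :: ennreal)" using True by simp
    ultimately show ?thesis by (simp only: \<Gamma> ge mult_1_right)
  qed
qed

text \<open>The energy inequality for all times \<open>s < t\<close>, and not only for almost all of them, since for almost every \<open>x\<close> the
increment of the squared excess is controlled at all times. Integrating that increment over \<open>x\<close> and the equation over
time, Fubini identifies the two integrals of the flux.\<close>

lemma excess_evolution:
  assumes st: "a \<le> s" "s < t" "t \<le> b" and r: "\<sigma> < \<rho>" "\<rho> \<le> r'" "3 * R / 4 \<le> r'" "r' \<le> R" "8 * \<sigma> \<le> 7 * r'"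
  shows "(\<integral>\<^sup>+x. ennreal ((\<phi> x * excess k t x)\<^sup>2) \<partial>lborel) + ennreal (2 * lam) * (\<integral>\<^sup>+\<tau>\<in>{s..<t}. gagliardo \<alpha> (\<lambda>x. \<phi> x * excess k \<tau> x) \<partial>lborel)
    \<le> (\<integral>\<^sup>+x. ennreal ((\<phi> x * excess k s x)\<^sup>2) \<partial>lborel) + (\<integral>\<^sup>+\<tau>\<in>{s..<t}. remainder \<rho> r' \<tau> \<partial>lborel)"
proof -
  note fi = flux_integrable[OF st(1,3)]
  define D where "D x = (LINT \<tau>|lborel. flux s t (\<tau>, x))" for x
  define \<Gamma> where "\<Gamma> \<tau> = (LINT x|lborel. flux s t (\<tau>, x))" for \<tau>
  have iD: "integrable lborel D" unfolding D_def
    using lborel_pair.integrable_snd[of "\<lambda>\<tau> x. flux s t (\<tau>, x)"] fi by simp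
  have i\<Gamma>: "integrable lborel \<Gamma>" unfolding \<Gamma>_def by (rule lborel_pair.integrable_fst'[OF fi])
  have eq: "(LINT x|lborel. D x) = (LINT \<tau>|lborel. \<Gamma> \<tau>)" unfolding D_def \<Gamma>_def
    using lborel_pair.Fubini_integral[of "\<lambda>\<tau> x. flux s t (\<tau>, x)"] fi by simp
  have [measurable]: "D \<in> borel_measurable borel" "\<Gamma> \<in> borel_measurable borel" using iD i\<Gamma> by auto
  note bal = nn_integral_pos_neg_balance[OF iD i\<Gamma> eq]
  let ?f = "\<lambda>t. \<integral>\<^sup>+x. ennreal ((\<phi> x * excess k t x)\<^sup>2) \<partial>lborel"
  let ?E = "\<integral>\<^sup>+\<tau>. gagliardo \<alpha> (\<lambda>x. \<phi> x * excess k \<tau> x) * indicator {s..<t} \<tau> \<partial>lborel"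
  let ?R = "\<integral>\<^sup>+\<tau>. remainder \<rho> r' \<tau> * indicator {s..<t} \<tau> \<partial>lborel"
  have 1: "?f t + (\<integral>\<^sup>+x. ennreal (- D x) \<partial>lborel) \<le> ?f s + (\<integral>\<^sup>+x. ennreal (D x) \<partial>lborel)"
  proof -
    have "?f t + (\<integral>\<^sup>+x. ennreal (- D x) \<partial>lborel) = (\<integral>\<^sup>+x. ennreal ((\<phi> x * excess k t x)\<^sup>2) + ennreal (- D x) \<partial>lborel)"
      by (rule nn_integral_add[symmetric]) measurable
    also have "\<dots> \<le> (\<integral>\<^sup>+x. ennreal ((\<phi> x * excess k s x)\<^sup>2) + ennreal (D x) \<partial>lborel)"
    proof (rule nn_integral_mono_AE)
      show "AE x in lborel. ennreal ((\<phi> x * excess k t x)\<^sup>2) + ennreal (- D x) \<le> ennreal ((\<phi> x * excess k s x)\<^sup>2) + ennreal (D x)"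
        using excess_sq_increment[OF st]
      proof eventually_elim
        case (elim x)
        then have le: "(\<phi> x * excess k t x)\<^sup>2 + max (- D x) 0 \<le> (\<phi> x * excess k s x)\<^sup>2 + max (D x) 0"
          by (auto simp: D_def max_def)
        have mx: "ennreal y = ennreal (max y 0)" for y by (simp add: max_def ennreal_neg)
        show ?case unfolding mx[of "D x"] mx[of "- D x"] using ennreal_leI[OF le]
          by (simp add: ennreal_plus[symmetric] del: ennreal_plus)
      qed
    qed
    also have "\<dots> = ?f s + (\<integral>\<^sup>+x. ennreal (D x) \<partial>lborel)"
      by (rule nn_integral_add) measurable
    finally show ?thesis .
  qed
  have 2: "(\<integral>\<^sup>+\<tau>. ennreal (\<Gamma> \<tau>) \<partial>lborel) + ennreal (2 * lam) * ?E \<le> (\<integral>\<^sup>+\<tau>. ennreal (- \<Gamma> \<tau>) \<partial>lborel) + ?R"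
  proof -
    have "(\<integral>\<^sup>+\<tau>. ennreal (\<Gamma> \<tau>) \<partial>lborel) + ennreal (2 * lam) * ?E = (\<integral>\<^sup>+\<tau>. ennreal (\<Gamma> \<tau>) + ennreal (2 * lam) * (gagliardo \<alpha> (\<lambda>x. \<phi> x * excess k \<tau> x) * indicator {s..<t} \<tau>) \<partial>lborel)"
      by (simp add: nn_integral_add nn_integral_cmult)
    also have "\<dots> \<le> (\<integral>\<^sup>+\<tau>. ennreal (- \<Gamma> \<tau>) + remainder \<rho> r' \<tau> * indicator {s..<t} \<tau> \<partial>lborel)"
      unfolding \<Gamma>_def by (rule nn_integral_mono_AE[OF flux_energy_bound[OF st r]])
    also have "\<dots> = (\<integral>\<^sup>+\<tau>. ennreal (- \<Gamma> \<tau>) \<partial>lborel) + ?R" by (simp add: nn_integral_add)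
    finally show ?thesis .
  qed
  let ?dm = "\<integral>\<^sup>+x. ennreal (- D x) \<partial>lborel" and ?gm = "\<integral>\<^sup>+\<tau>. ennreal (- \<Gamma> \<tau>) \<partial>lborel"
  have "?dm + ?gm + (?f t + ennreal (2 * lam) * ?E) = (?f t + ?dm) + ?gm + ennreal (2 * lam) * ?E" by (simp add: add_ac)
  also have "\<dots> \<le> (?f s + (\<integral>\<^sup>+x. ennreal (D x) \<partial>lborel)) + ?gm + ennreal (2 * lam) * ?E"
    by (intro add_right_mono 1)
  also have "\<dots> = ?f s + ((\<integral>\<^sup>+x. ennreal (D x) \<partial>lborel) + ?gm) + ennreal (2 * lam) * ?E" by (simp add: add_ac)
  also have "\<dots> = ?f s + ?dm + ((\<integral>\<^sup>+\<tau>. ennreal (\<Gamma> \<tau>) \<partial>lborel) + ennreal (2 * lam) * ?E)" unfolding bal(1) by (simp add: add_ac)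
  also have "\<dots> \<le> ?f s + ?dm + (?gm + ?R)" by (intro add_left_mono 2)
  also have "\<dots> = ?dm + ?gm + (?f s + ?R)" by (simp add: add_ac)
  finally have "?dm + ?gm + (?f t + ennreal (2 * lam) * ?E) \<le> ?dm + ?gm + (?f s + ?R)" .
  (* the negative parts are finite, so they can be subtracted *)
  moreover have "?dm + ?gm \<noteq> \<infinity>" using bal(2,3) by (simp add: less_top)
  ultimately show ?thesis by (simp add: ennreal_add_left_cancel_le)
qed

end

end

section \<open>The Caccioppoli inequality\<close>

definition bump_fun :: "'a::euclidean_space \<Rightarrow> real \<Rightarrow> real \<Rightarrow> 'a \<Rightarrow> real" where
  "bump_fun x0 \<rho> \<sigma> x = max 0 (min 1 ((\<sigma> - norm (x - x0)) / (\<sigma> - \<rho>)))"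

lemma bump_fun_cutoff:
  assumes "\<rho> < \<sigma>" shows "cutoff x0 \<sigma> (1 / (\<sigma> - \<rho>)) (bump_fun x0 \<rho> \<sigma>)"
  unfolding cutoff_def
proof (intro conjI allI impI)
  fix x y
  have clip: "\<bar>max 0 (min 1 s) - max 0 (min 1 t)\<bar> \<le> \<bar>s - t\<bar>" for s t :: real by (auto simp: max_def min_def)
  have "\<bar>bump_fun x0 \<rho> \<sigma> x - bump_fun x0 \<rho> \<sigma> y\<bar> \<le> \<bar>(\<sigma> - norm (x - x0)) / (\<sigma> - \<rho>) - (\<sigma> - norm (y - x0)) / (\<sigma> - \<rho>)\<bar>"
    unfolding bump_fun_def by (rule clip)
  also have "\<dots> = \<bar>norm (y - x0) - norm (x - x0)\<bar> / (\<sigma> - \<rho>)"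
    using assms by (simp add: diff_divide_distrib[symmetric] abs_divide)
  also have "\<dots> \<le> norm (x - y) / (\<sigma> - \<rho>)"
    using norm_triangle_ineq3[of "y - x0" "x - x0"] assms by (intro divide_right_mono) (auto simp: norm_minus_commute)
  finally show "\<bar>bump_fun x0 \<rho> \<sigma> x - bump_fun x0 \<rho> \<sigma> y\<bar> \<le> 1 / (\<sigma> - \<rho>) * norm (x - y)" by simp
next
  fix x assume "x \<notin> ball x0 \<sigma>"
  then have "\<sigma> - norm (x - x0) \<le> 0" by (simp add: dist_norm norm_minus_commute)
  then have "(\<sigma> - norm (x - x0)) / (\<sigma> - \<rho>) \<le> 0" using assms by (simp add: divide_le_0_iff)
  then show "bump_fun x0 \<rho> \<sigma> x = 0" by (simp add: bump_fun_def)
qed (auto simp: bump_fun_def)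

lemma bump_fun_eq_1:
  assumes "\<rho> < \<sigma>" "x \<in> ball x0 \<rho>" shows "bump_fun x0 \<rho> \<sigma> x = 1"
proof -
  have "1 \<le> (\<sigma> - norm (x - x0)) / (\<sigma> - \<rho>)"
    using assms by (simp add: dist_norm norm_minus_commute)
  then show ?thesis by (simp add: bump_fun_def)
qed

definition fk_const :: "nat \<Rightarrow> real \<Rightarrow> real \<Rightarrow> real" where
  "fk_const d \<alpha> m = 8 / unit_ball_vol (real d) * (2 * m / unit_ball_vol (real d)) powr (\<alpha> / real d)"

text \<open>By Chebyshev's inequality the function exceeds \<open>\<delta>\<close> on a set of measure at most \<open>V / \<delta>\<^sup>2\<close>, to which the
Faber-Krahn inequality applies. The factor is a positive power of \<open>V\<close>: this is the gain that drives
De Giorgi's iteration.\<close>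

lemma level_set_energy:
  fixes f :: "'a::euclidean_space \<Rightarrow> real" and \<alpha> V \<delta> :: real
  assumes f[measurable]: "f \<in> borel_measurable borel" and f0: "\<And>x. 0 \<le> f x"
    and \<alpha>: "0 < \<alpha>" "\<alpha> < 2" and V: "0 < V" "(\<integral>\<^sup>+x. ennreal ((f x)\<^sup>2) \<partial>lborel) \<le> ennreal V" and \<delta>: "0 < \<delta>"
  shows "(\<integral>\<^sup>+x. ennreal ((max (f x - \<delta>) 0)\<^sup>2) \<partial>lborel) \<le> ennreal (fk_const DIM('a) \<alpha> (V / \<delta>\<^sup>2)) * gagliardo \<alpha> f"
proof -
  let ?g = "\<lambda>x. max (f x - \<delta>) 0"
  have [measurable]: "{x. ?g x \<noteq> 0} \<in> sets borel" by measurable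
  have "ennreal (\<delta>\<^sup>2) * emeasure lborel {x. ?g x \<noteq> 0} = (\<integral>\<^sup>+x\<in>{x. ?g x \<noteq> 0}. ennreal (\<delta>\<^sup>2) \<partial>lborel)"
    by (simp add: nn_integral_cmult_indicator)
  also have "\<dots> \<le> (\<integral>\<^sup>+x. ennreal ((f x)\<^sup>2) \<partial>lborel)"
  proof (rule nn_integral_mono)
    fix x
    show "ennreal (\<delta>\<^sup>2) * indicator {x. ?g x \<noteq> 0} x \<le> ennreal ((f x)\<^sup>2)"
    proof (cases "?g x \<noteq> 0")
      case True
      then have "\<delta> \<le> f x" by (auto simp: max_def split: if_splits)
      then have "\<delta>\<^sup>2 \<le> (f x)\<^sup>2" using \<delta> by (intro power_mono) auto
      then show ?thesis using True by (simp add: ennreal_leI)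
    qed simp
  qed
  also have "\<dots> \<le> ennreal V" by (rule V(2))
  finally have *: "ennreal (\<delta>\<^sup>2) * emeasure lborel {x. ?g x \<noteq> 0} \<le> ennreal V" .
  have "emeasure lborel {x. ?g x \<noteq> 0} = ennreal (1 / \<delta>\<^sup>2) * (ennreal (\<delta>\<^sup>2) * emeasure lborel {x. ?g x \<noteq> 0})"
    using \<delta> by (simp add: mult.assoc[symmetric] ennreal_mult[symmetric])
  also have "\<dots> \<le> ennreal (1 / \<delta>\<^sup>2) * ennreal V" by (intro mult_left_mono *) simp
  also have "\<dots> = ennreal (V / \<delta>\<^sup>2)" using V by (simp add: ennreal_mult[symmetric])
  finally have m: "emeasure lborel {x. ?g x \<noteq> 0} \<le> ennreal (V / \<delta>\<^sup>2)" .
  have "(\<integral>\<^sup>+x. ennreal ((?g x)\<^sup>2) \<partial>lborel) \<le> ennreal (fk_const DIM('a) \<alpha> (V / \<delta>\<^sup>2)) * gagliardo \<alpha> ?g"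
    unfolding fk_const_def by (rule fractional_faber_krahn[OF _ \<alpha> _ m]) (use V \<delta> in auto)
  also have "gagliardo \<alpha> ?g \<le> gagliardo \<alpha> f"
    unfolding gagliardo_def
  proof (intro mult_left_mono nn_integral_mono ennreal_leI mult_right_mono)
    fix x y
    have "\<bar>?g x - ?g y\<bar> \<le> \<bar>f x - f y\<bar>" by (auto simp: max_def)
    then show "(?g x - ?g y)\<^sup>2 \<le> (f x - f y)\<^sup>2" by (rule abs_le_square_iff[THEN iffD1])
  qed auto
  finally show ?thesis by (simp add: mult_left_mono)
qed

context evolution
begin

lemma excess_mono: "k \<le> k' \<Longrightarrow> excess k' t x \<le> excess k t x"
  by (auto simp: excess_def)

lemma excess_level: "0 \<le> \<delta> \<Longrightarrow> excess (k + \<delta>) t x = max (excess k t x - \<delta>) 0"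
  by (auto simp: excess_def max_def)

text \<open>Averages \<open>excess_evolution\<close> over the starting times \<open>s\<close> in \<open>{\<theta>..<\<theta>'}\<close>, which replaces the value at time \<open>s\<close> by the
space-time integral divided by \<open>\<theta>' - \<theta>\<close>. The numbers \<open>D\<close>, \<open>D1\<close> and \<open>S\<close> bound the \<open>L\<^sup>2\<close> norm and
the \<open>L\<^sup>1\<close> norm of the excess on the cylinder, and its integral over the annulus at every time.\<close>

lemma caccioppoli:
  assumes k: "0 \<le> k" and \<sigma>: "0 < \<sigma>" and L: "0 < L" and \<phi>: "cutoff x0 \<sigma> L \<phi>"
    and r: "\<sigma> < \<rho>" "\<rho> \<le> r'" "3 * R / 4 \<le> r'" "r' \<le> R" "8 * \<sigma> \<le> 7 * r'"
    and \<theta>: "a \<le> \<theta>" "\<theta> < \<theta>'" "\<theta>' \<le> b"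
    and D: "0 \<le> D" "(\<integral>\<^sup>+\<tau>\<in>{\<theta>..<b}. (\<integral>\<^sup>+x\<in>ball x0 \<rho>. ennreal ((excess k \<tau> x)\<^sup>2) \<partial>lborel) \<partial>lborel) \<le> ennreal D"
    and D1: "0 \<le> D1" "(\<integral>\<^sup>+\<tau>\<in>{\<theta>..<b}. (\<integral>\<^sup>+x\<in>ball x0 \<rho>. ennreal (excess k \<tau> x) \<partial>lborel) \<partial>lborel) \<le> ennreal D1"
    and S: "0 \<le> S" "\<And>\<tau>. \<tau> \<in> {\<theta>..<b} \<Longrightarrow> (\<integral>\<^sup>+y\<in>ball x0 r' - ball x0 \<rho>. ennreal (excess k \<tau> y) \<partial>lborel) \<le> ennreal S"
    and X: "X = D / (\<theta>' - \<theta>) + 4 * Lam * (lipschitz_const DIM('a) * L powr \<alpha> / \<alpha>) * D + 4 * Lam * (2 - \<alpha>) * (\<rho> - \<sigma>) powr (- (real DIM('a) + \<alpha>)) * (S * D1)"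
  shows "t \<in> {\<theta>'..b} \<Longrightarrow> (\<integral>\<^sup>+x. ennreal ((\<phi> x * excess k t x)\<^sup>2) \<partial>lborel) \<le> ennreal X"
    "ennreal (2 * lam) * (\<integral>\<^sup>+\<tau>\<in>{\<theta>'..<b}. gagliardo \<alpha> (\<lambda>x. \<phi> x * excess k \<tau> x) \<partial>lborel) \<le> ennreal X"
proof -
  have \<sigma>R: "\<sigma> < R" using r by simp
  note [measurable] = cutoff_measurable[OF \<phi>] gagliardo_excess_measurable[OF k \<sigma> \<sigma>R L \<phi>] remainder_measurable[OF k \<sigma> \<sigma>R L \<phi>]
  define c1 where "c1 = 4 * Lam * (lipschitz_const DIM('a) * L powr \<alpha> / \<alpha>)"
  define c2 where "c2 = 4 * Lam * (2 - \<alpha>) * (\<rho> - \<sigma>) powr (- (real DIM('a) + \<alpha>))"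
  have c: "0 \<le> c1" "0 \<le> c2" using lam \<alpha> lipschitz_const_pos[of "DIM('a)"] by (auto simp: c1_def c2_def)
  have [measurable]: "ball x0 r' - ball x0 \<rho> \<in> sets borel" by auto
  let ?rem = "remainder k \<sigma> L \<phi> \<rho> r'"
  let ?f = "\<lambda>t. \<integral>\<^sup>+x. ennreal ((\<phi> x * excess k t x)\<^sup>2) \<partial>lborel"
  let ?g = "\<lambda>\<tau>. gagliardo \<alpha> (\<lambda>x. \<phi> x * excess k \<tau> x)"
  define Bd where "Bd = c1 * D + c2 * (S * D1)"
  have Bd: "0 \<le> Bd" using c D D1 S by (simp add: Bd_def)
  have \<phi>_le: "(\<phi> x)\<^sup>2 * e \<le> e" "x \<notin> ball x0 \<rho> \<Longrightarrow> \<phi> x = 0" if "0 \<le> e" for e x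
    using cutoffD(1,2)[OF \<phi>, of x] that cutoffD(4)[OF \<phi>, of x] r(1) by (auto simp: power_le_one intro!: mult_left_le_one_le)
  have rem_int: "(\<integral>\<^sup>+\<tau>\<in>{\<theta>..<b}. ?rem \<tau> \<partial>lborel) \<le> ennreal Bd"
  proof -
    let ?d = "\<lambda>\<tau>. \<integral>\<^sup>+x. ennreal ((excess k \<tau> x)\<^sup>2) * indicator (ball x0 \<rho>) x \<partial>lborel"
    let ?d1 = "\<lambda>\<tau>. \<integral>\<^sup>+x. ennreal (excess k \<tau> x) * indicator (ball x0 \<rho>) x \<partial>lborel"
    have "(\<integral>\<^sup>+\<tau>\<in>{\<theta>..<b}. ?rem \<tau> \<partial>lborel)
      \<le> (\<integral>\<^sup>+\<tau>. ennreal c1 * (?d \<tau> * indicator {\<theta>..<b} \<tau>) + ennreal c2 * ennreal S * (?d1 \<tau> * indicator {\<theta>..<b} \<tau>) \<partial>lborel)"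
    proof (rule nn_integral_mono)
      fix \<tau>
      show "?rem \<tau> * indicator {\<theta>..<b} \<tau> \<le> ennreal c1 * (?d \<tau> * indicator {\<theta>..<b} \<tau>) + ennreal c2 * ennreal S * (?d1 \<tau> * indicator {\<theta>..<b} \<tau>)"
      proof (cases "\<tau> \<in> {\<theta>..<b}")
        case True
        have "(\<integral>\<^sup>+x. ennreal ((\<phi> x)\<^sup>2 * excess k \<tau> x) \<partial>lborel) \<le> ?d1 \<tau>"
        proof (rule nn_integral_mono)
          fix x
          show "ennreal ((\<phi> x)\<^sup>2 * excess k \<tau> x) \<le> ennreal (excess k \<tau> x) * indicator (ball x0 \<rho>) x"
            using \<phi>_le[OF excess_nonneg[of k \<tau> x], of x] by (cases "x \<in> ball x0 \<rho>") (auto intro: ennreal_leI)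
        qed
        then have "(\<integral>\<^sup>+x. ennreal ((\<phi> x)\<^sup>2 * excess k \<tau> x) \<partial>lborel) * (\<integral>\<^sup>+y\<in>ball x0 r' - ball x0 \<rho>. ennreal (excess k \<tau> y) \<partial>lborel)
            \<le> ?d1 \<tau> * ennreal S"
          by (intro mult_mono S(2)[OF True]) auto
        then have "?rem \<tau> \<le> ennreal c1 * ?d \<tau> + ennreal c2 * (?d1 \<tau> * ennreal S)"
          unfolding remainder_def[OF k \<sigma> \<sigma>R L \<phi>] c1_def[symmetric] c2_def[symmetric]
          by (intro add_left_mono mult_left_mono) auto
        then show ?thesis using True by (simp add: mult_ac)
      qed simp
    qed
    also have "\<dots> = ennreal c1 * (\<integral>\<^sup>+\<tau>\<in>{\<theta>..<b}. ?d \<tau> \<partial>lborel) + ennreal c2 * ennreal S * (\<integral>\<^sup>+\<tau>\<in>{\<theta>..<b}. ?d1 \<tau> \<partial>lborel)"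
      by (simp add: nn_integral_add nn_integral_cmult)
    also have "\<dots> \<le> ennreal c1 * ennreal D + ennreal c2 * ennreal S * ennreal D1"
      by (intro add_mono mult_left_mono D D1) auto
    also have "\<dots> = ennreal Bd"
      using c D D1 S by (simp add: Bd_def ennreal_mult[symmetric] ennreal_plus[symmetric] mult.assoc del: ennreal_plus)
    finally show ?thesis .
  qed
  have main: "?f t + ennreal (2 * lam) * (\<integral>\<^sup>+\<tau>\<in>{\<theta>'..<t}. ?g \<tau> \<partial>lborel) \<le> ennreal X" if t: "t \<in> {\<theta>'..b}" for t
  proof -
    (* does not depend on s, so that the average over s leaves it unchanged *)
    define Y where "Y = ?f t + ennreal (2 * lam) * (\<integral>\<^sup>+\<tau>\<in>{\<theta>'..<t}. ?g \<tau> \<partial>lborel)"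
    have le: "Y \<le> ?f s + ennreal Bd" if s: "s \<in> {\<theta>..<\<theta>'}" for s
    proof -
      have "Y \<le> ?f t + ennreal (2 * lam) * (\<integral>\<^sup>+\<tau>\<in>{s..<t}. ?g \<tau> \<partial>lborel)"
        unfolding Y_def using s by (intro add_left_mono mult_left_mono nn_integral_mono) (auto simp: indicator_def)
      also have "\<dots> \<le> ?f s + (\<integral>\<^sup>+\<tau>\<in>{s..<t}. ?rem \<tau> \<partial>lborel)"
        using s t \<theta> by (intro excess_evolution[OF k \<sigma> \<sigma>R L \<phi> _ _ _ r]) auto
      also have "(\<integral>\<^sup>+\<tau>\<in>{s..<t}. ?rem \<tau> \<partial>lborel) \<le> (\<integral>\<^sup>+\<tau>\<in>{\<theta>..<b}. ?rem \<tau> \<partial>lborel)"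
        using s t by (intro nn_integral_mono mult_left_mono) (auto simp: indicator_def)
      also have "\<dots> \<le> ennreal Bd" by (rule rem_int)
      finally show ?thesis by (simp add: add_left_mono)
    qed
    have "ennreal (\<theta>' - \<theta>) * Y = (\<integral>\<^sup>+s\<in>{\<theta>..<\<theta>'}. Y \<partial>lborel)"
      using \<theta> by (simp add: nn_integral_cmult_indicator mult.commute)
    also have "\<dots> \<le> (\<integral>\<^sup>+s. (\<integral>\<^sup>+x\<in>ball x0 \<rho>. ennreal ((excess k s x)\<^sup>2) \<partial>lborel) * indicator {\<theta>..<b} s + ennreal Bd * indicator {\<theta>..<\<theta>'} s \<partial>lborel)"
    proof (rule nn_integral_mono)
      fix s
      show "Y * indicator {\<theta>..<\<theta>'} s \<le> (\<integral>\<^sup>+x\<in>ball x0 \<rho>. ennreal ((excess k s x)\<^sup>2) \<partial>lborel) * indicator {\<theta>..<b} s + ennreal Bd * indicator {\<theta>..<\<theta>'} s"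
      proof (cases "s \<in> {\<theta>..<\<theta>'}")
        case True
        have "?f s \<le> (\<integral>\<^sup>+x\<in>ball x0 \<rho>. ennreal ((excess k s x)\<^sup>2) \<partial>lborel)"
        proof (rule nn_integral_mono)
          fix x
          show "ennreal ((\<phi> x * excess k s x)\<^sup>2) \<le> ennreal ((excess k s x)\<^sup>2) * indicator (ball x0 \<rho>) x"
            using \<phi>_le[of "(excess k s x)\<^sup>2" x] by (cases "x \<in> ball x0 \<rho>") (auto simp: power_mult_distrib intro: ennreal_leI)
        qed
        then have "Y \<le> (\<integral>\<^sup>+x\<in>ball x0 \<rho>. ennreal ((excess k s x)\<^sup>2) \<partial>lborel) + ennreal Bd"
          using le[OF True] by (meson add_right_mono order_trans)
        then show ?thesis using True \<theta> by simp
      qed simp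
    qed
    also have "\<dots> = (\<integral>\<^sup>+s\<in>{\<theta>..<b}. (\<integral>\<^sup>+x\<in>ball x0 \<rho>. ennreal ((excess k s x)\<^sup>2) \<partial>lborel) \<partial>lborel) + ennreal Bd * ennreal (\<theta>' - \<theta>)"
      using \<theta> by (subst nn_integral_add) (auto simp: nn_integral_cmult_indicator)
    also have "\<dots> \<le> ennreal D + ennreal Bd * ennreal (\<theta>' - \<theta>)" by (intro add_right_mono D)
    finally have *: "ennreal (\<theta>' - \<theta>) * Y \<le> ennreal D + ennreal Bd * ennreal (\<theta>' - \<theta>)" .
    have "Y = ennreal (1 / (\<theta>' - \<theta>)) * (ennreal (\<theta>' - \<theta>) * Y)"
      using \<theta> by (simp add: mult.assoc[symmetric] ennreal_mult[symmetric])
    also have "\<dots> \<le> ennreal (1 / (\<theta>' - \<theta>)) * (ennreal D + ennreal Bd * ennreal (\<theta>' - \<theta>))" by (intro mult_left_mono *) simp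
    also have "\<dots> = ennreal (1 / (\<theta>' - \<theta>) * (D + Bd * (\<theta>' - \<theta>)))"
    proof -
      have "ennreal D + ennreal Bd * ennreal (\<theta>' - \<theta>) = ennreal (D + Bd * (\<theta>' - \<theta>))"
        using \<theta> D Bd by (simp add: ennreal_mult[symmetric] ennreal_plus[symmetric] del: ennreal_plus)
      then show ?thesis using \<theta> D Bd by (simp only:) (intro ennreal_mult[symmetric], auto)
    qed
    also have "1 / (\<theta>' - \<theta>) * (D + Bd * (\<theta>' - \<theta>)) = X"
      unfolding X Bd_def c1_def[symmetric] c2_def[symmetric] using \<theta> by (simp add: field_simps)
    finally show ?thesis unfolding Y_def .
  qed
  show "t \<in> {\<theta>'..b} \<Longrightarrow> ?f t \<le> ennreal X"
    using main[of t] by (meson le_iff_add order_trans)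
  show "ennreal (2 * lam) * (\<integral>\<^sup>+\<tau>\<in>{\<theta>'..<b}. ?g \<tau> \<partial>lborel) \<le> ennreal X"
    using main[of b] \<theta> by (intro order_trans[OF _ main[of b]]) (auto simp: add_increasing)
qed

end

section \<open>Constants of the iteration\<close>

text \<open>Collects the three terms of \<open>caccioppoli\<close> at step \<open>j\<close>, for a time step \<open>half_gap / (2 * 2 ^ j)\<close>, a cutoff of slope
\<open>32 * 2 ^ j / R\<close> and balls at distance \<open>3 * R / (32 * 2 ^ j)\<close>; each of them grows at most by the factor
\<open>2 ^ (d + 3)\<close> per step. The last factor makes the constant serve both the \<open>L\<^sup>2\<close> term and the energy, which comes
with the factor \<open>2 * lam\<close>.\<close>

definition iter_const :: "nat \<Rightarrow> real \<Rightarrow> real \<Rightarrow> real \<Rightarrow> real" where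
  "iter_const d \<alpha>0 lam Lam = (16 / \<alpha>0 + 4096 * Lam * lipschitz_const d / \<alpha>0
     + 32 * Lam * 16 ^ (d + 2) * (unit_ball_vol (real d) + 1)) * (1 + 1 / (2 * lam))"

text \<open>The same for the first step, where the cutoff has slope \<open>8 / R\<close> and there is no annulus.\<close>

definition start_const :: "nat \<Rightarrow> real \<Rightarrow> real \<Rightarrow> real \<Rightarrow> real" where
  "start_const d \<alpha>0 lam Lam = (8 / \<alpha>0 + 256 * Lam * lipschitz_const d / \<alpha>0) * (1 + 1 / (2 * lam))"

text \<open>The rate \<open>q\<close> of geometric decay. It solves \<open>(4 q) powr (\<alpha>0 / d) = 1 / 2 ^ (d + 3)\<close>: the gain of \<open>level_set_energy\<close> at step \<open>j\<close>
then beats the growth \<open>(2 ^ (d + 3)) ^ j\<close> of the constants. The \<open>4\<close> accounts for the halving of the level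
increments.\<close>

definition ratio_const :: "nat \<Rightarrow> real \<Rightarrow> real" where
  "ratio_const d \<alpha>0 = 1 / 4 * (2 ^ (d + 3)) powr (- (real d / \<alpha>0))"

text \<open>How small the initial energy must be, relative to \<open>M\<^sup>2 R^d\<close>, for the decay to start and to continue.\<close>

definition small_const :: "nat \<Rightarrow> real \<Rightarrow> real \<Rightarrow> real \<Rightarrow> real" where
  "small_const d \<alpha>0 lam Lam = min 1 (unit_ball_vol (real d) / 32
     * min 1 ((ratio_const d \<alpha>0 * unit_ball_vol (real d) / (8 * iter_const d \<alpha>0 lam Lam)) powr (real d / \<alpha>0)))"

lemma const_pos:
  assumes "0 < \<alpha>0" "0 < lam" "0 < Lam"
  shows "0 < iter_const d \<alpha>0 lam Lam" "0 < start_const d \<alpha>0 lam Lam" "0 < ratio_const d \<alpha>0"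
    "ratio_const d \<alpha>0 < 1" "0 < small_const d \<alpha>0 lam Lam"
proof -
  have l: "0 < lipschitz_const d" by (rule lipschitz_const_pos)
  show 1: "0 < iter_const d \<alpha>0 lam Lam" unfolding iter_const_def using assms l
    by (intro mult_pos_pos add_pos_nonneg add_nonneg_nonneg) auto
  show "0 < start_const d \<alpha>0 lam Lam" unfolding start_const_def using assms l
    by (intro mult_pos_pos add_pos_nonneg) auto
  show 2: "0 < ratio_const d \<alpha>0" by (simp add: ratio_const_def)
  have "((2::real) ^ (d + 3)) powr (- (real d / \<alpha>0)) \<le> 1"
  proof -
    have "((2::real) ^ (d + 3)) powr (- (real d / \<alpha>0)) \<le> 1 powr (- (real d / \<alpha>0))"
      using assms by (intro powr_mono_base_neg) auto
    then show ?thesis by simp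
  qed
  then show "ratio_const d \<alpha>0 < 1" by (simp add: ratio_const_def)
  show "0 < small_const d \<alpha>0 lam Lam" 
  proof -
    have u: "0 < unit_ball_vol (real d)" by simp
    then have "0 < ratio_const d \<alpha>0 * unit_ball_vol (real d) / (8 * iter_const d \<alpha>0 lam Lam)" using 1 2 by simp
    then have "0 < (ratio_const d \<alpha>0 * unit_ball_vol (real d) / (8 * iter_const d \<alpha>0 lam Lam)) powr (real d / \<alpha>0)"
      by (simp only: powr_gt_zero)
    with u show ?thesis unfolding small_const_def by (intro min_less_iff_conj[THEN iffD2] conjI mult_pos_pos) auto
  qed
qed

lemma mult_32_div: "0 < w \<Longrightarrow> e \<le> w / 32 * m \<Longrightarrow> 32 * e / w \<le> (m::real)"
  by (simp add: pos_divide_le_eq mult.commute)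

lemma powr_div_neg: "0 \<le> x \<Longrightarrow> 0 < r \<Longrightarrow> (x / r) powr e = x powr e * r powr (- e)" for x r e :: real
  by (simp add: powr_divide powr_minus_divide)

text \<open>The gain in step \<open>j\<close>: the squared \<open>L\<^sup>2\<close> norm is at most \<open>small_const * M\<^sup>2 * R ^ d * ratio_const ^ j\<close>, and the level is raised by
\<open>M / (4 * 2 ^ j)\<close> before the Faber-Krahn inequality is used. The exponent \<open>\<alpha> / d\<close> may be replaced by \<open>\<alpha>0 / d\<close> because the bases are at most \<open>1\<close>.\<close>

lemma fk_const_step:
  fixes \<alpha> \<alpha>0 M R lam Lam :: real and d :: nat
  assumes \<alpha>: "0 < \<alpha>0" "\<alpha>0 \<le> \<alpha>" and lam: "0 < lam" "0 < Lam" and M: "0 < M" and R: "0 < R" and d: "0 < d"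
  shows "fk_const d \<alpha> (small_const d \<alpha>0 lam Lam * M\<^sup>2 * R ^ d * ratio_const d \<alpha>0 ^ j / (M / (4 * 2 ^ j))\<^sup>2)
     \<le> ratio_const d \<alpha>0 / iter_const d \<alpha>0 lam Lam / (2 ^ (d + 3)) ^ j * R powr \<alpha>"
proof -
  define \<omega> where "\<omega> = unit_ball_vol (real d)"
  define q where "q = ratio_const d \<alpha>0"
  define \<epsilon> where "\<epsilon> = small_const d \<alpha>0 lam Lam"
  define C where "C = iter_const d \<alpha>0 lam Lam"
  define B where "B = (2::real) ^ (d + 3)"
  have \<omega>: "0 < \<omega>" by (simp add: \<omega>_def)
  have q: "0 < q" and \<epsilon>: "0 < \<epsilon>" and C: "0 < C" using const_pos[OF \<alpha>(1) lam] by (auto simp: q_def \<epsilon>_def C_def)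
  have B: "1 \<le> B" by (simp add: B_def)
  have base: "2 * (\<epsilon> * M\<^sup>2 * R ^ d * q ^ j / (M / (4 * 2 ^ j))\<^sup>2) / \<omega> = (32 * \<epsilon> / \<omega>) * (4 * q) ^ j * R ^ d"
    using M \<omega> by (simp add: power_divide power_mult_distrib power2_eq_square field_simps) (simp add: power_mult_distrib[symmetric])
  have e: "\<alpha>0 / real d \<le> \<alpha> / real d" using \<alpha> d by (simp add: divide_right_mono)
  have small: "32 * \<epsilon> / \<omega> \<le> 1" "32 * \<epsilon> / \<omega> \<le> (q * \<omega> / (8 * C)) powr (real d / \<alpha>0)"
  proof -
    have "\<epsilon> \<le> \<omega> / 32 * min 1 ((q * \<omega> / (8 * C)) powr (real d / \<alpha>0))"
      by (simp add: \<epsilon>_def small_const_def q_def \<omega>_def C_def)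
    then have "32 * \<epsilon> / \<omega> \<le> min 1 ((q * \<omega> / (8 * C)) powr (real d / \<alpha>0))"
      using mult_32_div[OF \<omega>] by blast
    then show "32 * \<epsilon> / \<omega> \<le> 1" "32 * \<epsilon> / \<omega> \<le> (q * \<omega> / (8 * C)) powr (real d / \<alpha>0)" by simp_all
  qed
  have s1: "(32 * \<epsilon> / \<omega>) powr (\<alpha> / real d) \<le> q * \<omega> / (8 * C)"
  proof -
    have "(32 * \<epsilon> / \<omega>) powr (\<alpha> / real d) \<le> (32 * \<epsilon> / \<omega>) powr (\<alpha>0 / real d)"
      using small(1) \<epsilon> \<omega> e by (intro powr_mono') auto
    also have "\<dots> \<le> ((q * \<omega> / (8 * C)) powr (real d / \<alpha>0)) powr (\<alpha>0 / real d)"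
      using small(2) \<epsilon> \<omega> \<alpha> d by (intro powr_mono2) auto
    also have "\<dots> = q * \<omega> / (8 * C)" using \<alpha> d q \<omega> C by (simp add: powr_powr)
    finally show ?thesis .
  qed
  have q4: "(4 * q) powr (\<alpha> / real d) \<le> 1 / B"
  proof -
    have q': "4 * q = B powr (- (real d / \<alpha>0))" by (simp add: q_def ratio_const_def B_def)
    have "4 * q \<le> 1" unfolding q' using B \<alpha> powr_mono_base_neg[of 1 B "real d / \<alpha>0"] by simp
    then have "(4 * q) powr (\<alpha> / real d) \<le> (4 * q) powr (\<alpha>0 / real d)" using q e by (intro powr_mono') auto
    also have "\<dots> = B powr (-1)" unfolding q' using \<alpha> d by (simp add: powr_powr)
    finally show ?thesis using B by (simp add: powr_minus field_simps)
  qed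
  have "fk_const d \<alpha> (\<epsilon> * M\<^sup>2 * R ^ d * q ^ j / (M / (4 * 2 ^ j))\<^sup>2) = 8 / \<omega> * ((32 * \<epsilon> / \<omega>) * (4 * q) ^ j * R ^ d) powr (\<alpha> / real d)"
    unfolding fk_const_def \<omega>_def[symmetric] base ..
  also have "((32 * \<epsilon> / \<omega>) * (4 * q) ^ j * R ^ d) powr (\<alpha> / real d) = (32 * \<epsilon> / \<omega>) powr (\<alpha> / real d) * ((4 * q) powr (\<alpha> / real d)) ^ j * R powr \<alpha>"
  proof -
    have "(R ^ d) powr (\<alpha> / real d) = R powr \<alpha>" using R d by (simp add: powr_realpow[symmetric] powr_powr)
    moreover have "((4 * q) ^ j) powr (\<alpha> / real d) = ((4 * q) powr (\<alpha> / real d)) ^ j"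
    proof -
      define z where "z = 4 * q"
      have z: "0 < z" using q by (simp add: z_def)
      then have "(z ^ j) powr (\<alpha> / real d) = (z powr (\<alpha> / real d)) ^ j"
        by (simp add: powr_realpow[symmetric] powr_powr mult.commute)
      then show ?thesis by (simp only: z_def)
    qed
    moreover have "((32 * \<epsilon> / \<omega>) * (4 * q) ^ j * R ^ d) powr (\<alpha> / real d) = (32 * \<epsilon> / \<omega>) powr (\<alpha> / real d) * ((4 * q) ^ j) powr (\<alpha> / real d) * (R ^ d) powr (\<alpha> / real d)"
    proof -
      have "0 \<le> 32 * \<epsilon> / \<omega>" "0 \<le> (4 * q) ^ j" "0 \<le> R ^ d" using \<epsilon> \<omega> q R by auto
      then show ?thesis by (simp only: powr_mult mult_nonneg_nonneg)
    qed
    ultimately show ?thesis by (simp only:)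
  qed
  also have "8 / \<omega> * ((32 * \<epsilon> / \<omega>) powr (\<alpha> / real d) * ((4 * q) powr (\<alpha> / real d)) ^ j * R powr \<alpha>)
      \<le> 8 / \<omega> * (q * \<omega> / (8 * C) * (1 / B) ^ j * R powr \<alpha>)"
    using s1 q4 \<omega> q C by (intro mult_left_mono mult_right_mono mult_mono power_mono) auto
  also have "\<dots> = q / C / B ^ j * R powr \<alpha>" using \<omega> C B by (simp add: power_one_over field_simps)
  finally show ?thesis by (simp add: q_def \<epsilon>_def C_def B_def)
qed

text \<open>\<open>1 - 2 powr (- \<alpha>)\<close> degenerates linearly as \<open>\<alpha>\<close> tends to \<open>0\<close>; hence the dependence of the constants on \<open>\<alpha>0\<close>.\<close>

lemma time_gap_bound:
  fixes R \<alpha> :: real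
  assumes "0 < R" "0 < \<alpha>" "\<alpha> < 2"
  shows "R powr \<alpha> * \<alpha> / 8 \<le> (R powr \<alpha> - (R / 2) powr \<alpha>) / 2"
proof -
  have "(R / 2) powr \<alpha> = R powr \<alpha> * 2 powr (- \<alpha>)" using assms by (simp add: powr_divide powr_minus field_simps)
  then have eq: "R powr \<alpha> - (R / 2) powr \<alpha> = R powr \<alpha> * (1 - 2 powr (- \<alpha>))" by (simp add: right_diff_distrib)
  have "R powr \<alpha> * \<alpha> / 8 = R powr \<alpha> * (\<alpha> / 4) / 2" by simp
  also have "\<dots> \<le> R powr \<alpha> * (1 - 2 powr (- \<alpha>)) / 2"
    using one_minus_two_powr_ge[of \<alpha>] assms by (intro divide_right_mono mult_left_mono) auto
  finally show ?thesis unfolding eq .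
qed

lemma caccioppoli_step_const:
  fixes \<alpha> \<alpha>0 M R lam Lam D g :: real and d j :: nat
  assumes \<alpha>: "0 < \<alpha>0" "\<alpha>0 \<le> \<alpha>" "\<alpha> < 2" and lam: "0 < lam" "0 < Lam" and M: "0 < M" and R: "0 < R" and D: "0 \<le> D"
    and g: "R powr \<alpha> * \<alpha> / 8 \<le> g"
  shows "D / (g / (2 * 2 ^ j)) + 4 * Lam * (lipschitz_const d * (32 * 2 ^ j / R) powr \<alpha> / \<alpha>) * D
     + 4 * Lam * (2 - \<alpha>) * (3 * R / (32 * 2 ^ j)) powr (- (real d + \<alpha>)) * (((unit_ball_vol (real d) + 1) * R ^ d * M) * (D / (M / (4 * 2 ^ j))))
     \<le> iter_const d \<alpha>0 lam Lam / (1 + 1 / (2 * lam)) * (2 ^ (d + 3)) ^ j * (R powr (- \<alpha>) * D)"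
proof -
  define \<omega> where "\<omega> = unit_ball_vol (real d)"
  have \<omega>: "0 < \<omega>" by (simp add: \<omega>_def)
  have l: "0 < lipschitz_const d" by (rule lipschitz_const_pos)
  define t where "t = (2::real) ^ j"
  have t: "1 \<le> t" by (simp add: t_def)
  have tB: "t \<le> (2 ^ (d + 3)) ^ j" "t\<^sup>2 \<le> (2 ^ (d + 3)) ^ j" "t ^ (d + 3) = (2 ^ (d + 3)) ^ j"
  proof -
    show *: "t ^ (d + 3) = (2 ^ (d + 3)) ^ j" by (simp add: t_def power_mult[symmetric] mult.commute)
    show "t \<le> (2 ^ (d + 3)) ^ j" unfolding *[symmetric] using t power_increasing[of 1 "d + 3" t] by simp
    show "t\<^sup>2 \<le> (2 ^ (d + 3)) ^ j" unfolding *[symmetric] using t by (intro power_increasing) auto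
  qed
  have Rp: "R powr \<alpha> * R powr (- \<alpha>) = 1" using R by (simp add: powr_minus)
  have Rpos: "0 < R powr \<alpha>" "0 < R powr (- \<alpha>)" using R by auto
  have gpos: "0 < g" 
  proof -
    have "0 < R powr \<alpha> * \<alpha> / 8" using \<alpha> R by simp
    then show ?thesis using g by linarith
  qed
  have ia: "1 / \<alpha> \<le> 1 / \<alpha>0" using \<alpha> by (simp add: frac_le)
  have 1: "D / (g / (2 * t)) \<le> 16 / \<alpha>0 * t * (R powr (- \<alpha>) * D)"
  proof -
    have "D / (g / (2 * t)) = 2 * t * D * (1 / g)" by simp
    also have "1 / g \<le> 8 / (R powr \<alpha> * \<alpha>)"
      using g gpos \<alpha> Rpos by (simp add: field_simps)
    also have "8 / (R powr \<alpha> * \<alpha>) = 8 * (1 / \<alpha>) * R powr (- \<alpha>)" using R by (simp add: powr_minus field_simps)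
    also have "\<dots> \<le> 8 * (1 / \<alpha>0) * R powr (- \<alpha>)" using ia by (intro mult_right_mono mult_left_mono) auto
    finally have "D / (g / (2 * t)) \<le> 2 * t * D * (8 * (1 / \<alpha>0) * R powr (- \<alpha>))"
      using t D by (simp add: mult_left_mono)
    then show ?thesis by (simp add: mult_ac)
  qed
  have 2: "4 * Lam * (lipschitz_const d * (32 * t / R) powr \<alpha> / \<alpha>) * D \<le> 4096 * Lam * lipschitz_const d / \<alpha>0 * t\<^sup>2 * (R powr (- \<alpha>) * D)"
  proof -
    have "(32 * t / R) powr \<alpha> = (32 * t) powr \<alpha> * R powr (- \<alpha>)"
      using R t by (simp add: powr_divide powr_minus field_simps)
    also have "(32 * t) powr \<alpha> \<le> (32 * t) powr (real 2)" using \<alpha> t by (intro powr_mono) auto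
    also have "(32 * t) powr (real 2) = 1024 * t\<^sup>2" using t by (subst powr_realpow) (auto simp: power_mult_distrib)
    finally have p: "(32 * t / R) powr \<alpha> \<le> 1024 * t\<^sup>2 * R powr (- \<alpha>)" by (simp add: mult_right_mono)
    have "4 * Lam * (lipschitz_const d * (32 * t / R) powr \<alpha> / \<alpha>) * D = 4 * Lam * lipschitz_const d * D * ((32 * t / R) powr \<alpha> * (1 / \<alpha>))" by simp
    also have "\<dots> \<le> 4 * Lam * lipschitz_const d * D * ((1024 * t\<^sup>2 * R powr (- \<alpha>)) * (1 / \<alpha>0))"
      using p ia lam l D \<alpha> by (intro mult_left_mono mult_mono) auto
    finally show ?thesis by (simp add: mult_ac)
  qed
  have 3: "4 * Lam * (2 - \<alpha>) * (3 * R / (32 * t)) powr (- (real d + \<alpha>)) * (((\<omega> + 1) * R ^ d * M) * (D / (M / (4 * t))))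
     \<le> 32 * Lam * 16 ^ (d + 2) * (\<omega> + 1) * t ^ (d + 3) * (R powr (- \<alpha>) * D)"
  proof -
    have "(3 * R / (32 * t)) powr (- (real d + \<alpha>)) = (32 / 3 * t / R) powr (real d + \<alpha>)"
    proof -
      have "32 / 3 * t / R = inverse (3 * R / (32 * t))" by simp
      then show ?thesis using R t by (simp only: powr_minus inverse_powr)
    qed
    also have "\<dots> = (32 / 3 * t) powr (real d + \<alpha>) * R powr (- (real d + \<alpha>))"
      using R t by (intro powr_div_neg) auto
    also have "(32 / 3 * t) powr (real d + \<alpha>) \<le> (16 * t) powr (real d + \<alpha>)" using t \<alpha> by (intro powr_mono2) auto
    also have "\<dots> \<le> (16 * t) powr (real (d + 2))" using \<alpha> t by (intro powr_mono) auto
    also have "\<dots> = (16 * t) ^ (d + 2)" using t by (intro powr_realpow) auto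
    also have "R powr (- (real d + \<alpha>)) = R powr (- \<alpha>) / R ^ d"
    proof -
      have "R powr (- (real d + \<alpha>)) = R powr (- \<alpha>) * R powr (- real d)" unfolding powr_add[symmetric] by (simp add: algebra_simps)
      also have "R powr (- real d) = 1 / R ^ d" using R by (simp add: powr_minus_divide powr_realpow)
      finally show ?thesis by simp
    qed
    finally have p: "(3 * R / (32 * t)) powr (- (real d + \<alpha>)) \<le> (16 * t) ^ (d + 2) * (R powr (- \<alpha>) / R ^ d)"
      using R by (simp add: mult_right_mono)
    have sd: "((\<omega> + 1) * R ^ d * M) * (D / (M / (4 * t))) = 4 * (\<omega> + 1) * R ^ d * t * D" using M t by (simp add: field_simps)
    have "4 * Lam * (2 - \<alpha>) * (3 * R / (32 * t)) powr (- (real d + \<alpha>)) * (4 * (\<omega> + 1) * R ^ d * t * D)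
      \<le> 4 * Lam * 2 * ((16 * t) ^ (d + 2) * (R powr (- \<alpha>) / R ^ d)) * (4 * (\<omega> + 1) * R ^ d * t * D)"
      using p \<alpha> lam \<omega> R t D by (intro mult_right_mono mult_mono) auto
    also have "\<dots> = 32 * Lam * 16 ^ (d + 2) * (\<omega> + 1) * t ^ (d + 3) * (R powr (- \<alpha>) * D)"
    proof -
      have "(16 * t) ^ (d + 2) * t = 16 ^ (d + 2) * t ^ (d + 3)" by (simp add: power_mult_distrib power_add power2_eq_square power3_eq_cube)
      moreover have "R ^ d / R ^ d = 1" using R by simp
      moreover have "4 * Lam * 2 * ((16 * t) ^ (d + 2) * (R powr (- \<alpha>) / R ^ d)) * (4 * (\<omega> + 1) * R ^ d * t * D)
         = 32 * Lam * (\<omega> + 1) * ((16 * t) ^ (d + 2) * t) * (R powr (- \<alpha>) * D) * (R ^ d / R ^ d)" by (simp add: mult_ac)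
      ultimately have "4 * Lam * 2 * ((16 * t) ^ (d + 2) * (R powr (- \<alpha>) / R ^ d)) * (4 * (\<omega> + 1) * R ^ d * t * D)
         = 32 * Lam * (\<omega> + 1) * (16 ^ (d + 2) * t ^ (d + 3)) * (R powr (- \<alpha>) * D) * 1" by (simp only:)
      then show ?thesis by (simp only: mult_ac mult_1_right)
    qed
    finally show ?thesis unfolding sd .
  qed
  have nn: "0 \<le> R powr (- \<alpha>) * D" using D by simp
  let ?B = "(2 ^ (d + 3)) ^ j :: real"
  have "16 / \<alpha>0 * t * (R powr (- \<alpha>) * D) \<le> 16 / \<alpha>0 * ?B * (R powr (- \<alpha>) * D)"
    using tB(1) \<alpha> nn by (intro mult_right_mono mult_left_mono) auto
  moreover have "4096 * Lam * lipschitz_const d / \<alpha>0 * t\<^sup>2 * (R powr (- \<alpha>) * D) \<le> 4096 * Lam * lipschitz_const d / \<alpha>0 * ?B * (R powr (- \<alpha>) * D)"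
    using tB(2) \<alpha> nn lam l by (intro mult_right_mono mult_left_mono) auto
  ultimately have "D / (g / (2 * t)) + 4 * Lam * (lipschitz_const d * (32 * t / R) powr \<alpha> / \<alpha>) * D
     + 4 * Lam * (2 - \<alpha>) * (3 * R / (32 * t)) powr (- (real d + \<alpha>)) * (((\<omega> + 1) * R ^ d * M) * (D / (M / (4 * t))))
     \<le> 16 / \<alpha>0 * ?B * (R powr (- \<alpha>) * D) + 4096 * Lam * lipschitz_const d / \<alpha>0 * ?B * (R powr (- \<alpha>) * D)
       + 32 * Lam * 16 ^ (d + 2) * (\<omega> + 1) * ?B * (R powr (- \<alpha>) * D)"
    using 1 2 3 unfolding tB(3) by linarith
  also have "\<dots> = (16 / \<alpha>0 + 4096 * Lam * lipschitz_const d / \<alpha>0 + 32 * Lam * 16 ^ (d + 2) * (\<omega> + 1)) * ?B * (R powr (- \<alpha>) * D)"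
    by (simp only: distrib_right)
  also have "16 / \<alpha>0 + 4096 * Lam * lipschitz_const d / \<alpha>0 + 32 * Lam * 16 ^ (d + 2) * (\<omega> + 1) = iter_const d \<alpha>0 lam Lam / (1 + 1 / (2 * lam))"
    unfolding iter_const_def \<omega>_def using lam by (simp add: add_pos_pos less_imp_neq[symmetric])
  finally show ?thesis unfolding t_def \<omega>_def .
qed

lemma caccioppoli_start_const:
  fixes \<alpha> \<alpha>0 R lam Lam D g :: real and d :: nat
  assumes \<alpha>: "0 < \<alpha>0" "\<alpha>0 \<le> \<alpha>" "\<alpha> < 2" and lam: "0 < lam" "0 < Lam" and R: "0 < R" and D: "0 \<le> D"
    and g: "R powr \<alpha> * \<alpha> / 8 \<le> g"
  shows "D / g + 4 * Lam * (lipschitz_const d * (8 / R) powr \<alpha> / \<alpha>) * D \<le> start_const d \<alpha>0 lam Lam / (1 + 1 / (2 * lam)) * (R powr (- \<alpha>) * D)"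
proof -
  have l: "0 < lipschitz_const d" by (rule lipschitz_const_pos)
  have Rpos: "0 < R powr \<alpha>" "0 < R powr (- \<alpha>)" using R by auto
  have gpos: "0 < g" 
  proof -
    have "0 < R powr \<alpha> * \<alpha> / 8" using \<alpha> R by simp
    then show ?thesis using g by linarith
  qed
  have ia: "1 / \<alpha> \<le> 1 / \<alpha>0" using \<alpha> by (simp add: frac_le)
  have 1: "D / g \<le> 8 / \<alpha>0 * (R powr (- \<alpha>) * D)"
  proof -
    have "1 / g \<le> 8 / (R powr \<alpha> * \<alpha>)" using g gpos \<alpha> Rpos by (simp add: field_simps)
    also have "8 / (R powr \<alpha> * \<alpha>) = 8 * (1 / \<alpha>) * R powr (- \<alpha>)" using R by (simp add: powr_minus field_simps)
    also have "\<dots> \<le> 8 * (1 / \<alpha>0) * R powr (- \<alpha>)" using ia by (intro mult_right_mono mult_left_mono) auto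
    finally have "D * (1 / g) \<le> D * (8 * (1 / \<alpha>0) * R powr (- \<alpha>))" using D by (intro mult_left_mono)
    then show ?thesis by (simp add: mult_ac)
  qed
  have 2: "4 * Lam * (lipschitz_const d * (8 / R) powr \<alpha> / \<alpha>) * D \<le> 256 * Lam * lipschitz_const d / \<alpha>0 * (R powr (- \<alpha>) * D)"
  proof -
    have "(8 / R) powr \<alpha> = 8 powr \<alpha> * R powr (- \<alpha>)" using R by (simp add: powr_divide powr_minus field_simps)
    also have "(8::real) powr \<alpha> \<le> 8 powr (real 2)" using \<alpha> by (intro powr_mono) auto
    also have "(8::real) powr (real 2) = 64" by (subst powr_realpow) auto
    finally have p: "(8 / R) powr \<alpha> \<le> 64 * R powr (- \<alpha>)" by (simp add: mult_right_mono)
    have "4 * Lam * (lipschitz_const d * (8 / R) powr \<alpha> / \<alpha>) * D = 4 * Lam * lipschitz_const d * D * ((8 / R) powr \<alpha> * (1 / \<alpha>))" by simp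
    also have "\<dots> \<le> 4 * Lam * lipschitz_const d * D * ((64 * R powr (- \<alpha>)) * (1 / \<alpha>0))"
      using p ia lam l D \<alpha> by (intro mult_left_mono mult_mono) auto
    finally show ?thesis by (simp add: mult_ac)
  qed
  have "D / g + 4 * Lam * (lipschitz_const d * (8 / R) powr \<alpha> / \<alpha>) * D \<le> (8 / \<alpha>0 + 256 * Lam * lipschitz_const d / \<alpha>0) * (R powr (- \<alpha>) * D)"
    using 1 2 by (simp add: distrib_right)
  also have "8 / \<alpha>0 + 256 * Lam * lipschitz_const d / \<alpha>0 = start_const d \<alpha>0 lam Lam / (1 + 1 / (2 * lam))"
    unfolding start_const_def using lam by (simp add: add_pos_pos less_imp_neq[symmetric])
  finally show ?thesis .
qed

lemma split_energy_bound:
  fixes G :: ennreal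
  assumes "0 < lam" "0 \<le> X" "X \<le> Y / (1 + 1 / (2 * lam))" "ennreal (2 * lam) * G \<le> ennreal X"
  shows "X \<le> Y" "G \<le> ennreal Y"
proof -
  have Y: "X * (1 + 1 / (2 * lam)) \<le> Y" using assms(1,3) by (simp add: pos_le_divide_eq add_pos_pos)
  have XX: "X * (1 + 1 / (2 * lam)) = X + X / (2 * lam)" by (simp add: distrib_left)
  have X2: "0 \<le> X / (2 * lam)" using assms by simp
  show "X \<le> Y" using Y XX X2 by linarith
  have "G = ennreal (1 / (2 * lam)) * (ennreal (2 * lam) * G)"
    using assms(1) by (simp add: mult.assoc[symmetric] ennreal_mult[symmetric])
  also have "\<dots> \<le> ennreal (1 / (2 * lam)) * ennreal X" by (intro mult_left_mono assms) simp
  also have "\<dots> = ennreal (X / (2 * lam))" using assms by (simp add: ennreal_mult[symmetric])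
  also have "\<dots> \<le> ennreal Y" using Y XX assms(2) by (intro ennreal_leI) linarith
  finally show "G \<le> ennreal Y" .
qed

section \<open>De Giorgi iteration\<close>

context evolution
begin

definition rad :: "nat \<Rightarrow> real" where "rad j = R / 2 + R / (4 * 2 ^ j)"

definition lev :: "real \<Rightarrow> nat \<Rightarrow> real" where "lev M j = M * (1 - 1 / 2 ^ j)"

text \<open>Half of the time between the two cylinders. The first half is spent on the step from the given \<open>L\<^sup>2\<close> norm to the first
energy bound, the second half on the iteration.\<close>

definition half_gap :: real where "half_gap = (R powr \<alpha> - (R / 2) powr \<alpha>) / 2"

definition start_time :: "nat \<Rightarrow> real" where "start_time j = b - ((R / 2) powr \<alpha> + half_gap / 2 ^ j)"

text \<open>The first cutoff is wider: its support may reach up to \<open>7 * R / 8\<close>, since the first step uses the whole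
ball of radius \<open>R\<close>. From then on the support of a cutoff lies strictly inside the ball on which the previous
cutoff is \<open>1\<close>.\<close>

definition cut_supp :: "nat \<Rightarrow> real" where "cut_supp j = (if j = 0 then 7 * R / 8 else rad j + R / (16 * 2 ^ j))"

definition cut :: "nat \<Rightarrow> 'a \<Rightarrow> real" where "cut j = bump_fun x0 (rad j) (cut_supp j)"

lemma rad_0: "rad 0 = 3 * R / 4" by (simp add: rad_def)

lemma lev_0: "lev M 0 = 0" by (simp add: lev_def)

lemma lev_nonneg: "0 \<le> M \<Longrightarrow> 0 \<le> lev M j" by (simp add: lev_def)

lemma lev_le: "0 \<le> M \<Longrightarrow> lev M j \<le> M" by (simp add: lev_def mult_left_le)

lemma lev_Suc: "lev M (Suc j) = lev M j + 2 * (M / (4 * 2 ^ j))"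
  by (simp add: lev_def field_simps)

lemma rad_bounds: "R / 2 < rad j" "rad j \<le> 3 * R / 4"
proof -
  show "R / 2 < rad j" using R by (simp add: rad_def)
  have "R / (4 * 2 ^ j) \<le> R / (4 * 1)" using R by (intro divide_left_mono mult_left_mono) auto
  then show "rad j \<le> 3 * R / 4" by (simp add: rad_def)
qed

lemma rad_less_cut_supp: "rad j < cut_supp j"
  using R rad_0 by (auto simp: cut_supp_def)

lemma half_gap_pos: "0 < half_gap"
  unfolding half_gap_def using R \<alpha> powr_less_mono2[of \<alpha> "R / 2" R] by simp

lemma half_gap_ge: "R powr \<alpha> * \<alpha> / 8 \<le> half_gap"
  unfolding half_gap_def by (rule time_gap_bound[OF R \<alpha>])

lemma start_time_bounds: "start_time j \<le> start_time (Suc j)" "start_time 0 \<le> start_time j" "start_time j \<le> b - (R / 2) powr \<alpha>"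
proof -
  have "half_gap / 2 ^ Suc j \<le> half_gap / 2 ^ j" using half_gap_pos by (intro divide_left_mono) auto
  then show "start_time j \<le> start_time (Suc j)" by (simp add: start_time_def)
  have "half_gap / 2 ^ j \<le> half_gap / 1" using half_gap_pos by (intro divide_left_mono) auto
  then show "start_time 0 \<le> start_time j" by (simp add: start_time_def)
  show "start_time j \<le> b - (R / 2) powr \<alpha>" using half_gap_pos by (simp add: start_time_def)
qed

lemma start_time_0: "b - a = R powr \<alpha> \<Longrightarrow> start_time 0 - a = half_gap"
proof -
  assume len: "b - a = R powr \<alpha>"
  have "start_time 0 = b - ((R / 2) powr \<alpha> + half_gap)" by (simp add: start_time_def)
  moreover have "2 * half_gap = R powr \<alpha> - (R / 2) powr \<alpha>" by (simp add: half_gap_def)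
  ultimately show ?thesis using len by linarith
qed

lemma cut_cutoff: "cutoff x0 (cut_supp j) (1 / (cut_supp j - rad j)) (cut j)"
  unfolding cut_def by (rule bump_fun_cutoff[OF rad_less_cut_supp])

lemma cut_measurable [measurable]: "cut j \<in> borel_measurable borel"
  by (rule cutoff_measurable[OF cut_cutoff])

lemma cut_eq_1: "x \<in> ball x0 (rad j) \<Longrightarrow> cut j x = 1"
  unfolding cut_def by (rule bump_fun_eq_1[OF rad_less_cut_supp])

text \<open>The quantity that is iterated: the \<open>L\<^sup>2\<close> norm at every time together with the energy over all times, above
the \<open>j\<close>-th level on the \<open>j\<close>-th cylinder.\<close>

definition level_bound :: "real \<Rightarrow> nat \<Rightarrow> real \<Rightarrow> bool" where
  "level_bound M j V \<longleftrightarrow>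
    (\<forall>t\<in>{start_time j..b}. (\<integral>\<^sup>+x. ennreal ((cut j x * excess (lev M j) t x)\<^sup>2) \<partial>lborel) \<le> ennreal V) \<and>
    (\<integral>\<^sup>+\<tau>\<in>{start_time j..<b}. gagliardo \<alpha> (\<lambda>x. cut j x * excess (lev M j) \<tau> x) \<partial>lborel) \<le> ennreal V"

text \<open>One application of \<open>caccioppoli\<close> at level \<open>0\<close>, with \<open>\<rho> = r' = R\<close>: the annulus is empty, so that \<open>S = 0\<close> and
any finite bound \<open>D1\<close> will do.\<close>

lemma level_bound_start:
  assumes \<alpha>0: "0 < \<alpha>0" "\<alpha>0 \<le> \<alpha>" and len: "b - a = R powr \<alpha>"
    and D: "0 \<le> D" "(\<integral>\<^sup>+\<tau>\<in>{a..<b}. (\<integral>\<^sup>+x\<in>ball x0 R. ennreal ((max (U (\<tau>, x)) 0)\<^sup>2) \<partial>lborel) \<partial>lborel) \<le> ennreal D"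
  shows "level_bound M 0 (start_const DIM('a) \<alpha>0 lam Lam * (R powr (- \<alpha>) * D))"
proof -
  have gap: "start_time 0 - a = half_gap" "a < start_time 0" "start_time 0 \<le> b"
  proof -
    show *: "start_time 0 - a = half_gap" by (rule start_time_0[OF len])
    show "a < start_time 0" using * half_gap_pos by linarith
    show "start_time 0 \<le> b" using start_time_bounds(3)[of 0] powr_ge_zero[of "R / 2" \<alpha>] by linarith
  qed
  have cs: "cut_supp 0 = 7 * R / 8" by (simp add: cut_supp_def)
  have L: "1 / (cut_supp 0 - rad 0) = 8 / R" unfolding cs rad_0 using R by (simp add: field_simps)
  note cc = cut_cutoff[of 0, unfolded L]
  have D': "(\<integral>\<^sup>+\<tau>\<in>{a..<b}. (\<integral>\<^sup>+x\<in>ball x0 R. ennreal ((excess 0 \<tau> x)\<^sup>2) \<partial>lborel) \<partial>lborel) \<le> ennreal D"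
    by (rule order_trans[OF nn_integral_mono[OF mult_right_mono[OF nn_integral_mono[OF mult_right_mono]]] D(2)])
       (auto intro!: ennreal_leI power_mono excess_le excess_nonneg)
  define D1 where "D1 = unit_ball_vol DIM('a) * R ^ DIM('a) * (b - a) + D"
  have D1: "0 \<le> D1" using D ab R by (simp add: D1_def)
  have D1': "(\<integral>\<^sup>+\<tau>\<in>{a..<b}. (\<integral>\<^sup>+x\<in>ball x0 R. ennreal (excess 0 \<tau> x) \<partial>lborel) \<partial>lborel) \<le> ennreal D1"
  proof -
    have "(\<integral>\<^sup>+\<tau>\<in>{a..<b}. (\<integral>\<^sup>+x\<in>ball x0 R. ennreal (excess 0 \<tau> x) \<partial>lborel) \<partial>lborel)
      \<le> (\<integral>\<^sup>+\<tau>\<in>{a..<b}. (emeasure lborel (ball x0 R) + (\<integral>\<^sup>+x\<in>ball x0 R. ennreal ((excess 0 \<tau> x)\<^sup>2) \<partial>lborel)) \<partial>lborel)"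
    proof (intro nn_integral_mono mult_right_mono)
      fix \<tau>
      show "(\<integral>\<^sup>+x\<in>ball x0 R. ennreal (excess 0 \<tau> x) \<partial>lborel)
          \<le> emeasure lborel (ball x0 R) + (\<integral>\<^sup>+x\<in>ball x0 R. ennreal ((excess 0 \<tau> x)\<^sup>2) \<partial>lborel)"
        using nn_integral_le_square[of 1 "excess 0 \<tau>" lborel "ball x0 R"] by simp
    qed simp
    also have "\<dots> = emeasure lborel (ball x0 R) * ennreal (b - a) + (\<integral>\<^sup>+\<tau>\<in>{a..<b}. (\<integral>\<^sup>+x\<in>ball x0 R. ennreal ((excess 0 \<tau> x)\<^sup>2) \<partial>lborel) \<partial>lborel)"
      unfolding distrib_right using ab by (subst nn_integral_add) (auto simp: nn_integral_cmult_indicator)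
    also have "\<dots> \<le> ennreal (unit_ball_vol DIM('a) * R ^ DIM('a)) * ennreal (b - a) + ennreal D"
      using R by (intro add_mono D') (simp add: emeasure_ball)
    also have "\<dots> = ennreal D1" using R ab D unfolding D1_def by (simp add: ennreal_mult ennreal_plus)
    finally show ?thesis .
  qed
  define X where "X = D / (start_time 0 - a) + 4 * Lam * (lipschitz_const DIM('a) * (8 / R) powr \<alpha> / \<alpha>) * D + 4 * Lam * (2 - \<alpha>) * (R - cut_supp 0) powr (- (real DIM('a) + \<alpha>)) * (0 * D1)"
  have X: "X = D / half_gap + 4 * Lam * (lipschitz_const DIM('a) * (8 / R) powr \<alpha> / \<alpha>) * D" unfolding X_def gap(1) by simp
  have X0: "0 \<le> X" unfolding X using D half_gap_pos lam \<alpha> lipschitz_const_pos[of "DIM('a)"] by simp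
  have Xle: "X \<le> start_const DIM('a) \<alpha>0 lam Lam / (1 + 1 / (2 * lam)) * (R powr (- \<alpha>) * D)"
    unfolding X by (rule caccioppoli_start_const[OF \<alpha>0 \<alpha>(2) lam R D(1) half_gap_ge])
  have "0 < cut_supp 0" "0 < 8 / R" "cut_supp 0 < R" "R \<le> R" "3 * R / 4 \<le> R" "8 * cut_supp 0 \<le> 7 * R"
    using R by (auto simp: cs)
  note c = caccioppoli[OF order_refl this(1,2) cc this(3,4,5,4,6) order_refl gap(2,3) D(1) D' D1 D1' order_refl _ X_def]
  have c1: "(\<integral>\<^sup>+x. ennreal ((cut 0 x * excess 0 t x)\<^sup>2) \<partial>lborel) \<le> ennreal X" if "t \<in> {start_time 0..b}" for t
    by (rule c(1)) (use that in auto)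
  have c2: "ennreal (2 * lam) * (\<integral>\<^sup>+\<tau>\<in>{start_time 0..<b}. gagliardo \<alpha> (\<lambda>x. cut 0 x * excess 0 \<tau> x) \<partial>lborel) \<le> ennreal X"
    by (rule c(2)) auto
  have Xle': "X \<le> (start_const DIM('a) \<alpha>0 lam Lam * (R powr (- \<alpha>) * D)) / (1 + 1 / (2 * lam))" using Xle by simp
  note s = split_energy_bound[OF lam(1) X0 Xle' c2]
  show ?thesis unfolding level_bound_def lev_0
    using c1 s(2) order_trans[OF _ ennreal_leI[OF s(1)]] by blast
qed

text \<open>The level is raised by \<open>2 \<delta>\<close>. The first \<open>\<delta>\<close> is spent on \<open>level_set_energy\<close>, which turns the energy bound of
step \<open>j\<close> into the small bound \<open>D = F V\<close> on the space-time \<open>L\<^sup>2\<close> norm; the second one makes the \<open>L\<^sup>1\<close> norm at most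
\<open>D / \<delta>\<close>. With these, \<open>caccioppoli\<close> gives the bounds of step \<open>j + 1\<close>. The assumption on the \<open>L\<^sup>1\<close> norm over
the ball of radius \<open>3 R / 4\<close> controls the annulus in all steps alike.\<close>

lemma level_bound_step:
  assumes \<alpha>0: "0 < \<alpha>0" "\<alpha>0 \<le> \<alpha>" and len: "b - a = R powr \<alpha>" and M: "0 < M"
    and V: "V = small_const DIM('a) \<alpha>0 lam Lam * M\<^sup>2 * R ^ DIM('a) * ratio_const DIM('a) \<alpha>0 ^ j"
    and lb: "level_bound M j V"
    and S: "\<And>\<tau>. \<tau> \<in> {start_time 0..b} \<Longrightarrow> (\<integral>\<^sup>+y\<in>ball x0 (3 * R / 4). ennreal (excess 0 \<tau> y) \<partial>lborel)
       \<le> ennreal ((unit_ball_vol DIM('a) + 1) * R ^ DIM('a) * M)"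
  shows "level_bound M (Suc j) (ratio_const DIM('a) \<alpha>0 * V)"
proof -
  define \<delta> where "\<delta> = M / (4 * 2 ^ j)"
  have \<delta>: "0 < \<delta>" using M by (simp add: \<delta>_def)
  note cp = const_pos[OF \<alpha>0(1) lam, where d="DIM('a)"]
  have V0: "0 < V" unfolding V using cp M R by simp
  define F where "F = fk_const DIM('a) \<alpha> (V / \<delta>\<^sup>2)"
  have F0: "0 \<le> F" by (simp add: F_def fk_const_def)
  define D where "D = F * V"
  have D0: "0 \<le> D" using F0 V0 by (simp add: D_def)
  let ?k = "lev M (Suc j)" and ?k' = "lev M j + \<delta>"
  have kk: "?k = ?k' + \<delta>" by (simp add: lev_Suc \<delta>_def)
  have k0: "0 \<le> ?k" using M by (intro lev_nonneg) simp
  have start: "a \<le> start_time j"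
  proof -
    have "start_time 0 - a = half_gap" by (rule start_time_0[OF len])
    then show ?thesis using half_gap_pos start_time_bounds(2)[of j] by linarith
  qed
  have eb: "(\<integral>\<^sup>+\<tau>\<in>{start_time j..<b}. (\<integral>\<^sup>+x\<in>ball x0 (rad j). ennreal ((excess ?k' \<tau> x)\<^sup>2) \<partial>lborel) \<partial>lborel) \<le> ennreal D"
  proof -
    have [measurable]: "(\<lambda>\<tau>. gagliardo \<alpha> (\<lambda>x. cut j x * excess (lev M j) \<tau> x)) \<in> borel_measurable borel"
      unfolding gagliardo_def by measurable
    have "(\<integral>\<^sup>+\<tau>\<in>{start_time j..<b}. (\<integral>\<^sup>+x\<in>ball x0 (rad j). ennreal ((excess ?k' \<tau> x)\<^sup>2) \<partial>lborel) \<partial>lborel)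
      \<le> (\<integral>\<^sup>+\<tau>. ennreal F * (gagliardo \<alpha> (\<lambda>x. cut j x * excess (lev M j) \<tau> x) * indicator {start_time j..<b} \<tau>) \<partial>lborel)"
    proof (rule nn_integral_mono)
      fix \<tau>
      show "(\<integral>\<^sup>+x\<in>ball x0 (rad j). ennreal ((excess ?k' \<tau> x)\<^sup>2) \<partial>lborel) * indicator {start_time j..<b} \<tau>
        \<le> ennreal F * (gagliardo \<alpha> (\<lambda>x. cut j x * excess (lev M j) \<tau> x) * indicator {start_time j..<b} \<tau>)"
      proof (cases "\<tau> \<in> {start_time j..<b}")
        case True
        let ?f = "\<lambda>x. cut j x * excess (lev M j) \<tau> x"
        have "(\<integral>\<^sup>+x\<in>ball x0 (rad j). ennreal ((excess ?k' \<tau> x)\<^sup>2) \<partial>lborel) \<le> (\<integral>\<^sup>+x. ennreal ((max (?f x - \<delta>) 0)\<^sup>2) \<partial>lborel)"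
        proof (rule nn_integral_mono)
          fix x
          show "ennreal ((excess ?k' \<tau> x)\<^sup>2) * indicator (ball x0 (rad j)) x \<le> ennreal ((max (?f x - \<delta>) 0)\<^sup>2)"
            using \<delta> cut_eq_1[of x j] by (cases "x \<in> ball x0 (rad j)") (auto simp: excess_level)
        qed
        also have "\<dots> \<le> ennreal F * gagliardo \<alpha> ?f"
          unfolding F_def
        proof (rule level_set_energy[OF _ _ \<alpha> V0 _ \<delta>])
          show "0 \<le> ?f x" for x using cutoffD(1)[OF cut_cutoff] excess_nonneg by simp
          show "(\<integral>\<^sup>+x. ennreal ((?f x)\<^sup>2) \<partial>lborel) \<le> ennreal V" using lb True unfolding level_bound_def by auto
        qed measurable
        finally show ?thesis using True by simp
      qed simp
    qed
    also have "\<dots> = ennreal F * (\<integral>\<^sup>+\<tau>\<in>{start_time j..<b}. gagliardo \<alpha> (\<lambda>x. cut j x * excess (lev M j) \<tau> x) \<partial>lborel)"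
      by (rule nn_integral_cmult) measurable
    also have "\<dots> \<le> ennreal F * ennreal V" using lb unfolding level_bound_def by (intro mult_left_mono) auto
    also have "\<dots> = ennreal D" using F0 V0 by (simp add: D_def ennreal_mult)
    finally show ?thesis .
  qed
  have D': "(\<integral>\<^sup>+\<tau>\<in>{start_time j..<b}. (\<integral>\<^sup>+x\<in>ball x0 (rad j). ennreal ((excess ?k \<tau> x)\<^sup>2) \<partial>lborel) \<partial>lborel) \<le> ennreal D"
    by (rule order_trans[OF nn_integral_mono[OF mult_right_mono[OF nn_integral_mono[OF mult_right_mono]]] eb])
       (use \<delta> in \<open>auto intro!: ennreal_leI power_mono excess_mono excess_nonneg simp: kk\<close>)
  have D1': "(\<integral>\<^sup>+\<tau>\<in>{start_time j..<b}. (\<integral>\<^sup>+x\<in>ball x0 (rad j). ennreal (excess ?k \<tau> x) \<partial>lborel) \<partial>lborel) \<le> ennreal (D / \<delta>)"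
  proof -
    (* where the excess over the higher level is positive, the lower excess is at least \<delta> *)
    have pt: "ennreal (excess ?k \<tau> x) \<le> ennreal (1 / \<delta>) * ennreal ((excess ?k' \<tau> x)\<^sup>2)" for \<tau> x
    proof -
      define E where "E = excess ?k' \<tau> x"
      have E: "excess ?k \<tau> x = max (E - \<delta>) 0" unfolding kk E_def using \<delta> by (intro excess_level) simp
      have "max (E - \<delta>) 0 \<le> 1 / \<delta> * E\<^sup>2"
      proof (cases "\<delta> \<le> E")
        case True
        have "max (E - \<delta>) 0 \<le> E" using True \<delta> by simp
        also have "\<dots> \<le> E * E / \<delta>" using True \<delta> mult_left_mono[OF True, of E] by (simp add: pos_le_divide_eq)
        finally show ?thesis by (simp add: power2_eq_square)
      qed (use \<delta> in simp)
      then show ?thesis unfolding E E_def[symmetric] using \<delta> by (simp add: ennreal_mult[symmetric] ennreal_leI)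
    qed
    have "(\<integral>\<^sup>+\<tau>\<in>{start_time j..<b}. (\<integral>\<^sup>+x\<in>ball x0 (rad j). ennreal (excess ?k \<tau> x) \<partial>lborel) \<partial>lborel)
      \<le> (\<integral>\<^sup>+\<tau>\<in>{start_time j..<b}. (\<integral>\<^sup>+x\<in>ball x0 (rad j). ennreal (1 / \<delta>) * ennreal ((excess ?k' \<tau> x)\<^sup>2) \<partial>lborel) \<partial>lborel)"
      by (intro nn_integral_mono mult_right_mono pt) auto
    also have "\<dots> = ennreal (1 / \<delta>) * (\<integral>\<^sup>+\<tau>\<in>{start_time j..<b}. (\<integral>\<^sup>+x\<in>ball x0 (rad j). ennreal ((excess ?k' \<tau> x)\<^sup>2) \<partial>lborel) \<partial>lborel)"
      by (simp add: nn_integral_cmult mult.assoc)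
    also have "\<dots> \<le> ennreal (1 / \<delta>) * ennreal D" by (intro mult_left_mono eb) simp
    also have "\<dots> = ennreal (D / \<delta>)" using \<delta> D0 by (simp add: ennreal_mult[symmetric])
    finally show ?thesis .
  qed
  define \<sigma> where "\<sigma> = cut_supp (Suc j)"
  define L where "L = 1 / (cut_supp (Suc j) - rad (Suc j))"
  define T where "T = (unit_ball_vol DIM('a) + 1) * R ^ DIM('a) * M"
  have T0: "0 \<le> T" using R M by (simp add: T_def)
  have twoj: "0 < (2::real) ^ j" "1 \<le> (2::real) ^ j" by simp_all
  have L_eq: "L = 32 * 2 ^ j / R" unfolding L_def cut_supp_def using R by (simp add: field_simps)
  have gap_eq: "rad j - \<sigma> = 3 * R / (32 * 2 ^ j)" unfolding \<sigma>_def cut_supp_def rad_def using R by (simp add: field_simps)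
  have time_eq: "start_time (Suc j) - start_time j = half_gap / (2 * 2 ^ j)" by (simp add: start_time_def field_simps)
  have g1: "0 < \<sigma>" unfolding \<sigma>_def using rad_less_cut_supp[of "Suc j"] rad_bounds(1)[of "Suc j"] R by linarith
  have g2: "0 < L" unfolding L_eq using R by simp
  have g3: "\<sigma> < rad j"
  proof -
    have "0 < 3 * R / (32 * 2 ^ j)" using R by simp
    then show ?thesis using gap_eq by linarith
  qed
  have g4: "8 * \<sigma> \<le> 7 * (3 * R / 4)"
  proof -
    have "\<sigma> = R / 2 + 5 / 32 * (R / 2 ^ j)" unfolding \<sigma>_def cut_supp_def rad_def by (simp add: field_simps)
    moreover have "R / 2 ^ j \<le> R / 1" using R by (intro divide_left_mono) auto
    ultimately show ?thesis by simp
  qed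
  have g5: "start_time j < start_time (Suc j)"
  proof -
    have "0 < half_gap / (2 * 2 ^ j)" using half_gap_pos by simp
    then show ?thesis using time_eq by linarith
  qed
  have g6: "start_time (Suc j) \<le> b"
    using start_time_bounds(3)[of "Suc j"] powr_ge_zero[of "R / 2" \<alpha>] by linarith
  have S': "(\<integral>\<^sup>+y. ennreal (excess ?k \<tau> y) * indicator (ball x0 (3 * R / 4) - ball x0 (rad j)) y \<partial>lborel) \<le> ennreal T"
    if "\<tau> \<in> {start_time j..<b}" for \<tau>
  proof -
    have "\<tau> \<in> {start_time 0..b}" using that start_time_bounds(2)[of j] by auto
    then have *: "(\<integral>\<^sup>+y\<in>ball x0 (3 * R / 4). ennreal (excess 0 \<tau> y) \<partial>lborel) \<le> ennreal T" unfolding T_def by (rule S)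
    show ?thesis
      by (rule order_trans[OF nn_integral_mono *]) (auto intro!: mult_mono ennreal_leI excess_mono k0 simp: indicator_def)
  qed
  define X where "X = D / (start_time (Suc j) - start_time j) + 4 * Lam * (lipschitz_const DIM('a) * L powr \<alpha> / \<alpha>) * D
     + 4 * Lam * (2 - \<alpha>) * (rad j - \<sigma>) powr (- (real DIM('a) + \<alpha>)) * (T * (D / \<delta>))"
  have cc: "cutoff x0 \<sigma> L (cut (Suc j))" unfolding \<sigma>_def L_def by (rule cut_cutoff)
  have R34: "3 * R / 4 \<le> R" using R by simp
  have Dd0: "0 \<le> D / \<delta>" using D0 \<delta> by simp
  note c = caccioppoli[OF k0 g1 g2 cc g3 rad_bounds(2) order_refl R34 g4 start g5 g6 D0 D' Dd0 D1' T0 S' X_def]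
  have c1: "(\<integral>\<^sup>+x. ennreal ((cut (Suc j) x * excess ?k t x)\<^sup>2) \<partial>lborel) \<le> ennreal X" if "t \<in> {start_time (Suc j)..b}" for t
    by (rule c(1)) (use that in auto)
  have c2: "ennreal (2 * lam) * (\<integral>\<^sup>+\<tau>\<in>{start_time (Suc j)..<b}. gagliardo \<alpha> (\<lambda>x. cut (Suc j) x * excess ?k \<tau> x) \<partial>lborel) \<le> ennreal X"
    by (rule c(2)) auto
  have X0: "0 \<le> X"
    unfolding X_def time_eq using D0 Dd0 \<delta> T0 half_gap_pos lam \<alpha> lipschitz_const_pos[of "DIM('a)"]
    by (intro add_nonneg_nonneg mult_nonneg_nonneg divide_nonneg_nonneg) auto
  have X1: "X \<le> iter_const DIM('a) \<alpha>0 lam Lam / (1 + 1 / (2 * lam)) * (2 ^ (DIM('a) + 3)) ^ j * (R powr (- \<alpha>) * D)"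
    unfolding X_def time_eq L_eq gap_eq T_def \<delta>_def
    by (rule caccioppoli_step_const[OF \<alpha>0 \<alpha>(2) lam M R D0 half_gap_ge])
  have X2: "iter_const DIM('a) \<alpha>0 lam Lam * (2 ^ (DIM('a) + 3)) ^ j * (R powr (- \<alpha>) * D) \<le> ratio_const DIM('a) \<alpha>0 * V"
  proof -
    define C q B where "C = iter_const DIM('a) \<alpha>0 lam Lam" and "q = ratio_const DIM('a) \<alpha>0" and "B = ((2::real) ^ (DIM('a) + 3)) ^ j"
    have C: "0 < C" and B: "0 < B" using cp by (auto simp: C_def B_def)
    have Fle: "F \<le> q / C / B * R powr \<alpha>"
      unfolding F_def V \<delta>_def C_def q_def B_def using \<alpha>0 lam M R by (intro fk_const_step) auto
    have "C * B * (R powr (- \<alpha>) * D) \<le> C * B * (R powr (- \<alpha>) * ((q / C / B * R powr \<alpha>) * V))"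
      unfolding D_def using Fle C B V0 by (intro mult_left_mono mult_right_mono) auto
    also have "\<dots> = q * V * (R powr (- \<alpha>) * R powr \<alpha>)" using C B by simp
    also have "R powr (- \<alpha>) * R powr \<alpha> = 1" using R by (simp add: powr_minus)
    finally show ?thesis by (simp add: C_def B_def q_def)
  qed
  have X3: "X \<le> (ratio_const DIM('a) \<alpha>0 * V) / (1 + 1 / (2 * lam))"
  proof -
    have "X \<le> (iter_const DIM('a) \<alpha>0 lam Lam * (2 ^ (DIM('a) + 3)) ^ j * (R powr (- \<alpha>) * D)) / (1 + 1 / (2 * lam))" using X1 by simp
    also have "\<dots> \<le> (ratio_const DIM('a) \<alpha>0 * V) / (1 + 1 / (2 * lam))" using X2 lam by (intro divide_right_mono) auto
    finally show ?thesis .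
  qed
  note s = split_energy_bound[OF lam(1) X0 X3 c2]
  show ?thesis unfolding level_bound_def
    using c1 s(2) order_trans[OF _ ennreal_leI[OF s(1)]] by blast
qed

text \<open>De Giorgi's iteration: the energies above the levels \<open>lev M j\<close> decay geometrically, so there is nothing above \<open>M + height t\<close>.\<close>

lemma local_bound:
  assumes \<alpha>0: "0 < \<alpha>0" "\<alpha>0 \<le> \<alpha>" and len: "b - a = R powr \<alpha>" and M: "0 < M"
    and D: "0 \<le> D" "(\<integral>\<^sup>+\<tau>\<in>{a..<b}. (\<integral>\<^sup>+x\<in>ball x0 R. ennreal ((max (U (\<tau>, x)) 0)\<^sup>2) \<partial>lborel) \<partial>lborel) \<le> ennreal D"
    and MD: "start_const DIM('a) \<alpha>0 lam Lam * (R powr (- \<alpha>) * D) \<le> small_const DIM('a) \<alpha>0 lam Lam * M\<^sup>2 * R ^ DIM('a)"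
    and t: "t \<in> {b - (R / 2) powr \<alpha>..b}"
  shows "AE x in lborel. x \<in> ball x0 (R / 2) \<longrightarrow> U (t, x) \<le> M + height t"
proof -
  (* q is the ratio of decay, \<epsilon> the admissible initial size *)
  define q \<epsilon> where "q = ratio_const DIM('a) \<alpha>0" and "\<epsilon> = small_const DIM('a) \<alpha>0 lam Lam"
  note cp = const_pos[OF \<alpha>0(1) lam, where d="DIM('a)"]
  have q: "0 < q" "q < 1" and \<epsilon>: "0 < \<epsilon>" "\<epsilon> \<le> 1" using cp by (auto simp: q_def \<epsilon>_def small_const_def)
  have start: "level_bound M 0 (\<epsilon> * M\<^sup>2 * R ^ DIM('a))"
    using level_bound_start[OF \<alpha>0 len D, of M] order_trans[OF _ ennreal_leI[OF MD]]
    unfolding level_bound_def \<epsilon>_def by blast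
  (* the bound over the larger ball that every step needs for its annulus *)
  have S: "(\<integral>\<^sup>+y\<in>ball x0 (3 * R / 4). ennreal (excess 0 \<tau> y) \<partial>lborel) \<le> ennreal ((unit_ball_vol DIM('a) + 1) * R ^ DIM('a) * M)"
    if "\<tau> \<in> {start_time 0..b}" for \<tau>
  proof -
    let ?B = "ball x0 (3 * R / 4)"
    have cut_le: "(\<integral>\<^sup>+y\<in>?B. ennreal ((excess 0 \<tau> y)\<^sup>2) \<partial>lborel) \<le> (\<integral>\<^sup>+y. ennreal ((cut 0 y * excess (lev M 0) \<tau> y)\<^sup>2) \<partial>lborel)"
    proof (rule nn_integral_mono)
      fix y
      show "ennreal ((excess 0 \<tau> y)\<^sup>2) * indicator ?B y \<le> ennreal ((cut 0 y * excess (lev M 0) \<tau> y)\<^sup>2)"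
        using cut_eq_1[of y 0] by (cases "y \<in> ?B") (auto simp: rad_0 lev_0)
    qed
    have "(\<integral>\<^sup>+y\<in>?B. ennreal (excess 0 \<tau> y) \<partial>lborel)
       \<le> ennreal M * emeasure lborel ?B + ennreal (1 / M) * (\<integral>\<^sup>+y\<in>?B. ennreal ((excess 0 \<tau> y)\<^sup>2) \<partial>lborel)"
      by (rule nn_integral_le_square[OF M]) auto
    also have "\<dots> \<le> ennreal M * ennreal (unit_ball_vol DIM('a) * R ^ DIM('a)) + ennreal (1 / M) * ennreal (\<epsilon> * M\<^sup>2 * R ^ DIM('a))"
    proof (intro add_mono mult_left_mono)
      have "(3 * R / 4) ^ DIM('a) \<le> R ^ DIM('a)" using R by (intro power_mono) auto
      then show "emeasure lborel ?B \<le> ennreal (unit_ball_vol DIM('a) * R ^ DIM('a))"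
        using R by (auto simp: emeasure_ball intro!: ennreal_leI mult_left_mono)
      have "(\<integral>\<^sup>+y. ennreal ((cut 0 y * excess (lev M 0) \<tau> y)\<^sup>2) \<partial>lborel) \<le> ennreal (\<epsilon> * M\<^sup>2 * R ^ DIM('a))"
        using start that unfolding level_bound_def by blast
      with cut_le show "(\<integral>\<^sup>+y\<in>?B. ennreal ((excess 0 \<tau> y)\<^sup>2) \<partial>lborel) \<le> ennreal (\<epsilon> * M\<^sup>2 * R ^ DIM('a))"
        by (rule order_trans)
    qed auto
    also have "\<dots> = ennreal (M * (unit_ball_vol DIM('a) * R ^ DIM('a)) + 1 / M * (\<epsilon> * M\<^sup>2 * R ^ DIM('a)))"
      using M R \<epsilon> by (simp add: ennreal_mult[symmetric] ennreal_plus[symmetric] del: ennreal_plus)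
    also have "\<dots> \<le> ennreal ((unit_ball_vol DIM('a) + 1) * R ^ DIM('a) * M)"
    proof (rule ennreal_leI)
      have "1 / M * (\<epsilon> * M\<^sup>2 * R ^ DIM('a)) = \<epsilon> * (M * R ^ DIM('a))" using M by (simp add: power2_eq_square)
      also have "\<dots> \<le> 1 * (M * R ^ DIM('a))" using \<epsilon> M R by (intro mult_right_mono) auto
      finally show "M * (unit_ball_vol DIM('a) * R ^ DIM('a)) + 1 / M * (\<epsilon> * M\<^sup>2 * R ^ DIM('a)) \<le> (unit_ball_vol DIM('a) + 1) * R ^ DIM('a) * M"
        by (simp add: algebra_simps)
    qed
    finally show ?thesis .
  qed
  have all: "level_bound M j (\<epsilon> * M\<^sup>2 * R ^ DIM('a) * q ^ j)" for j
  proof (induction j)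
    case 0 then show ?case using start by simp
  next
    case (Suc j)
    have "level_bound M (Suc j) (q * (\<epsilon> * M\<^sup>2 * R ^ DIM('a) * q ^ j))"
      unfolding q_def by (rule level_bound_step[OF \<alpha>0 len M _ _ S]) (use Suc in \<open>simp_all add: q_def \<epsilon>_def\<close>)
    then show ?case by (simp add: mult_ac)
  qed
  let ?I = "\<integral>\<^sup>+x. ennreal ((excess M t x)\<^sup>2) * indicator (ball x0 (R / 2)) x \<partial>lborel"
  have le: "?I \<le> ennreal (\<epsilon> * M\<^sup>2 * R ^ DIM('a) * q ^ j)" for j
  proof -
    have "?I \<le> (\<integral>\<^sup>+x. ennreal ((cut j x * excess (lev M j) t x)\<^sup>2) \<partial>lborel)"
    proof (rule nn_integral_mono)
      fix x
      show "ennreal ((excess M t x)\<^sup>2) * indicator (ball x0 (R / 2)) x \<le> ennreal ((cut j x * excess (lev M j) t x)\<^sup>2)"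
      proof (cases "x \<in> ball x0 (R / 2)")
        case True
        then have "cut j x = 1" using rad_bounds(1)[of j] by (intro cut_eq_1) auto
        moreover have "(excess M t x)\<^sup>2 \<le> (excess (lev M j) t x)\<^sup>2"
          using M by (intro power_mono excess_mono lev_le excess_nonneg) auto
        ultimately show ?thesis using True by (simp add: ennreal_leI)
      qed simp
    qed
    also have "t \<in> {start_time j..b}" using t start_time_bounds(3)[of j] by auto
    then have "(\<integral>\<^sup>+x. ennreal ((cut j x * excess (lev M j) t x)\<^sup>2) \<partial>lborel) \<le> ennreal (\<epsilon> * M\<^sup>2 * R ^ DIM('a) * q ^ j)"
      using all[of j] unfolding level_bound_def by blast
    finally show ?thesis .
  qed
  have "(\<lambda>j. \<epsilon> * M\<^sup>2 * R ^ DIM('a) * q ^ j) \<longlonglongrightarrow> \<epsilon> * M\<^sup>2 * R ^ DIM('a) * 0"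
    using q by (intro tendsto_mult_left LIMSEQ_realpow_zero) auto
  then have "(\<lambda>j. ennreal (\<epsilon> * M\<^sup>2 * R ^ DIM('a) * q ^ j)) \<longlonglongrightarrow> ennreal 0" by (intro tendsto_ennrealI) simp
  then have "?I \<le> ennreal 0" using le by (intro LIMSEQ_le_const) auto
  then have "AE x in lborel. ennreal ((excess M t x)\<^sup>2) * indicator (ball x0 (R / 2)) x = 0"
    by (subst (asm) ennreal_0) (simp add: nn_integral_0_iff_AE)
  then show ?thesis
  proof eventually_elim
    case (elim x)
    then show ?case by (cases "x \<in> ball x0 (R / 2)") (auto simp: excess_def max_def split: if_splits)
  qed
qed

end

section \<open>Borel versions of Lebesgue measurable functions\<close>

lemma measurable_lebesgue_AE:
  assumes eq: "AE x in lborel. f x = g x" and g: "g \<in> borel_measurable borel"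
  shows "f \<in> borel_measurable lebesgue"
proof (rule measurableI)
  fix A :: "'b set" assume A: "A \<in> sets borel"
  obtain N where N: "{x. f x \<noteq> g x} \<subseteq> N" "N \<in> null_sets lborel"
    using eq by (auto simp: eventually_ae_filter)
  have gA: "g -` A \<in> sets lebesgue" using measurable_sets[OF g A] by auto
  have NL: "N \<in> null_sets lebesgue" using N(2) by (rule null_sets_completionI)
  have "(f -` A) \<inter> N \<in> null_sets lebesgue"
    by (rule null_sets_completion_subset[OF _ NL]) auto
  then have "(f -` A) \<inter> N \<in> sets lebesgue" by auto
  then have "(g -` A - N) \<union> ((f -` A) \<inter> N) \<in> sets lebesgue"
    by (intro sets.Un sets.Diff gA null_setsD2[OF NL])
  moreover have "f -` A = (g -` A - N) \<union> ((f -` A) \<inter> N)" using N(1) by auto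
  ultimately show "f -` A \<inter> space lebesgue \<in> sets lebesgue" by simp
qed simp

lemma integral_lebesgue_AE:
  fixes g :: "'a::euclidean_space \<Rightarrow> real"
  assumes eq: "AE x in lborel. f x = g x" and g: "g \<in> borel_measurable borel"
  shows "(LINT x|lebesgue. f x) = (LINT x|lborel. g x)"
proof -
  have "(LINT x|lebesgue. f x) = (LINT x|lebesgue. g x)"
  proof (rule integral_cong_AE)
    show "f \<in> borel_measurable lebesgue" by (rule measurable_lebesgue_AE[OF eq g])
    show "g \<in> borel_measurable lebesgue" using g by (intro measurable_completion) simp
    show "AE x in lebesgue. f x = g x" using eq by (rule AE_completion)
  qed
  also have "\<dots> = (LINT x|lborel. g x)" using g by (intro integral_completion) simp
  finally show ?thesis .
qed

text \<open>Fubini's theorem for null sets, in both orders and without measurability of the property itself.\<close>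

lemma AE_lborel_pair:
  assumes "AE z in (lborel :: ('a::euclidean_space \<times> 'b::euclidean_space) measure). P z"
  shows "AE x in lborel. AE y in lborel. P (x, y)" "AE y in lborel. AE x in lborel. P (x, y)"
proof -
  obtain N where N: "{z. \<not> P z} \<subseteq> N" "N \<in> null_sets (lborel :: ('a \<times> 'b) measure)"
    using assms by (auto simp: eventually_ae_filter)
  have NM: "N \<in> sets (lborel \<Otimes>\<^sub>M lborel)" using N(2) unfolding lborel_prod by auto
  have "AE z in (lborel \<Otimes>\<^sub>M lborel). z \<notin> N" unfolding lborel_prod using N(2) by (rule AE_not_in)
  then have 1: "AE x in lborel. AE y in lborel. (x, y) \<notin> N" by (rule lborel_pair.AE_pair)
  then have 2: "AE y in lborel. AE x in lborel. (x, y) \<notin> N"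
  proof (subst (asm) lborel_pair.AE_commute)
    have "{z \<in> space (lborel \<Otimes>\<^sub>M lborel). (fst z, snd z) \<notin> N} = space (lborel \<Otimes>\<^sub>M lborel) - N" by auto
    also have "\<dots> \<in> sets (lborel \<Otimes>\<^sub>M lborel)" using NM by (rule sets.compl_sets)
    finally show "{z \<in> space (lborel \<Otimes>\<^sub>M lborel). (fst z, snd z) \<notin> N} \<in> sets (lborel \<Otimes>\<^sub>M lborel)" .
  qed
  show "AE x in lborel. AE y in lborel. P (x, y)"
    using 1 by eventually_elim (use N(1) in \<open>auto elim!: eventually_mono\<close>)
  show "AE y in lborel. AE x in lborel. P (x, y)"
    using 2 by eventually_elim (use N(1) in \<open>auto elim!: eventually_mono\<close>)
qed

lemma borel_version_real:
  fixes f :: "'a::euclidean_space \<Rightarrow> real"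
  assumes f: "f \<in> borel_measurable (lebesgue_on S)" and S: "S \<in> sets borel"
  obtains g where "g \<in> borel_measurable borel" "AE x in lborel. x \<in> S \<longrightarrow> f x = g x"
proof -
  have SL: "S \<in> sets lebesgue" using S by auto
  have "(\<lambda>x. if x \<in> S then f x else 0) \<in> borel_measurable lebesgue"
    using f SL by (simp add: borel_measurable_if)
  from completion_ex_borel_measurable_real[OF this]
  obtain g where g: "g \<in> borel_measurable lborel" "AE x in lborel. (if x \<in> S then f x else 0) = g x" by blast
  show ?thesis
  proof (rule that)
    show "g \<in> borel_measurable borel" using g by simp
    show "AE x in lborel. x \<in> S \<longrightarrow> f x = g x" using g(2) by eventually_elim auto
  qed
qed

lemma borel_version_ennreal:
  fixes f :: "'a::euclidean_space \<Rightarrow> ennreal"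
  assumes f: "f \<in> borel_measurable (lebesgue_on S)" and S: "S \<in> sets borel"
  obtains g where "g \<in> borel_measurable borel" "AE x in lborel. x \<in> S \<longrightarrow> f x = g x"
proof -
  have SL: "S \<inter> space lebesgue \<in> sets lebesgue" using S by auto
  have "(\<lambda>x. f x * indicator S x) \<in> borel_measurable lebesgue"
    using f borel_measurable_restrict_space_iff_ennreal[OF SL, of f] by simp
  from completion_ex_borel_measurable[OF this]
  obtain g where g: "g \<in> borel_measurable lborel" "AE x in lborel. f x * indicator S x = g x" by blast
  show ?thesis
  proof (rule that)
    show "g \<in> borel_measurable borel" using g by simp
    show "AE x in lborel. x \<in> S \<longrightarrow> f x = g x" using g(2) by eventually_elim auto
  qed
qed

lemma ennsqrt_square: "(ennsqrt x)\<^sup>2 = x"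
  by (cases x) (auto simp: ennsqrt_def ennreal_power)

lemma ennsqrt_mono: "x \<le> y \<Longrightarrow> ennsqrt x \<le> ennsqrt y"
  by (cases x; cases y) (auto simp: ennsqrt_def top_unique intro!: ennreal_leI)

lemma le_ennsqrt: "x\<^sup>2 \<le> y \<Longrightarrow> x \<le> ennsqrt y"
proof -
  assume "x\<^sup>2 \<le> y"
  then have "ennsqrt (x\<^sup>2) \<le> ennsqrt y" by (rule ennsqrt_mono)
  moreover have "ennsqrt (x\<^sup>2) = x" by (cases x) (auto simp: ennsqrt_def ennreal_power)
  ultimately show ?thesis by simp
qed

lemma ennsqrt_mult: "ennsqrt (x * y) = ennsqrt x * ennsqrt y"
proof -
  have sq: "ennsqrt (z\<^sup>2) = z" for z by (cases z) (auto simp: ennsqrt_def ennreal_power)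
  have "ennsqrt x * ennsqrt y = ennsqrt ((ennsqrt x * ennsqrt y)\<^sup>2)" by (simp add: sq)
  also have "(ennsqrt x * ennsqrt y)\<^sup>2 = x * y" by (simp add: power_mult_distrib ennsqrt_square)
  finally show ?thesis by simp
qed

lemma ennsqrt_measurable [measurable]: "ennsqrt \<in> borel_measurable borel"
  unfolding ennsqrt_def by measurable

lemma ennsqrt_finite: "ennsqrt x < \<infinity> \<longleftrightarrow> x < \<infinity>"
  by (cases x) (auto simp: ennsqrt_def)

lemma Cauchy_Schwarz_ennsqrt:
  assumes "f \<in> borel_measurable M" "g \<in> borel_measurable M"
  shows "(\<integral>\<^sup>+x. f x * g x \<partial>M) \<le> ennsqrt (\<integral>\<^sup>+x. (f x)\<^sup>2 \<partial>M) * ennsqrt (\<integral>\<^sup>+x. (g x)\<^sup>2 \<partial>M)"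
  unfolding ennsqrt_mult[symmetric] by (rule le_ennsqrt[OF Cauchy_Schwarz_nn_integral[OF assms]])

section \<open>Integrability of weak subsolutions\<close>

text \<open>A weak subsolution on \<open>I \<times> \<Omega>\<close> near the cylinder \<open>{s0..t0} \<times> cball x0 R\<close>, together with Borel versions \<open>U1\<close>, \<open>W1\<close> and \<open>K1\<close>
of the solution, of its time derivative and of the kernel. The versions are needed for Fubini's theorem; the
equation itself is only available for the original functions, at every single time.\<close>

locale borel_subsolution =
  fixes \<alpha> lam Lam R s0 t0 :: real and x0 :: "'a::euclidean_space" and I :: "real set" and \<Omega> :: "'a set"
    and K :: "real \<Rightarrow> 'a \<Rightarrow> 'a \<Rightarrow> ennreal" and u w :: "real \<Rightarrow> 'a \<Rightarrow> real"
    and U1 W1 :: "real \<times> 'a \<Rightarrow> real" and K1 :: "real \<times> 'a \<times> 'a \<Rightarrow> ennreal"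
  assumes \<alpha>: "0 < \<alpha>" "\<alpha> < 2" and lam: "0 < lam" "0 < Lam" "lam \<le> Lam" and R: "0 < R" and s0t0: "s0 < t0"
    and J: "{s0..t0} \<subseteq> I" and I: "open I" and ball_\<Omega>: "cball x0 R \<subseteq> \<Omega>" and \<Omega>: "open \<Omega>"
    and U1_meas [measurable]: "U1 \<in> borel_measurable (borel \<Otimes>\<^sub>M borel)"
    and W1_meas [measurable]: "W1 \<in> borel_measurable (borel \<Otimes>\<^sub>M borel)"
    and K1_meas [measurable]: "K1 \<in> borel_measurable (borel \<Otimes>\<^sub>M (borel \<Otimes>\<^sub>M borel))"
    and U1: "AE z in lborel. fst z \<in> I \<longrightarrow> u (fst z) (snd z) = U1 z"
    and W1: "AE z in lborel. fst z \<in> I \<and> snd z \<in> \<Omega> \<longrightarrow> w (fst z) (snd z) = W1 z"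
    and K1: "AE z in lborel. fst z \<in> I \<longrightarrow> K (fst z) (fst (snd z)) (snd (snd z)) = K1 z"
    and K_bounds: "\<And>t x y. t \<in> I \<Longrightarrow> ennreal (lam * (2 - \<alpha>)) * frac_kernel \<alpha> x y \<le> K t x y"
      "\<And>t x y. t \<in> I \<Longrightarrow> K t x y \<le> ennreal (Lam * (2 - \<alpha>)) * frac_kernel \<alpha> x y"
    and u_H: "L2loc_Hloc \<alpha> I \<Omega> u" and u_L1: "L1loc_L1weighted \<alpha> I u" and u_L2: "Linfloc_L2loc I \<Omega> u"
    and w_L2: "L1loc_L2loc I \<Omega> w" and u_w: "weak_time_deriv I \<Omega> u w"
    and sub: "\<And>t \<phi>. t \<in> I \<Longrightarrow> \<phi> \<in> H_space_supp \<alpha> \<Omega> \<Longrightarrow> AE x in lebesgue. 0 \<le> \<phi> x \<Longrightarrow>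
        (LINT x:\<Omega>|lebesgue. w t x * \<phi> x) + energy (K t) (u t) \<phi> \<le> 0"
begin

abbreviation "B \<equiv> ball x0 R"

lemma ball_inside: "compactly_inside B \<Omega>"
  unfolding compactly_inside_def using R ball_\<Omega> by simp

lemma ball_subset: "B \<subseteq> \<Omega>" using ball_\<Omega> by auto

lemma U1_time: "AE t in lborel. t \<in> I \<longrightarrow> (AE x in lborel. u t x = U1 (t, x))"
  using AE_lborel_pair(1)[OF U1] by eventually_elim (auto elim!: eventually_mono)

lemma U1_space: "AE x in lborel. AE t in lborel. t \<in> I \<longrightarrow> u t x = U1 (t, x)"
  using AE_lborel_pair(2)[OF U1] by simp

lemma W1_time: "AE t in lborel. t \<in> I \<longrightarrow> (AE x in lborel. x \<in> \<Omega> \<longrightarrow> w t x = W1 (t, x))"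
  using AE_lborel_pair(1)[OF W1] by eventually_elim (auto elim!: eventually_mono)

lemma W1_space: "AE x in lborel. x \<in> \<Omega> \<longrightarrow> (AE t in lborel. t \<in> I \<longrightarrow> w t x = W1 (t, x))"
  using AE_lborel_pair(2)[OF W1] by eventually_elim (auto elim!: eventually_mono)

lemma K1_time: "AE t in lborel. t \<in> I \<longrightarrow> (AE x in lborel. AE y in lborel. K t x y = K1 (t, x, y))"
  using AE_lborel_pair(1)[OF K1]
proof eventually_elim
  case (elim t)
  show ?case
  proof
    assume "t \<in> I"
    then have "AE z in lborel. K t (fst z) (snd z) = K1 (t, z)" using elim by simp
    from AE_lborel_pair(1)[OF this] show "AE x in lborel. AE y in lborel. K t x y = K1 (t, x, y)" by simp
  qed
qed

lemma U1_sq: "\<exists>C\<ge>0. AE t in lborel. t \<in> {s0..t0} \<longrightarrow> (\<integral>\<^sup>+x\<in>B. ennreal ((U1 (t, x))\<^sup>2) \<partial>lborel) \<le> ennreal C"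
proof -
  obtain C where "AE t in lebesgue. t \<in> {s0..t0} \<longrightarrow> L2_norm B (u t) \<le> ennreal C"
    using u_L2 J ball_inside unfolding Linfloc_L2loc_def by (meson compact_Icc)
  then have "AE t in lborel. t \<in> {s0..t0} \<longrightarrow> L2_norm B (u t) \<le> ennreal C" by (simp add: AE_completion_iff)
  then have "AE t in lborel. t \<in> {s0..t0} \<longrightarrow> (\<integral>\<^sup>+x\<in>B. ennreal ((U1 (t, x))\<^sup>2) \<partial>lborel) \<le> ennreal ((max C 0)\<^sup>2)"
    using U1_time
  proof eventually_elim
    case (elim t)
    show ?case
    proof
      assume t: "t \<in> {s0..t0}"
      then have "AE x in lborel. u t x = U1 (t, x)" using elim J by auto
      then have "(\<integral>\<^sup>+x\<in>B. ennreal ((U1 (t, x))\<^sup>2) \<partial>lborel) = (\<integral>\<^sup>+x\<in>B. ennreal ((u t x)\<^sup>2) \<partial>lborel)"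
        by (intro nn_integral_cong_AE) (auto elim!: eventually_mono)
      also have "\<dots> = (L2_norm B (u t))\<^sup>2" by (simp add: L2_norm_def ennsqrt_square nn_integral_completion)
      also have "\<dots> \<le> (ennreal (max C 0))\<^sup>2" using elim t by (intro power_mono) (auto intro: order_trans ennreal_leI)
      also have "\<dots> = ennreal ((max C 0)\<^sup>2)" by (simp add: ennreal_power)
      finally show "(\<integral>\<^sup>+x\<in>B. ennreal ((U1 (t, x))\<^sup>2) \<partial>lborel) \<le> \<dots>" .
    qed
  qed
  then show ?thesis by (intro exI[of _ "(max C 0)\<^sup>2"]) simp
qed

definition W_norm :: "real \<Rightarrow> ennreal" where
  "W_norm t = ennsqrt (\<integral>\<^sup>+x\<in>B. ennreal ((W1 (t, x))\<^sup>2) \<partial>lborel)"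

lemma W_norm_measurable [measurable]: "W_norm \<in> borel_measurable borel"
  unfolding W_norm_def by measurable

lemma W_norm_integral: "(\<integral>\<^sup>+t\<in>{s0..t0}. W_norm t \<partial>lborel) < \<infinity>"
proof -
  have "(\<integral>\<^sup>+t\<in>{s0..t0}. L2_norm B (w t) \<partial>lebesgue) < \<infinity>"
    using w_L2 J ball_inside unfolding L1loc_L2loc_def by (meson compact_Icc)
  then have "(\<integral>\<^sup>+t\<in>{s0..t0}. L2_norm B (w t) \<partial>lborel) < \<infinity>" by (simp add: nn_integral_completion)
  moreover have "(\<integral>\<^sup>+t\<in>{s0..t0}. W_norm t \<partial>lborel) = (\<integral>\<^sup>+t\<in>{s0..t0}. L2_norm B (w t) \<partial>lborel)"
  proof (rule nn_integral_cong_AE)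
    show "AE t in lborel. W_norm t * indicator {s0..t0} t = L2_norm B (w t) * indicator {s0..t0} t"
      using W1_time
    proof eventually_elim
      case (elim t)
      show ?case
      proof (cases "t \<in> {s0..t0}")
        case True
        then have "AE x in lborel. x \<in> \<Omega> \<longrightarrow> w t x = W1 (t, x)" using elim J by auto
        then have "(\<integral>\<^sup>+x\<in>B. ennreal ((W1 (t, x))\<^sup>2) \<partial>lborel) = (\<integral>\<^sup>+x\<in>B. ennreal ((w t x)\<^sup>2) \<partial>lborel)"
          by (intro nn_integral_cong_AE) (use ball_subset in \<open>auto elim!: eventually_mono simp: indicator_def\<close>)
        then show ?thesis by (simp add: W_norm_def L2_norm_def nn_integral_completion)
      qed simp
    qed
  qed
  ultimately show ?thesis by simp
qed

lemma U1_fractional: "AE t in lborel. t \<in> {s0..t0} \<longrightarrow>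
  (\<integral>\<^sup>+x. \<integral>\<^sup>+y. ennreal ((U1 (t, x) - U1 (t, y))\<^sup>2 * riesz_kernel \<alpha> (x - y)) * indicator B x * indicator B y \<partial>lborel \<partial>lborel) < \<infinity>"
proof -
  let ?E = "\<lambda>t. \<integral>\<^sup>+x. \<integral>\<^sup>+y. ennreal ((U1 (t, x) - U1 (t, y))\<^sup>2 * riesz_kernel \<alpha> (x - y)) * indicator B x * indicator B y \<partial>lborel \<partial>lborel"
  have [measurable]: "?E \<in> borel_measurable borel" by measurable
  have "(\<integral>\<^sup>+t\<in>{s0..t0}. (H_norm \<alpha> B (u t))\<^sup>2 \<partial>lebesgue) < \<infinity>"
    using u_H J ball_inside unfolding L2loc_Hloc_def by (meson compact_Icc)
  then have fin: "(\<integral>\<^sup>+t\<in>{s0..t0}. (H_norm \<alpha> B (u t))\<^sup>2 \<partial>lborel) < \<infinity>" by (simp add: nn_integral_completion)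
  have "(\<integral>\<^sup>+t\<in>{s0..t0}. ennreal (2 - \<alpha>) * ?E t \<partial>lborel) \<le> (\<integral>\<^sup>+t\<in>{s0..t0}. (H_norm \<alpha> B (u t))\<^sup>2 \<partial>lborel)"
  proof (rule nn_integral_mono_AE)
    show "AE t in lborel. ennreal (2 - \<alpha>) * ?E t * indicator {s0..t0} t \<le> (H_norm \<alpha> B (u t))\<^sup>2 * indicator {s0..t0} t"
      using U1_time
    proof eventually_elim
      case (elim t)
      show ?case
      proof (cases "t \<in> {s0..t0}")
        case True
        then have ae: "AE x in lborel. u t x = U1 (t, x)" using elim J by auto
        have "?E t = (\<integral>\<^sup>+x\<in>B. (\<integral>\<^sup>+y\<in>B. ennreal ((u t x - u t y)\<^sup>2) * frac_kernel \<alpha> x y \<partial>lborel) \<partial>lborel)"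
        proof (rule nn_integral_cong_AE)
          show "AE x in lborel. (\<integral>\<^sup>+y. ennreal ((U1 (t, x) - U1 (t, y))\<^sup>2 * riesz_kernel \<alpha> (x - y)) * indicator B x * indicator B y \<partial>lborel)
            = (\<integral>\<^sup>+y\<in>B. ennreal ((u t x - u t y)\<^sup>2) * frac_kernel \<alpha> x y \<partial>lborel) * indicator B x"
            using ae
          proof eventually_elim
            case (elim x)
            have "(\<integral>\<^sup>+y. ennreal ((U1 (t, x) - U1 (t, y))\<^sup>2 * riesz_kernel \<alpha> (x - y)) * indicator B x * indicator B y \<partial>lborel)
              = (\<integral>\<^sup>+y. ennreal ((u t x - u t y)\<^sup>2) * frac_kernel \<alpha> x y * indicator B y * indicator B x \<partial>lborel)"
            proof (rule nn_integral_cong_AE)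
              show "AE y in lborel. ennreal ((U1 (t, x) - U1 (t, y))\<^sup>2 * riesz_kernel \<alpha> (x - y)) * indicator B x * indicator B y
                 = ennreal ((u t x - u t y)\<^sup>2) * frac_kernel \<alpha> x y * indicator B y * indicator B x"
                using ae
              proof eventually_elim
                case (elim y)
                have "ennreal ((u t x - u t y)\<^sup>2) * frac_kernel \<alpha> x y = ennreal ((u t x - u t y)\<^sup>2 * riesz_kernel \<alpha> (x - y))"
                  by (rule ennreal_mult_frac_kernel) auto
                then show ?case unfolding elim \<open>u t x = U1 (t, x)\<close> by (cases "x \<in> B") auto
              qed
            qed
            then show ?case by (cases "x \<in> B") auto
          qed
        qed
        then have "ennreal (2 - \<alpha>) * ?E t \<le> (H_norm \<alpha> B (u t))\<^sup>2"
          by (simp add: H_norm_def ennsqrt_square nn_integral_completion add_increasing)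
        then show ?thesis using True by simp
      qed simp
    qed
  qed
  then have "(\<integral>\<^sup>+t\<in>{s0..t0}. ennreal (2 - \<alpha>) * ?E t \<partial>lborel) \<noteq> \<infinity>" using fin by (auto simp: top_unique)
  then have "AE t in lborel. ennreal (2 - \<alpha>) * ?E t * indicator {s0..t0} t \<noteq> \<infinity>"
    by (intro nn_integral_PInf_AE) auto
  then show ?thesis
    by eventually_elim (use \<alpha> in \<open>auto simp: ennreal_mult_eq_top_iff less_top\<close>)
qed

text \<open>Away from \<open>x0\<close> the kernel is dominated by the weight of \<open>L1_weighted_norm\<close>, because \<open>1 + |y| \<le> c |x0 - y|\<close>.\<close>

lemma riesz_weight:
  assumes "0 < r" "y \<notin> ball x0 r"
  shows "riesz_kernel \<alpha> (x0 - y) \<le> ((1 + norm x0) / r + 1) powr (real DIM('a) + \<alpha>) * (1 + norm y) powr (- real DIM('a) - \<alpha>)"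
proof -
  define p where "p = real DIM('a) + \<alpha>"
  define c where "c = (1 + norm x0) / r + 1"
  have p: "0 \<le> p" using \<alpha> by (simp add: p_def)
  have c: "0 < c" 
  proof -
    have "0 \<le> (1 + norm x0) / r" using assms by simp
    then show ?thesis unfolding c_def by linarith
  qed
  have n: "r \<le> norm (x0 - y)" using assms by (simp add: dist_norm)
  have "norm y \<le> norm x0 + norm (x0 - y)" using norm_triangle_ineq4[of x0 "x0 - y"] by simp
  moreover have "1 + norm x0 \<le> (1 + norm x0) / r * norm (x0 - y)"
  proof -
    have "(1 + norm x0) / r * r \<le> (1 + norm x0) / r * norm (x0 - y)" using n assms(1) by (intro mult_left_mono) auto
    then show ?thesis using assms(1) by simp
  qed
  ultimately have "1 + norm y \<le> c * norm (x0 - y)" by (simp add: c_def distrib_right)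
  then have "(1 + norm y) / c \<le> norm (x0 - y)" using c by (simp add: pos_divide_le_eq mult.commute)
  then have "norm (x0 - y) powr (- p) \<le> ((1 + norm y) / c) powr (- p)"
    using c p by (intro powr_mono_base_neg divide_pos_pos) (auto intro: add_pos_nonneg)
  also have "\<dots> = c powr p * (1 + norm y) powr (- p)" using c by (simp add: powr_divide powr_minus field_simps)
  finally show ?thesis by (simp add: riesz_kernel_def p_def c_def)
qed

lemma U1_tail:
  assumes r: "0 < r"
  shows "(\<integral>\<^sup>+t\<in>{s0..t0}. (\<integral>\<^sup>+y\<in>- ball x0 r. ennreal (\<bar>U1 (t, y)\<bar> * riesz_kernel \<alpha> (x0 - y)) \<partial>lborel) \<partial>lborel) < \<infinity>"
proof -
  define c where "c = ((1 + norm x0) / r + 1) powr (real DIM('a) + \<alpha>)"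
  have "(\<integral>\<^sup>+t\<in>{s0..t0}. L1_weighted_norm \<alpha> (u t) \<partial>lebesgue) < \<infinity>"
    using u_L1 J unfolding L1loc_L1weighted_def by (meson compact_Icc)
  then have fin: "(\<integral>\<^sup>+t\<in>{s0..t0}. L1_weighted_norm \<alpha> (u t) \<partial>lborel) < \<infinity>" by (simp add: nn_integral_completion)
  let ?N = "\<lambda>t. \<integral>\<^sup>+y. ennreal (\<bar>U1 (t, y)\<bar> * (1 + norm y) powr (- real DIM('a) - \<alpha>)) \<partial>lborel"
  have N: "(\<integral>\<^sup>+t\<in>{s0..t0}. L1_weighted_norm \<alpha> (u t) \<partial>lborel) = (\<integral>\<^sup>+t\<in>{s0..t0}. ?N t \<partial>lborel)"
  proof (rule nn_integral_cong_AE)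
    show "AE t in lborel. L1_weighted_norm \<alpha> (u t) * indicator {s0..t0} t = ?N t * indicator {s0..t0} t"
      using U1_time
    proof eventually_elim
      case (elim t)
      show ?case
      proof (cases "t \<in> {s0..t0}")
        case True
        then have ae: "AE x in lborel. u t x = U1 (t, x)" using elim J by auto
        have "L1_weighted_norm \<alpha> (u t) = ?N t"
          unfolding L1_weighted_norm_def nn_integral_completion using ae
          by (intro nn_integral_cong_AE) (auto elim!: eventually_mono)
        then show ?thesis by simp
      qed simp
    qed
  qed
  have "(\<integral>\<^sup>+t\<in>{s0..t0}. (\<integral>\<^sup>+y\<in>- ball x0 r. ennreal (\<bar>U1 (t, y)\<bar> * riesz_kernel \<alpha> (x0 - y)) \<partial>lborel) \<partial>lborel)
    \<le> (\<integral>\<^sup>+t\<in>{s0..t0}. (\<integral>\<^sup>+y. ennreal c * ennreal (\<bar>U1 (t, y)\<bar> * (1 + norm y) powr (- real DIM('a) - \<alpha>)) \<partial>lborel) \<partial>lborel)"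
  proof (intro nn_integral_mono mult_right_mono)
    fix t and y
    show "ennreal (\<bar>U1 (t, y)\<bar> * riesz_kernel \<alpha> (x0 - y)) * indicator (- ball x0 r) y \<le> ennreal c * ennreal (\<bar>U1 (t, y)\<bar> * (1 + norm y) powr (- real DIM('a) - \<alpha>))"
    proof (cases "y \<in> ball x0 r")
      case False
      have "\<bar>U1 (t, y)\<bar> * riesz_kernel \<alpha> (x0 - y) \<le> \<bar>U1 (t, y)\<bar> * (c * (1 + norm y) powr (- real DIM('a) - \<alpha>))"
        using riesz_weight[OF r False] unfolding c_def by (intro mult_left_mono) auto
      then have "\<bar>U1 (t, y)\<bar> * riesz_kernel \<alpha> (x0 - y) \<le> c * (\<bar>U1 (t, y)\<bar> * (1 + norm y) powr (- real DIM('a) - \<alpha>))"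
        by (simp add: mult_ac)
      then show ?thesis using False by (simp add: ennreal_mult[symmetric] c_def ennreal_leI)
    qed simp
  qed simp
  also have "\<dots> = ennreal c * (\<integral>\<^sup>+t\<in>{s0..t0}. ?N t \<partial>lborel)"
    by (simp add: nn_integral_cmult mult.assoc)
  also have "\<dots> < \<infinity>" using fin unfolding N by (simp add: ennreal_mult_less_top)
  finally show ?thesis .
qed

end

section \<open>A version that is absolutely continuous in time\<close>

lemma test_family_vanish:
  assumes ab: "a < b" and \<eta>: "\<eta> \<in> test_family a b"
  shows "t \<notin> {a<..<b} \<Longrightarrow> \<eta> t = 0" "t \<notin> {a<..<b} \<Longrightarrow> deriv \<eta> t = 0"
    "\<eta> \<in> borel_measurable borel" "deriv \<eta> \<in> borel_measurable borel"
proof -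
  obtain p q n where e: "\<eta> = bump_primitive a b p q (1 / real (Suc n))" and pq: "a < p" "p < q" "q < b"
    using \<eta> unfolding test_family_def by blast
  have c: "0 < 1 / real (Suc n)" by simp
  note d = deriv_bump_primitive[OF ab pq c]
  have sub: "{supp_lo a b p<..<supp_hi a b q} \<subseteq> {a<..<b}"
    using balanced_bump_supp(1,2)[OF ab pq c] by auto
  show "t \<notin> {a<..<b} \<Longrightarrow> \<eta> t = 0" using sub bump_primitive_zero[OF ab pq c, of t] unfolding e by blast
  show "t \<notin> {a<..<b} \<Longrightarrow> deriv \<eta> t = 0" using sub balanced_bump_supp(3)[OF ab pq c, of t] unfolding e d by blast
  show "deriv \<eta> \<in> borel_measurable borel" unfolding e d by (rule balanced_bump_measurable[OF ab pq c])
  show "\<eta> \<in> borel_measurable borel" unfolding e bump_primitive_def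
    by (rule primitive_measurable[OF balanced_bump_integrable[OF ab pq c]])
qed

lemma primitive_eq_if: "primitive w t = (LINT s|lborel. (if s < t then w s else 0))"
  unfolding primitive_def by (intro Bochner_Integration.integral_cong) auto

context borel_subsolution
begin

abbreviation "JJ \<equiv> {s0..t0}"

definition U_cut :: "'a \<Rightarrow> real \<Rightarrow> real" where "U_cut x s = indicator JJ s * U1 (s, x)"
definition W_cut :: "'a \<Rightarrow> real \<Rightarrow> real" where "W_cut x s = indicator JJ s * W1 (s, x)"

lemma U_cut_measurable [measurable]: "(\<lambda>(x, s). U_cut x s) \<in> borel_measurable (borel \<Otimes>\<^sub>M borel)"
  unfolding U_cut_def by measurable
lemma W_cut_measurable [measurable]: "(\<lambda>(x, s). W_cut x s) \<in> borel_measurable (borel \<Otimes>\<^sub>M borel)"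
  unfolding W_cut_def by measurable

lemma primitive_W_measurable [measurable]: "(\<lambda>(t, x). primitive (W_cut x) t) \<in> borel_measurable (borel \<Otimes>\<^sub>M borel)"
  unfolding primitive_eq_if by measurable

text \<open>The constant of integration given by \<open>weak_derivative_imp_primitive\<close>.\<close>

definition base_value :: "'a \<Rightarrow> real" where
  "base_value x = (LINT s|lborel. ref_bump s0 t0 s * (U_cut x s - primitive (W_cut x) s)) / (LINT s|lborel. ref_bump s0 t0 s)"

lemma base_value_measurable [measurable]: "base_value \<in> borel_measurable borel"
  unfolding base_value_def ref_bump_def by measurable

text \<open>The version of the solution that is absolutely continuous in time. It is modified only where a time
derivative is available; outside the ball the values enter through the tails, for which \<open>U1\<close> is good enough.\<close>

definition U_ac :: "real \<times> 'a \<Rightarrow> real" where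
  "U_ac z = (if fst z \<in> JJ \<and> snd z \<in> B then base_value (snd z) + primitive (W_cut (snd z)) (fst z) else U1 z)"

lemma U_ac_measurable [measurable]: "U_ac \<in> borel_measurable (borel \<Otimes>\<^sub>M borel)"
proof -
  have "U_ac = (\<lambda>z. indicator JJ (fst z) * indicator B (snd z) * (base_value (snd z) + primitive (W_cut (snd z)) (fst z))
     + (1 - indicator JJ (fst z) * indicator B (snd z)) * U1 z)"
    by (auto simp: U_ac_def indicator_def fun_eq_iff)
  also have "\<dots> \<in> borel_measurable (borel \<Otimes>\<^sub>M borel)" by measurable
  finally show ?thesis .
qed

lemma AE_integrable_section:
  fixes F :: "real \<times> 'a \<Rightarrow> real"
  assumes F [measurable]: "F \<in> borel_measurable (borel \<Otimes>\<^sub>M borel)"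
    and fin: "(\<integral>\<^sup>+t\<in>JJ. (\<integral>\<^sup>+x\<in>B. ennreal \<bar>F (t, x)\<bar> \<partial>lborel) \<partial>lborel) < \<infinity>"
  shows "AE x in lborel. x \<in> B \<longrightarrow> integrable lborel (\<lambda>s. indicator JJ s * F (s, x))"
proof -
  have "(\<integral>\<^sup>+x. (\<integral>\<^sup>+t. ennreal \<bar>F (t, x)\<bar> * indicator B x * indicator JJ t \<partial>lborel) \<partial>lborel)
     = (\<integral>\<^sup>+t. (\<integral>\<^sup>+x. ennreal \<bar>F (t, x)\<bar> * indicator B x * indicator JJ t \<partial>lborel) \<partial>lborel)"
    by (rule lborel_pair.Fubini'[where f="\<lambda>t x. ennreal \<bar>F (t, x)\<bar> * indicator B x * indicator JJ t"]) measurable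
  also have "\<dots> = (\<integral>\<^sup>+t\<in>JJ. (\<integral>\<^sup>+x\<in>B. ennreal \<bar>F (t, x)\<bar> \<partial>lborel) \<partial>lborel)"
    by (simp add: nn_integral_multc)
  finally have "(\<integral>\<^sup>+x. (\<integral>\<^sup>+t. ennreal \<bar>F (t, x)\<bar> * indicator B x * indicator JJ t \<partial>lborel) \<partial>lborel) \<noteq> \<infinity>" using fin by simp
  then have "AE x in lborel. (\<integral>\<^sup>+t. ennreal \<bar>F (t, x)\<bar> * indicator B x * indicator JJ t \<partial>lborel) \<noteq> \<infinity>"
    by (intro nn_integral_PInf_AE) auto
  then show ?thesis
  proof eventually_elim
    case (elim x)
    show ?case
    proof
      assume x: "x \<in> B"
      show "integrable lborel (\<lambda>s. indicator JJ s * F (s, x))"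
      proof (rule integrableI_bounded)
        have "(\<integral>\<^sup>+s. ennreal (norm (indicator JJ s * F (s, x))) \<partial>lborel) = (\<integral>\<^sup>+t. ennreal \<bar>F (t, x)\<bar> * indicator B x * indicator JJ t \<partial>lborel)"
          by (intro nn_integral_cong) (use x in \<open>auto simp: indicator_def\<close>)
        then show "(\<integral>\<^sup>+s. ennreal (norm (indicator JJ s * F (s, x))) \<partial>lborel) < \<infinity>" using elim by (simp add: less_top)
      qed measurable
    qed
  qed
qed

lemma U_cut_integrable: "AE x in lborel. x \<in> B \<longrightarrow> integrable lborel (U_cut x)"
proof -
  obtain C where C: "0 \<le> C" "AE t in lborel. t \<in> JJ \<longrightarrow> (\<integral>\<^sup>+x\<in>B. ennreal ((U1 (t, x))\<^sup>2) \<partial>lborel) \<le> ennreal C"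
    using U1_sq by blast
  have "(\<integral>\<^sup>+t\<in>JJ. (\<integral>\<^sup>+x\<in>B. ennreal \<bar>U1 (t, x)\<bar> \<partial>lborel) \<partial>lborel)
    \<le> (\<integral>\<^sup>+t\<in>JJ. (emeasure lborel B + ennreal C) \<partial>lborel)"
  proof (rule nn_integral_mono_AE)
    show "AE t in lborel. (\<integral>\<^sup>+x\<in>B. ennreal \<bar>U1 (t, x)\<bar> \<partial>lborel) * indicator JJ t \<le> (emeasure lborel B + ennreal C) * indicator JJ t"
      using C(2)
    proof eventually_elim
      case (elim t)
      have le: "(\<integral>\<^sup>+x\<in>B. ennreal \<bar>U1 (t, x)\<bar> \<partial>lborel) \<le> emeasure lborel B + (\<integral>\<^sup>+x\<in>B. ennreal ((U1 (t, x))\<^sup>2) \<partial>lborel)"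
        using nn_integral_le_square[of 1 "\<lambda>x. \<bar>U1 (t, x)\<bar>" lborel B] by simp
      show ?case
      proof (cases "t \<in> JJ")
        case True
        then have "(\<integral>\<^sup>+x\<in>B. ennreal ((U1 (t, x))\<^sup>2) \<partial>lborel) \<le> ennreal C" using elim by blast
        then have "emeasure lborel B + (\<integral>\<^sup>+x\<in>B. ennreal ((U1 (t, x))\<^sup>2) \<partial>lborel) \<le> emeasure lborel B + ennreal C"
          by (rule add_left_mono)
        with le have "(\<integral>\<^sup>+x\<in>B. ennreal \<bar>U1 (t, x)\<bar> \<partial>lborel) \<le> emeasure lborel B + ennreal C" by (rule order_trans)
        then show ?thesis by (rule mult_right_mono) simp
      qed simp
    qed
  qed
  also have "\<dots> < \<infinity>" using R s0t0 by (simp add: nn_integral_cmult_indicator emeasure_ball ennreal_mult_less_top)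
  finally show ?thesis using AE_integrable_section[OF U1_meas] by (simp add: U_cut_def[abs_def])
qed

lemma W_cut_integrable: "AE x in lborel. x \<in> B \<longrightarrow> integrable lborel (W_cut x)"
proof -
  have "(\<integral>\<^sup>+t\<in>JJ. (\<integral>\<^sup>+x\<in>B. ennreal \<bar>W1 (t, x)\<bar> \<partial>lborel) \<partial>lborel)
    \<le> (\<integral>\<^sup>+t. ennsqrt (emeasure lborel B) * (W_norm t * indicator JJ t) \<partial>lborel)"
  proof (rule nn_integral_mono)
    fix t
    have "(\<integral>\<^sup>+x\<in>B. ennreal \<bar>W1 (t, x)\<bar> \<partial>lborel) = (\<integral>\<^sup>+x. indicator B x * (ennreal \<bar>W1 (t, x)\<bar> * indicator B x) \<partial>lborel)"
      by (intro nn_integral_cong) (auto simp: indicator_def)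
    also have "\<dots> \<le> ennsqrt (\<integral>\<^sup>+x. (indicator B x)\<^sup>2 \<partial>lborel) * ennsqrt (\<integral>\<^sup>+x. (ennreal \<bar>W1 (t, x)\<bar> * indicator B x)\<^sup>2 \<partial>lborel)"
      by (rule Cauchy_Schwarz_ennsqrt) measurable
    also have "(\<integral>\<^sup>+x. (indicator B x)\<^sup>2 \<partial>(lborel :: 'a measure)) = emeasure lborel B"
    proof -
      have "(indicator B x)\<^sup>2 = (indicator B x :: ennreal)" for x by (cases "x \<in> B") auto
      then show ?thesis by simp
    qed
    also have "(\<integral>\<^sup>+x. (ennreal \<bar>W1 (t, x)\<bar> * indicator B x)\<^sup>2 \<partial>lborel) = (\<integral>\<^sup>+x\<in>B. ennreal ((W1 (t, x))\<^sup>2) \<partial>lborel)"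
      by (intro nn_integral_cong) (auto simp: indicator_def ennreal_power)
    finally have "(\<integral>\<^sup>+x\<in>B. ennreal \<bar>W1 (t, x)\<bar> \<partial>lborel) \<le> ennsqrt (emeasure lborel B) * W_norm t" by (simp add: W_norm_def)
    then show "(\<integral>\<^sup>+x\<in>B. ennreal \<bar>W1 (t, x)\<bar> \<partial>lborel) * indicator JJ t \<le> ennsqrt (emeasure lborel B) * (W_norm t * indicator JJ t)"
      by (simp add: mult_right_mono mult.assoc[symmetric])
  qed
  also have "\<dots> = ennsqrt (emeasure lborel B) * (\<integral>\<^sup>+t\<in>JJ. W_norm t \<partial>lborel)" by (rule nn_integral_cmult) measurable
  also have "\<dots> < \<infinity>" using W_norm_integral R ennsqrt_finite[of "emeasure lborel B"] by (simp add: ennreal_mult_less_top emeasure_ball)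
  finally show ?thesis using AE_integrable_section[OF W1_meas] by (simp add: W_cut_def[abs_def])
qed

lemma test_functions_mono: "test_functions {s0<..<t0} \<subseteq> test_functions I"
proof -
  have "{s0<..<t0} \<subseteq> I" using J greaterThanLessThan_subseteq_atLeastAtMost_iff[of s0 t0 s0 t0] by auto
  then show ?thesis unfolding test_functions_def by blast
qed

text \<open>One null set of points \<open>x\<close> for all test functions of the countable family.\<close>

lemma weak_identity: "AE x in lborel. x \<in> B \<longrightarrow> (\<forall>\<eta>\<in>test_family s0 t0.
    (LINT t|lborel. deriv \<eta> t * U_cut x t) = - (LINT t|lborel. \<eta> t * W_cut x t))"
proof -
  have "\<forall>\<eta>\<in>test_family s0 t0. AE x in lborel. x \<in> \<Omega> \<longrightarrow> (LINT t:I|lebesgue. deriv \<eta> t * u t x) = - (LINT t:I|lebesgue. \<eta> t * w t x)"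
    using u_w test_family_test_functions[OF s0t0] test_functions_mono unfolding weak_time_deriv_def by (auto simp: AE_completion_iff)
  then have "AE x in lborel. \<forall>\<eta>\<in>test_family s0 t0. x \<in> \<Omega> \<longrightarrow> (LINT t:I|lebesgue. deriv \<eta> t * u t x) = - (LINT t:I|lebesgue. \<eta> t * w t x)"
    by (subst AE_ball_countable[OF test_family_countable])
  then show ?thesis
    using U1_space W1_space
  proof eventually_elim
    case (elim x)
    show ?case
    proof (intro impI ballI)
      fix \<eta> assume x: "x \<in> B" and \<eta>: "\<eta> \<in> test_family s0 t0"
      have x\<Omega>: "x \<in> \<Omega>" using x ball_subset by auto
      note v = test_family_vanish[OF s0t0 \<eta>]
      note [measurable] = v(3,4)
      have in_J: "t \<in> JJ" if "\<eta> t \<noteq> 0 \<or> deriv \<eta> t \<noteq> 0" for t using v(1,2)[of t] that by force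
      have "(LINT t:I|lebesgue. deriv \<eta> t * u t x) = (LINT t|lborel. deriv \<eta> t * U_cut x t)"
        unfolding set_lebesgue_integral_def
      proof (rule integral_lebesgue_AE)
        show "AE t in lborel. indicator I t *\<^sub>R (deriv \<eta> t * u t x) = deriv \<eta> t * U_cut x t"
          using elim(2)
        proof eventually_elim
          case (elim t)
          then show ?case using in_J[of t] J by (cases "deriv \<eta> t = 0") (auto simp: U_cut_def)
        qed
      qed measurable
      moreover have "(LINT t:I|lebesgue. \<eta> t * w t x) = (LINT t|lborel. \<eta> t * W_cut x t)"
        unfolding set_lebesgue_integral_def
      proof (rule integral_lebesgue_AE)
        have "AE t in lborel. t \<in> I \<longrightarrow> w t x = W1 (t, x)" using elim x\<Omega> by blast
        then show "AE t in lborel. indicator I t *\<^sub>R (\<eta> t * w t x) = \<eta> t * W_cut x t"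
        proof eventually_elim
          case (elim t)
          then show ?case using in_J[of t] J by (cases "\<eta> t = 0") (auto simp: W_cut_def)
        qed
      qed measurable
      ultimately show "(LINT t|lborel. deriv \<eta> t * U_cut x t) = - (LINT t|lborel. \<eta> t * W_cut x t)"
        using elim(1) \<eta> x\<Omega> by auto
    qed
  qed
qed

text \<open>For almost every \<open>x\<close> the two versions agree at almost every time, by the du Bois-Reymond lemma; Fubini's theorem
exchanges the quantifiers.\<close>

lemma U_ac_AE: "AE t in lborel. AE x in lborel. U_ac (t, x) = U1 (t, x)"
proof -
  have "AE x in lborel. AE t in lborel. U_ac (t, x) = U1 (t, x)"
    using weak_identity U_cut_integrable W_cut_integrable
  proof eventually_elim
    case (elim x)
    show ?case
    proof (cases "x \<in> B")
      case True
      have "AE t in lborel. t \<in> {s0<..<t0} \<longrightarrow> U_cut x t = base_value x + primitive (W_cut x) t"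
        unfolding base_value_def using elim True by (intro weak_derivative_imp_primitive[OF s0t0]) auto
      then show ?thesis
        using AE_lborel_singleton[of s0] AE_lborel_singleton[of t0]
      proof eventually_elim
        case (elim t)
        then show ?case using True by (auto simp: U_ac_def U_cut_def)
      qed
    qed (simp add: U_ac_def)
  qed
  moreover have "(AE t in lborel. AE x in lborel. U_ac (t, x) = U1 (t, x)) \<longleftrightarrow> (AE x in lborel. AE t in lborel. U_ac (t, x) = U1 (t, x))"
    by (rule lborel_pair.AE_commute) measurable
  ultimately show ?thesis by blast
qed

lemma U_ac_primitive: "AE x in lborel. x \<in> B \<longrightarrow> integrable lborel (\<lambda>s. indicator JJ s * W1 (s, x)) \<and>
      (\<forall>t\<in>JJ. U_ac (t, x) = U_ac (s0, x) + primitive (\<lambda>s. indicator JJ s * W1 (s, x)) t)"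
  using W_cut_integrable
proof eventually_elim
  case (elim x)
  have "(\<lambda>s. indicator {..<s0} s * W_cut x s) = (\<lambda>s. 0)" by (auto simp: W_cut_def indicator_def)
  then have p0: "primitive (W_cut x) s0 = 0" unfolding primitive_def by simp
  have W: "W_cut x = (\<lambda>s. indicator JJ s * W1 (s, x))" by (simp add: W_cut_def[abs_def])
  show ?case
    using elim p0 s0t0 by (auto simp: U_ac_def W[symmetric])
qed

lemma U_ac_nn_integral_cong:
  assumes "AE x in lborel. U_ac (t, x) = U1 (t, x)"
  shows "(\<integral>\<^sup>+x. ennreal (F (U_ac (t, x)) x) * c x \<partial>lborel) = (\<integral>\<^sup>+x. ennreal (F (U1 (t, x)) x) * c x \<partial>lborel)"
  using assms by (intro nn_integral_cong_AE) (auto elim!: eventually_mono)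

lemma U_ac_static: "AE t in lborel. t \<in> JJ \<longrightarrow> static_energy \<alpha> R x0 (\<lambda>x. U_ac (t, x))"
proof -
  obtain C where C: "0 \<le> C" "AE t in lborel. t \<in> JJ \<longrightarrow> (\<integral>\<^sup>+x\<in>B. ennreal ((U1 (t, x))\<^sup>2) \<partial>lborel) \<le> ennreal C"
    using U1_sq by blast
  have "AE t in lborel. (\<integral>\<^sup>+y\<in>- B. ennreal (\<bar>U1 (t, y)\<bar> * riesz_kernel \<alpha> (x0 - y)) \<partial>lborel) * indicator JJ t \<noteq> \<infinity>"
    using U1_tail[OF R] by (intro nn_integral_PInf_AE) auto
  then show ?thesis
    using C(2) U1_fractional U_ac_AE
  proof eventually_elim
    case (elim t)
    show ?case
    proof
      assume t: "t \<in> JJ"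
      note cong = U_ac_nn_integral_cong[OF elim(4)]
      show "static_energy \<alpha> R x0 (\<lambda>x. U_ac (t, x))"
      proof
        show "0 < \<alpha>" "\<alpha> < 2" "0 < R" using \<alpha> R by auto
        show "(\<lambda>x. U_ac (t, x)) \<in> borel_measurable borel" by measurable
        show "(\<integral>\<^sup>+x\<in>B. ennreal ((U_ac (t, x))\<^sup>2) \<partial>lborel) < \<infinity>"
          unfolding cong[of "\<lambda>v x. v\<^sup>2"] using elim(2) t by (auto intro: le_less_trans)
        show "(\<integral>\<^sup>+y\<in>- B. ennreal (\<bar>U_ac (t, y)\<bar> * riesz_kernel \<alpha> (x0 - y)) \<partial>lborel) < \<infinity>"
          unfolding cong[of "\<lambda>v y. \<bar>v\<bar> * riesz_kernel \<alpha> (x0 - y)"] using elim(1) t by (simp add: less_top)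
        have "(\<integral>\<^sup>+x. \<integral>\<^sup>+y. ennreal ((U_ac (t, x) - U_ac (t, y))\<^sup>2 * riesz_kernel \<alpha> (x - y)) * indicator B x * indicator B y \<partial>lborel \<partial>lborel)
          = (\<integral>\<^sup>+x. \<integral>\<^sup>+y. ennreal ((U1 (t, x) - U1 (t, y))\<^sup>2 * riesz_kernel \<alpha> (x - y)) * indicator B x * indicator B y \<partial>lborel \<partial>lborel)"
          using elim(4)
        proof (intro nn_integral_cong_AE, eventually_elim)
          case (elim x)
          show ?case using \<open>AE x in lborel. U_ac (t, x) = U1 (t, x)\<close>
          proof (intro nn_integral_cong_AE, eventually_elim)
            case (elim y)
            then show ?case using \<open>U_ac (t, x) = U1 (t, x)\<close> by simp
          qed
        qed
        also have "\<dots> < \<infinity>" using elim(3) t by blast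
        finally show "(\<integral>\<^sup>+x. \<integral>\<^sup>+y. ennreal ((U_ac (t, x) - U_ac (t, y))\<^sup>2 * riesz_kernel \<alpha> (x - y)) * indicator B x * indicator B y \<partial>lborel \<partial>lborel) < \<infinity>" .
      qed
    qed
  qed
qed

lemma U_ac_sq: "\<exists>C. AE t in lborel. t \<in> JJ \<longrightarrow> (\<integral>\<^sup>+x\<in>B. ennreal ((U_ac (t, x))\<^sup>2) \<partial>lborel) \<le> ennreal C"
proof -
  obtain C where C: "0 \<le> C" "AE t in lborel. t \<in> JJ \<longrightarrow> (\<integral>\<^sup>+x\<in>B. ennreal ((U1 (t, x))\<^sup>2) \<partial>lborel) \<le> ennreal C"
    using U1_sq by blast
  show ?thesis
    by (rule exI[of _ C], use C(2) U_ac_AE in eventually_elim) (use U_ac_nn_integral_cong[of _ "\<lambda>v x. v\<^sup>2"] in auto)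
qed

lemma U_ac_W_L1: "(\<integral>\<^sup>+t\<in>JJ. (\<integral>\<^sup>+x\<in>B. ennreal (\<bar>U_ac (t, x)\<bar> * \<bar>W1 (t, x)\<bar>) \<partial>lborel) \<partial>lborel) < \<infinity>"
proof -
  obtain C where C: "0 \<le> C" "AE t in lborel. t \<in> JJ \<longrightarrow> (\<integral>\<^sup>+x\<in>B. ennreal ((U1 (t, x))\<^sup>2) \<partial>lborel) \<le> ennreal C"
    using U1_sq by blast
  have "(\<integral>\<^sup>+t\<in>JJ. (\<integral>\<^sup>+x\<in>B. ennreal (\<bar>U_ac (t, x)\<bar> * \<bar>W1 (t, x)\<bar>) \<partial>lborel) \<partial>lborel)
    \<le> (\<integral>\<^sup>+t. ennsqrt (ennreal C) * (W_norm t * indicator JJ t) \<partial>lborel)"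
  proof (rule nn_integral_mono_AE)
    show "AE t in lborel. (\<integral>\<^sup>+x\<in>B. ennreal (\<bar>U_ac (t, x)\<bar> * \<bar>W1 (t, x)\<bar>) \<partial>lborel) * indicator JJ t \<le> ennsqrt (ennreal C) * (W_norm t * indicator JJ t)"
      using C(2) U_ac_AE
    proof eventually_elim
      case (elim t)
      show ?case
      proof (cases "t \<in> JJ")
        case True
        have "(\<integral>\<^sup>+x\<in>B. ennreal (\<bar>U_ac (t, x)\<bar> * \<bar>W1 (t, x)\<bar>) \<partial>lborel) = (\<integral>\<^sup>+x\<in>B. ennreal (\<bar>U1 (t, x)\<bar> * \<bar>W1 (t, x)\<bar>) \<partial>lborel)"
          by (rule U_ac_nn_integral_cong[OF elim(2), of "\<lambda>v x. \<bar>v\<bar> * \<bar>W1 (t, x)\<bar>"])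
        also have "\<dots> = (\<integral>\<^sup>+x. (ennreal \<bar>U1 (t, x)\<bar> * indicator B x) * (ennreal \<bar>W1 (t, x)\<bar> * indicator B x) \<partial>lborel)"
          by (intro nn_integral_cong) (auto simp: indicator_def ennreal_mult)
        also have "\<dots> \<le> ennsqrt (\<integral>\<^sup>+x. (ennreal \<bar>U1 (t, x)\<bar> * indicator B x)\<^sup>2 \<partial>lborel) * ennsqrt (\<integral>\<^sup>+x. (ennreal \<bar>W1 (t, x)\<bar> * indicator B x)\<^sup>2 \<partial>lborel)"
          by (rule Cauchy_Schwarz_ennsqrt) measurable
        also have "(\<integral>\<^sup>+x. (ennreal \<bar>U1 (t, x)\<bar> * indicator B x)\<^sup>2 \<partial>lborel) = (\<integral>\<^sup>+x\<in>B. ennreal ((U1 (t, x))\<^sup>2) \<partial>lborel)"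
          by (intro nn_integral_cong) (auto simp: indicator_def ennreal_power)
        also have "(\<integral>\<^sup>+x. (ennreal \<bar>W1 (t, x)\<bar> * indicator B x)\<^sup>2 \<partial>lborel) = (\<integral>\<^sup>+x\<in>B. ennreal ((W1 (t, x))\<^sup>2) \<partial>lborel)"
          by (intro nn_integral_cong) (auto simp: indicator_def ennreal_power)
        also have "ennsqrt (\<integral>\<^sup>+x\<in>B. ennreal ((U1 (t, x))\<^sup>2) \<partial>lborel) \<le> ennsqrt (ennreal C)"
          using elim True by (intro ennsqrt_mono) blast
        finally show ?thesis using True by (simp add: W_norm_def mult_right_mono)
      qed simp
    qed
  qed
  also have "\<dots> = ennsqrt (ennreal C) * (\<integral>\<^sup>+t\<in>JJ. W_norm t \<partial>lborel)" by (rule nn_integral_cmult) measurable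
  also have "\<dots> < \<infinity>" using W_norm_integral ennsqrt_finite[of "ennreal C"] by (simp add: ennreal_mult_less_top)
  finally show ?thesis .
qed

lemma U_ac_tail:
  assumes "0 < r"
  shows "(\<integral>\<^sup>+t\<in>JJ. (\<integral>\<^sup>+y\<in>- ball x0 r. ennreal (\<bar>U_ac (t, y)\<bar> * riesz_kernel \<alpha> (x0 - y)) \<partial>lborel) \<partial>lborel) < \<infinity>"
proof -
  have "(\<integral>\<^sup>+t\<in>JJ. (\<integral>\<^sup>+y\<in>- ball x0 r. ennreal (\<bar>U_ac (t, y)\<bar> * riesz_kernel \<alpha> (x0 - y)) \<partial>lborel) \<partial>lborel)
    = (\<integral>\<^sup>+t\<in>JJ. (\<integral>\<^sup>+y\<in>- ball x0 r. ennreal (\<bar>U1 (t, y)\<bar> * riesz_kernel \<alpha> (x0 - y)) \<partial>lborel) \<partial>lborel)"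
  proof (rule nn_integral_cong_AE)
    show "AE t in lborel. (\<integral>\<^sup>+y\<in>- ball x0 r. ennreal (\<bar>U_ac (t, y)\<bar> * riesz_kernel \<alpha> (x0 - y)) \<partial>lborel) * indicator JJ t
      = (\<integral>\<^sup>+y\<in>- ball x0 r. ennreal (\<bar>U1 (t, y)\<bar> * riesz_kernel \<alpha> (x0 - y)) \<partial>lborel) * indicator JJ t"
      using U_ac_AE
    proof eventually_elim
      case (elim t)
      show ?case unfolding U_ac_nn_integral_cong[OF elim, of "\<lambda>v y. \<bar>v\<bar> * riesz_kernel \<alpha> (x0 - y)"] ..
    qed
  qed
  with U1_tail[OF assms] show ?thesis by simp
qed

end

section \<open>The supremum bound\<close>

text \<open>Turns the smallness condition of \<open>local_bound\<close> into \<open>M\<^sup>2 \<ge> sup_const * D / (R powr \<alpha> * R ^ d)\<close>, where \<open>D\<close> is the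
space-time integral of \<open>(U\<^sub>+)\<^sup>2\<close>.\<close>

definition sup_const :: "nat \<Rightarrow> real \<Rightarrow> real \<Rightarrow> real \<Rightarrow> real" where
  "sup_const d \<alpha>0 lam Lam = start_const d \<alpha>0 lam Lam / small_const d \<alpha>0 lam Lam"

text \<open>This is \<open>height_coeff / (2 - \<alpha>)\<close>.\<close>

definition tail_const :: "nat \<Rightarrow> real \<Rightarrow> real" where
  "tail_const d Lam = 2 * Lam * 8 ^ (d + 2)"

text \<open>One \<open>M\<close> comes from the level in \<open>local_bound\<close>, the rest from the part of the tail between the radii \<open>3 R / 4\<close> and
\<open>R\<close> that \<open>height_bound\<close> controls by \<open>M\<close>.\<close>

definition mean_const :: "nat \<Rightarrow> real \<Rightarrow> real \<Rightarrow> real \<Rightarrow> real" where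
  "mean_const d \<alpha>0 lam Lam = 1 + tail_const d Lam * (2 * 2 ^ (d + 2) * (unit_ball_vol (real d) + 1 / sup_const d \<alpha>0 lam Lam))"

context evolution
begin

text \<open>The level rises by the tail outside \<open>ball x0 (3 * R / 4)\<close>. Outside \<open>ball x0 R\<close> this is the tail in the theorem; in between, the
kernel is bounded by \<open>P\<close>, and \<open>le_add_square\<close> with the level \<open>M\<close> as its parameter reduces the \<open>L\<^sup>1\<close> norm to the integral \<open>D\<close> of the square,
which is at most \<open>M\<^sup>2\<close> times the volume of the cylinder, up to a constant.\<close>

lemma height_bound:
  assumes len: "b - a = R powr \<alpha>" and M: "0 < M" and C: "0 < C"
    and D: "0 \<le> D" "(\<integral>\<^sup>+\<tau>\<in>{a..<b}. (\<integral>\<^sup>+x\<in>ball x0 R. ennreal ((max (U (\<tau>, x)) 0)\<^sup>2) \<partial>lborel) \<partial>lborel) \<le> ennreal D"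
    and MD: "C * (R powr (- \<alpha>) * D) \<le> M\<^sup>2 * R ^ DIM('a)"
    and T: "0 \<le> T" "(\<integral>\<^sup>+\<tau>\<in>{a..b}. (\<integral>\<^sup>+y\<in>- ball x0 R. ennreal (max (U (\<tau>, y)) 0 * riesz_kernel \<alpha> (x0 - y)) \<partial>lborel) \<partial>lborel) \<le> ennreal T"
  shows "height t \<le> tail_const DIM('a) Lam * ((2 - \<alpha>) * T + 2 * 2 ^ (DIM('a) + 2) * (unit_ball_vol DIM('a) + 1 / C) * M)"
proof -
  let ?B = "ball x0 R"
  define P where "P = (3 * R / 4) powr (- (real DIM('a) + \<alpha>))"
  have P: "0 \<le> P" by (simp add: P_def)
  define V where "V = unit_ball_vol DIM('a) * R ^ DIM('a) * R powr \<alpha>"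
  have V: "0 \<le> V" using R by (simp add: V_def)
  let ?far = "\<lambda>\<tau>. \<integral>\<^sup>+y. ennreal (max (U (\<tau>, y)) 0 * riesz_kernel \<alpha> (x0 - y)) * indicator (- ?B) y \<partial>lborel"
  let ?sq = "\<lambda>\<tau>. \<integral>\<^sup>+x. ennreal ((max (U (\<tau>, x)) 0)\<^sup>2) * indicator ?B x \<partial>lborel"
  have ot: "outer_tail \<tau> \<le> ?far \<tau> + ennreal P * (ennreal M * emeasure lborel ?B + ennreal (1 / M) * ?sq \<tau>)" for \<tau>
  proof -
    have "outer_tail \<tau> \<le> (\<integral>\<^sup>+y. ennreal (max (U (\<tau>, y)) 0 * riesz_kernel \<alpha> (x0 - y)) * indicator (- ?B) y
        + ennreal P * (ennreal M * indicator ?B y + ennreal (1 / M) * (ennreal ((max (U (\<tau>, y)) 0)\<^sup>2) * indicator ?B y)) \<partial>lborel)"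
      unfolding outer_tail_def
    proof (rule nn_integral_mono)
      fix y
      define e where "e = max (U (\<tau>, y)) 0"
      have e: "0 \<le> e" by (simp add: e_def)
      show "ennreal (max (U (\<tau>, y)) 0 * riesz_kernel \<alpha> (x0 - y)) * indicator (- ball x0 (3 * R / 4)) y
        \<le> ennreal (max (U (\<tau>, y)) 0 * riesz_kernel \<alpha> (x0 - y)) * indicator (- ?B) y
        + ennreal P * (ennreal M * indicator ?B y + ennreal (1 / M) * (ennreal ((max (U (\<tau>, y)) 0)\<^sup>2) * indicator ?B y))"
        unfolding e_def[symmetric]
      proof (cases "y \<in> ?B")
        case False
        then show "ennreal (e * riesz_kernel \<alpha> (x0 - y)) * indicator (- ball x0 (3 * R / 4)) y
          \<le> ennreal (e * riesz_kernel \<alpha> (x0 - y)) * indicator (- ?B) y + ennreal P * (ennreal M * indicator ?B y + ennreal (1 / M) * (ennreal (e\<^sup>2) * indicator ?B y))"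
          by (auto simp: indicator_def)
      next
        case True
        show "ennreal (e * riesz_kernel \<alpha> (x0 - y)) * indicator (- ball x0 (3 * R / 4)) y
          \<le> ennreal (e * riesz_kernel \<alpha> (x0 - y)) * indicator (- ?B) y + ennreal P * (ennreal M * indicator ?B y + ennreal (1 / M) * (ennreal (e\<^sup>2) * indicator ?B y))"
        proof (cases "y \<in> ball x0 (3 * R / 4)")
          case False
          have "riesz_kernel \<alpha> (x0 - y) \<le> P"
            unfolding P_def riesz_kernel_def using False R \<alpha> by (intro powr_mono_base_neg) (auto simp: dist_norm)
          then have "e * riesz_kernel \<alpha> (x0 - y) \<le> e * P" using e by (rule mult_left_mono)
          also have "e \<le> M + 1 / M * e\<^sup>2" by (rule le_add_square[OF M])
          then have "e * P \<le> P * (M + 1 / M * e\<^sup>2)" using P by (metis mult.commute mult_left_mono)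
          finally have "ennreal (e * riesz_kernel \<alpha> (x0 - y)) \<le> ennreal (P * (M + 1 / M * e\<^sup>2))" by (rule ennreal_leI)
          also have "\<dots> = ennreal P * (ennreal M + ennreal (1 / M) * ennreal (e\<^sup>2))"
            using P M by (simp add: ennreal_mult[symmetric] ennreal_plus[symmetric] del: ennreal_plus)
          finally show ?thesis using True False by simp
        qed simp
      qed
    qed
    also have "\<dots> = ?far \<tau> + ennreal P * (ennreal M * emeasure lborel ?B + ennreal (1 / M) * ?sq \<tau>)"
      by (simp add: nn_integral_add nn_integral_cmult nn_integral_cmult_indicator)
    finally show ?thesis .
  qed
  have sq: "(\<integral>\<^sup>+\<tau>\<in>{a..b}. ?sq \<tau> \<partial>lborel) \<le> ennreal D"
  proof -
    have "(\<integral>\<^sup>+\<tau>\<in>{a..b}. ?sq \<tau> \<partial>lborel) = (\<integral>\<^sup>+\<tau>\<in>{a..<b}. ?sq \<tau> \<partial>lborel)"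
    proof (rule nn_integral_cong_AE)
      show "AE \<tau> in lborel. ?sq \<tau> * indicator {a..b} \<tau> = ?sq \<tau> * indicator {a..<b} \<tau>"
        using AE_lborel_singleton[of b] by eventually_elim (auto simp: indicator_def)
    qed
    with D(2) show ?thesis by simp
  qed
  have "(\<integral>\<^sup>+\<tau>\<in>{a..b}. outer_tail \<tau> \<partial>lborel)
    \<le> (\<integral>\<^sup>+\<tau>. ?far \<tau> * indicator {a..b} \<tau> + ennreal P * (ennreal M * emeasure lborel ?B * indicator {a..b} \<tau> + ennreal (1 / M) * (?sq \<tau> * indicator {a..b} \<tau>)) \<partial>lborel)"
    using ot by (intro nn_integral_mono) (auto simp: indicator_def)
  also have "\<dots> = (\<integral>\<^sup>+\<tau>\<in>{a..b}. ?far \<tau> \<partial>lborel) + ennreal P * (ennreal M * emeasure lborel ?B * ennreal (b - a) + ennreal (1 / M) * (\<integral>\<^sup>+\<tau>\<in>{a..b}. ?sq \<tau> \<partial>lborel))"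
    using ab by (simp add: nn_integral_add nn_integral_cmult nn_integral_cmult_indicator)
  also have "\<dots> \<le> ennreal T + ennreal P * (ennreal M * emeasure lborel ?B * ennreal (b - a) + ennreal (1 / M) * ennreal D)"
    by (intro add_mono mult_left_mono T sq) auto
  also have "emeasure lborel ?B = ennreal (unit_ball_vol DIM('a) * R ^ DIM('a))" using R by (simp add: emeasure_ball)
  also have "ennreal M * ennreal (unit_ball_vol DIM('a) * R ^ DIM('a)) * ennreal (b - a) = ennreal (M * V)"
    unfolding len V_def using M R by (simp add: ennreal_mult[symmetric] mult.assoc)
  also have "ennreal T + ennreal P * (ennreal (M * V) + ennreal (1 / M) * ennreal D) = ennreal (T + P * (M * V + 1 / M * D))"
    using T P M V D by (simp add: ennreal_mult[symmetric] ennreal_plus[symmetric] del: ennreal_plus)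
  finally have o: "(\<integral>\<^sup>+\<tau>\<in>{a..b}. outer_tail \<tau> \<partial>lborel) \<le> ennreal (T + P * (M * V + 1 / M * D))" .
  have nn: "0 \<le> T + P * (M * V + 1 / M * D)" using T P M V D by simp
  have "ennreal (height t) \<le> ennreal height_coeff * ennreal (T + P * (M * V + 1 / M * D))"
    by (rule order_trans[OF height_le]) (intro mult_left_mono o, simp)
  also have "\<dots> = ennreal (height_coeff * (T + P * (M * V + 1 / M * D)))"
    using nn height_coeff_pos by (simp add: ennreal_mult[symmetric])
  finally have h: "height t \<le> height_coeff * (T + P * (M * V + 1 / M * D))"
    using nn height_coeff_pos by (subst (asm) ennreal_le_iff) auto
  define Rd where "Rd = R ^ DIM('a) * R powr \<alpha>"
  have Rd: "0 < Rd" using R by (simp add: Rd_def)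
  have DM: "1 / M * D \<le> 1 / C * M * Rd"
  proof -
    have "C * D = C * (R powr (- \<alpha>) * D) * R powr \<alpha>" using R by (simp add: powr_minus)
    also have "\<dots> \<le> M\<^sup>2 * R ^ DIM('a) * R powr \<alpha>" using MD by (intro mult_right_mono) auto
    finally have "C * D \<le> M * M * Rd" by (simp add: Rd_def power2_eq_square mult.assoc)
    then show ?thesis using M C by (simp add: field_simps)
  qed
  (* the largest value of the kernel on the annulus times the volume scale of the cylinder *)
  have PR: "P * Rd \<le> 2 ^ (DIM('a) + 2)"
  proof -
    have "Rd = R powr (real DIM('a) + \<alpha>)" using R by (simp add: Rd_def powr_add powr_realpow)
    moreover have "P = (4 / 3) powr (real DIM('a) + \<alpha>) * R powr (- (real DIM('a) + \<alpha>))"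
    proof -
      have "P = inverse ((3 * R / 4) powr (real DIM('a) + \<alpha>))" unfolding P_def by (rule powr_minus)
      also have "(3 * R / 4) powr (real DIM('a) + \<alpha>) = (3 / 4 * R) powr (real DIM('a) + \<alpha>)" by simp
      also have "\<dots> = (3 / 4) powr (real DIM('a) + \<alpha>) * R powr (real DIM('a) + \<alpha>)" by (rule powr_mult)
      also have "inverse \<dots> = inverse ((3 / 4) powr (real DIM('a) + \<alpha>)) * inverse (R powr (real DIM('a) + \<alpha>))" by (rule inverse_mult_distrib)
      also have "inverse ((3 / 4) powr (real DIM('a) + \<alpha>)) = (4 / 3) powr (real DIM('a) + \<alpha>)" by (simp add: inverse_powr[symmetric])
      also have "inverse (R powr (real DIM('a) + \<alpha>)) = R powr (- (real DIM('a) + \<alpha>))" by (rule powr_minus[symmetric])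
      finally show ?thesis .
    qed
    moreover have "R powr (- (real DIM('a) + \<alpha>)) * R powr (real DIM('a) + \<alpha>) = 1" using R unfolding powr_add[symmetric] by simp
    ultimately have "P * Rd = (4 / 3) powr (real DIM('a) + \<alpha>)" by simp
    also have "\<dots> \<le> 2 powr (real DIM('a) + \<alpha>)" using \<alpha> by (intro powr_mono2) auto
    also have "\<dots> \<le> 2 powr (real (DIM('a) + 2))" using \<alpha> by (intro powr_mono) auto
    also have "\<dots> = 2 ^ (DIM('a) + 2)" by (rule powr_realpow) simp
    finally show ?thesis .
  qed
  define m where "m = (unit_ball_vol DIM('a) + 1 / C) * M"
  have m: "0 \<le> m" using C M by (simp add: m_def)
  have "P * (M * V + 1 / M * D) \<le> P * (M * V + 1 / C * M * Rd)" using DM P by (intro mult_left_mono add_left_mono)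
  also have "\<dots> = (P * Rd) * m" by (simp add: V_def Rd_def m_def algebra_simps)
  also have "\<dots> \<le> 2 ^ (DIM('a) + 2) * m" using PR m by (rule mult_right_mono)
  finally have PP: "P * (M * V + 1 / M * D) \<le> 2 ^ (DIM('a) + 2) * m" .
  have dist: "2 * Lam * (2 - \<alpha>) * 8 ^ (DIM('a) + 2) * (T + X) = 2 * Lam * 8 ^ (DIM('a) + 2) * ((2 - \<alpha>) * T + (2 - \<alpha>) * X)" for X
    by (simp only: ring_distribs mult_ac)
  have "height_coeff * (T + P * (M * V + 1 / M * D)) = tail_const DIM('a) Lam * ((2 - \<alpha>) * T + (2 - \<alpha>) * (P * (M * V + 1 / M * D)))"
    unfolding height_coeff_def tail_const_def by (rule dist)
  also have "\<dots> \<le> tail_const DIM('a) Lam * ((2 - \<alpha>) * T + 2 * (2 ^ (DIM('a) + 2) * m))"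
    using \<alpha> lam P M V D by (intro mult_left_mono add_left_mono mult_mono[OF _ PP]) (auto simp: tail_const_def)
  finally show ?thesis using h by (simp add: m_def mult.assoc)
qed

text \<open>The smallest \<open>M\<close> admitted by \<open>local_bound\<close> is the root mean square \<open>m\<close>, up to a constant. It may be \<open>0\<close>,
while \<open>local_bound\<close> asks for a positive level; so \<open>M\<close> tends to \<open>m\<close> from above.\<close>

lemma sup_bound:
  assumes \<alpha>0: "0 < \<alpha>0" "\<alpha>0 \<le> \<alpha>" and len: "b - a = R powr \<alpha>"
    and D: "0 \<le> D" "(\<integral>\<^sup>+\<tau>\<in>{a..<b}. (\<integral>\<^sup>+x\<in>ball x0 R. ennreal ((max (U (\<tau>, x)) 0)\<^sup>2) \<partial>lborel) \<partial>lborel) \<le> ennreal D"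
    and T: "0 \<le> T" "(\<integral>\<^sup>+\<tau>\<in>{a..b}. (\<integral>\<^sup>+y\<in>- ball x0 R. ennreal (max (U (\<tau>, y)) 0 * riesz_kernel \<alpha> (x0 - y)) \<partial>lborel) \<partial>lborel) \<le> ennreal T"
    and t: "t \<in> {b - (R / 2) powr \<alpha>..b}"
  shows "AE x in lborel. x \<in> ball x0 (R / 2) \<longrightarrow>
     U (t, x) \<le> mean_const DIM('a) \<alpha>0 lam Lam * sqrt (sup_const DIM('a) \<alpha>0 lam Lam * (D / (R powr \<alpha> * R ^ DIM('a))))
        + tail_const DIM('a) Lam * ((2 - \<alpha>) * T)"
proof -
  define C where "C = sup_const DIM('a) \<alpha>0 lam Lam"
  note cp = const_pos[OF \<alpha>0(1) lam, where d="DIM('a)"]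
  have C: "0 < C" using cp by (simp add: C_def sup_const_def)
  define m where "m = sqrt (C * (D / (R powr \<alpha> * R ^ DIM('a))))"
  have m: "0 \<le> m" using C D R by (simp add: m_def)
  have one: "AE x in lborel. x \<in> ball x0 (R / 2) \<longrightarrow> U (t, x) \<le> mean_const DIM('a) \<alpha>0 lam Lam * (m + 1 / real (Suc n)) + tail_const DIM('a) Lam * ((2 - \<alpha>) * T)" for n
  proof -
    define M where "M = m + 1 / real (Suc n)"
    have M: "0 < M" "m \<le> M" using m by (auto simp: M_def add_nonneg_pos)
    have "m\<^sup>2 \<le> M\<^sup>2" using M m by (intro power_mono) auto
    then have "C * (D / (R powr \<alpha> * R ^ DIM('a))) * R ^ DIM('a) \<le> M\<^sup>2 * R ^ DIM('a)"
      using C D R by (intro mult_right_mono) (auto simp: m_def)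
    then have MD: "C * (R powr (- \<alpha>) * D) \<le> M\<^sup>2 * R ^ DIM('a)" using R by (simp add: powr_minus field_simps)
    have sm: "0 < small_const DIM('a) \<alpha>0 lam Lam" using cp by simp
    have "small_const DIM('a) \<alpha>0 lam Lam * (C * (R powr (- \<alpha>) * D)) \<le> small_const DIM('a) \<alpha>0 lam Lam * (M\<^sup>2 * R ^ DIM('a))"
      using MD sm by (intro mult_left_mono) auto
    moreover have "small_const DIM('a) \<alpha>0 lam Lam * C = start_const DIM('a) \<alpha>0 lam Lam" using sm by (simp add: C_def sup_const_def)
    ultimately have MD': "start_const DIM('a) \<alpha>0 lam Lam * (R powr (- \<alpha>) * D) \<le> small_const DIM('a) \<alpha>0 lam Lam * M\<^sup>2 * R ^ DIM('a)"
      by (simp add: mult.assoc[symmetric])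
    have h: "M + height t \<le> mean_const DIM('a) \<alpha>0 lam Lam * M + tail_const DIM('a) Lam * ((2 - \<alpha>) * T)"
      using height_bound[OF len M(1) C D MD T, of t] unfolding mean_const_def C_def[symmetric] by (simp add: algebra_simps)
    show ?thesis
      using local_bound[OF \<alpha>0 len M(1) D MD' t] unfolding M_def[symmetric]
      by eventually_elim (use h in linarith)
  qed
  then have "AE x in lborel. \<forall>n. x \<in> ball x0 (R / 2) \<longrightarrow> U (t, x) \<le> mean_const DIM('a) \<alpha>0 lam Lam * (m + 1 / real (Suc n)) + tail_const DIM('a) Lam * ((2 - \<alpha>) * T)"
    by (simp only: AE_all_countable) blast
  then show ?thesis
  proof eventually_elim
    case (elim x)
    show ?case
    proof
      assume x: "x \<in> ball x0 (R / 2)"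
      have "(\<lambda>n. mean_const DIM('a) \<alpha>0 lam Lam * (m + 1 / real (Suc n)) + tail_const DIM('a) Lam * ((2 - \<alpha>) * T))
        \<longlonglongrightarrow> mean_const DIM('a) \<alpha>0 lam Lam * (m + 0) + tail_const DIM('a) Lam * ((2 - \<alpha>) * T)"
        using LIMSEQ_inverse_real_of_nat by (intro tendsto_intros) (simp add: inverse_eq_divide)
      then have "U (t, x) \<le> mean_const DIM('a) \<alpha>0 lam Lam * (m + 0) + tail_const DIM('a) Lam * ((2 - \<alpha>) * T)"
        by (rule LIMSEQ_le_const) (use elim x in auto)
      then show "U (t, x) \<le> mean_const DIM('a) \<alpha>0 lam Lam * sqrt (sup_const DIM('a) \<alpha>0 lam Lam * (D / (R powr \<alpha> * R ^ DIM('a)))) + tail_const DIM('a) Lam * ((2 - \<alpha>) * T)"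
        by (simp add: m_def C_def)
    qed
  qed
qed

end

context borel_subsolution
begin

text \<open>At almost every time the original functions agree with their Borel versions for almost every \<open>x\<close> or \<open>(x, y)\<close>, so the
equation can be rewritten in terms of the versions and \<open>form_lower_bound\<close> applies.\<close>

lemma U_ac_subsolution:
  "AE t in lborel. t \<in> JJ \<longrightarrow> (\<forall>l \<sigma> L \<phi>. 0 \<le> l \<and> 0 < \<sigma> \<and> \<sigma> < R \<and> 0 < L \<and> cutoff x0 \<sigma> L \<phi> \<longrightarrow>
      (LINT x|lborel. W1 (t, x) * ((\<phi> x)\<^sup>2 * max (U_ac (t, x) - l) 0))
        \<le> Lam * (2 - \<alpha>) * enn2real (cross_energy \<alpha> \<phi> (\<lambda>x. max (U_ac (t, x) - l) 0))
          - lam * (2 - \<alpha>) * enn2real (sq_energy \<alpha> (\<lambda>x. \<phi> x * max (U_ac (t, x) - l) 0)))"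
  using U_ac_static U_ac_AE U1_time W1_time K1_time
proof eventually_elim
  case (elim t)
  show ?case
  proof (intro impI allI, elim conjE)
    fix l \<sigma> L :: real and \<phi> :: "'a \<Rightarrow> real"
    assume t: "t \<in> JJ" and l: "0 \<le> l" and \<sigma>: "0 < \<sigma>" "\<sigma> < R" and L: "0 < L" and \<phi>: "cutoff x0 \<sigma> L \<phi>"
    have tI: "t \<in> I" using t J by auto
    interpret static_energy \<alpha> R x0 "\<lambda>x. U_ac (t, x)" using elim(1) t by blast
    have tr: "trunc l = (\<lambda>x. max (U_ac (t, x) - l) 0)" by (rule ext) (simp add: trunc_def)
    define \<psi> where "\<psi> = test l \<phi>"
    have \<psi>: "\<psi> x = (\<phi> x)\<^sup>2 * max (U_ac (t, x) - l) 0" for x unfolding \<psi>_def test_def[OF l \<sigma> L \<phi>] tr ..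
    have \<psi>m [measurable]: "\<psi> \<in> borel_measurable borel" unfolding \<psi>_def by (rule test_measurable[OF l \<sigma> L \<phi>])
    have \<psi>H: "\<psi> \<in> H_space_supp \<alpha> \<Omega>" unfolding \<psi>_def
      by (rule test_in_H_space_supp[OF l \<sigma> L \<phi>]) (use \<sigma> ball_\<Omega> in auto)
    have uU: "AE x in lborel. u t x = U_ac (t, x)"
      using elim(2) elim(3)[rule_format, OF tI] by eventually_elim simp
    have weak: "(LINT x:\<Omega>|lebesgue. w t x * \<psi> x) + energy (K t) (u t) \<psi> \<le> 0"
      by (rule sub[OF tI \<psi>H]) (simp add: \<psi>)
    have pair: "(LINT x:\<Omega>|lebesgue. w t x * \<psi> x) = (LINT x|lborel. W1 (t, x) * \<psi> x)"
      unfolding set_lebesgue_integral_def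
    proof (rule integral_lebesgue_AE)
      show "AE x in lborel. indicator \<Omega> x *\<^sub>R (w t x * \<psi> x) = W1 (t, x) * \<psi> x"
        using elim(4)[rule_format, OF tI]
      proof eventually_elim
        case (elim x)
        show ?case
        proof (cases "x \<in> \<Omega>")
          case False
          then have "x \<notin> ball x0 \<sigma>" using ball_\<Omega> \<sigma> by (force simp: subset_iff)
          then have "\<psi> x = 0" unfolding \<psi>_def by (rule test_zero[OF l \<sigma> L \<phi>])
          then show ?thesis by simp
        qed (use elim in simp)
      qed
    qed measurable
    define lam' Lam' where "lam' = lam * (2 - \<alpha>)" and "Lam' = Lam * (2 - \<alpha>)"
    have lL: "0 \<le> lam'" "0 \<le> Lam'" "lam' \<le> Lam'" using lam \<alpha> by (auto simp: lam'_def Lam'_def mult_right_mono)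
    (* the Borel version satisfies the bounds on the kernel only almost everywhere; clipping
       enforces them everywhere *)
    define k where "k z = max (lam' * riesz_kernel \<alpha> (fst z - snd z)) (min (Lam' * riesz_kernel \<alpha> (fst z - snd z)) (enn2real (K1 (t, fst z, snd z))))" for z
    have km: "k \<in> borel_measurable borel"
      unfolding borel_prod[symmetric] k_def by measurable
    have kb: "lam' * riesz_kernel \<alpha> (x - y) \<le> k (x, y)" "k (x, y) \<le> Lam' * riesz_kernel \<alpha> (x - y)" for x y
      using lL mult_right_mono[OF lL(3), of "riesz_kernel \<alpha> (x - y)"] by (auto simp: k_def)
    have fm [measurable]: "form l \<phi> k \<in> borel_measurable (borel \<Otimes>\<^sub>M borel)"
      using form_measurable[OF l \<sigma> L \<phi> km lL(1,2) kb] by (simp add: borel_prod)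
    have fi: "integrable (lborel \<Otimes>\<^sub>M lborel) (form l \<phi> k)"
      by (rule form_integrable[OF l \<sigma> L \<phi> km lL(1,2) kb])
    have "energy (K t) (u t) \<psi> = (LINT x|lborel. LINT y|lborel. form l \<phi> k (x, y))"
      unfolding energy_def
    proof (rule integral_lebesgue_AE)
      show "AE x in lborel. (LINT y|lebesgue. (u t x - u t y) * (\<psi> x - \<psi> y) * enn2real (K t x y)) = (LINT y|lborel. form l \<phi> k (x, y))"
        using uU elim(5)[rule_format, OF tI]
      proof eventually_elim
        case (elim x)
        show ?case
        proof (rule integral_lebesgue_AE)
          show "AE y in lborel. (u t x - u t y) * (\<psi> x - \<psi> y) * enn2real (K t x y) = form l \<phi> k (x, y)"
            using uU elim(2) AE_lborel_singleton[of x]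
          proof eventually_elim
            case (elim y)
            have xy: "x \<noteq> y" using elim(3) by simp
            have b: "ennreal (lam' * riesz_kernel \<alpha> (x - y)) \<le> K t x y" "K t x y \<le> ennreal (Lam' * riesz_kernel \<alpha> (x - y))"
              using K_bounds[OF tI, of x y] lL unfolding frac_kernel_eq_riesz[OF xy] lam'_def[symmetric] Lam'_def[symmetric]
              by (simp_all add: ennreal_mult)
            define K' where "K' = enn2real (K t x y)"
            have KK: "K t x y = ennreal K'" using b(2) unfolding K'_def by (metis ennreal_enn2real ennreal_less_top le_less_trans)
            have K'0: "0 \<le> K'" by (simp add: K'_def)
            have "lam' * riesz_kernel \<alpha> (x - y) \<le> K'" "K' \<le> Lam' * riesz_kernel \<alpha> (x - y)"
              using b K'0 lL unfolding KK by (simp_all add: ennreal_le_iff)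
            then have "k (x, y) = K'" using elim(2) by (simp add: k_def K'_def)
            then show ?case
              unfolding form_def[OF l \<sigma> L \<phi> km lL(1,2) kb] \<psi>_def K'_def using elim(1) \<open>u t x = U_ac (t, x)\<close> by simp
          qed
          show "(\<lambda>y. form l \<phi> k (x, y)) \<in> borel_measurable borel" by measurable
        qed
      qed
      show "(\<lambda>x. LINT y|lborel. form l \<phi> k (x, y)) \<in> borel_measurable borel" by measurable
    qed
    also have "\<dots> = (LINT z|(lborel \<Otimes>\<^sub>M lborel). form l \<phi> k z)" by (rule lborel_pair.integral_fst'[OF fi])
    finally have en: "lam' * enn2real (sq_energy \<alpha> (\<lambda>x. \<phi> x * trunc l x)) - Lam' * enn2real (cross_energy \<alpha> \<phi> (trunc l)) \<le> energy (K t) (u t) \<psi>"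
      using form_lower_bound[OF l \<sigma> L \<phi> km lL(1,2) kb] by simp
    show "(LINT x|lborel. W1 (t, x) * ((\<phi> x)\<^sup>2 * max (U_ac (t, x) - l) 0))
        \<le> Lam * (2 - \<alpha>) * enn2real (cross_energy \<alpha> \<phi> (\<lambda>x. max (U_ac (t, x) - l) 0))
          - lam * (2 - \<alpha>) * enn2real (sq_energy \<alpha> (\<lambda>x. \<phi> x * max (U_ac (t, x) - l) 0))"
      using weak[unfolded pair] en unfolding \<psi> tr lam'_def Lam'_def by linarith
  qed
qed

lemma evolution_U_ac: "evolution \<alpha> lam Lam R s0 t0 x0 U_ac W1"
proof
  show "0 < \<alpha>" "\<alpha> < 2" "0 < R" "s0 < t0" "0 < lam" "0 < Lam" using \<alpha> R s0t0 lam by auto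
  show "U_ac \<in> borel_measurable (borel \<Otimes>\<^sub>M borel)" by measurable
  show "W1 \<in> borel_measurable (borel \<Otimes>\<^sub>M borel)" by measurable
qed (use U_ac_primitive U_ac_sq U_ac_W_L1 U_ac_static U_ac_tail[of "3 * R / 4"] U_ac_subsolution R in simp_all)

end

section \<open>Local boundedness of weak subsolutions\<close>

context borel_subsolution
begin

lemma u_U_ac: "AE t in lborel. t \<in> JJ \<longrightarrow> (AE x in lborel. u t x = U_ac (t, x))"
  using U1_time U_ac_AE
proof eventually_elim
  case (elim t)
  show ?case
  proof
    assume "t \<in> JJ"
    then have "AE x in lborel. u t x = U1 (t, x)" using elim J by auto
    then show "AE x in lborel. u t x = U_ac (t, x)" using elim(2) by eventually_elim simp
  qed
qed

lemma square_integral_U_ac: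
  "(\<integral>\<^sup>+t\<in>{s0<..<t0}. (\<integral>\<^sup>+x\<in>B. ennreal ((max (u t x) 0)\<^sup>2) \<partial>lebesgue) \<partial>lebesgue)
   = (\<integral>\<^sup>+t\<in>{s0..<t0}. (\<integral>\<^sup>+x\<in>B. ennreal ((max (U_ac (t, x)) 0)\<^sup>2) \<partial>lborel) \<partial>lborel)"
  unfolding nn_integral_completion
proof (rule nn_integral_cong_AE)
  show "AE t in lborel. (\<integral>\<^sup>+x\<in>B. ennreal ((max (u t x) 0)\<^sup>2) \<partial>lborel) * indicator {s0<..<t0} t
     = (\<integral>\<^sup>+x\<in>B. ennreal ((max (U_ac (t, x)) 0)\<^sup>2) \<partial>lborel) * indicator {s0..<t0} t"
    using u_U_ac AE_lborel_singleton[of s0]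
  proof eventually_elim
    case (elim t)
    show ?case
    proof (cases "t \<in> JJ")
      case True
      then have "AE x in lborel. u t x = U_ac (t, x)" using elim by auto
      then have "(\<integral>\<^sup>+x\<in>B. ennreal ((max (u t x) 0)\<^sup>2) \<partial>lborel) = (\<integral>\<^sup>+x\<in>B. ennreal ((max (U_ac (t, x)) 0)\<^sup>2) \<partial>lborel)"
        by (intro nn_integral_cong_AE) (auto elim!: eventually_mono)
      then show ?thesis using elim(2) by (auto simp: indicator_def)
    qed (auto simp: indicator_def)
  qed
qed

lemma square_integral_finite:
  "(\<integral>\<^sup>+t\<in>{s0..<t0}. (\<integral>\<^sup>+x\<in>B. ennreal ((max (U_ac (t, x)) 0)\<^sup>2) \<partial>lborel) \<partial>lborel) < \<infinity>"
proof -
  obtain C where C: "AE t in lborel. t \<in> JJ \<longrightarrow> (\<integral>\<^sup>+x\<in>B. ennreal ((U_ac (t, x))\<^sup>2) \<partial>lborel) \<le> ennreal C"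
    using U_ac_sq by blast
  have "(\<integral>\<^sup>+t\<in>{s0..<t0}. (\<integral>\<^sup>+x\<in>B. ennreal ((max (U_ac (t, x)) 0)\<^sup>2) \<partial>lborel) \<partial>lborel)
    \<le> (\<integral>\<^sup>+t\<in>{s0..<t0}. ennreal C \<partial>lborel)"
  proof (rule nn_integral_mono_AE)
    show "AE t in lborel. (\<integral>\<^sup>+x\<in>B. ennreal ((max (U_ac (t, x)) 0)\<^sup>2) \<partial>lborel) * indicator {s0..<t0} t
      \<le> ennreal C * indicator {s0..<t0} t"
      using C
    proof eventually_elim
      case (elim t)
      have "(\<integral>\<^sup>+x\<in>B. ennreal ((max (U_ac (t, x)) 0)\<^sup>2) \<partial>lborel) \<le> (\<integral>\<^sup>+x\<in>B. ennreal ((U_ac (t, x))\<^sup>2) \<partial>lborel)"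
        by (intro nn_integral_mono mult_right_mono ennreal_leI) (auto simp: max_def)
      then show ?case using elim by (auto simp: indicator_def)
    qed
  qed
  also have "\<dots> < \<infinity>" using s0t0 by (simp add: nn_integral_cmult_indicator ennreal_mult_less_top)
  finally show ?thesis .
qed

lemma tail_integral_U_ac:
  "(\<integral>\<^sup>+t\<in>{s0<..<t0}. Tail \<alpha> (\<lambda>x. max (u t x) 0) R x0 \<partial>lebesgue)
   = ennreal ((2 - \<alpha>) * R powr \<alpha>) * (\<integral>\<^sup>+t\<in>JJ. (\<integral>\<^sup>+y\<in>- B. ennreal (max (U_ac (t, y)) 0 * riesz_kernel \<alpha> (x0 - y)) \<partial>lborel) \<partial>lborel)"
proof -
  have "(\<integral>\<^sup>+t\<in>{s0<..<t0}. Tail \<alpha> (\<lambda>x. max (u t x) 0) R x0 \<partial>lebesgue)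
    = (\<integral>\<^sup>+t. ennreal ((2 - \<alpha>) * R powr \<alpha>) * ((\<integral>\<^sup>+y\<in>- B. ennreal (max (U_ac (t, y)) 0 * riesz_kernel \<alpha> (x0 - y)) \<partial>lborel) * indicator JJ t) \<partial>lborel)"
    unfolding nn_integral_completion Tail_def
  proof (rule nn_integral_cong_AE)
    show "AE t in lborel. ennreal ((2 - \<alpha>) * R powr \<alpha>) * (\<integral>\<^sup>+y\<in>- B. ennreal \<bar>max (u t y) 0\<bar> * frac_kernel \<alpha> x0 y \<partial>lborel) * indicator {s0<..<t0} t
      = ennreal ((2 - \<alpha>) * R powr \<alpha>) * ((\<integral>\<^sup>+y\<in>- B. ennreal (max (U_ac (t, y)) 0 * riesz_kernel \<alpha> (x0 - y)) \<partial>lborel) * indicator JJ t)"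
      using u_U_ac AE_lborel_singleton[of s0] AE_lborel_singleton[of t0]
    proof eventually_elim
      case (elim t)
      show ?case
      proof (cases "t \<in> JJ")
        case True
        then have ae: "AE x in lborel. u t x = U_ac (t, x)" using elim by auto
        have "(\<integral>\<^sup>+y\<in>- B. ennreal \<bar>max (u t y) 0\<bar> * frac_kernel \<alpha> x0 y \<partial>lborel) = (\<integral>\<^sup>+y\<in>- B. ennreal (max (U_ac (t, y)) 0 * riesz_kernel \<alpha> (x0 - y)) \<partial>lborel)"
        proof (rule nn_integral_cong_AE)
          show "AE y in lborel. ennreal \<bar>max (u t y) 0\<bar> * frac_kernel \<alpha> x0 y * indicator (- B) y
            = ennreal (max (U_ac (t, y)) 0 * riesz_kernel \<alpha> (x0 - y)) * indicator (- B) y"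
            using ae AE_lborel_singleton[of x0]
          proof eventually_elim
            case (elim y)
            have "ennreal \<bar>max (u t y) 0\<bar> * frac_kernel \<alpha> x0 y = ennreal (\<bar>max (u t y) 0\<bar> * riesz_kernel \<alpha> (x0 - y))"
              by (rule ennreal_mult_frac_kernel) (use elim in auto)
            then show ?case unfolding elim(1) by simp
          qed
        qed
        then show ?thesis using True elim(2,3) by (auto simp: indicator_def)
      qed (auto simp: indicator_def)
    qed
  qed
  also have "\<dots> = ennreal ((2 - \<alpha>) * R powr \<alpha>) * (\<integral>\<^sup>+t\<in>JJ. (\<integral>\<^sup>+y\<in>- B. ennreal (max (U_ac (t, y)) 0 * riesz_kernel \<alpha> (x0 - y)) \<partial>lborel) \<partial>lborel)"
    by (rule nn_integral_cmult) measurable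
  finally show ?thesis .
qed

lemma tail_integral_finite:
  "(\<integral>\<^sup>+t\<in>JJ. (\<integral>\<^sup>+y\<in>- B. ennreal (max (U_ac (t, y)) 0 * riesz_kernel \<alpha> (x0 - y)) \<partial>lborel) \<partial>lborel) < \<infinity>"
  by (rule le_less_trans[OF nn_integral_mono[OF mult_right_mono[OF nn_integral_mono[OF mult_right_mono]]] U_ac_tail[OF R]])
     (auto intro!: ennreal_leI mult_right_mono)

text \<open>The supremum is over a product set, while the bound holds for every time and almost every \<open>x\<close>; a Borel set in
the product is null if almost all of its sections are.\<close>

lemma AE_product_le:
  assumes le: "\<And>t. t \<in> S \<Longrightarrow> AE x in lborel. x \<in> A \<longrightarrow> U_ac (t, x) \<le> C"
    and S: "S \<in> sets borel" "S \<subseteq> JJ" and A: "A \<in> sets borel"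
  shows "AE z in lebesgue. z \<in> S \<times> A \<longrightarrow> u (fst z) (snd z) \<le> C"
proof -
  note [measurable] = S(1) A
  have "AE z in (lborel \<Otimes>\<^sub>M lborel). fst z \<in> S \<and> snd z \<in> A \<longrightarrow> U_ac z \<le> C"
  proof (rule lborel_pair.AE_pair_measure)
    show "AE t in lborel. AE x in lborel. fst (t, x) \<in> S \<and> snd (t, x) \<in> A \<longrightarrow> U_ac (t, x) \<le> C"
    proof (rule AE_I2)
      fix t :: real
      show "AE x in lborel. fst (t, x) \<in> S \<and> snd (t, x) \<in> A \<longrightarrow> U_ac (t, x) \<le> C"
        using le[of t] by (cases "t \<in> S") auto
    qed
    show "{z \<in> space (lborel \<Otimes>\<^sub>M lborel). fst z \<in> S \<and> snd z \<in> A \<longrightarrow> U_ac z \<le> C} \<in> sets (lborel \<Otimes>\<^sub>M lborel)"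
      by measurable
  qed
  moreover have "AE z in (lborel \<Otimes>\<^sub>M lborel). U_ac z = U1 z"
    by (rule lborel_pair.AE_pair_measure[OF _ U_ac_AE]) measurable
  ultimately have "AE z in lborel. z \<in> S \<times> A \<longrightarrow> u (fst z) (snd z) \<le> C"
    unfolding lborel_prod using U1
  proof eventually_elim
    case (elim z)
    then show ?case using S(2) J by (auto simp: mem_Times_iff)
  qed
  then show ?thesis by (rule AE_completion)
qed

text \<open>The real-valued bound \<open>sup_bound\<close>, rewritten for the original function and in \<open>[0,\<infinity>]\<close>. Once the normalisations
by the volume of the cylinder and by the length of the time interval are inserted, all powers of \<open>R\<close> cancel.\<close>

lemma local_boundedness:
  assumes \<alpha>0: "0 < \<alpha>0" "\<alpha>0 \<le> \<alpha>" and len: "t0 - s0 = R powr \<alpha>"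
    and u_meas: "(\<lambda>(t, x). u t x) \<in> borel_measurable (lebesgue_on (I \<times> UNIV))"
    and c: "mean_const DIM('a) \<alpha>0 lam Lam * sqrt (sup_const DIM('a) \<alpha>0 lam Lam * unit_ball_vol DIM('a)) \<le> c"
      "tail_const DIM('a) Lam \<le> c"
  shows "esssup (lebesgue_on (time_int_minus \<alpha> (R / 2) t0 \<times> ball x0 (R / 2))) (\<lambda>(t, x). ennreal (max (u t x) 0))
         \<le> ennreal c * ennsqrt ((\<integral>\<^sup>+t\<in>time_int_minus \<alpha> R t0. (\<integral>\<^sup>+x\<in>ball x0 R. ennreal ((max (u t x) 0)\<^sup>2) \<partial>lebesgue) \<partial>lebesgue)
               / emeasure lebesgue (time_int_minus \<alpha> R t0 \<times> ball x0 R))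
           + ennreal c / emeasure lebesgue (time_int_minus \<alpha> R t0) *
              (\<integral>\<^sup>+t\<in>time_int_minus \<alpha> R t0. Tail \<alpha> (\<lambda>x. max (u t x) 0) R x0 \<partial>lebesgue)" (is ?bound)
    and "(\<integral>\<^sup>+t\<in>time_int_minus \<alpha> R t0. (\<integral>\<^sup>+x\<in>ball x0 R. ennreal ((max (u t x) 0)\<^sup>2) \<partial>lebesgue) \<partial>lebesgue) < \<infinity>" (is ?sq)
    and "(\<integral>\<^sup>+t\<in>time_int_minus \<alpha> R t0. Tail \<alpha> (\<lambda>x. max (u t x) 0) R x0 \<partial>lebesgue) < \<infinity>" (is ?tl)
    and "in_Linfty (lebesgue_on (time_int_minus \<alpha> (R / 2) t0 \<times> ball x0 (R / 2))) (\<lambda>(t, x). max (u t x) 0)" (is ?inf)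
proof -
  interpret evolution \<alpha> lam Lam R s0 t0 x0 U_ac W1 by (rule evolution_U_ac)
  have int: "time_int_minus \<alpha> R t0 = {s0<..<t0}" unfolding time_int_minus_def len[symmetric] by simp
  define D where "D = enn2real (\<integral>\<^sup>+t\<in>{s0..<t0}. (\<integral>\<^sup>+x\<in>B. ennreal ((max (U_ac (t, x)) 0)\<^sup>2) \<partial>lborel) \<partial>lborel)"
  define T where "T = enn2real (\<integral>\<^sup>+t\<in>JJ. (\<integral>\<^sup>+y\<in>- B. ennreal (max (U_ac (t, y)) 0 * riesz_kernel \<alpha> (x0 - y)) \<partial>lborel) \<partial>lborel)"
  have D: "(\<integral>\<^sup>+t\<in>{s0..<t0}. (\<integral>\<^sup>+x\<in>B. ennreal ((max (U_ac (t, x)) 0)\<^sup>2) \<partial>lborel) \<partial>lborel) = ennreal D"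
    unfolding D_def using square_integral_finite by simp
  have T: "(\<integral>\<^sup>+t\<in>JJ. (\<integral>\<^sup>+y\<in>- B. ennreal (max (U_ac (t, y)) 0 * riesz_kernel \<alpha> (x0 - y)) \<partial>lborel) \<partial>lborel) = ennreal T"
    unfolding T_def using tail_integral_finite by simp
  have D0: "0 \<le> D" and T0: "0 \<le> T" by (simp_all add: D_def T_def)
  have D': "(\<integral>\<^sup>+t\<in>time_int_minus \<alpha> R t0. (\<integral>\<^sup>+x\<in>ball x0 R. ennreal ((max (u t x) 0)\<^sup>2) \<partial>lebesgue) \<partial>lebesgue) = ennreal D"
    unfolding int square_integral_U_ac by (rule D)
  have T': "(\<integral>\<^sup>+t\<in>time_int_minus \<alpha> R t0. Tail \<alpha> (\<lambda>x. max (u t x) 0) R x0 \<partial>lebesgue) = ennreal ((2 - \<alpha>) * R powr \<alpha> * T)"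
    unfolding int tail_integral_U_ac T using \<alpha> by (simp add: ennreal_mult')
  show ?sq unfolding D' by simp
  show ?tl unfolding T' by simp
  define S where "S = time_int_minus \<alpha> (R / 2) t0"
  define A where "A = ball x0 (R / 2)"
  have "(R / 2) powr \<alpha> \<le> R powr \<alpha>" using R \<alpha> by (intro powr_mono2) auto
  then have S: "S \<subseteq> JJ" "S \<subseteq> {t0 - (R / 2) powr \<alpha>..t0}" "S \<in> sets borel" using len by (auto simp: S_def time_int_minus_def)
  have A: "A \<in> sets borel" by (simp add: A_def)
  define \<omega> where "\<omega> = unit_ball_vol (real DIM('a))"
  have \<omega>: "0 < \<omega>" by (simp add: \<omega>_def)
  define P where "P = R powr \<alpha> * R ^ DIM('a)"
  have P: "0 < P" using R by (simp add: P_def)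
  define C where "C = sup_const DIM('a) \<alpha>0 lam Lam"
  define N where "N = mean_const DIM('a) \<alpha>0 lam Lam"
  define E where "E = N * sqrt (C * (D / P)) + tail_const DIM('a) Lam * ((2 - \<alpha>) * T)"
  have C: "0 < C" using const_pos[OF \<alpha>0(1) lam(1,2), where d="DIM('a)"] by (simp add: C_def sup_const_def)
  have tc: "0 \<le> tail_const DIM('a) Lam" using lam by (simp add: tail_const_def)
  have c0: "0 \<le> c" using tc c(2) by simp
  have ae: "AE z in lebesgue. z \<in> S \<times> A \<longrightarrow> u (fst z) (snd z) \<le> E"
  proof (rule AE_product_le)
    fix t assume "t \<in> S"
    then have t: "t \<in> {t0 - (R / 2) powr \<alpha>..t0}" using S by auto
    show "AE x in lborel. x \<in> A \<longrightarrow> U_ac (t, x) \<le> E"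
      unfolding A_def E_def N_def C_def P_def
      by (rule sup_bound[OF \<alpha>0 len D0 _ T0 _ t]) (simp_all only: D T order_refl)
  qed (use S A in auto)
  have SA: "S \<times> A \<in> sets (borel :: (real \<times> 'a) measure)" unfolding S_def time_int_minus_def A_def by (intro borel_open open_Times) auto
  then have SAL: "S \<times> A \<inter> space lebesgue \<in> sets lebesgue" by auto
  have "S \<times> A \<subseteq> I \<times> UNIV" using S J by auto
  from measurable_restrict_mono[OF u_meas this]
  have um: "(\<lambda>(t, x). u t x) \<in> borel_measurable (lebesgue_on (S \<times> A))" .
  have um1: "(\<lambda>(t, x). max (u t x) 0) \<in> borel_measurable (lebesgue_on (S \<times> A))"
    using borel_measurable_max[OF um borel_measurable_const[of 0]] by (simp add: case_prod_unfold max.commute)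
  then have um2: "(\<lambda>(t, x). ennreal (max (u t x) 0)) \<in> borel_measurable (lebesgue_on (S \<times> A))"
    using measurable_compose[OF um1 measurable_ennreal] by (simp add: case_prod_unfold)
  have sup: "esssup (lebesgue_on (S \<times> A)) (\<lambda>(t, x). ennreal (max (u t x) 0)) \<le> ennreal E"
  proof (rule esssup_I[OF um2])
    have "0 \<le> N * sqrt (C * (D / P))"
      using C D0 P tc \<omega> unfolding N_def mean_const_def C_def[symmetric] \<omega>_def[symmetric] by simp
    then have "0 \<le> E" using tc \<alpha> T0 by (simp add: E_def)
    with ae show "AE z in lebesgue_on (S \<times> A). (case z of (t, x) \<Rightarrow> ennreal (max (u t x) 0)) \<le> ennreal E"
      unfolding AE_restrict_space_iff[OF SAL] by (auto elim!: eventually_mono intro!: ennreal_leI)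
  qed
  then show ?inf
    using um1 unfolding S_def[symmetric] A_def[symmetric] in_Linfty_def
    by (simp add: case_prod_unfold le_less_trans)
  have vol1: "emeasure lebesgue (time_int_minus \<alpha> R t0) = ennreal (R powr \<alpha>)"
    unfolding int using s0t0 len by simp
  have vol2: "emeasure lebesgue (time_int_minus \<alpha> R t0 \<times> ball x0 R) = ennreal (P * \<omega>)"
  proof -
    have o: "open ({s0<..<t0} \<times> B)" by (intro open_Times) auto
    have "emeasure lebesgue ({s0<..<t0} \<times> B) = emeasure (lborel \<Otimes>\<^sub>M lborel) ({s0<..<t0} \<times> B)"
      unfolding lborel_prod using o by simp
    also have "\<dots> = emeasure lborel {s0<..<t0} * emeasure lborel B" by (rule lborel.emeasure_pair_measure_Times) auto
    also have "\<dots> = ennreal (P * \<omega>)"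
      using s0t0 len R by (simp add: emeasure_ball P_def \<omega>_def ennreal_mult[symmetric] mult_ac)
    finally show ?thesis unfolding int .
  qed
  have "N * sqrt (C * (D / P)) = N * sqrt (C * \<omega>) * sqrt (D / (P * \<omega>))"
    using \<omega> by (simp add: real_sqrt_mult[symmetric])
  also have "\<dots> \<le> c * sqrt (D / (P * \<omega>))"
    using c(1) D0 P \<omega> unfolding N_def C_def \<omega>_def by (intro mult_right_mono) auto
  finally have 1: "N * sqrt (C * (D / P)) \<le> c * sqrt (D / (P * \<omega>))" .
  have 2: "tail_const DIM('a) Lam * ((2 - \<alpha>) * T) \<le> c * ((2 - \<alpha>) * T)"
    using c(2) \<alpha> T0 by (intro mult_right_mono) auto
  have "ennreal E \<le> ennreal (c * sqrt (D / (P * \<omega>)) + c * ((2 - \<alpha>) * T))"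
    using 1 2 unfolding E_def by (intro ennreal_leI) linarith
  also have "\<dots> = ennreal c * ennreal (sqrt (D / (P * \<omega>))) + ennreal (c * ((2 - \<alpha>) * T))"
    using c0 D0 P \<omega> \<alpha> T0 by (simp add: ennreal_plus ennreal_mult)
  also have "ennreal (sqrt (D / (P * \<omega>))) = ennsqrt (ennreal D / ennreal (P * \<omega>))"
    using D0 P \<omega> by (simp add: divide_ennreal ennsqrt_def)
  also have "ennreal (c * ((2 - \<alpha>) * T)) = ennreal c / ennreal (R powr \<alpha>) * ennreal ((2 - \<alpha>) * R powr \<alpha> * T)"
    using c0 R \<alpha> T0 by (simp add: divide_ennreal ennreal_mult[symmetric])
  finally show ?bound
    using sup unfolding D' T' vol1 vol2 S_def A_def by (rule order_trans[rotated])
qed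

end

theorem theorem1p8:
  fixes \<alpha>0 lam Lam :: real
  assumes "0 < \<alpha>0" and "\<alpha>0 < 2" and "0 < lam" and "lam \<le> Lam"
  shows "\<exists>c>0. \<forall>(\<alpha>::real) (a::real) (b::real) (\<Omega>::(real^'n) set)
      (K :: real \<Rightarrow> real^'n \<Rightarrow> real^'n \<Rightarrow> ennreal).
    \<alpha>0 \<le> \<alpha> \<and> \<alpha> < 2 \<and> 0 \<le> a \<and> a < b \<and>
    open \<Omega> \<and> connected \<Omega> \<and> \<Omega> \<noteq> {} \<and> bounded \<Omega> \<and>
    (\<lambda>(t, x, y). K t x y) \<in> borel_measurable (lebesgue_on ({0..} \<times> UNIV \<times> UNIV)) \<and>
    (\<forall>t\<in>{a<..<b}. \<forall>x y. K t x y = K t y x) \<and>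
    (\<forall>t\<in>{a<..<b}. \<forall>x y. ennreal (lam * (2 - \<alpha>)) * frac_kernel \<alpha> x y \<le> K t x y \<and>
                         K t x y \<le> ennreal (Lam * (2 - \<alpha>)) * frac_kernel \<alpha> x y) \<longrightarrow>
    (\<forall>R t0 x0 u.
       0 < R \<and> t0 \<in> {a<..<b} \<and> x0 \<in> \<Omega> \<and>
       time_int \<alpha> (4 * R) t0 \<times> ball x0 (4 * R) \<subseteq> {a<..<b} \<times> \<Omega> \<and>
       weak_subsolution \<alpha> K {a<..<b} \<Omega> u \<longrightarrow>
       esssup (lebesgue_on (time_int_minus \<alpha> (R / 2) t0 \<times> ball x0 (R / 2)))
              (\<lambda>(t, x). ennreal (max (u t x) 0))
         \<le> ennreal c * ennsqrt
              ((\<integral>\<^sup>+t\<in>time_int_minus \<alpha> R t0.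
                  (\<integral>\<^sup>+x\<in>ball x0 R. ennreal ((max (u t x) 0)\<^sup>2) \<partial>lebesgue) \<partial>lebesgue)
               / emeasure lebesgue (time_int_minus \<alpha> R t0 \<times> ball x0 R))
           + ennreal c / emeasure lebesgue (time_int_minus \<alpha> R t0) *
              (\<integral>\<^sup>+t\<in>time_int_minus \<alpha> R t0. Tail \<alpha> (\<lambda>x. max (u t x) 0) R x0 \<partial>lebesgue)
       \<and> (\<integral>\<^sup>+t\<in>time_int_minus \<alpha> R t0.
            (\<integral>\<^sup>+x\<in>ball x0 R. ennreal ((max (u t x) 0)\<^sup>2) \<partial>lebesgue) \<partial>lebesgue) < \<infinity>
       \<and> (\<integral>\<^sup>+t\<in>time_int_minus \<alpha> R t0. Tail \<alpha> (\<lambda>x. max (u t x) 0) R x0 \<partial>lebesgue) < \<infinity>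
       \<and> in_Linfty (lebesgue_on (time_int_minus \<alpha> (R / 2) t0 \<times> ball x0 (R / 2)))
              (\<lambda>(t, x). max (u t x) 0))"
proof -
  define d where "d = CARD('n)"
  define c where "c = max 1 (max (mean_const d \<alpha>0 lam Lam * sqrt (sup_const d \<alpha>0 lam Lam * unit_ball_vol (real d))) (tail_const d Lam))"
  have dim: "DIM(real^'n) = d" by (simp add: d_def)
  show ?thesis
  (* c depends on the dimension, \<alpha>0, lam and Lam only; 1 makes it positive *)
  proof (intro exI[of _ c] conjI allI impI; (elim conjE)?)
    show "0 < c" by (simp add: c_def)
  next
    fix \<alpha> a b :: real and \<Omega> :: "(real^'n) set" and K :: "real \<Rightarrow> real^'n \<Rightarrow> real^'n \<Rightarrow> ennreal"
      and R t0 :: real and x0 :: "real^'n" and u :: "real \<Rightarrow> real^'n \<Rightarrow> real"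
    assume \<alpha>2: "\<alpha>0 \<le> \<alpha>" "\<alpha> < 2" and a: "0 \<le> a" and \<Omega>: "open \<Omega>"
      and Km: "(\<lambda>(t, x, y). K t x y) \<in> borel_measurable (lebesgue_on ({0..} \<times> UNIV \<times> UNIV))"
      and Kb: "\<forall>t\<in>{a<..<b}. \<forall>x y. ennreal (lam * (2 - \<alpha>)) * frac_kernel \<alpha> x y \<le> K t x y \<and> K t x y \<le> ennreal (Lam * (2 - \<alpha>)) * frac_kernel \<alpha> x y"
      and R: "0 < R" and Q: "time_int \<alpha> (4 * R) t0 \<times> ball x0 (4 * R) \<subseteq> {a<..<b} \<times> \<Omega>"
      and u: "weak_subsolution \<alpha> K {a<..<b} \<Omega> u"
    let ?I = "{a<..<b}"
    define s0 where "s0 = t0 - R powr \<alpha>"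
    from u obtain w where um: "(\<lambda>(t, x). u t x) \<in> borel_measurable (lebesgue_on (?I \<times> UNIV))"
      and uH: "L2loc_Hloc \<alpha> ?I \<Omega> u" and uL1: "L1loc_L1weighted \<alpha> ?I u" and uL2: "Linfloc_L2loc ?I \<Omega> u"
      and wm: "(\<lambda>(t, x). w t x) \<in> borel_measurable (lebesgue_on (?I \<times> \<Omega>))"
      and wL2: "L1loc_L2loc ?I \<Omega> w" and uw: "weak_time_deriv ?I \<Omega> u w"
      and sub: "\<forall>t\<in>?I. \<forall>\<phi>\<in>H_space_supp \<alpha> \<Omega>. (AE x in lebesgue. 0 \<le> \<phi> x) \<longrightarrow>
                 (LINT x:\<Omega>|lebesgue. w t x * \<phi> x) + energy (K t) (u t) \<phi> \<le> 0"
      unfolding weak_subsolution_def by blast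
    have "open (?I \<times> (UNIV :: (real^'n) set))" "open (?I \<times> \<Omega>)" using \<Omega> by (auto intro: open_Times)
    then have bI: "?I \<times> (UNIV :: (real^'n) set) \<in> sets borel" "?I \<times> \<Omega> \<in> sets borel" by auto
    have "closed ({0::real..} \<times> (UNIV :: (real^'n) set) \<times> (UNIV :: (real^'n) set))" by (auto intro: closed_Times)
    then have bK: "{0::real..} \<times> (UNIV :: (real^'n) set) \<times> (UNIV :: (real^'n) set) \<in> sets borel" by auto
    obtain U1 where U1: "U1 \<in> borel_measurable borel" "AE z in lborel. z \<in> ?I \<times> (UNIV :: (real^'n) set) \<longrightarrow> (case z of (t, x) \<Rightarrow> u t x) = U1 z"
      using borel_version_real[OF um bI(1)] by blast
    obtain W1 where W1: "W1 \<in> borel_measurable borel" "AE z in lborel. z \<in> ?I \<times> \<Omega> \<longrightarrow> (case z of (t, x) \<Rightarrow> w t x) = W1 z"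
      using borel_version_real[OF wm bI(2)] by blast
    obtain K1 where K1: "K1 \<in> borel_measurable borel"
      "AE z in lborel. z \<in> {0..} \<times> (UNIV :: (real^'n) set) \<times> (UNIV :: (real^'n) set) \<longrightarrow> (case z of (t, x, y) \<Rightarrow> K t x y) = K1 z"
      using borel_version_ennreal[OF Km bK] by blast
    have r: "0 < R powr \<alpha>" "R powr \<alpha> < (4 * R) powr \<alpha>"
      using R \<alpha>2 assms(1) by (auto intro!: powr_less_mono2)
    (* the inclusion of products gives inclusions of the factors because both are nonempty *)
    have sub_I: "time_int \<alpha> (4 * R) t0 \<subseteq> ?I" and sub_\<Omega>: "ball x0 (4 * R) \<subseteq> \<Omega>"
    proof -
      have "t0 \<in> time_int \<alpha> (4 * R) t0" "x0 \<in> ball x0 (4 * R)" using r R by (auto simp: time_int_def)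
      then show "time_int \<alpha> (4 * R) t0 \<subseteq> ?I" "ball x0 (4 * R) \<subseteq> \<Omega>" using Q by blast+
    qed
    interpret borel_subsolution \<alpha> lam Lam R s0 t0 x0 ?I \<Omega> K u w U1 W1 K1
    proof
      show "0 < \<alpha>" "\<alpha> < 2" "0 < lam" "0 < Lam" "lam \<le> Lam" "0 < R" "s0 < t0" "open ?I" "open \<Omega>"
        using \<alpha>2 assms R \<Omega> r by (auto simp: s0_def)
      have "{s0..t0} \<subseteq> time_int \<alpha> (4 * R) t0" using r by (auto simp: s0_def time_int_def)
      then show "{s0..t0} \<subseteq> ?I" using sub_I by blast
      have "cball x0 R \<subseteq> ball x0 (4 * R)" using R by auto
      then show "cball x0 R \<subseteq> \<Omega>" using sub_\<Omega> by blast
      show "U1 \<in> borel_measurable (borel \<Otimes>\<^sub>M borel)" "W1 \<in> borel_measurable (borel \<Otimes>\<^sub>M borel)" "K1 \<in> borel_measurable (borel \<Otimes>\<^sub>M (borel \<Otimes>\<^sub>M borel))"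
        using U1(1) W1(1) K1(1) by (simp_all add: borel_prod)
      show "AE z in lborel. fst z \<in> ?I \<longrightarrow> u (fst z) (snd z) = U1 z" using U1(2) by eventually_elim auto
      show "AE z in lborel. fst z \<in> ?I \<and> snd z \<in> \<Omega> \<longrightarrow> w (fst z) (snd z) = W1 z" using W1(2) by eventually_elim auto
      show "AE z in lborel. fst z \<in> ?I \<longrightarrow> K (fst z) (fst (snd z)) (snd (snd z)) = K1 z" using K1(2) by eventually_elim (use a in auto)
      show "ennreal (lam * (2 - \<alpha>)) * frac_kernel \<alpha> x y \<le> K t x y" "K t x y \<le> ennreal (Lam * (2 - \<alpha>)) * frac_kernel \<alpha> x y" if "t \<in> ?I" for t x y
        using Kb that by auto
      show "(LINT x:\<Omega>|lebesgue. w t x * \<phi> x) + energy (K t) (u t) \<phi> \<le> 0"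
        if "t \<in> ?I" "\<phi> \<in> H_space_supp \<alpha> \<Omega>" "AE x in lebesgue. 0 \<le> \<phi> x" for t \<phi> using sub that by blast
    qed (fact uH uL1 uL2 wL2 uw)+
    have len: "t0 - s0 = R powr \<alpha>" by (simp add: s0_def)
    have "mean_const DIM(real^'n) \<alpha>0 lam Lam * sqrt (sup_const DIM(real^'n) \<alpha>0 lam Lam * unit_ball_vol DIM(real^'n)) \<le> c"
      "tail_const DIM(real^'n) Lam \<le> c" unfolding dim by (simp_all add: c_def)
    note bounded = local_boundedness[OF assms(1) \<alpha>2(1) len um this]
    show "esssup (lebesgue_on (time_int_minus \<alpha> (R / 2) t0 \<times> ball x0 (R / 2))) (\<lambda>(t, x). ennreal (max (u t x) 0))
         \<le> ennreal c * ennsqrt ((\<integral>\<^sup>+t\<in>time_int_minus \<alpha> R t0. (\<integral>\<^sup>+x\<in>ball x0 R. ennreal ((max (u t x) 0)\<^sup>2) \<partial>lebesgue) \<partial>lebesgue)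
               / emeasure lebesgue (time_int_minus \<alpha> R t0 \<times> ball x0 R))
           + ennreal c / emeasure lebesgue (time_int_minus \<alpha> R t0) *
              (\<integral>\<^sup>+t\<in>time_int_minus \<alpha> R t0. Tail \<alpha> (\<lambda>x. max (u t x) 0) R x0 \<partial>lebesgue)"
      by (rule bounded(1))
    show "(\<integral>\<^sup>+t\<in>time_int_minus \<alpha> R t0. (\<integral>\<^sup>+x\<in>ball x0 R. ennreal ((max (u t x) 0)\<^sup>2) \<partial>lebesgue) \<partial>lebesgue) < \<infinity>"
      by (rule bounded(2))
    show "(\<integral>\<^sup>+t\<in>time_int_minus \<alpha> R t0. Tail \<alpha> (\<lambda>x. max (u t x) 0) R x0 \<partial>lebesgue) < \<infinity>"
      by (rule bounded(3))
    show "in_Linfty (lebesgue_on (time_int_minus \<alpha> (R / 2) t0 \<times> ball x0 (R / 2))) (\<lambda>(t, x). max (u t x) 0)"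
      by (rule bounded(4))
  qed
qed

end
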